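(* Let $\tau>0$ and $z_0\in L^2(0,1)\setminus\{0\}$. For every $\varepsilon\geqslant 0$, the norm-optimal problem $$N_\varepsilon(\tau)=\inf\left\{\|u\|_{L^\infty((0,\tau)\times I)}:\ u\in L^\infty((0,\tau)\times I),\ z_\varepsilon(\tau;z_0,u)=0\right\}$$ admits a unique solution $u_\varepsilon^\tau$ (that is, there is exactly one $u_\varepsilon^\tau\in L^\infty((0,\tau)\times I)$ with $z_\varepsilon(\tau;z_0,u_\varepsilon^\tau)=0$ and $\|u_\varepsilon^\tau\|_{L^\infty((0,\tau)\times I)}=N_\varepsilon(\tau)$), and it is bang-bang: $$|u_\varepsilon^\tau(t,x)|=N_\varepsilon(\tau)\quad\text{for almost every }(t,x)\in(0,\tau)\times I.$$ Moreover, as $\varepsilon\to0$ (through positive values), $N_\varepsilon(\tau)\to N_0(\tau)$, $u_\varepsilon^\tau$ converges to $u_0^\tau$ weakly-* in $L^\infty((0,\tau)\times I)$, and $u_\varepsilon^\tau\to u_0^\tau$ strongly in $L^p((0,\tau)\times I)$ for every $1\leqslant p<\infty$.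
   Context: Let $a\in L^\infty(\mathbb R)$ be a real-valued $1$-periodic function such that, for some constant $K>0$, $K^{-1}\leqslant a(x)\leqslant K$ for a.e. $x\in\mathbb R$. Let $I\subset(0,1)$ be a nonempty open interval with characteristic function $\chi_I$. For $\varepsilon>0$ put $a_\varepsilon(x)=a(x/\varepsilon)$, and for $\varepsilon=0$ let $a_0$ be the constant $a_0=\left(\int_0^1\frac{1}{a(y)}\,dy\right)^{-1}$ (homogenized coefficient). Function spaces consist of complex-valued functions. For $\varepsilon\geqslant0$, $z_0\in L^2(0,1)$ and a control $u$, $z_\varepsilon(\cdot;z_0,u)$ denotes the (mild) solution of $$\partial_t z(t,x)-\partial_x\bigl(a_\varepsilon(x)\,\partial_x z(t,x)\bigr)=u(t,x)\chi_I(x)\quad (t\geqslant0,\ x\in(0,1)),$$ $$z(t,0)=z(t,1)=0\quad(t\geqslant0),\qquad z(0,x)=z_0(x)\quad(x\in(0,1)).$$ *)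

theory Defs
  imports "HOL-Probability.Essential_Supremum"
begin

section \<open>The Hilbert space $L^2(0,1)$\<close>

abbreviation unit_leb :: "real measure" where
  "unit_leb \<equiv> lebesgue_on {0<..<1}"

definition sq_integrable :: "(real \<Rightarrow> complex) \<Rightarrow> bool" where
  "sq_integrable f \<longleftrightarrow>
     f \<in> borel_measurable unit_leb \<and> integrable unit_leb (\<lambda>x. (norm (f x))\<^sup>2)"

lemma sq_integrableI:
  "f \<in> borel_measurable unit_leb \<Longrightarrow> integrable unit_leb (\<lambda>x. (norm (f x))\<^sup>2) \<Longrightarrow> sq_integrable f"
  by (simp add: sq_integrable_def)

lemma sq_integrable_measurable: "sq_integrable f \<Longrightarrow> f \<in> borel_measurable unit_leb"
  by (simp add: sq_integrable_def)

lemma sq_integrable_zero: "sq_integrable (\<lambda>x. 0)"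
  by (simp add: sq_integrable_def)

lemma sq_integrable_add:
  assumes "sq_integrable f" "sq_integrable g"
  shows "sq_integrable (\<lambda>x. f x + g x)"
proof -
  have [measurable]: "f \<in> borel_measurable unit_leb" "g \<in> borel_measurable unit_leb"
    using assms by (auto simp: sq_integrable_def)
  have "integrable unit_leb (\<lambda>x. (norm (f x + g x))\<^sup>2)"
  proof (rule Bochner_Integration.integrable_bound)
    show "integrable unit_leb (\<lambda>x. 2 * (norm (f x))\<^sup>2 + 2 * (norm (g x))\<^sup>2)"
      using assms by (auto simp: sq_integrable_def)
    show "AE x in unit_leb. norm ((norm (f x + g x))\<^sup>2) \<le> norm (2 * (norm (f x))\<^sup>2 + 2 * (norm (g x))\<^sup>2)"
    proof (rule AE_I2)
      fix x
      have "(norm (f x + g x))\<^sup>2 \<le> (norm (f x) + norm (g x))\<^sup>2"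
        by (intro power_mono norm_triangle_ineq) auto
      also have "\<dots> \<le> 2 * (norm (f x))\<^sup>2 + 2 * (norm (g x))\<^sup>2"
        using sum_squares_bound[of "norm (f x)" "norm (g x)"] by (simp add: power2_sum)
      finally show "norm ((norm (f x + g x))\<^sup>2) \<le> norm (2 * (norm (f x))\<^sup>2 + 2 * (norm (g x))\<^sup>2)"
        by simp
    qed
  qed measurable
  then show ?thesis by (intro sq_integrableI) measurable
qed

lemma sq_integrable_scaleR:
  assumes "sq_integrable f"
  shows "sq_integrable (\<lambda>x. r *\<^sub>R f x)"
  using assms by (auto simp: sq_integrable_def power_mult_distrib)

lemma sq_integrable_uminus: "sq_integrable f \<Longrightarrow> sq_integrable (\<lambda>x. - f x)"
  by (auto simp: sq_integrable_def)

lemma sq_integrable_diff: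
  assumes "sq_integrable f" "sq_integrable g"
  shows "sq_integrable (\<lambda>x. f x - g x)"
  using sq_integrable_add[OF assms(1) sq_integrable_uminus[OF assms(2)]] by simp

lemma integrable_inner_sq:
  assumes "sq_integrable f" "sq_integrable g"
  shows "integrable unit_leb (\<lambda>x. f x \<bullet> g x)"
proof -
  have [measurable]: "f \<in> borel_measurable unit_leb" "g \<in> borel_measurable unit_leb"
    using assms by (auto simp: sq_integrable_def)
  show ?thesis
  proof (rule Bochner_Integration.integrable_bound)
    show "integrable unit_leb (\<lambda>x. (norm (f x))\<^sup>2 + (norm (g x))\<^sup>2)"
      using assms by (auto simp: sq_integrable_def)
    show "AE x in unit_leb. norm (f x \<bullet> g x) \<le> norm ((norm (f x))\<^sup>2 + (norm (g x))\<^sup>2)"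
    proof (rule AE_I2)
      fix x
      have "\<bar>f x \<bullet> g x\<bar> \<le> norm (f x) * norm (g x)"
        by (rule Cauchy_Schwarz_ineq2)
      also have "\<dots> \<le> (norm (f x))\<^sup>2 + (norm (g x))\<^sup>2"
        using sum_squares_bound[of "norm (f x)" "norm (g x)"]
          mult_nonneg_nonneg[OF norm_ge_zero[of "f x"] norm_ge_zero[of "g x"]]
        by linarith
      finally show "norm (f x \<bullet> g x) \<le> norm ((norm (f x))\<^sup>2 + (norm (g x))\<^sup>2)"
        by simp
    qed
  qed measurable
qed

quotient_type L2 = "real \<Rightarrow> complex" / partial:
  "\<lambda>f g. sq_integrable f \<and> sq_integrable g \<and> (AE x in unit_leb. f x = g x)"
proof (rule part_equivpI)
  show "\<exists>f. sq_integrable f \<and> sq_integrable f \<and> (AE x in unit_leb. f x = f x)"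
    using sq_integrable_zero by auto
  show "symp (\<lambda>f g. sq_integrable f \<and> sq_integrable g \<and> (AE x in unit_leb. f x = g x))"
    by (rule sympI) (auto elim: eventually_mono)
  show "transp (\<lambda>f g. sq_integrable f \<and> sq_integrable g \<and> (AE x in unit_leb. f x = g x))"
    by (rule transpI) (auto elim: eventually_elim2)
qed

text \<open>The library's inner product spaces are real, so \<open>L2\<close> carries the real part of the Hermitian
  inner product; the induced norm is the usual one.\<close>

instantiation L2 :: real_inner
begin

lift_definition zero_L2 :: L2 is "\<lambda>x. 0"
  by (simp add: sq_integrable_zero)

lift_definition plus_L2 :: "L2 \<Rightarrow> L2 \<Rightarrow> L2" is "\<lambda>f g x. f x + g x"
  by (auto simp: sq_integrable_add elim: eventually_elim2)

lift_definition minus_L2 :: "L2 \<Rightarrow> L2 \<Rightarrow> L2" is "\<lambda>f g x. f x - g x"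
  by (auto simp: sq_integrable_diff elim: eventually_elim2)

lift_definition uminus_L2 :: "L2 \<Rightarrow> L2" is "\<lambda>f x. - f x"
  by (auto simp: sq_integrable_uminus)

lift_definition scaleR_L2 :: "real \<Rightarrow> L2 \<Rightarrow> L2" is "\<lambda>r f x. r *\<^sub>R f x"
  by (auto simp: sq_integrable_scaleR)

lift_definition inner_L2 :: "L2 \<Rightarrow> L2 \<Rightarrow> real" is "\<lambda>f g. LINT x|unit_leb. f x \<bullet> g x"
  by (rule integral_cong_AE)
    (auto intro!: borel_measurable_inner sq_integrable_measurable elim: eventually_elim2)

definition norm_L2 :: "L2 \<Rightarrow> real" where "norm_L2 f = sqrt (inner f f)"
definition dist_L2 :: "L2 \<Rightarrow> L2 \<Rightarrow> real" where "dist_L2 f g = norm (f - g)"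
definition sgn_L2 :: "L2 \<Rightarrow> L2" where "sgn_L2 f = inverse (norm f) *\<^sub>R f"
definition uniformity_L2 :: "(L2 \<times> L2) filter" where
  "uniformity_L2 = (INF e\<in>{0<..}. principal {(f, g). dist f g < e})"
definition open_L2 :: "L2 set \<Rightarrow> bool" where
  "open_L2 S \<longleftrightarrow> (\<forall>f\<in>S. \<forall>\<^sub>F (f', g) in uniformity. f' = f \<longrightarrow> g \<in> S)"

instance
proof
  fix f g h :: L2 and r s :: real
  show "f + g + h = f + (g + h)" by transfer (auto simp: sq_integrable_add add.assoc)
  show "f + g = g + f" by transfer (auto simp: sq_integrable_add add.commute)
  show "0 + f = f" by transfer auto
  show "- f + f = 0" by transfer (auto simp: sq_integrable_zero)
  show "f - g = f + - g" by transfer (auto simp: sq_integrable_diff)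
  show "r *\<^sub>R (f + g) = r *\<^sub>R f + r *\<^sub>R g"
    by transfer (auto simp: sq_integrable_add sq_integrable_scaleR scaleR_add_right
        intro!: sq_integrable_add[of "\<lambda>x. r *\<^sub>R _ x" "\<lambda>x. r *\<^sub>R _ x", simplified])
  show "(r + s) *\<^sub>R f = r *\<^sub>R f + s *\<^sub>R f"
    by transfer (auto simp: sq_integrable_add sq_integrable_scaleR scaleR_add_left
        intro!: sq_integrable_add)
  show "r *\<^sub>R s *\<^sub>R f = (r * s) *\<^sub>R f"
    by transfer (use sq_integrable_scaleR in auto)
  show "1 *\<^sub>R f = f" by transfer auto
  show "dist f g = norm (f - g)" by (rule dist_L2_def)
  show "sgn f = inverse (norm f) *\<^sub>R f" by (rule sgn_L2_def)
  show "uniformity = (INF e\<in>{0<..}. principal {(f::L2, g). dist f g < e})"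
    by (rule uniformity_L2_def)
  show "open S \<longleftrightarrow> (\<forall>f\<in>S. \<forall>\<^sub>F (f', g) in uniformity. f' = f \<longrightarrow> g \<in> S)" for S :: "L2 set"
    by (rule open_L2_def)
  show "inner f g = inner g f" by transfer (simp add: inner_commute)
  show "inner (f + g) h = inner f h + inner g h"
    by transfer (simp add: inner_add_left integrable_inner_sq)
  show "inner (r *\<^sub>R f) g = r * inner f g" by transfer simp
  show "0 \<le> inner f f" by transfer simp
  show "inner f f = 0 \<longleftrightarrow> f = 0"
  proof transfer
    fix f assume "sq_integrable f \<and> sq_integrable f \<and> (AE x in unit_leb. f x = f x)"
    then have f: "sq_integrable f" by simp
    show "(LINT x|unit_leb. f x \<bullet> f x) = 0 \<longleftrightarrow>
        sq_integrable f \<and> sq_integrable (\<lambda>x. 0) \<and> (AE x in unit_leb. f x = 0)"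
      using integral_nonneg_eq_0_iff_AE[OF integrable_inner_sq[OF f f]] f
      by (simp add: sq_integrable_zero)
  qed
  show "norm f = sqrt (inner f f)" by (rule norm_L2_def)
qed

end

definition L2_of :: "(real \<Rightarrow> complex) \<Rightarrow> L2" where
  "L2_of f = (if sq_integrable f then abs_L2 f else 0)"

lemma sq_integrable_rep: "sq_integrable (rep_L2 F)"
  using Quotient_rep_reflp[OF Quotient_L2, of F] by simp

lemma L2_of_rep: "L2_of (rep_L2 F) = F"
  using Quotient_abs_rep[OF Quotient_L2, of F] by (simp add: L2_of_def sq_integrable_rep)

lemma L2_of_eqI:
  "sq_integrable f \<Longrightarrow> sq_integrable g \<Longrightarrow> AE x in unit_leb. f x = g x \<Longrightarrow> L2_of f = L2_of g"
  unfolding L2_of_def by (auto intro!: Quotient_rel_abs[OF Quotient_L2])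

lemma L2_of_add: "sq_integrable f \<Longrightarrow> sq_integrable g \<Longrightarrow> L2_of (\<lambda>x. f x + g x) = L2_of f + L2_of g"
  by (simp add: L2_of_def sq_integrable_add plus_L2.abs_eq)

lemma L2_of_diff: "sq_integrable f \<Longrightarrow> sq_integrable g \<Longrightarrow> L2_of (\<lambda>x. f x - g x) = L2_of f - L2_of g"
  by (simp add: L2_of_def sq_integrable_diff minus_L2.abs_eq)

lemma L2_of_scaleR: "sq_integrable f \<Longrightarrow> L2_of (\<lambda>x. r *\<^sub>R f x) = r *\<^sub>R L2_of f"
  by (simp add: L2_of_def sq_integrable_scaleR scaleR_L2.abs_eq)

lemma L2_of_zero: "L2_of (\<lambda>x. 0) = 0"
  by (simp add: L2_of_def sq_integrable_zero zero_L2_def)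

lemma norm_L2_of: "sq_integrable f \<Longrightarrow> (norm (L2_of f))\<^sup>2 = (LINT x|unit_leb. (norm (f x))\<^sup>2)"
  by (simp add: power2_norm_eq_inner L2_of_def inner_L2.abs_eq)

lemma norm_L2_of_nn:
  "sq_integrable f \<Longrightarrow>
     (\<integral>\<^sup>+x. ennreal ((norm (f x))\<^sup>2) \<partial>unit_leb) = ennreal ((norm (L2_of f))\<^sup>2)"
  unfolding norm_L2_of by (rule nn_integral_eq_integral) (auto simp: sq_integrable_def)

lemma unit_leb_finite: "finite_measure unit_leb"
  by (rule finite_measure_lebesgue_on) (simp add: fmeasurable_def)

lemma unit_leb_measure: "measure unit_leb {0<..<1} = 1"
  by (simp add: measure_restrict_space)

lemma nn_integral_norm_le:
  assumes f: "sq_integrable f" and c: "c > 0" "norm (L2_of f) \<le> c"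
  shows "(\<integral>\<^sup>+x. ennreal (norm (f x)) \<partial>unit_leb) \<le> ennreal c"
proof -
  interpret finite_measure unit_leb by (rule unit_leb_finite)
  let ?g = "\<lambda>x. (norm (f x))\<^sup>2 / (2 * c) + c / 2"
  have int: "integrable unit_leb (\<lambda>x. (norm (f x))\<^sup>2)"
    using f by (simp add: sq_integrable_def)
  have le: "norm (f x) \<le> ?g x" for x
  proof -
    have "2 * norm (f x) * c \<le> (norm (f x))\<^sup>2 + c\<^sup>2"
      by (rule sum_squares_bound)
    then show ?thesis
      using c by (simp add: field_simps power2_eq_square)
  qed
  have "(\<integral>\<^sup>+x. ennreal (norm (f x)) \<partial>unit_leb) \<le> (\<integral>\<^sup>+x. ennreal (?g x) \<partial>unit_leb)"
    by (intro nn_integral_mono ennreal_leI le)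
  also have "\<dots> = ennreal (LINT x|unit_leb. ?g x)"
    by (rule nn_integral_eq_integral) (use int c in auto)
  also have "(LINT x|unit_leb. ?g x) = (norm (L2_of f))\<^sup>2 / (2 * c) + c / 2"
    using int f by (simp add: norm_L2_of unit_leb_measure)
  also have "\<dots> \<le> c"
  proof -
    have "(norm (L2_of f))\<^sup>2 \<le> c\<^sup>2"
      using c by (intro power_mono) auto
    then show ?thesis
      using c by (simp add: field_simps power2_eq_square)
  qed
  finally show ?thesis by (simp add: ennreal_leI)
qed

lemma L2_Cauchy_convergent:
  fixes X :: "nat \<Rightarrow> L2"
  assumes X: "Cauchy X"
  shows "convergent X"
proof -
  interpret finite_measure unit_leb by (rule unit_leb_finite)
  have "\<exists>N. \<forall>m\<ge>N. \<forall>n\<ge>N. dist (X m) (X n) < (1/2) ^ k" for k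
    using X unfolding Cauchy_def by simp
  then obtain N where N: "\<And>k m n. m \<ge> N k \<Longrightarrow> n \<ge> N k \<Longrightarrow> dist (X m) (X n) < (1/2) ^ k"
    by metis
  define r where "r k = (\<Sum>i\<le>k. N i)" for k
  have rN: "N j \<le> r k" if "j \<le> k" for j k
    unfolding r_def using that by (intro member_le_sum) auto
  define f where "f n = rep_L2 (X n)" for n
  have f: "sq_integrable (f n)" and fX: "L2_of (f n) = X n" for n
    by (auto simp: f_def sq_integrable_rep L2_of_rep)
  have fm[measurable]: "f n \<in> borel_measurable unit_leb" for n
    using f by (simp add: sq_integrable_def)
  define d where "d k x = f (r (Suc k)) x - f (r k) x" for k x
  have dsq: "sq_integrable (d k)" for k
    unfolding d_def by (intro sq_integrable_diff f)
  have [measurable]: "d k \<in> borel_measurable unit_leb" for k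
    using dsq by (simp add: sq_integrable_def)
  have "norm (L2_of (d k)) \<le> (1/2) ^ k" for k
    using N[of k "r (Suc k)" "r k"] rN[of k k] rN[of k "Suc k"]
    by (simp add: d_def[abs_def] L2_of_diff f fX dist_norm less_imp_le)
  then have "(\<integral>\<^sup>+x. ennreal (norm (d k x)) \<partial>unit_leb) \<le> ennreal ((1/2) ^ k)" for k
    by (intro nn_integral_norm_le dsq) auto
  then have "(\<Sum>k. \<integral>\<^sup>+x. ennreal (norm (d k x)) \<partial>unit_leb) \<le> (\<Sum>k. ennreal ((1/2) ^ k))"
    by (intro suminf_le) auto
  also have "\<dots> = ennreal (\<Sum>k. (1/2) ^ k)"
    by (intro suminf_ennreal2) auto
  finally have "(\<integral>\<^sup>+x. (\<Sum>k. ennreal (norm (d k x))) \<partial>unit_leb) \<noteq> \<infinity>"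
    by (subst nn_integral_suminf) (auto simp: top_unique)
  then have "AE x in unit_leb. (\<Sum>k. ennreal (norm (d k x))) \<noteq> \<infinity>"
    by (intro nn_integral_PInf_AE) auto
  then have conv: "AE x in unit_leb. convergent (\<lambda>k. f (r k) x)"
  proof (rule eventually_mono)
    fix x assume "(\<Sum>k. ennreal (norm (d k x))) \<noteq> \<infinity>"
    then have "summable (\<lambda>k. norm (d k x))"
      by (intro summable_suminf_not_top) (auto simp: top_unique)
    then have "summable (\<lambda>k. d k x)"
      by (rule summable_norm_cancel)
    then have "convergent (\<lambda>n. \<Sum>k<n. d k x)"
      by (simp add: summable_iff_convergent)
    moreover have "(\<Sum>k<n. d k x) = f (r n) x - f (r 0) x" for n
      unfolding d_def by (rule sum_lessThan_telescope)
    ultimately show "convergent (\<lambda>k. f (r k) x)"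
      using convergent_add[of "\<lambda>n. f (r n) x - f (r 0) x" "\<lambda>n. f (r 0) x"]
      by (simp add: convergent_const)
  qed
  define F where "F x = lim (\<lambda>k. f (r k) x)" for x
  have [measurable]: "F \<in> borel_measurable unit_leb"
    unfolding F_def by measurable
  have lim: "AE x in unit_leb. (\<lambda>k. f (r k) x) \<longlonglongrightarrow> F x"
    using conv by (auto simp: F_def convergent_LIMSEQ_iff elim: eventually_mono)
  have bound: "(\<integral>\<^sup>+x. ennreal ((norm (f n x - F x))\<^sup>2) \<partial>unit_leb) \<le> ennreal (((1/2) ^ k)\<^sup>2)"
    if n: "n \<ge> N k" for n k
  proof -
    have "AE x in unit_leb. ennreal ((norm (f n x - F x))\<^sup>2) =
        liminf (\<lambda>j. ennreal ((norm (f n x - f (r j) x))\<^sup>2))"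
      using lim
    proof (rule eventually_mono)
      fix x assume "(\<lambda>k. f (r k) x) \<longlonglongrightarrow> F x"
      then have "(\<lambda>j. ennreal ((norm (f n x - f (r j) x))\<^sup>2)) \<longlonglongrightarrow> ennreal ((norm (f n x - F x))\<^sup>2)"
        by (intro tendsto_intros)
      then show "ennreal ((norm (f n x - F x))\<^sup>2) = liminf (\<lambda>j. ennreal ((norm (f n x - f (r j) x))\<^sup>2))"
        by (intro lim_imp_Liminf[symmetric]) auto
    qed
    then have "(\<integral>\<^sup>+x. ennreal ((norm (f n x - F x))\<^sup>2) \<partial>unit_leb) =
        (\<integral>\<^sup>+x. liminf (\<lambda>j. ennreal ((norm (f n x - f (r j) x))\<^sup>2)) \<partial>unit_leb)"
      by (rule nn_integral_cong_AE)
    also have "\<dots> \<le> liminf (\<lambda>j. \<integral>\<^sup>+x. ennreal ((norm (f n x - f (r j) x))\<^sup>2) \<partial>unit_leb)"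
      by (rule nn_integral_liminf) measurable
    also have "\<dots> \<le> liminf (\<lambda>j. ennreal (((1/2) ^ k)\<^sup>2))"
    proof (rule Liminf_mono, rule eventually_sequentiallyI)
      fix j assume "k \<le> j"
      then have "dist (X n) (X (r j)) < (1/2) ^ k"
        using n rN by (intro N) auto
      then have "ennreal ((norm (X n - X (r j)))\<^sup>2) \<le> ennreal (((1/2) ^ k)\<^sup>2)"
        by (intro ennreal_leI power_mono) (auto simp: dist_norm)
      then show "(\<integral>\<^sup>+x. ennreal ((norm (f n x - f (r j) x))\<^sup>2) \<partial>unit_leb) \<le> ennreal (((1/2) ^ k)\<^sup>2)"
        by (simp only: norm_L2_of_nn[OF sq_integrable_diff[OF f f]] L2_of_diff[OF f f] fX)
    qed
    also have "\<dots> = ennreal (((1/2) ^ k)\<^sup>2)"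
      by (rule Liminf_const) simp
    finally show ?thesis .
  qed
  have diff: "sq_integrable (\<lambda>x. f n x - F x)" if "n \<ge> N k" for n k
  proof (rule sq_integrableI)
    show "integrable unit_leb (\<lambda>x. (norm (f n x - F x))\<^sup>2)"
      using bound[OF that]
      by (intro integrableI_bounded) (auto intro: le_less_trans)
  qed measurable
  have "sq_integrable (\<lambda>x. f (N 0) x - (f (N 0) x - F x))"
    by (rule sq_integrable_diff[OF f diff]) (rule order_refl)
  then have Fsq: "sq_integrable F" by simp
  have close: "norm (X n - L2_of F) \<le> (1/2) ^ k" if "n \<ge> N k" for n k
  proof -
    have "ennreal ((norm (X n - L2_of F))\<^sup>2) \<le> ennreal (((1/2) ^ k)\<^sup>2)"
      using bound[OF that] norm_L2_of_nn[OF diff[OF that]] by (simp add: L2_of_diff f Fsq fX)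
    then have "(norm (X n - L2_of F))\<^sup>2 \<le> ((1/2) ^ k)\<^sup>2"
      by (subst (asm) ennreal_le_iff) auto
    then show ?thesis by (rule power2_le_imp_le) simp
  qed
  have "X \<longlonglongrightarrow> L2_of F"
  proof (rule metric_LIMSEQ_I)
    fix e :: real assume "e > 0"
    then obtain k where "(1/2) ^ k < e"
      using real_arch_pow_inv[of e "1/2"] by auto
    then have "dist (X n) (L2_of F) < e" if "n \<ge> N k" for n
      using close[OF that] by (simp add: dist_norm)
    then show "\<exists>M. \<forall>n\<ge>M. dist (X n) (L2_of F) < e" by blast
  qed
  then show ?thesis by (rule convergentI)
qed

instance L2 :: banach
  by standard (rule L2_Cauchy_convergent)

lemma L2_of_dominated_convergence:
  fixes f :: "nat \<Rightarrow> real \<Rightarrow> complex"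
  assumes f: "\<And>n. sq_integrable (f n)" and h: "sq_integrable h"
    and g: "integrable unit_leb (\<lambda>x. (g x)\<^sup>2)"
    and lim: "\<And>x. x \<in> {0<..<1} \<Longrightarrow> (\<lambda>n. f n x) \<longlonglongrightarrow> h x"
    and bound: "\<And>n x. x \<in> {0<..<1} \<Longrightarrow> norm (f n x) \<le> g x"
  shows "(\<lambda>n. L2_of (f n)) \<longlonglongrightarrow> L2_of h"
proof -
  have [measurable]: "f n \<in> borel_measurable unit_leb" "h \<in> borel_measurable unit_leb" for n
    using f h by (auto simp: sq_integrable_def)
  have hb: "norm (h x) \<le> g x" if "x \<in> {0<..<1}" for x
    using tendsto_norm[OF lim[OF that]] by (rule LIMSEQ_le_const2) (use bound[OF that] in auto)
  have "(\<lambda>n. LINT x|unit_leb. (norm (f n x - h x))\<^sup>2) \<longlonglongrightarrow> (LINT x|unit_leb. 0)"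
  proof (rule integral_dominated_convergence[where w = "\<lambda>x. 4 * (g x)\<^sup>2"])
    show "integrable unit_leb (\<lambda>x. 4 * (g x)\<^sup>2)"
      using g by simp
    show "AE x in unit_leb. (\<lambda>n. (norm (f n x - h x))\<^sup>2) \<longlonglongrightarrow> 0"
    proof (rule AE_I2)
      fix x assume "x \<in> space unit_leb"
      then have "(\<lambda>n. (norm (f n x - h x))\<^sup>2) \<longlonglongrightarrow> (norm (h x - h x))\<^sup>2"
        by (intro tendsto_intros lim) simp
      then show "(\<lambda>n. (norm (f n x - h x))\<^sup>2) \<longlonglongrightarrow> 0" by simp
    qed
    show "AE x in unit_leb. norm ((norm (f n x - h x))\<^sup>2) \<le> 4 * (g x)\<^sup>2" for n
    proof (rule AE_I2)
      fix x assume "x \<in> space unit_leb"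
      then have x: "x \<in> {0<..<1}" by simp
      have "norm (f n x - h x) \<le> 2 * g x"
        using norm_triangle_ineq4[of "f n x" "h x"] bound[OF x, of n] hb[OF x] by simp
      then have "(norm (f n x - h x))\<^sup>2 \<le> (2 * g x)\<^sup>2"
        by (intro power_mono) auto
      then show "norm ((norm (f n x - h x))\<^sup>2) \<le> 4 * (g x)\<^sup>2"
        by (simp add: power_mult_distrib)
    qed
  qed measurable
  then have "(\<lambda>n. (norm (L2_of (f n) - L2_of h))\<^sup>2) \<longlonglongrightarrow> 0"
    using f h by (simp add: norm_L2_of[symmetric] sq_integrable_diff L2_of_diff)
  then have "(\<lambda>n. sqrt ((norm (L2_of (f n) - L2_of h))\<^sup>2)) \<longlonglongrightarrow> sqrt 0"
    by (rule tendsto_real_sqrt)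
  then have "(\<lambda>n. norm (L2_of (f n) - L2_of h)) \<longlonglongrightarrow> 0"
    by simp
  then show ?thesis
    by (simp add: tendsto_norm_zero_iff LIM_zero_iff)
qed

lemma sq_integrable_bounded:
  assumes "f \<in> borel_measurable unit_leb" "\<And>x. x \<in> {0<..<1} \<Longrightarrow> norm (f x) \<le> c"
  shows "sq_integrable f"
proof (rule sq_integrableI[OF assms(1)])
  interpret finite_measure unit_leb by (rule unit_leb_finite)
  have [measurable]: "f \<in> borel_measurable unit_leb" by fact
  show "integrable unit_leb (\<lambda>x. (norm (f x))\<^sup>2)"
    by (rule integrable_const_bound[where B = "c\<^sup>2"])
      (auto intro!: AE_I2 power_mono assms(2))
qed

lemma sets_unit_leb_borel: "A \<in> sets borel \<Longrightarrow> A \<inter> {0<..<1} \<in> sets unit_leb"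
  by (auto simp: sets_restrict_space)

lemma sq_integrable_indicator:
  assumes "A \<inter> {0<..<1} \<in> sets unit_leb"
  shows "sq_integrable (\<lambda>x. indicator A x *\<^sub>R (y::complex))"
proof (rule sq_integrable_bounded[where c = "norm y"])
  have "(\<lambda>x. indicator (A \<inter> {0<..<1}) x *\<^sub>R y) \<in> borel_measurable unit_leb"
    using assms by measurable
  then show "(\<lambda>x. indicator A x *\<^sub>R y) \<in> borel_measurable unit_leb"
    by (subst measurable_cong[where g = "\<lambda>x. indicator (A \<inter> {0<..<1}) x *\<^sub>R y"])
      (auto simp: indicator_def)
qed (auto simp: indicator_def)

definition L2_step :: "rat \<Rightarrow> bool \<Rightarrow> L2" where
  "L2_step q b = L2_of (\<lambda>x. indicator {..<of_rat q} x *\<^sub>R (if b then 1 else \<i>))"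

definition L2_dense :: "L2 set" where
  "L2_dense = range (\<lambda>l. sum_list (map (\<lambda>(p, q, b). of_rat p *\<^sub>R L2_step q b) l))"

lemma countable_L2_dense: "countable L2_dense"
  by (simp add: L2_dense_def)

lemma L2_dense_add: "F \<in> L2_dense \<Longrightarrow> G \<in> L2_dense \<Longrightarrow> F + G \<in> L2_dense"
  unfolding L2_dense_def
proof clarify
  fix l m :: "(rat \<times> rat \<times> bool) list"
  show "sum_list (map (\<lambda>(p, q, b). of_rat p *\<^sub>R L2_step q b) l) +
      sum_list (map (\<lambda>(p, q, b). of_rat p *\<^sub>R L2_step q b) m)
      \<in> range (\<lambda>l. sum_list (map (\<lambda>(p, q, b). of_rat p *\<^sub>R L2_step q b) l))"
    by (rule range_eqI[of _ _ "l @ m"]) simp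
qed

lemma L2_dense_scale: "F \<in> L2_dense \<Longrightarrow> of_rat c *\<^sub>R F \<in> L2_dense"
  unfolding L2_dense_def
proof clarify
  fix l :: "(rat \<times> rat \<times> bool) list"
  have "of_rat c *\<^sub>R sum_list (map (\<lambda>(p, q, b). of_rat p *\<^sub>R L2_step q b) l) =
      sum_list (map (\<lambda>(p, q, b). of_rat p *\<^sub>R L2_step q b) (map (\<lambda>(p, q, b). (c * p, q, b)) l))"
    by (induction l) (auto simp: scaleR_add_right of_rat_mult)
  then show "of_rat c *\<^sub>R sum_list (map (\<lambda>(p, q, b). of_rat p *\<^sub>R L2_step q b) l)
      \<in> range (\<lambda>l. sum_list (map (\<lambda>(p, q, b). of_rat p *\<^sub>R L2_step q b) l))"
    by (rule range_eqI)
qed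

lemma L2_dense_zero: "0 \<in> L2_dense"
  unfolding L2_dense_def by (rule range_eqI[of _ _ "[]"]) simp

lemma L2_step_in_dense: "L2_step q b \<in> L2_dense"
  unfolding L2_dense_def by (rule range_eqI[of _ _ "[(1, q, b)]"]) simp

lemma closure_L2_dense_add:
  assumes "F \<in> closure L2_dense" "G \<in> closure L2_dense"
  shows "F + G \<in> closure L2_dense"
proof -
  obtain X Y where X: "\<And>n. X n \<in> L2_dense" "X \<longlonglongrightarrow> F" and Y: "\<And>n. Y n \<in> L2_dense" "Y \<longlonglongrightarrow> G"
    using assms unfolding closure_sequential by metis
  have "(\<lambda>n. X n + Y n) \<longlonglongrightarrow> F + G"
    by (intro tendsto_add X Y)
  then show ?thesis
    unfolding closure_sequential
    by (intro exI[of _ "\<lambda>n. X n + Y n"]) (simp add: X Y L2_dense_add)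
qed

lemma closure_L2_dense_scale:
  assumes "F \<in> closure L2_dense"
  shows "(c::real) *\<^sub>R F \<in> closure L2_dense"
proof -
  obtain X where X: "\<And>n. X n \<in> L2_dense" "X \<longlonglongrightarrow> F"
    using assms unfolding closure_sequential by metis
  have "\<exists>q::rat. \<bar>of_rat q - c\<bar> < 1 / Suc n" for n
    using of_rat_dense[of "c - 1 / Suc n" "c + 1 / Suc n"]
    by (auto simp: abs_less_iff algebra_simps)
  then obtain q :: "nat \<Rightarrow> rat" where q: "\<And>n. \<bar>of_rat (q n) - c\<bar> < 1 / Suc n"
    by metis
  have "(\<lambda>n. of_rat (q n) - c) \<longlonglongrightarrow> 0"
    by (rule Lim_null_comparison[OF always_eventually LIMSEQ_inverse_real_of_nat])
      (use q in \<open>auto simp: inverse_eq_divide less_imp_le\<close>)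
  then have "(\<lambda>n. of_rat (q n)) \<longlonglongrightarrow> c"
    by (simp add: LIM_zero_iff)
  then have "(\<lambda>n. of_rat (q n) *\<^sub>R X n) \<longlonglongrightarrow> c *\<^sub>R F"
    by (intro tendsto_scaleR X)
  then show ?thesis
    unfolding closure_sequential
    by (intro exI[of _ "\<lambda>n. of_rat (q n) *\<^sub>R X n"]) (simp add: X L2_dense_scale)
qed

lemma closure_L2_dense_zero: "0 \<in> closure L2_dense"
  using L2_dense_zero closure_subset by blast

lemma closure_L2_dense_limit:
  "(\<And>n. X n \<in> closure L2_dense) \<Longrightarrow> X \<longlonglongrightarrow> F \<Longrightarrow> F \<in> closure L2_dense"
  using closed_sequentially[OF closed_closure] by blast

lemma closure_L2_dense_lessThan:
  fixes a :: real
  shows "L2_of (\<lambda>x. indicator {..<a} x *\<^sub>R (if b then 1 else \<i>)) \<in> closure L2_dense"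
proof -
  interpret finite_measure unit_leb by (rule unit_leb_finite)
  have "\<exists>q::rat. a - 1 / Suc n < of_rat q \<and> of_rat q < a" for n
    using of_rat_dense[of "a - 1 / Suc n" a] by auto
  then obtain q :: "nat \<Rightarrow> rat" where q: "\<And>n. a - 1 / Suc n < of_rat (q n)" "\<And>n. of_rat (q n) < a"
    by metis
  have qa: "(\<lambda>n. of_rat (q n)) \<longlonglongrightarrow> a"
  proof (rule tendsto_sandwich)
    show "(\<lambda>n. a - 1 / Suc n) \<longlonglongrightarrow> a"
      using tendsto_diff[OF tendsto_const[of a] LIMSEQ_inverse_real_of_nat]
      by (simp add: inverse_eq_divide)
    show "(\<lambda>n. a) \<longlonglongrightarrow> a" by simp
  qed (use q in \<open>auto intro!: always_eventually less_imp_le\<close>)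
  have "(\<lambda>n. L2_of (\<lambda>x. indicator {..<of_rat (q n)} x *\<^sub>R (if b then 1 else \<i>)))
      \<longlonglongrightarrow> L2_of (\<lambda>x. indicator {..<a} x *\<^sub>R (if b then 1 else \<i>))"
  proof (rule L2_of_dominated_convergence[where g = "\<lambda>x. 1"])
    fix x :: real assume "x \<in> {0<..<1}"
    have "\<forall>\<^sub>F n in sequentially. indicator {..<of_rat (q n)} x = (indicator {..<a} x :: real)"
    proof (cases "x < a")
      case True
      then show ?thesis
        using order_tendstoD(1)[OF qa True] by (auto elim: eventually_mono simp: indicator_def)
    next
      case False
      then show ?thesis
        using q(2) by (intro always_eventually allI) (auto simp: indicator_def, meson less_trans)
    qed
    then show "(\<lambda>n. indicator {..<of_rat (q n)} x *\<^sub>R (if b then 1 else \<i>))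
        \<longlonglongrightarrow> indicator {..<a} x *\<^sub>R (if b then 1 else \<i>)"
      by (intro tendsto_eventually) (auto elim: eventually_mono)
  qed (auto intro!: sq_integrable_indicator sets_unit_leb_borel split: split_indicator)
  then have "(\<lambda>n. L2_step (q n) b) \<longlonglongrightarrow> L2_of (\<lambda>x. indicator {..<a} x *\<^sub>R (if b then 1 else \<i>))"
    by (simp only: L2_step_def)
  moreover have "L2_step (q n) b \<in> closure L2_dense" for n
    using closure_subset L2_step_in_dense by (rule subsetD)
  ultimately show ?thesis
    by (rule closure_L2_dense_limit[rotated])
qed

lemma closure_L2_dense_borel:
  assumes "A \<in> sets borel"
  shows "L2_of (\<lambda>x. indicator A x *\<^sub>R (if b then 1 else \<i>)) \<in> closure L2_dense"
proof -
  interpret finite_measure unit_leb by (rule unit_leb_finite)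
  let ?y = "(if b then 1 else \<i>) :: complex"
  note sqi = sq_integrable_indicator[OF sets_unit_leb_borel]
  have sb: "sets (borel :: real measure) = sigma_sets UNIV (range lessThan)"
    by (subst borel_Iio) simp
  have "Int_stable (range lessThan :: real set set)"
    unfolding Int_stable_def
  proof clarify
    show "{..<c} \<inter> {..<d} \<in> range lessThan" for c d :: real
      by (rule range_eqI[of _ _ "min c d"]) auto
  qed
  moreover have "range lessThan \<subseteq> Pow (UNIV :: real set)" by simp
  moreover have "A \<in> sigma_sets UNIV (range lessThan)"
    using assms by (simp add: sb)
  ultimately show ?thesis
  proof (induction A rule: sigma_sets_induct_disjoint)
    case (basic A)
    then show ?case by (elim rangeE) (simp only: closure_L2_dense_lessThan)
  next
    case empty
    then show ?case by (simp add: L2_of_zero closure_L2_dense_zero)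
  next
    case (compl A)
    then have A: "A \<in> sets borel" by (simp add: sb)
    let ?f = "\<lambda>x. indicator {..<1::real} x *\<^sub>R ?y" and ?g = "\<lambda>x. (- 1) *\<^sub>R (indicator A x *\<^sub>R ?y)"
    have f: "sq_integrable ?f" by (rule sqi) simp
    have g: "sq_integrable ?g" by (rule sq_integrable_scaleR[OF sqi[OF A]])
    have "L2_of (\<lambda>x. indicator (UNIV - A) x *\<^sub>R ?y) = L2_of (\<lambda>x. ?f x + ?g x)"
    proof (rule L2_of_eqI[OF sqi sq_integrable_add[OF f g]])
      show "AE x in unit_leb. indicator (UNIV - A) x *\<^sub>R ?y = ?f x + ?g x"
        by (rule AE_I2) (simp add: indicator_def)
    qed (use A in auto)
    also have "\<dots> = L2_of ?f + (- 1) *\<^sub>R L2_of (\<lambda>x. indicator A x *\<^sub>R ?y)"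
      by (simp only: L2_of_add[OF f g] L2_of_scaleR[OF sqi[OF A]])
    also have "\<dots> \<in> closure L2_dense"
      by (intro closure_L2_dense_add closure_L2_dense_scale closure_L2_dense_lessThan compl)
    finally show ?case .
  next
    case (union A)
    have A: "A n \<in> sets borel" for n
      unfolding sb using union(2) by blast
    have UN: "(\<Union>i<n. A i) \<in> sets borel" for n :: nat
      using A by (intro sets.finite_UN) simp_all
    have "L2_of (\<lambda>x. indicator (\<Union>i<n. A i) x *\<^sub>R ?y) \<in> closure L2_dense" for n
    proof (induction n)
      case 0
      then show ?case by (simp add: L2_of_zero closure_L2_dense_zero)
    next
      case (Suc n)
      have "A n \<inter> (\<Union>i<n. A i) = {}"
      proof -
        have "A n \<inter> A i = {}" if "i < n" for i
          using disjoint_family_onD[OF union(1), of n i] that by simp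
        then show ?thesis by blast
      qed
      then have "indicator (\<Union>i<Suc n. A i) x = (indicator (\<Union>i<n. A i) x + indicator (A n) x :: real)" for x
        unfolding lessThan_Suc by (auto split: split_indicator)
      then have "(\<lambda>x. indicator (\<Union>i<Suc n. A i) x *\<^sub>R ?y) =
          (\<lambda>x. indicator (\<Union>i<n. A i) x *\<^sub>R ?y + indicator (A n) x *\<^sub>R ?y)"
        by (simp only: scaleR_add_left)
      then have "L2_of (\<lambda>x. indicator (\<Union>i<Suc n. A i) x *\<^sub>R ?y) =
          L2_of (\<lambda>x. indicator (\<Union>i<n. A i) x *\<^sub>R ?y) + L2_of (\<lambda>x. indicator (A n) x *\<^sub>R ?y)"
        by (simp only: L2_of_add[OF sqi[OF UN] sqi[OF A]])
      then show ?case
        using closure_L2_dense_add[OF Suc union(3)[of n]] by (simp only:)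
    qed
    moreover have "(\<lambda>n. L2_of (\<lambda>x. indicator (\<Union>i<n. A i) x *\<^sub>R ?y))
        \<longlonglongrightarrow> L2_of (\<lambda>x. indicator (\<Union>i. A i) x *\<^sub>R ?y)"
    proof (rule L2_of_dominated_convergence[where g = "\<lambda>x. 1"])
      show "(\<lambda>n. indicator (\<Union>i<n. A i) x *\<^sub>R ?y) \<longlonglongrightarrow> indicator (\<Union>i. A i) x *\<^sub>R ?y" for x
        by (intro tendsto_scaleR LIMSEQ_indicator_UN tendsto_const)
      show "sq_integrable (\<lambda>x. indicator (\<Union>i. A i) x *\<^sub>R ?y)"
        by (rule sqi[OF sets.countable_UN]) (use A in blast)
      show "sq_integrable (\<lambda>x. indicator (\<Union>i<n. A i) x *\<^sub>R ?y)" for n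
        by (rule sqi[OF UN])
    qed (simp_all split: split_indicator)
    ultimately show ?case by (rule closure_L2_dense_limit)
  qed
qed

lemma closure_L2_dense_indicator:
  assumes A: "A \<in> sets unit_leb"
  shows "L2_of (\<lambda>x. indicator A x *\<^sub>R y) \<in> closure L2_dense"
proof -
  have A1: "A \<in> sets lebesgue" "A \<subseteq> {0<..<1}"
    using A by (auto simp: sets_restrict_space_iff)
  let ?B = "main_part lborel A"
  have B: "?B \<in> sets borel"
    using main_part_sets[OF A1(1)] by simp
  have "AE x in lborel. x \<in> A \<longleftrightarrow> x \<in> ?B"
    using AE_notin_null_part[OF A1(1)] main_part_null_part_Un[OF A1(1)]
    by (auto elim!: eventually_mono)
  then have AE: "AE x in unit_leb. x \<in> A \<longleftrightarrow> x \<in> ?B"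
    by (intro AE_restrict_space_iff[THEN iffD2] eventually_mono[OF AE_completion]) auto
  have sq: "sq_integrable (\<lambda>x. indicator A x *\<^sub>R c)" for c
    using A A1(2) by (intro sq_integrable_indicator) (simp add: Int_absorb2)
  have AB: "L2_of (\<lambda>x. indicator A x *\<^sub>R c) = L2_of (\<lambda>x. indicator ?B x *\<^sub>R c)" for c :: complex
  proof (rule L2_of_eqI[OF sq sq_integrable_indicator[OF sets_unit_leb_borel[OF B]]])
    show "AE x in unit_leb. indicator A x *\<^sub>R c = indicator ?B x *\<^sub>R c"
      using AE by (rule eventually_mono) (simp add: indicator_def)
  qed
  have "(\<lambda>x. indicator A x *\<^sub>R y) =
      (\<lambda>x. Re y *\<^sub>R (indicator A x *\<^sub>R 1) + Im y *\<^sub>R (indicator A x *\<^sub>R \<i>))"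
    by (auto simp: fun_eq_iff complex_eq_iff indicator_def)
  then have "L2_of (\<lambda>x. indicator A x *\<^sub>R y) =
      Re y *\<^sub>R L2_of (\<lambda>x. indicator ?B x *\<^sub>R 1) + Im y *\<^sub>R L2_of (\<lambda>x. indicator ?B x *\<^sub>R \<i>)"
    by (simp only: L2_of_add[OF sq_integrable_scaleR[OF sq] sq_integrable_scaleR[OF sq]] L2_of_scaleR[OF sq] AB)
  then show ?thesis
    using closure_L2_dense_borel[OF B, of True] closure_L2_dense_borel[OF B, of False]
    by (simp only: if_True if_False) (intro closure_L2_dense_add closure_L2_dense_scale)
qed

lemma closure_L2_dense: "closure L2_dense = UNIV"
proof -
  interpret finite_measure unit_leb by (rule unit_leb_finite)
  have "F \<in> closure L2_dense" for F
  proof -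
    define f where "f = rep_L2 F"
    have f: "sq_integrable f" "F = L2_of f"
      by (simp_all add: f_def sq_integrable_rep L2_of_rep)
    have [measurable]: "f \<in> borel_measurable unit_leb"
      using f by (simp add: sq_integrable_def)
    obtain s where s: "\<forall>i. simple_function unit_leb (s i)"
      "\<forall>x\<in>space unit_leb. (\<lambda>i. s i x) \<longlonglongrightarrow> f x"
      "\<forall>i. \<forall>x\<in>space unit_leb. dist (s i x) 0 \<le> 2 * dist (f x) 0"
      using borel_measurable_implies_sequence_metric[of f unit_leb 0] by auto
    have sm [measurable]: "s i \<in> borel_measurable unit_leb" for i
      using s(1) by (intro borel_measurable_simple_function) simp
    have fin: "finite (s i ` {0<..<1})" for i
      using simple_functionD(1)[OF s(1)[rule_format, of i]] by simp
    have ssq: "sq_integrable (s i)" for i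
    proof (rule sq_integrable_bounded[OF sm, where c = "Max (insert 0 (norm ` s i ` {0<..<1}))"])
      fix x :: real assume "x \<in> {0<..<1}"
      then show "norm (s i x) \<le> Max (insert 0 (norm ` s i ` {0<..<1}))"
        using fin[of i] by (intro Max_ge) auto
    qed
    have "L2_of (s i) \<in> closure L2_dense" for i
    proof -
      define T where "T y = s i -` {y} \<inter> {0<..<1}" for y
      have T: "T y \<in> sets unit_leb" for y
        using simple_functionD(2)[OF s(1)[rule_format, of i], of "{y}"] by (simp add: T_def)
      have Tsq: "sq_integrable (\<lambda>x. indicator (T y) x *\<^sub>R y)" for y
        using T[of y] by (intro sq_integrable_indicator) (simp add: T_def Int_assoc)
      have sum: "sq_integrable (\<lambda>x. \<Sum>y\<in>Y. indicator (T y) x *\<^sub>R y) \<and>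
          L2_of (\<lambda>x. \<Sum>y\<in>Y. indicator (T y) x *\<^sub>R y) \<in> closure L2_dense" if "finite Y" for Y
        using that
      proof induction
        case empty
        then show ?case
          by (simp add: sq_integrable_zero L2_of_zero closure_L2_dense_zero)
      next
        case (insert y Y)
        then show ?case
          by (simp only: sum.insert sq_integrable_add Tsq L2_of_add closure_L2_dense_add
              closure_L2_dense_indicator T simp_thms)
      qed
      have "L2_of (s i) = L2_of (\<lambda>x. \<Sum>y\<in>s i ` {0<..<1}. indicator (T y) x *\<^sub>R y)"
      proof (rule L2_of_eqI[OF ssq])
        show "AE x in unit_leb. s i x = (\<Sum>y\<in>s i ` {0<..<1}. indicator (T y) x *\<^sub>R y)"
        proof (rule AE_I2)
          fix x assume "x \<in> space unit_leb"
          then have x: "x \<in> {0<..<1}" by simp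
          have "(\<Sum>y\<in>s i ` {0<..<1}. indicator (T y) x *\<^sub>R y) =
              (\<Sum>y\<in>s i ` {0<..<1}. if s i x = y then y else 0)"
            using x by (intro sum.cong) (auto simp: T_def indicator_def)
          also have "\<dots> = s i x"
            using x fin[of i] by (subst sum.delta') auto
          finally show "s i x = (\<Sum>y\<in>s i ` {0<..<1}. indicator (T y) x *\<^sub>R y)" by simp
        qed
      qed (use sum fin in auto)
      then show ?thesis using sum fin by simp
    qed
    moreover have "(\<lambda>i. L2_of (s i)) \<longlonglongrightarrow> L2_of f"
    proof (rule L2_of_dominated_convergence[OF ssq f(1), where g = "\<lambda>x. 2 * norm (f x)"])
      show "integrable unit_leb (\<lambda>x. (2 * norm (f x))\<^sup>2)"
        using f(1) by (simp add: sq_integrable_def power_mult_distrib)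
    qed (use s in auto)
    ultimately show ?thesis
      unfolding f(2) by (rule closure_L2_dense_limit)
  qed
  then show ?thesis by auto
qed

instance L2 :: second_countable_topology
proof
  let ?B = "(\<lambda>(d, n). ball d (1 / Suc n)) ` (L2_dense \<times> UNIV)"
  have "topological_basis ?B"
  proof (rule topological_basisI)
    fix O' :: "L2 set" and F assume "open O'" "F \<in> O'"
    then obtain e where e: "e > 0" "ball F e \<subseteq> O'"
      by (auto simp: open_contains_ball)
    obtain n where n: "1 / Suc n < e / 2"
      using nat_approx_posE[of "e / 2"] e(1) by auto
    have "F \<in> closure L2_dense" by (simp add: closure_L2_dense)
    then obtain d where d: "d \<in> L2_dense" "dist d F < 1 / Suc n"
      unfolding closure_approachable by (drule_tac x = "1 / Suc n" in spec) auto
    have "ball d (1 / Suc n) \<subseteq> ball F e"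
    proof
      fix G assume "G \<in> ball d (1 / Suc n)"
      then show "G \<in> ball F e"
        using dist_triangle[of F G d] d(2) n by (simp add: dist_commute)
    qed
    then show "\<exists>B'\<in>?B. F \<in> B' \<and> B' \<subseteq> O'"
      using d e(2) by (intro bexI[of _ "ball d (1 / Suc n)"]) auto
  qed auto
  moreover have "countable ?B"
    by (rule countable_image, rule countable_SIGMA) (simp_all add: countable_L2_dense)
  ultimately show "\<exists>B::L2 set set. countable B \<and> open = generate_topology B"
    by (blast intro: topological_basis_imp_subbasis)
qed


section \<open>Mild solutions of abstract Cauchy problems\<close>

definition c0_semigroup :: "(real \<Rightarrow> 'x \<Rightarrow> 'x::real_normed_vector) \<Rightarrow> bool" where
  "c0_semigroup S \<longleftrightarrow>
     (\<forall>t\<ge>0. bounded_linear (S t)) \<and>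
     (\<forall>x. S 0 x = x) \<and>
     (\<forall>s\<ge>0. \<forall>t\<ge>0. \<forall>x. S (s + t) x = S s (S t x)) \<and>
     (\<forall>x. ((\<lambda>t. S t x) \<longlongrightarrow> x) (at_right 0))"

text \<open>Unbounded operators are represented by their graphs: \<open>A x y\<close> means that \<open>x\<close> belongs to the
  domain of \<open>A\<close> and \<open>A x = y\<close>. The generator is required to be exactly \<open>A\<close>, domain included; a
  strongly continuous semigroup is determined by its generator. (In particular linearity over the
  reals suffices in \<^const>\<open>c0_semigroup\<close>: the semigroup generated by a complex-linear operator is
  complex-linear.)\<close>

definition has_generator ::
  "(real \<Rightarrow> 'x \<Rightarrow> 'x::real_normed_vector) \<Rightarrow> ('x \<Rightarrow> 'x \<Rightarrow> bool) \<Rightarrow> bool" where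
  "has_generator S A \<longleftrightarrow>
     (\<forall>x y. A x y \<longleftrightarrow> ((\<lambda>t. (S t x - x) /\<^sub>R t) \<longlongrightarrow> y) (at_right 0))"

text \<open>The mild solution on $[0,T]$ of $z' = Az + f$, $z(0) = z_0$, given by Duhamel's formula with
  a Bochner integral. Only the values of \<open>f\<close> on $(0,T)$ are used.\<close>

definition mild_solution ::
  "('x \<Rightarrow> 'x \<Rightarrow> bool) \<Rightarrow> real \<Rightarrow> 'x \<Rightarrow> (real \<Rightarrow> 'x) \<Rightarrow> (real \<Rightarrow> 'x::{banach, second_countable_topology}) \<Rightarrow> bool"
  where
  "mild_solution A T z0 f z \<longleftrightarrow>
     (\<exists>S. c0_semigroup S \<and> has_generator S A \<and>
        (\<forall>t\<in>{0..T}.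
           integrable (lebesgue_on {0<..<t}) (\<lambda>s. S (t - s) (f s)) \<and>
           z t = S t z0 + (LINT s|lebesgue_on {0<..<t}. S (t - s) (f s))))"


section \<open>The operator $\partial_x (c\, \partial_x)$ with Dirichlet boundary conditions\<close>

text \<open>Smooth functions with compact support in $(0,1)$.\<close>

definition test_function :: "(real \<Rightarrow> real) \<Rightarrow> bool" where
  "test_function \<phi> \<longleftrightarrow>
     (\<forall>k. (deriv ^^ k) \<phi> differentiable_on UNIV) \<and> closure {x. \<phi> x \<noteq> 0} \<subseteq> {0<..<1}"

definition weak_deriv :: "L2 \<Rightarrow> L2 \<Rightarrow> bool" where
  "weak_deriv F G \<longleftrightarrow>
     (\<forall>\<phi>. test_function \<phi> \<longrightarrow>
        (LINT x|unit_leb. deriv \<phi> x *\<^sub>R rep_L2 F x) = - (LINT x|unit_leb. \<phi> x *\<^sub>R rep_L2 G x))"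

definition H1 :: "L2 set" where
  "H1 = {F. \<exists>G. weak_deriv F G}"

text \<open>Every element of $H^1(0,1)$ has a unique representative that is continuous on $[0,1]$; the
  boundary values are those of this representative.\<close>

definition H1_0 :: "L2 set" where
  "H1_0 = {F \<in> H1. \<exists>w. continuous_on {0..1} w \<and> w 0 = 0 \<and> w 1 = 0 \<and>
                        (AE x in unit_leb. rep_L2 F x = w x)}"

text \<open>Domain: $F \<in> H^1_0(0,1)$ with $c\,F' \<in> H^1(0,1)$. The coefficient \<open>c\<close> is meant to be
  essentially bounded, so that the argument of \<^const>\<open>L2_of\<close> is square integrable.\<close>

definition divergence_op :: "(real \<Rightarrow> real) \<Rightarrow> L2 \<Rightarrow> L2 \<Rightarrow> bool" where
  "divergence_op c F H \<longleftrightarrow>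
     F \<in> H1_0 \<and> (\<exists>G. weak_deriv F G \<and> weak_deriv (L2_of (\<lambda>x. c x *\<^sub>R rep_L2 G x)) H)"


section \<open>Lebesgue norms and convergence\<close>

definition Linf_norm :: "'a measure \<Rightarrow> ('a \<Rightarrow> complex) \<Rightarrow> ennreal" where
  "Linf_norm M u = esssup M (\<lambda>p. ennreal (norm (u p)))"

text \<open>Representatives of elements of $L^\infty(M)$; equality in $L^\infty(M)$ is equality almost
  everywhere.\<close>

definition Linf :: "'a measure \<Rightarrow> ('a \<Rightarrow> complex) set" where
  "Linf M = {u \<in> borel_measurable M. Linf_norm M u < \<infinity>}"

text \<open>Meaningful when the \<open>p\<close>-th power of the modulus is integrable, e.g. for essentially bounded \<open>u\<close>
  on a finite measure space.\<close>

definition Lp_norm :: "real \<Rightarrow> 'a measure \<Rightarrow> ('a \<Rightarrow> complex) \<Rightarrow> real" where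
  "Lp_norm p M u = (LINT x|M. norm (u x) powr p) powr (1 / p)"

definition weak_star_tendsto ::
  "'a measure \<Rightarrow> ('i \<Rightarrow> 'a \<Rightarrow> complex) \<Rightarrow> ('a \<Rightarrow> complex) \<Rightarrow> 'i filter \<Rightarrow> bool" where
  "weak_star_tendsto M u v \<F> \<longleftrightarrow>
     (\<forall>\<phi> :: 'a \<Rightarrow> complex. integrable M \<phi> \<longrightarrow>
        ((\<lambda>i. LINT x|M. u i x * \<phi> x) \<longlongrightarrow> (LINT x|M. v x * \<phi> x)) \<F>)"


section \<open>The norm-optimal control problem\<close>

definition coef :: "(real \<Rightarrow> real) \<Rightarrow> real \<Rightarrow> real \<Rightarrow> real" where
  "coef a \<epsilon> x = (if \<epsilon> = 0 then inverse (LINT y|lebesgue_on {0..1}. 1 / a y) else a (x / \<epsilon>))"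

abbreviation cylinder :: "real \<Rightarrow> real set \<Rightarrow> (real \<times> real) measure" where
  "cylinder \<tau> I \<equiv> lebesgue_on ({0<..<\<tau>} \<times> I)"

text \<open>For almost every \<open>t\<close> the slice below is square integrable; the convention
  \<^term>\<open>L2_of f = 0\<close> for other functions only concerns a null set of times.\<close>

definition source :: "real set \<Rightarrow> (real \<times> real \<Rightarrow> complex) \<Rightarrow> real \<Rightarrow> L2" where
  "source I u t = L2_of (\<lambda>x. indicator I x *\<^sub>R u (t, x))"

definition null_controls ::
  "(real \<Rightarrow> real) \<Rightarrow> real set \<Rightarrow> real \<Rightarrow> L2 \<Rightarrow> real \<Rightarrow> (real \<times> real \<Rightarrow> complex) set" where
  "null_controls a I \<tau> z0 \<epsilon> =
     {u \<in> Linf (cylinder \<tau> I).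
        \<exists>z. mild_solution (divergence_op (coef a \<epsilon>)) \<tau> z0 (source I u) z \<and> z \<tau> = 0}"

definition optimal_norm ::
  "(real \<Rightarrow> real) \<Rightarrow> real set \<Rightarrow> real \<Rightarrow> L2 \<Rightarrow> real \<Rightarrow> ennreal" where
  "optimal_norm a I \<tau> z0 \<epsilon> = (INF u\<in>null_controls a I \<tau> z0 \<epsilon>. Linf_norm (cylinder \<tau> I) u)"

definition norm_optimal ::
  "(real \<Rightarrow> real) \<Rightarrow> real set \<Rightarrow> real \<Rightarrow> L2 \<Rightarrow> real \<Rightarrow> (real \<times> real \<Rightarrow> complex) \<Rightarrow> bool" where
  "norm_optimal a I \<tau> z0 \<epsilon> u \<longleftrightarrow>
     u \<in> null_controls a I \<tau> z0 \<epsilon> \<and> Linf_norm (cylinder \<tau> I) u = optimal_norm a I \<tau> z0 \<epsilon>"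

end

theory Submission
  imports Defs "HOL-Computational_Algebra.Fundamental_Theorem_Algebra"
begin

text \<open>The inverse \<open>B\<close> of the operator \<open>z \<mapsto> - (a z')'\<close> is bounded, self-adjoint, positive and injective on
  \<open>L\<^sup>2\<close>, and the heat semigroup is the continuous function \<open>S t = exp (- t / B)\<close> of it. Lagrange extrapolation in time
  bounds all \<open>B\<close>-powers of \<open>S t \<psi>\<close> on \<open>I\<close> by the integral of the \<open>L\<^sup>1(I)\<close> norm of \<open>S r \<psi>\<close>; solving the equation
  sideways in \<open>x\<close>, from a point of \<open>I\<close>, extends the bound to \<open>(0,1)\<close>, and summing over geometrically shrinking time
  intervals gives an observability inequality whose constant depends only on \<open>K\<close>, \<open>I\<close> and \<open>\<tau>\<close>, not on the coefficient.
  By convex separation, the optimal norm is the least \<open>N\<close> such that \<open>- \<langle>S \<tau> \<psi>, z0\<rangle> \<le> N\<close> times the integral of the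
  \<open>L\<^sup>1(I)\<close> norm of \<open>S r \<psi>\<close>, for all \<open>\<psi>\<close>. If an optimal control were smaller than \<open>N\<close> on a set of positive measure,
  almost maximizers \<open>\<psi>\<close>, slightly regularized, would have a weak limit \<open>v \<noteq> 0\<close> whose evolution vanishes on that set;
  time analyticity and sideways uniqueness exclude this. Averaging two optimal controls then gives uniqueness.
  As \<open>\<epsilon> \<rightarrow> 0\<close>, the inverse coefficients converge weakly, hence the operators \<open>B\<close> and the semigroups converge strongly.
  Uniform observability bounds the limit of the costs from above. Weak limits of optimal controls are optimal, hence
  unique, and since the moduli of the controls are constant, weak convergence forces the costs to converge and the
  convergence of the controls to be strong.\<close>

text \<open>The coefficient is only measurable and oscillates ever faster, so estimates that
  differentiate it, such as Carleman inequalities, are out of reach. Dimension one offers a way out: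
  at a fixed time, solution and flux obey a first-order system in \<open>x\<close> that sees the
  coefficient only through \<open>1 / K\<close> and \<open>K\<close>. Every second step of that
  system costs one time derivative, which is why all of them are needed, with factorial bounds.
  Formally they are negative powers of \<open>B\<close>, that is, bounded symbols of the functional
  calculus. Two limits are obstructed at an end of the time interval. Almost maximizers of the dual
  problem are bounded only after a positive time \<open>\<eta>\<close>, hence the bang-bang property
  is first proved up to \<open>\<tau> - \<eta>\<close>. And a control for the limit problem leaves
  the oscillating system only near zero, a residue that no control removes in an instant; it is
  absorbed by shifting the control in time by \<open>\<eta>\<close>
  (\<open>cost_perturbation\<close>). Weak limits are never taken as such: wherever one is meant,
  the proof picks a common point of nested closed convex sets, found by minimizing a norm.\<close>

abbreviation U :: "real measure" where "U \<equiv> unit_leb"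

section \<open>Convexity in Hilbert spaces\<close>

text \<open>The parallelogram argument in abstract form, since it serves twice: for vectors of a
  Hilbert space and for functions that are not identified almost everywhere. There \<open>q\<close>
  is a squared norm and \<open>d\<close> a squared distance. The infima of \<open>q\<close> over
  \<open>C n\<close> increase and stay below \<open>R\<close>, hence converge, and the midpoint of
  two almost minimizers cannot fall much below them.\<close>

lemma minimizing_sequence_Cauchy:
  fixes C :: "nat \<Rightarrow> 'v set" and q :: "'v \<Rightarrow> real" and d :: "'v \<Rightarrow> 'v \<Rightarrow> real"
  assumes ne: "\<And>n. C n \<noteq> {}" and dec: "\<And>n. C (Suc n) \<subseteq> C n"
    and q0: "\<And>u. u \<in> C 0 \<Longrightarrow> 0 \<le> q u" and qR: "\<And>u. u \<in> C 0 \<Longrightarrow> q u \<le> R"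
    and mid: "\<And>n u v. u \<in> C n \<Longrightarrow> v \<in> C n \<Longrightarrow> mid u v \<in> C n"
    and par: "\<And>u v. u \<in> C 0 \<Longrightarrow> v \<in> C 0 \<Longrightarrow> d u v \<le> 2 * q u + 2 * q v - 4 * q (mid u v)"
  shows "\<exists>u. (\<forall>n. u n \<in> C n) \<and> (\<forall>e>0. \<exists>N. \<forall>m\<ge>N. \<forall>n\<ge>N. d (u m) (u n) < e)"
proof -
  define m where "m n = Inf (q ` C n)" for n
  have anti: "C k \<subseteq> C n" if "n \<le> k" for n k using lift_Suc_antimono_le[of C n k] dec that by blast
  hence C0: "u \<in> C 0" if "u \<in> C n" for n u using that by blast
  have bdd: "bdd_below (q ` C n)" for n using q0 C0 by (intro bdd_belowI[of _ 0]) auto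
  have m_le: "m n \<le> q u" if "u \<in> C n" for n u unfolding m_def using bdd that by (intro cInf_lower) auto
  have m_mono: "m n \<le> m k" if "n \<le> k" for n k unfolding m_def using ne anti[OF that] bdd by (intro cInf_superset_mono) auto
  have mR: "m n \<le> R" for n
  proof -
    obtain w where "w \<in> C n" using ne[of n] by blast
    thus ?thesis using m_le qR[OF C0] by (meson order_trans)
  qed
  have "norm (m n) \<le> \<bar>m 0\<bar> + \<bar>R\<bar>" for n using mR[of n] m_mono[of 0 n] unfolding real_norm_def by linarith
  hence "convergent m" using m_mono by (intro Bseq_mono_convergent BseqI') auto
  hence Cm: "Cauchy m" by (rule convergent_Cauchy)
  have "\<exists>v. v \<in> C n \<and> q v < m n + inverse (Suc n)" for n
    using cInf_lessD[of "q ` C n" "m n + inverse (Suc n)"] ne[of n] by (auto simp: m_def)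
  then obtain u where u: "\<And>n. u n \<in> C n" "\<And>n. q (u n) < m n + inverse (Suc n)" by metis
  have "\<exists>N. \<forall>i\<ge>N. \<forall>j\<ge>N. d (u i) (u j) < e" if "e > 0" for e
  proof -
    have "e / 16 > 0" using that by simp
    then obtain N1 where N1: "\<And>i j. i \<ge> N1 \<Longrightarrow> j \<ge> N1 \<Longrightarrow> dist (m i) (m j) < e / 16"
      using Cm unfolding Cauchy_def by blast
    obtain N2 where N2: "inverse (real (Suc N2)) < e / 16" using reals_Archimedean \<open>e / 16 > 0\<close> by blast
    have "d (u i) (u j) < e" if ij: "i \<ge> max N1 N2" "j \<ge> max N1 N2" for i j
    proof -
      define k where "k = min i j"
      have "u i \<in> C k" "u j \<in> C k" using u(1) anti[of k i] anti[of k j] by (auto simp: k_def)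
      note par[OF C0[OF this(1)] C0[OF this(2)]] and m_le[OF mid[OF this]]
      moreover have "\<bar>m i - m k\<bar> < e / 16" "\<bar>m j - m k\<bar> < e / 16"
        using N1[of i k] N1[of j k] ij by (auto simp: k_def dist_real_def)
      moreover have "inverse (real (Suc i)) \<le> inverse (real (Suc N2))"
        "inverse (real (Suc j)) \<le> inverse (real (Suc N2))" using ij by (auto intro!: le_imp_inverse_le)
      ultimately show ?thesis using u(2)[of i] u(2)[of j] N2 by linarith
    qed
    thus ?thesis by blast
  qed
  thus ?thesis using u(1) by blast
qed

lemma midpoint_parallelogram:
  fixes u v :: "'a::real_inner"
  shows "(norm (u - v))^2 = 2 * (norm u)^2 + 2 * (norm v)^2 - 4 * (norm ((1/2) *\<^sub>R (u + v)))^2"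
proof -
  have "(norm ((1/2) *\<^sub>R (u + v)))^2 = (norm (u + v))^2 / 4" by (simp add: power_divide)
  thus ?thesis by (simp add: power2_norm_eq_inner inner_simps inner_commute)
qed

text \<open>This is the part of weak compactness of balls that the proof uses; the common point is a
  norm limit of almost minimal points of the sets.\<close>

lemma Inter_nested_closed_convex_nonempty:
  fixes C :: "nat \<Rightarrow> 'a::{real_inner, banach} set"
  assumes "\<And>n. C n \<noteq> {}" and dec: "\<And>n. C (Suc n) \<subseteq> C n"
    and cl: "\<And>n. closed (C n)" and cv: "\<And>n. convex (C n)" and bd: "\<And>x. x \<in> C 0 \<Longrightarrow> norm x \<le> R"
  shows "(\<Inter>n. C n) \<noteq> {}"
proof -
  have sq: "(norm x)^2 \<le> R^2" if "x \<in> C 0" for x using bd[OF that] by (intro power_mono) auto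
  have mid: "(1/2) *\<^sub>R (x + y) \<in> C n" if "x \<in> C n" "y \<in> C n" for n x y
    using convexD[OF cv that, of "1/2" "1/2"] by (simp add: scaleR_add_right)
  have "\<exists>u. (\<forall>n. u n \<in> C n) \<and> (\<forall>e>0. \<exists>N. \<forall>m\<ge>N. \<forall>n\<ge>N. (norm (u m - u n))^2 < e)"
    by (rule minimizing_sequence_Cauchy[where q = "\<lambda>x. (norm x)^2" and R = "R^2"
        and mid = "\<lambda>x y. (1/2) *\<^sub>R (x + y)"])
      (use assms(1) dec sq mid eq_refl[OF midpoint_parallelogram] in auto)
  then obtain u where u: "\<And>n. u n \<in> C n"
    "\<And>e. e > 0 \<Longrightarrow> \<exists>N. \<forall>m\<ge>N. \<forall>n\<ge>N. (norm (u m - u n))^2 < e" by blast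
  have "Cauchy u" unfolding Cauchy_def
  proof (intro allI impI)
    fix e :: real assume "e > 0"
    then obtain N where "\<forall>m\<ge>N. \<forall>n\<ge>N. (norm (u m - u n))^2 < e^2" using u(2)[of "e^2"] by auto
    thus "\<exists>M. \<forall>m\<ge>M. \<forall>n\<ge>M. dist (u m) (u n) < e"
      using \<open>e > 0\<close> by (auto simp: dist_norm intro: power2_less_imp_less less_imp_le)
  qed
  then obtain l where l: "u \<longlonglongrightarrow> l" using Cauchy_convergent convergent_def by blast
  have anti: "C k \<subseteq> C n" if "n \<le> k" for n k using lift_Suc_antimono_le[of C n k] dec that by blast
  have "l \<in> C n" for n using cl
  proof (rule Lim_in_closed_set[OF _ _ _ l])
    show "\<forall>\<^sub>F k in sequentially. u k \<in> C n" using u(1) anti by (intro eventually_sequentiallyI[of n]) blast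
  qed simp
  thus ?thesis by blast
qed

lemma closed_convex_nearest_point:
  fixes K :: "'a::{real_inner, banach} set"
  assumes "closed K" "convex K" "K \<noteq> {}"
  obtains p where "p \<in> K" "\<And>k. k \<in> K \<Longrightarrow> inner (y - p) (k - p) \<le> 0"
proof -
  define \<delta> where "\<delta> = infdist y K"
  define C where "C n = K \<inter> cball y (\<delta> + inverse (Suc n))" for n
  have ne: "C n \<noteq> {}" for n
  proof -
    have "\<exists>k\<in>K. dist y k < \<delta> + inverse (Suc n)"
      using cInf_lessD[of "dist y ` K" "\<delta> + inverse (Suc n)"] assms(3) by (auto simp: \<delta>_def infdist_notempty)
    thus ?thesis by (force simp: C_def)
  qed
  have dec: "C (Suc n) \<subseteq> C n" for n
  proof -
    have "inverse (real (Suc (Suc n))) \<le> inverse (real (Suc n))" by (intro le_imp_inverse_le) auto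
    thus ?thesis unfolding C_def by (intro Int_mono order_refl subset_cball) linarith
  qed
  have bd: "norm x \<le> norm y + \<delta> + 1" if "x \<in> C n" for n x
  proof -
    have "dist y x \<le> \<delta> + inverse (Suc n)" "inverse (real (Suc n)) \<le> 1"
      using that by (auto simp: C_def intro!: le_imp_inverse_le simp: field_simps)
    thus ?thesis using norm_triangle_ineq3[of x y] by (simp add: dist_norm norm_minus_commute)
  qed
  have clcv: "closed (C n)" "convex (C n)" for n using assms(1,2) by (auto simp: C_def closed_Int convex_Int)
  have "(\<Inter>n. C n) \<noteq> {}"
    by (rule Inter_nested_closed_convex_nonempty[where R = "norm y + \<delta> + 1"]; fact ne dec clcv bd)
  then obtain p where p: "\<And>n. p \<in> C n" by blast
  have pK: "p \<in> K" using p by (auto simp: C_def)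
  have "dist y p \<le> \<delta>"
  proof (rule field_le_epsilon)
    fix e :: real assume "e > 0"
    then obtain n where "inverse (real (Suc n)) < e" using reals_Archimedean by blast
    thus "dist y p \<le> \<delta> + e" using p[of n] by (simp add: C_def)
  qed
  hence min: "dist y p \<le> dist y k" if "k \<in> K" for k using infdist_le[OF that, of y] by (simp add: \<delta>_def)
  have "inner (y - p) (k - p) \<le> 0" if k: "k \<in> K" for k
  proof (rule ccontr)
    assume "\<not> inner (y - p) (k - p) \<le> 0"
    hence pos: "inner (y - p) (k - p) > 0" by simp
    hence kp: "norm (k - p) > 0" by auto
    \<comment> \<open>The step towards \<open>k\<close> that minimizes the distance to
      \<open>y\<close> along the ray, cut off at \<open>1\<close> so as to stay in
      \<open>K\<close>.\<close>
    define s where "s = min 1 (inner (y - p) (k - p) / (norm (k - p))^2)"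
    have s: "0 < s" "s \<le> 1" using pos kp by (auto simp: s_def)
    have "s * (norm (k - p))^2 \<le> inner (y - p) (k - p)" using kp by (simp add: s_def min_def field_simps)
    hence "s * (s * (norm (k - p))^2) \<le> s * inner (y - p) (k - p)" using s by (intro mult_left_mono) auto
    moreover have "s * inner (y - p) (k - p) > 0" using s pos by simp
    moreover have "p + s *\<^sub>R (k - p) \<in> K" using convexD[OF assms(2) pK k, of "1 - s" s] s by (simp add: algebra_simps)
    hence "(norm (y - p))^2 \<le> (norm (y - (p + s *\<^sub>R (k - p))))^2" using min by (intro power_mono) (auto simp: dist_norm)
    moreover have "(norm (y - (p + s *\<^sub>R (k - p))))^2 =
        (norm (y - p))^2 - 2 * (s * inner (y - p) (k - p)) + s * (s * (norm (k - p))^2)"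
      by (simp add: power2_norm_eq_inner inner_simps inner_commute algebra_simps)
    ultimately show False by linarith
  qed
  thus thesis using that pK by blast
qed

lemma closed_convex_separation:
  fixes K :: "'a::{real_inner, banach} set"
  assumes "closed K" "convex K" "K \<noteq> {}" "y \<notin> K"
  obtains \<psi> b where "\<And>k. k \<in> K \<Longrightarrow> inner \<psi> k \<le> b" "b < inner \<psi> y"
proof -
  obtain p where p: "p \<in> K" "\<And>k. k \<in> K \<Longrightarrow> inner (y - p) (k - p) \<le> 0"
    using closed_convex_nearest_point[OF assms(1-3)] by blast
  show thesis
  proof (rule that[of "y - p" "inner (y - p) p"])
    show "inner (y - p) k \<le> inner (y - p) p" if "k \<in> K" for k using p(2)[OF that] by (simp add: inner_diff_right)
    have "y - p \<noteq> 0" using p assms(4) by auto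
    hence "inner (y - p) (y - p) > 0" by simp
    thus "inner (y - p) p < inner (y - p) y" by (simp add: inner_diff_right)
  qed
qed

text \<open>A hyperplane that separates a point from the closed range is bounded on a linear
  subspace and so vanishes there; symmetry turns this into \<open>B \<psi> = 0\<close>.\<close>

lemma closure_range_symmetric_injective:
  fixes B :: "'a::{real_inner, banach} \<Rightarrow> 'a"
  assumes "linear B" and sym: "\<And>x y. inner (B x) y = inner x (B y)"
    and inj: "\<And>x. B x = 0 \<Longrightarrow> x = 0"
  shows "closure (range B) = UNIV"
proof -
  interpret linear B by fact
  have "y \<in> closure (range B)" for y
  proof (rule ccontr)
    assume y: "y \<notin> closure (range B)"
    have cv: "convex (closure (range B))" by (intro convex_closure convex_linear_image assms convex_UNIV)
    obtain \<psi> b where \<psi>: "\<And>k. k \<in> closure (range B) \<Longrightarrow> inner \<psi> k \<le> b" "b < inner \<psi> y"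
      using closed_convex_separation[OF closed_closure cv _ y] by auto
    have le: "r * inner \<psi> (B x) \<le> b" for x r
      using \<psi>(1)[OF subsetD[OF closure_subset rangeI], of "r *\<^sub>R x"] by (simp add: scale)
    have "inner \<psi> (B x) = 0" for x
    proof (rule ccontr)
      assume "inner \<psi> (B x) \<noteq> 0"
      thus False using le[of "(b + 1) / inner \<psi> (B x)" x] by simp
    qed
    hence "inner (B \<psi>) (B \<psi>) = 0" using sym by simp
    hence "\<psi> = 0" using inj by simp
    thus False using \<psi> le[of 0 0] by simp
  qed
  thus ?thesis by blast
qed

text \<open>A substitute for weak compactness of balls of \<open>L^2\<close>: minimal-norm elements of the sets converge.\<close>

lemma nested_convex_functions_nonempty:
  fixes C :: "nat \<Rightarrow> ('b \<Rightarrow> complex) set"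
  assumes "finite_measure M"
    and ne: "\<And>n. C n \<noteq> {}" and dec: "\<And>n. C (Suc n) \<subseteq> C n"
    and meas: "\<And>u. u \<in> C 0 \<Longrightarrow> u \<in> borel_measurable M"
    and bd: "\<And>u. u \<in> C 0 \<Longrightarrow> AE x in M. norm (u x) \<le> R"
    and mid: "\<And>n u v. u \<in> C n \<Longrightarrow> v \<in> C n \<Longrightarrow> (\<lambda>x. (1/2) *\<^sub>R (u x + v x)) \<in> C n"
    and cl: "\<And>n u v. (\<And>k. u k \<in> C n) \<Longrightarrow> v \<in> borel_measurable M \<Longrightarrow>
        AE x in M. (\<lambda>k. u k x) \<longlonglongrightarrow> v x \<Longrightarrow> v \<in> C n"
  shows "(\<Inter>n. C n) \<noteq> {}"
proof -
  interpret finite_measure M by (rule assms(1))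
  have anti: "C k \<subseteq> C n" if "n \<le> k" for n k using lift_Suc_antimono_le[of C n k] dec that by blast
  hence C0: "u \<in> C 0" if "u \<in> C n" for n u using that by blast
  have intsq: "integrable M (\<lambda>x. (norm (u x))^2)" if "u \<in> C 0" for u using meas[OF that] bd[OF that]
    by (intro integrable_const_bound[where B = "R^2"]) (auto elim!: eventually_mono intro: power_mono)
  have int: "integrable M u" if "u \<in> C 0" for u using meas[OF that] bd[OF that] by (intro integrable_const_bound[where B = R]) auto
  have mdiff: "(\<lambda>x. u x - v x) \<in> borel_measurable M" if "u \<in> C 0" "v \<in> C 0" for u v
    using meas[OF that(1)] meas[OF that(2)] by measurable
  have intd: "integrable M (\<lambda>x. (norm (u x - v x))^2)" if "u \<in> C 0" "v \<in> C 0" for u v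
  proof (rule integrable_const_bound[where B = "(2 * R)^2"])
    show "AE x in M. norm ((norm (u x - v x))^2) \<le> (2 * R)^2" using bd[OF that(1)] bd[OF that(2)]
    proof eventually_elim
      case (elim x)
      hence "norm (u x - v x) \<le> 2 * R" using norm_triangle_ineq4[of "u x" "v x"] by linarith
      hence "(norm (u x - v x))^2 \<le> (2 * R)^2" by (intro power_mono) auto
      thus ?case by simp
    qed
  qed (use mdiff[OF that] in measurable)
  define q where "q u = (LINT x|M. (norm (u x :: complex))^2)" for u
  define d where "d u v = (LINT x|M. (norm (u x - v x :: complex))^2)" for u v
  have q0: "0 \<le> q u" for u by (simp add: q_def)
  have qR: "q u \<le> R^2 * measure M (space M)" if "u \<in> C 0" for u
  proof -
    have "q u \<le> (LINT x|M. R^2)" unfolding q_def using intsq[OF that] bd[OF that]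
      by (intro integral_mono_AE) (auto elim!: eventually_mono intro: power_mono)
    thus ?thesis by (simp add: mult.commute)
  qed
  have par: "d u v \<le> 2 * q u + 2 * q v - 4 * q (\<lambda>x. (1/2) *\<^sub>R (u x + v x))" if "u \<in> C 0" "v \<in> C 0" for u v
    unfolding d_def q_def midpoint_parallelogram using intsq[OF that(1)] intsq[OF that(2)] intsq[OF mid[OF that]] by simp
  have "\<exists>u. (\<forall>n. u n \<in> C n) \<and> (\<forall>e>0. \<exists>N. \<forall>m\<ge>N. \<forall>n\<ge>N. d (u m) (u n) < e)"
    by (rule minimizing_sequence_Cauchy[where C = C and q = q and d = d and R = "R^2 * measure M (space M)"
        and mid = "\<lambda>u v x. (1/2) *\<^sub>R (u x + v x)", OF ne dec q0 qR mid par])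
  then obtain u where u: "\<And>n. u n \<in> C n" "\<And>e. e > 0 \<Longrightarrow> \<exists>N. \<forall>m\<ge>N. \<forall>n\<ge>N. d (u m) (u n) < e"
    by blast
  note u0 = C0[OF u(1)]
  \<comment> \<open>A subsequence that converges almost everywhere is extracted from an
    \<open>L^1\<close> Cauchy sequence, so the quadratic smallness is first weakened by means of
    \<open>y \<le> y^2 / s + s\<close>.\<close>
  have L1: "\<exists>N. \<forall>i\<ge>N. \<forall>j\<ge>N. (LINT x|M. norm (u i x - u j x)) < e" if "e > 0" for e
  proof -
    define s where "s = e / (2 * (measure M (space M) + 1))"
    have m: "measure M (space M) + 1 > 0" using measure_nonneg[of M "space M"] by linarith
    hence s: "s > 0" "s * measure M (space M) < e / 2" using \<open>e > 0\<close> by (simp_all add: s_def field_simps)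
    obtain N where N: "\<And>i j. i \<ge> N \<Longrightarrow> j \<ge> N \<Longrightarrow> d (u i) (u j) < s * (e / 2)"
      using u(2)[of "s * (e / 2)"] \<open>e > 0\<close> s by auto
    have "(LINT x|M. norm (u i x - u j x)) < e" if ij: "i \<ge> N" "j \<ge> N" for i j
    proof -
      have "(LINT x|M. norm (u i x - u j x)) \<le> (LINT x|M. (norm (u i x - u j x))^2 / s + s)"
      proof (rule integral_mono)
        show "norm (u i x - u j x) \<le> (norm (u i x - u j x))^2 / s + s" for x
        proof (cases "norm (u i x - u j x) \<le> s")
          case False
          hence "norm (u i x - u j x) * s \<le> (norm (u i x - u j x))^2" unfolding power2_eq_square by (intro mult_left_mono) auto
          hence "norm (u i x - u j x) \<le> (norm (u i x - u j x))^2 / s" using s by (simp add: pos_le_divide_eq)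
          thus ?thesis using s by linarith
        qed (use s in "simp add: add_increasing")
      qed (use int[OF u0] intd[OF u0 u0] in auto)
      also have "\<dots> = d (u i) (u j) / s + s * measure M (space M)" using intd[OF u0 u0] by (simp add: d_def)
      also have "d (u i) (u j) / s < e / 2" using N[OF ij] s by (simp add: pos_divide_less_eq mult.commute)
      finally show ?thesis using s by linarith
    qed
    thus ?thesis by blast
  qed
  obtain r where r: "strict_mono r" "AE x in M. Cauchy (\<lambda>i. u (r i) x)"
    using cauchy_L1_AE_cauchy_subseq[OF int[OF u0] L1] by blast
  have [measurable]: "u k \<in> borel_measurable M" for k using meas[OF u0] .
  define v where "v x = lim (\<lambda>i. u (r i) x)" for x
  have v[measurable]: "v \<in> borel_measurable M" unfolding v_def[abs_def] by measurable
  have lim: "AE x in M. (\<lambda>i. u (r i) x) \<longlonglongrightarrow> v x"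
    using r(2) by eventually_elim (simp add: v_def Cauchy_convergent_iff convergent_LIMSEQ_iff)
  have "v \<in> C n" for n
  proof (rule cl[OF _ v])
    show "u (r (k + n)) \<in> C n" for k using u(1)[of "r (k + n)"] anti[of n "r (k + n)"] seq_suble[OF r(1), of "k + n"] by auto
    show "AE x in M. (\<lambda>k. u (r (k + n)) x) \<longlonglongrightarrow> v x"
      using lim by eventually_elim (rule LIMSEQ_ignore_initial_segment)
  qed
  thus ?thesis by blast
qed

section \<open>Functional calculus of a positive operator\<close>

definition op_poly :: "('a \<Rightarrow> 'a) \<Rightarrow> real poly \<Rightarrow> 'a \<Rightarrow> 'a::real_vector" where
  "op_poly B p x = (\<Sum>i\<le>degree p. coeff p i *\<^sub>R (B ^^ i) x)"

lemma op_poly_sum: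
  assumes "degree p \<le> n"
  shows "op_poly B p x = (\<Sum>i\<le>n. coeff p i *\<^sub>R (B ^^ i) x)"
  unfolding op_poly_def using assms by (intro sum.mono_neutral_left) (auto simp: coeff_eq_0)

lemma op_poly_add: "op_poly B (p + q) x = op_poly B p x + op_poly B q x"
proof -
  have "op_poly B r x = (\<Sum>i\<le>max (degree p) (degree q). coeff r i *\<^sub>R (B ^^ i) x)" if "r \<in> {p, q, p + q}" for r
    using that degree_add_le_max[of p q] by (intro op_poly_sum) auto
  thus ?thesis by (simp add: scaleR_add_left sum.distrib)
qed

lemma op_poly_smult: "op_poly B (smult c p) x = c *\<^sub>R op_poly B p x"
  using op_poly_sum[of "smult c p" "degree p" B x] degree_smult_le[of c p] by (simp add: op_poly_def scaleR_sum_right)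

lemma op_poly_0 [simp]: "op_poly B 0 x = 0" by (simp add: op_poly_def)

lemma op_poly_pCons:
  assumes "linear B"
  shows "op_poly B (pCons a p) x = a *\<^sub>R x + B (op_poly B p x)"
proof -
  interpret linear B by fact
  have "op_poly B (pCons a p) x = (\<Sum>i\<le>Suc (degree p). coeff (pCons a p) i *\<^sub>R (B ^^ i) x)"
    by (intro op_poly_sum degree_pCons_le)
  also have "\<dots> = a *\<^sub>R x + B (op_poly B p x)" by (subst sum.atMost_Suc_shift) (simp add: op_poly_def sum scale)
  finally show ?thesis .
qed

lemma linear_op_poly:
  assumes "linear B"
  shows "linear (op_poly B p)"
proof (induction p)
  case 0
  thus ?case by (simp add: linear_iff)
next
  case (pCons a p)
  thus ?case using assms by (simp add: linear_iff op_poly_pCons scaleR_add_right)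
qed

lemma op_poly_mult:
  assumes "linear B"
  shows "op_poly B (p * q) x = op_poly B p (op_poly B q x)"
proof (induction p)
  case (pCons a p)
  thus ?case using assms by (simp add: op_poly_pCons op_poly_add op_poly_smult)
qed simp

lemma op_poly_commute:
  assumes "linear B"
  shows "B (op_poly B p x) = op_poly B p (B x)"
proof (induction p)
  case (pCons a p)
  thus ?case using assms by (simp add: op_poly_pCons linear_iff)
qed (use assms in "simp add: linear_iff linear_0")

text \<open>Multiplication by \<open>z\<close>, seen as a real-linear operator, is itself an
  instance of the calculus; evaluating real polynomials at complex points is thereby reduced to
  \<open>op_poly\<close>.\<close>

lemma op_poly_complex: "op_poly ((*) z) p 1 = poly (map_poly complex_of_real p) z"
proof (induction p)
  case (pCons a p)
  have "linear ((*) z)" by (simp add: linear_iff algebra_simps)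
  thus ?case using pCons by (simp add: op_poly_pCons map_poly_pCons scaleR_conv_of_real)
qed simp

text \<open>The remainder of \<open>q\<close> modulo the real quadratic of \<open>z\<close> has
  degree at most one and vanishes at \<open>z\<close>; when \<open>Im z \<noteq> 0\<close>, both of
  its coefficients are therefore zero.\<close>

lemma real_poly_complex_root_factor:
  fixes q :: "real poly"
  assumes "poly (map_poly complex_of_real q) z = 0"
  shows "(Im z = 0 \<longrightarrow> [:- Re z, 1:] dvd q) \<and>
    (Im z \<noteq> 0 \<longrightarrow> [:(Re z)^2 + (Im z)^2, - 2 * Re z, 1:] dvd q)"
proof (intro conjI impI)
  let ?m = "(*) z"
  have lin: "linear ?m" by (simp add: linear_iff algebra_simps)
  have q: "op_poly ?m q 1 = 0" using assms by (simp add: op_poly_complex)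
  {
    assume "Im z = 0"
    hence z: "z = of_real (Re z)" by (simp add: complex_eq_iff)
    have "poly (map_poly complex_of_real p) (of_real x) = of_real (poly p x)" for p x by (induction p) (simp_all add: map_poly_pCons)
    hence "poly q (Re z) = 0" using assms z by (metis of_real_eq_0_iff)
    thus "[:- Re z, 1:] dvd q" by (simp add: poly_eq_0_iff_dvd)
  }
  {
    assume im: "Im z \<noteq> 0"
    let ?d = "[:(Re z)^2 + (Im z)^2, - 2 * Re z, 1:]"
    have d: "op_poly ?m ?d w = 0" for w
    proof -
      have "op_poly ?m ?d w = (of_real ((Re z)^2 + (Im z)^2) - 2 * of_real (Re z) * z + z * z) * w"
        by (simp add: op_poly_pCons[OF lin] scaleR_conv_of_real algebra_simps)
      also have "of_real ((Re z)^2 + (Im z)^2) - 2 * of_real (Re z) * z + z * z = 0" by (simp add: complex_eq_iff power2_eq_square)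
      finally show ?thesis by simp
    qed
    have "op_poly ?m (?d * (q div ?d) + q mod ?d) 1 = 0" using q by (simp only: mult_div_mod_eq)
    hence r: "op_poly ?m (q mod ?d) 1 = 0" by (simp only: op_poly_add op_poly_mult[OF lin] d) simp
    have "degree (q mod ?d) < 2" using degree_mod_less'[of ?d q] by (cases "q mod ?d = 0") auto
    hence "op_poly ?m (q mod ?d) 1 = (\<Sum>i\<le>1. coeff (q mod ?d) i *\<^sub>R ((?m ^^ i) 1))" by (intro op_poly_sum) simp
    hence "of_real (coeff (q mod ?d) 0) + of_real (coeff (q mod ?d) 1) * z = 0" using r by (simp add: scaleR_conv_of_real)
    hence "coeff (q mod ?d) 0 = 0 \<and> coeff (q mod ?d) 1 = 0" using im by (auto simp: complex_eq_iff)
    hence "coeff (q mod ?d) n = 0" for n using coeff_eq_0[of "q mod ?d" n] \<open>degree (q mod ?d) < 2\<close>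
      by (cases "n < 2") (auto simp: less_2_cases_iff)
    hence "q mod ?d = 0" by (simp add: poly_eq_iff)
    thus "?d dvd q" by (simp only: mod_eq_0_iff_dvd)
  }
qed

section \<open>Spectral bounds for polynomials of a positive operator\<close>

locale positive_operator =
  fixes B :: "'a::{real_inner, banach} \<Rightarrow> 'a" and M :: real
  assumes bl: "bounded_linear B"
    and sym: "inner (B x) y = inner x (B y)"
    and pos: "0 \<le> inner (B x) x"
    and le_M: "inner (B x) x \<le> M * (norm x)^2"
    and M_pos: "0 < M"
begin

lemma lin: "linear B"
  using bl by (rule bounded_linear.linear)

lemma op_poly_bounded_linear: "bounded_linear (op_poly B p)"
proof (induction p)
  case 0
  thus ?case unfolding op_poly_0[abs_def] by (simp add: bounded_linear_zero)
next
  case (pCons a p)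
  have "bounded_linear (\<lambda>x. a *\<^sub>R x + B (op_poly B p x))" using pCons bl
    by (intro bounded_linear_add bounded_linear_scaleR_right bounded_linear_compose[OF bl])
  thus ?case by (simp add: op_poly_pCons[OF lin, abs_def])
qed

lemma op_poly_sym: "inner (op_poly B p x) y = inner x (op_poly B p y)"
proof (induction p arbitrary: x y)
  case (pCons a p)
  thus ?case by (simp add: op_poly_pCons[OF lin] inner_simps sym op_poly_commute[OF lin])
qed simp

text \<open>A replacement for the spectral mapping theorem over a real space: \<open>q\<close> is
  split into real factors. A linear factor is bounded below by the distance of its root from
  \<open>[0, M]\<close>, a quadratic one is \<open>(B - Re z)^2 + (Im z)^2\<close>, and lower bounds
  multiply.\<close>

lemma op_poly_bounded_below:
  assumes "\<And>b. 0 \<le> b \<Longrightarrow> b \<le> M \<Longrightarrow> poly q b \<noteq> 0"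
  shows "\<exists>c>0. \<forall>x. c * norm x \<le> norm (op_poly B q x)"
  using assms
proof (induction "degree q" arbitrary: q rule: less_induct)
  case less
  have "q \<noteq> 0" using less.prems[of 0] M_pos by auto
  show ?case
  proof (cases "degree q = 0")
    case True
    then obtain a where a: "q = [:a:]" by (meson degree_eq_zeroE)
    hence "a \<noteq> 0" using \<open>q \<noteq> 0\<close> by auto
    thus ?thesis using a by (intro exI[of _ "\<bar>a\<bar>"]) (simp add: op_poly_pCons[OF lin] linear_0[OF lin])
  next
    case False
    have "\<not> constant (poly (map_poly complex_of_real q))" using False by (simp add: constant_degree degree_map_poly)
    then obtain z where z: "poly (map_poly complex_of_real q) z = 0" using fundamental_theorem_of_algebra by blast
    note fac = real_poly_complex_root_factor[OF z]
    have step: ?thesis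
      if d: "q = d * r" "degree d > 0" and c: "c > 0" "\<And>y. c * norm y \<le> norm (op_poly B d y)" for d r c
    proof -
      have "d \<noteq> 0" "r \<noteq> 0" using d \<open>q \<noteq> 0\<close> by auto
      hence "degree r < degree q" using d by (simp add: degree_mult_eq)
      moreover have "poly r b \<noteq> 0" if "0 \<le> b" "b \<le> M" for b using less.prems[OF that] d by auto
      ultimately obtain c' where c': "c' > 0" "\<And>x. c' * norm x \<le> norm (op_poly B r x)" using less.hyps by blast
      have "c * c' * norm x \<le> norm (op_poly B q x)" for x
      proof -
        have "c * (c' * norm x) \<le> c * norm (op_poly B r x)" using c c' by (intro mult_left_mono) auto
        also have "\<dots> \<le> norm (op_poly B q x)" unfolding d(1) op_poly_mult[OF lin] by (rule c)
        finally show ?thesis by (simp add: mult.assoc)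
      qed
      thus ?thesis using c c' by (intro exI[of _ "c * c'"]) auto
    qed
    have low: "c * norm y \<le> norm w" if "c * (norm y)^2 \<le> \<bar>inner w y\<bar>" for c and w y :: 'a
    proof (cases "y = 0")
      case False
      have "c * norm y * norm y \<le> norm w * norm y"
        using that Cauchy_Schwarz_ineq2[of w y] by (simp add: power2_eq_square mult.assoc)
      thus ?thesis using False by simp
    qed simp
    show ?thesis
    proof (cases "Im z = 0")
      case True
      then obtain r where r: "q = [:- Re z, 1:] * r" using fac by auto
      \<comment> \<open>The distance of the root from the interval \<open>[0, M]\<close>, which
        contains the numerical range of \<open>B\<close>.\<close>
      define e where "e = (if Re z < 0 then - Re z else Re z - M)"
      have "\<not> (0 \<le> Re z \<and> Re z \<le> M)" using less.prems[of "Re z"] r by auto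
      hence e: "e > 0" by (auto simp: e_def)
      show ?thesis
      proof (rule step[OF r _ e])
        fix y
        have "inner (op_poly B [:- Re z, 1:] y) y = inner (B y) y - Re z * (norm y)^2"
          by (simp add: op_poly_pCons[OF lin] linear_0[OF lin] inner_simps power2_norm_eq_inner)
        moreover have "e * (norm y)^2 \<le> \<bar>inner (B y) y - Re z * (norm y)^2\<bar>"
          using pos[of y] le_M[of y] by (auto simp: e_def algebra_simps)
        ultimately show "e * norm y \<le> norm (op_poly B [:- Re z, 1:] y)" by (intro low) simp
      qed simp
    next
      case False
      then obtain r where r: "q = [:(Re z)^2 + (Im z)^2, - 2 * Re z, 1:] * r" using fac by auto
      show ?thesis
      proof (rule step[OF r])
        show "(Im z)^2 > 0" using False by simp
        fix y
        have "inner (op_poly B [:(Re z)^2 + (Im z)^2, - 2 * Re z, 1:] y) y =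
            (norm (B y - Re z *\<^sub>R y))^2 + (Im z)^2 * (norm y)^2"
        proof -
          have "inner (B (B y)) y = inner (B y) (B y)" by (rule sym)
          thus ?thesis by (simp add: op_poly_pCons[OF lin] linear_add[OF lin] linear_scale[OF lin] linear_0[OF lin]
                linear_diff[OF lin] inner_simps power2_norm_eq_inner inner_commute[of y "B y"] algebra_simps
                power2_eq_square[of "Re z"] power2_eq_square[of "Im z"])
        qed
        thus "(Im z)^2 * norm y \<le> norm (op_poly B [:(Re z)^2 + (Im z)^2, - 2 * Re z, 1:] y)" by (intro low) simp
      qed simp
    qed
  qed
qed

text \<open>Otherwise \<open>\<nu> = \<parallel>p(B)\<parallel>\<close> exceeds \<open>\<bar>p\<bar>\<close> on the interval, so \<open>p(B)^2 - \<nu>^2\<close> is bounded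
  below; but almost maximising vectors of \<open>p(B)\<close> are almost annihilated by it.\<close>

lemma norm_op_poly_le:
  assumes s: "\<And>b. 0 \<le> b \<Longrightarrow> b \<le> M \<Longrightarrow> \<bar>poly p b\<bar> \<le> s"
  shows "norm (op_poly B p x) \<le> s * norm x"
proof -
  define T where "T = op_poly B p"
  define \<nu> where "\<nu> = onorm T"
  have T: "bounded_linear T" unfolding T_def by (rule op_poly_bounded_linear)
  have Tle: "norm (T x) \<le> \<nu> * norm x" for x using onorm[OF T] by (simp add: \<nu>_def)
  have Tsym: "inner (T x) y = inner x (T y)" for x y by (simp add: T_def op_poly_sym)
  have s0: "s \<ge> 0" using s[of 0] M_pos by simp
  have "\<nu> \<le> s"
  proof (rule ccontr)
    assume "\<not> \<nu> \<le> s"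
    hence \<nu>: "\<nu> > s" "\<nu> > 0" using s0 by auto
    let ?q = "p * p - [:\<nu>^2:]"
    have "poly ?q b \<noteq> 0" if "0 \<le> b" "b \<le> M" for b
    proof -
      have "\<bar>poly p b\<bar>^2 < \<nu>^2" using s[OF that] \<nu> by (intro power_strict_mono) auto
      thus ?thesis by (simp add: power2_eq_square)
    qed
    then obtain c where c: "c > 0" "\<And>x. c * norm x \<le> norm (op_poly B ?q x)" using op_poly_bounded_below by blast
    have q: "op_poly B ?q x = T (T x) - \<nu>^2 *\<^sub>R x" for x
    proof -
      have "op_poly B ?q x = op_poly B (p * p + smult (-1) [:\<nu>^2:]) x"
        by (simp only: smult_minus_left smult_1_left diff_conv_add_uminus)
      also have "\<dots> = T (T x) - \<nu>^2 *\<^sub>R x"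
        by (simp only: op_poly_add op_poly_smult op_poly_mult[OF lin] op_poly_pCons[OF lin] T_def) (simp add: linear_0[OF lin])
      finally show ?thesis .
    qed
    have est: "\<nu>^2 * (norm (T x))^2 \<le> (\<nu>^2 * \<nu>^2 - c^2) * (norm x)^2" for x
    proof -
      have "(c * norm x)^2 \<le> (norm (T (T x) - \<nu>^2 *\<^sub>R x))^2"
        using c(1) c(2)[of x] unfolding q[of x] by (intro power_mono) auto
      also have "\<dots> = (norm (T (T x)))^2 - 2 * \<nu>^2 * (norm (T x))^2 + \<nu>^2 * \<nu>^2 * (norm x)^2"
        by (simp add: power2_norm_eq_inner inner_simps Tsym inner_commute algebra_simps)
      also have "(norm (T (T x)))^2 \<le> (\<nu> * norm (T x))^2" by (intro power_mono Tle) simp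
      finally show ?thesis by (simp add: power_mult_distrib algebra_simps)
    qed
    \<comment> \<open>The lower bound \<open>c\<close> for \<open>p(B)^2 - \<nu>^2\<close> improves
      the norm bound of \<open>T\<close> from \<open>\<nu>\<close> to \<open>k < \<nu>\<close>; the
      maximum only keeps the root real.\<close>
    define k where "k = sqrt (max 0 (\<nu>^2 - c^2 / \<nu>^2))"
    have "norm (T x) \<le> k * norm x" for x
    proof -
      have "(norm (T x))^2 \<le> (\<nu>^2 - c^2 / \<nu>^2) * (norm x)^2"
        using est[of x] \<nu> by (simp add: field_simps power2_eq_square)
      also have "\<dots> \<le> max 0 (\<nu>^2 - c^2 / \<nu>^2) * (norm x)^2" by (intro mult_right_mono) auto
      also have "\<dots> = (k * norm x)^2" by (simp add: k_def power_mult_distrib)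
      finally show ?thesis by (rule power2_le_imp_le) (simp add: k_def)
    qed
    note Tk = this
    have "\<nu> \<le> k" unfolding \<nu>_def by (intro onorm_bound Tk) (simp add: k_def)
    moreover have "k < \<nu>"
    proof -
      have "max 0 (\<nu>^2 - c^2 / \<nu>^2) < \<nu>^2" using \<nu> c by simp
      thus ?thesis unfolding k_def using \<nu> by (metis less_imp_le real_sqrt_abs real_sqrt_less_iff abs_of_pos)
    qed
    ultimately show False by simp
  qed
  hence "\<nu> * norm x \<le> s * norm x" by (intro mult_right_mono) auto
  thus ?thesis using Tle[of x] by (simp add: T_def)
qed

lemma op_poly_diff: "op_poly B (p - q) x = op_poly B p x - op_poly B q x"
proof -
  have "op_poly B ((p - q) + q) x = op_poly B (p - q) x + op_poly B q x" by (rule op_poly_add)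
  thus ?thesis by simp
qed

lemma norm_B_le: "norm (B x) \<le> M * norm x"
  using norm_op_poly_le[of "[:0, 1:]" M x] by (simp add: op_poly_pCons[OF lin] linear_0[OF lin])

end

section \<open>Continuous functions of a positive operator\<close>

lemma uniform_poly_limit:
  assumes "continuous_on {0..M} (f :: real \<Rightarrow> real)"
  shows "\<exists>p. uniform_limit {0..M} (\<lambda>n. poly (p n)) f sequentially"
proof -
  obtain g where g: "uniform_limit {0..M} g f sequentially" "\<And>n. polynomial_function (g n)"
    using Stone_Weierstrass_uniform_limit[OF compact_Icc assms] by blast
  have "\<exists>p. poly p = g n" for n
  proof -
    obtain a k where a: "g n = (\<lambda>x. \<Sum>i\<le>k. a i * x ^ i)"
      using g(2)[of n] real_polynomial_function_iff_sum[of "g n"] by (auto simp: real_polynomial_function_eq)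
    have "poly (\<Sum>i\<le>k. monom (a i) i) = g n" by (simp add: a fun_eq_iff poly_sum poly_monom)
    thus ?thesis ..
  qed
  then obtain p where p: "\<And>n. poly (p n) = g n" by metis
  show ?thesis using g(1) by (intro exI[of _ p]) (simp add: p)
qed

lemma norm_diff_triple_le:
  fixes x a b c :: "'a::real_normed_vector"
  assumes "x = a - b - c" "norm a \<le> p" "norm b \<le> q" "norm c \<le> r"
  shows "norm x \<le> p + q + r"
  unfolding assms(1) using norm_triangle_ineq4[of "a - b" c] norm_triangle_ineq4[of a b] assms(2-4) by linarith

text \<open>The approximating polynomials are an arbitrary choice; by \<open>cfc_lim\<close> every
  other uniformly convergent choice leads to the same limit.\<close>

definition cfc :: "('a \<Rightarrow> 'a) \<Rightarrow> real \<Rightarrow> (real \<Rightarrow> real) \<Rightarrow> 'a \<Rightarrow> 'a::real_normed_vector" where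
  "cfc B M f x = lim (\<lambda>n. op_poly B ((SOME p. uniform_limit {0..M} (\<lambda>n. poly (p n)) f sequentially) n) x)"

context positive_operator
begin

lemma norm_op_poly_diff_le:
  "(\<And>b. 0 \<le> b \<Longrightarrow> b \<le> M \<Longrightarrow> \<bar>poly p b - poly q b\<bar> \<le> s) \<Longrightarrow> norm (op_poly B p x - op_poly B q x) \<le> s * norm x"
  using norm_op_poly_le[of "p - q" s x] by (simp add: op_poly_diff)

lemma op_poly_uniformly_close:
  assumes p: "uniform_limit {0..M} (\<lambda>n. poly (p n)) f sequentially"
    and q: "uniform_limit {0..M} (\<lambda>n. poly (q n)) f sequentially" and e: "e > 0"
  shows "\<exists>N. \<forall>m\<ge>N. \<forall>n\<ge>N. norm (op_poly B (p m) x - op_poly B (q n) x) < e"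
proof -
  define d where "d = e / (2 * (norm x + 1))"
  have n: "norm x + 1 > 0" using norm_ge_zero[of x] by linarith
  hence d: "d > 0" using e by (simp add: d_def)
  have "2 * d * (norm x + 1) = e" using n by (simp add: d_def field_simps)
  hence dx: "2 * d * norm x < e" using d by (simp add: algebra_simps)
  obtain N where N: "\<forall>n\<ge>N. (\<forall>b\<in>{0..M}. \<bar>poly (p n) b - f b\<bar> < d) \<and> (\<forall>b\<in>{0..M}. \<bar>poly (q n) b - f b\<bar> < d)"
    using eventually_conj[OF uniform_limitD[OF p d] uniform_limitD[OF q d]] unfolding eventually_sequentially dist_real_def by blast
  have "norm (op_poly B (p m) x - op_poly B (q n) x) < e" if "m \<ge> N" "n \<ge> N" for m n
  proof (rule le_less_trans[OF norm_op_poly_diff_le dx])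
    fix b assume "0 \<le> b" "b \<le> M"
    hence "\<bar>poly (p m) b - f b\<bar> < d" "\<bar>poly (q n) b - f b\<bar> < d" using N that by auto
    thus "\<bar>poly (p m) b - poly (q n) b\<bar> \<le> 2 * d" by linarith
  qed
  thus ?thesis by blast
qed

lemma cfc_lim:
  assumes p: "uniform_limit {0..M} (\<lambda>n. poly (p n)) f sequentially"
  shows "(\<lambda>n. op_poly B (p n) x) \<longlonglongrightarrow> cfc B M f x"
proof -
  define q where "q = (SOME p. uniform_limit {0..M} (\<lambda>n. poly (p n)) f sequentially)"
  have q: "uniform_limit {0..M} (\<lambda>n. poly (q n)) f sequentially" unfolding q_def
    by (rule someI[of "\<lambda>p. uniform_limit {0..M} (\<lambda>n. poly (p n)) f sequentially", OF p])
  have "Cauchy (\<lambda>n. op_poly B (q n) x)" unfolding Cauchy_def dist_norm using op_poly_uniformly_close[OF q q] by blast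
  hence "(\<lambda>n. op_poly B (q n) x) \<longlonglongrightarrow> cfc B M f x"
    by (simp add: cfc_def q_def Cauchy_convergent_iff convergent_LIMSEQ_iff)
  moreover have "(\<lambda>n. op_poly B (p n) x - op_poly B (q n) x) \<longlonglongrightarrow> 0"
    using op_poly_uniformly_close[OF p q] by (intro LIMSEQ_I) force
  ultimately show ?thesis using tendsto_add by fastforce
qed

lemma cfc_poly: "cfc B M (poly p) x = op_poly B p x"
  using cfc_lim[OF uniform_limit_const, of p x] by (simp add: LIMSEQ_const_iff)

lemma cfc_id: "cfc B M (\<lambda>b. b) x = B x"
proof -
  have "(\<lambda>b. b) = poly [:0, 1::real:]" by (rule ext) simp
  thus ?thesis using cfc_poly[of "[:0, 1:]" x] by (simp add: op_poly_pCons[OF lin] linear_0[OF lin])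
qed

lemma cfc_const: "cfc B M (\<lambda>b. c) x = c *\<^sub>R x"
proof -
  have "(\<lambda>b. c) = poly [:c:]" by (simp add: fun_eq_iff)
  thus ?thesis using cfc_poly[of "[:c:]" x] by (simp add: op_poly_pCons[OF lin] linear_0[OF lin])
qed

lemma cfc_add:
  assumes "continuous_on {0..M} f" "continuous_on {0..M} g"
  shows "cfc B M (\<lambda>b. f b + g b) x = cfc B M f x + cfc B M g x"
proof -
  obtain p q where pq: "uniform_limit {0..M} (\<lambda>n. poly (p n)) f sequentially" "uniform_limit {0..M} (\<lambda>n. poly (q n)) g sequentially"
    using uniform_poly_limit assms by blast
  have "uniform_limit {0..M} (\<lambda>n. poly (p n + q n)) (\<lambda>b. f b + g b) sequentially"
    using uniform_limit_add[OF pq] by (simp add: uniform_limit_iff)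
  from cfc_lim[OF this, of x] tendsto_add[OF cfc_lim[OF pq(1), of x] cfc_lim[OF pq(2), of x]] show ?thesis
    unfolding op_poly_add by (rule LIMSEQ_unique)
qed

lemma norm_cfc_le:
  assumes f: "continuous_on {0..M} f" and s: "\<And>b. 0 \<le> b \<Longrightarrow> b \<le> M \<Longrightarrow> \<bar>f b\<bar> \<le> s"
  shows "norm (cfc B M f x) \<le> s * norm x"
proof -
  obtain p where p: "uniform_limit {0..M} (\<lambda>n. poly (p n)) f sequentially" using uniform_poly_limit[OF f] by blast
  have le: "norm (cfc B M f x) \<le> (s + e) * norm x" if "e > 0" for e
  proof (rule tendsto_upperbound[OF tendsto_norm[OF cfc_lim[OF p]]])
    show "\<forall>\<^sub>F n in sequentially. norm (op_poly B (p n) x) \<le> (s + e) * norm x" using uniform_limitD[OF p that]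
    proof eventually_elim
      case (elim n)
      show ?case
      proof (rule norm_op_poly_le)
        fix b assume b: "0 \<le> b" "b \<le> M"
        hence "\<bar>poly (p n) b - f b\<bar> < e" using elim by (auto simp: dist_real_def)
        thus "\<bar>poly (p n) b\<bar> \<le> s + e" using s[OF b] by linarith
      qed
    qed
  qed simp
  have "((\<lambda>e. (s + e) * norm x) \<longlongrightarrow> (s + 0) * norm x) (at_right 0)" by (intro tendsto_intros)
  hence "norm (cfc B M f x) \<le> (s + 0) * norm x"
    by (rule tendsto_lowerbound) (auto intro!: le eventually_at_right_less[THEN eventually_mono])
  thus ?thesis by simp
qed

lemma cfc_mult:
  assumes f: "continuous_on {0..M} f" and g: "continuous_on {0..M} g"
  shows "cfc B M (\<lambda>b. f b * g b) x = cfc B M f (cfc B M g x)"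
proof -
  obtain p q where p: "uniform_limit {0..M} (\<lambda>n. poly (p n)) f sequentially" and q: "uniform_limit {0..M} (\<lambda>n. poly (q n)) g sequentially"
    using uniform_poly_limit f g by blast
  have bd: "bounded (f ` {0..M})" "bounded (g ` {0..M})" by (intro compact_imp_bounded compact_continuous_image f g compact_Icc)+
  then obtain F where F: "\<forall>b\<in>{0..M}. \<bar>f b\<bar> \<le> F" by (auto simp: bounded_iff)
  have "uniform_limit {0..M} (\<lambda>n. poly (p n * q n)) (\<lambda>b. f b * g b) sequentially"
    using uniform_lim_mult[OF p q bd] by (simp add: uniform_limit_iff)
  hence 1: "(\<lambda>n. op_poly B (p n) (op_poly B (q n) x)) \<longlonglongrightarrow> cfc B M (\<lambda>b. f b * g b) x"
    using cfc_lim by (simp add: op_poly_mult[OF lin, symmetric])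
  have "(\<lambda>n. norm (op_poly B (q n) x - cfc B M g x)) \<longlonglongrightarrow> 0" using tendsto_norm_zero[OF LIM_zero[OF cfc_lim[OF q]]] .
  hence z: "(\<lambda>n. (F + 1) * norm (op_poly B (q n) x - cfc B M g x)) \<longlonglongrightarrow> 0" by (rule tendsto_mult_right_zero)
  have "(\<lambda>n. op_poly B (p n) (op_poly B (q n) x - cfc B M g x)) \<longlonglongrightarrow> 0"
  proof (rule Lim_null_comparison[OF _ z])
    show "\<forall>\<^sub>F n in sequentially. norm (op_poly B (p n) (op_poly B (q n) x - cfc B M g x)) \<le> (F + 1) * norm (op_poly B (q n) x - cfc B M g x)"
      using uniform_limitD[OF p zero_less_one]
    proof eventually_elim
      case (elim n)
      show ?case
      proof (rule norm_op_poly_le)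
        fix b assume "0 \<le> b" "b \<le> M"
        thus "\<bar>poly (p n) b\<bar> \<le> F + 1" using elim[rule_format, of b] F[rule_format, of b] unfolding dist_real_def by auto
      qed
    qed
  qed
  from tendsto_add[OF this cfc_lim[OF p, of "cfc B M g x"]]
  have "(\<lambda>n. op_poly B (p n) (op_poly B (q n) x)) \<longlonglongrightarrow> cfc B M f (cfc B M g x)"
    by (simp add: linear_diff[OF linear_op_poly[OF lin]])
  thus ?thesis by (rule LIMSEQ_unique[OF 1])
qed

lemma cfc_scale:
  "continuous_on {0..M} f \<Longrightarrow> cfc B M (\<lambda>b. c * f b) x = c *\<^sub>R cfc B M f x"
  using cfc_mult[OF continuous_on_const, of f c x] by (simp add: cfc_const)

lemma cfc_diff:
  assumes f: "continuous_on {0..M} f" and g: "continuous_on {0..M} g"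
  shows "cfc B M (\<lambda>b. f b - g b) x = cfc B M f x - cfc B M g x"
  using cfc_add[OF f continuous_on_mult_left[OF g], of "-1" x] cfc_scale[OF g, of "-1" x] by simp

lemma cfc_sym:
  assumes f: "continuous_on {0..M} f"
  shows "inner (cfc B M f x) y = inner x (cfc B M f y)"
proof -
  obtain p where p: "uniform_limit {0..M} (\<lambda>n. poly (p n)) f sequentially" using uniform_poly_limit[OF f] by blast
  show ?thesis
    using tendsto_inner[OF cfc_lim[OF p, of x] tendsto_const[of y]] tendsto_inner[OF tendsto_const[of x] cfc_lim[OF p, of y]]
    unfolding op_poly_sym by (rule LIMSEQ_unique)
qed

text \<open>Linearity is read off from symmetry: both sides have the same inner product with every
  vector.\<close>

lemma bounded_linear_cfc:
  assumes f: "continuous_on {0..M} f"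
  shows "bounded_linear (cfc B M f)"
proof -
  have "inner z (cfc B M f (x + y)) = inner z (cfc B M f x + cfc B M f y)" for x y z
    unfolding inner_add_right cfc_sym[OF f, symmetric] ..
  hence add: "cfc B M f (x + y) = cfc B M f x + cfc B M f y" for x y using vector_eq_ldot by blast
  have "inner z (cfc B M f (c *\<^sub>R x)) = inner z (c *\<^sub>R cfc B M f x)" for c x z
    unfolding inner_scaleR_right cfc_sym[OF f, symmetric] ..
  hence scale: "cfc B M f (c *\<^sub>R x) = c *\<^sub>R cfc B M f x" for c x using vector_eq_ldot by blast
  have "bounded (f ` {0..M})" by (intro compact_imp_bounded compact_continuous_image f compact_Icc)
  then obtain F where F: "\<forall>b\<in>{0..M}. \<bar>f b\<bar> \<le> F" by (auto simp: bounded_iff)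
  show ?thesis by (rule bounded_linear_intro[of _ F]) (use norm_cfc_le[OF f, of F] F in "simp_all add: add scale mult.commute[of _ F]")
qed

end

section \<open>Strong convergence of operator functions\<close>

lemma tendsto_op_poly:
  assumes Bn: "\<And>i. positive_operator (Bn i) M" and B: "positive_operator B M"
    and lim: "\<And>x. ((\<lambda>i. Bn i x) \<longlongrightarrow> B x) \<F>"
  shows "((\<lambda>i. op_poly (Bn i) p x) \<longlongrightarrow> op_poly B p x) \<F>"
proof (induction p)
  case (pCons a p)
  let ?y = "\<lambda>i. op_poly (Bn i) p x" and ?z = "op_poly B p x"
  note lin = positive_operator.lin[OF Bn] positive_operator.lin[OF B]
  have *: "((\<lambda>i. M * norm (?y i - ?z)) \<longlongrightarrow> M * norm (?z - ?z)) \<F>" by (intro tendsto_intros pCons)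
  have "((\<lambda>i. Bn i (?y i - ?z)) \<longlongrightarrow> 0) \<F>"
  proof (rule Lim_null_comparison)
    show "\<forall>\<^sub>F i in \<F>. norm (Bn i (?y i - ?z)) \<le> M * norm (?y i - ?z)"
      by (intro always_eventually allI positive_operator.norm_B_le[OF Bn])
    show "((\<lambda>i. M * norm (?y i - ?z)) \<longlongrightarrow> 0) \<F>" using * by simp
  qed
  hence "((\<lambda>i. a *\<^sub>R x + (Bn i (?y i - ?z) + Bn i ?z)) \<longlongrightarrow> a *\<^sub>R x + (0 + B ?z)) \<F>"
    by (intro tendsto_intros lim)
  thus ?case by (simp add: op_poly_pCons lin linear_diff)
qed simp

text \<open>Only strong convergence of the operators is available. Since they share the interval
  \<open>[0, M]\<close>, one polynomial approximates \<open>f\<close> equally well for all of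
  them.\<close>

lemma tendsto_cfc:
  assumes Bn: "\<And>i. positive_operator (Bn i) M" and B: "positive_operator B M"
    and lim: "\<And>x. ((\<lambda>i. Bn i x) \<longlongrightarrow> B x) \<F>"
    and f: "continuous_on {0..M} f"
  shows "((\<lambda>i. cfc (Bn i) M f x) \<longlongrightarrow> cfc B M f x) \<F>"
proof (rule tendstoI)
  fix d :: real assume "0 < d"
  define e where "e = d / (3 * (norm x + 1))"
  have n: "norm x + 1 > 0" using norm_ge_zero[of x] by linarith
  have e: "0 < e" using n \<open>0 < d\<close> by (simp add: e_def)
  have "e * (norm x + 1) = d / 3" using n by (simp add: e_def field_simps)
  hence ex: "e * norm x < d / 3" using e by (simp add: algebra_simps)
  obtain p' where "uniform_limit {0..M} (\<lambda>n. poly (p' n)) f sequentially" using uniform_poly_limit[OF f] by blast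
  from eventually_happens'[OF _ uniform_limitD[OF this e]] obtain p where p: "\<forall>b\<in>{0..M}. \<bar>poly p b - f b\<bar> < e"
    by (auto simp: dist_real_def)
  have close: "dist (cfc A M f x) (op_poly A p x) < d / 3" if A: "positive_operator A M" for A
  proof -
    have "norm (cfc A M (\<lambda>b. f b - poly p b) x) \<le> e * norm x"
      using p by (intro positive_operator.norm_cfc_le[OF A] continuous_intros f) (force simp: abs_minus_commute)
    thus ?thesis using positive_operator.cfc_diff[OF A f, of "poly p" x] ex
      by (simp add: continuous_on_poly positive_operator.cfc_poly[OF A] dist_norm)
  qed
  have "\<forall>\<^sub>F i in \<F>. dist (op_poly (Bn i) p x) (op_poly B p x) < d / 3"
    using \<open>0 < d\<close> by (intro tendstoD tendsto_op_poly[OF Bn B lim]) auto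
  thus "\<forall>\<^sub>F i in \<F>. dist (cfc (Bn i) M f x) (cfc B M f x) < d"
  proof eventually_elim
    case (elim i)
    thus ?case using close[OF Bn[of i]] close[OF B] dist_commute[of "op_poly B p x" "cfc B M f x"]
        dist_triangle[of "cfc (Bn i) M f x" "cfc B M f x" "op_poly (Bn i) p x"]
        dist_triangle[of "op_poly (Bn i) p x" "cfc B M f x" "op_poly B p x"] by linarith
  qed
qed

section \<open>Heat semigroups\<close>

text \<open>The uniform boundedness principle through Baire's theorem, with a time interval that
  shrinks as the bound \<open>m\<close> grows. Arbitrary semigroups matter because
  \<open>mild_solution\<close> speaks of some semigroup with the given generator, which has to be
  identified.\<close>

lemma c0_semigroup_locally_bounded:
  fixes S :: "real \<Rightarrow> 'a::banach \<Rightarrow> 'a"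
  assumes S: "c0_semigroup S"
  obtains \<delta> C where "\<delta> > 0" "C \<ge> 1" "\<And>t x. 0 \<le> t \<Longrightarrow> t \<le> \<delta> \<Longrightarrow> norm (S t x) \<le> C * norm x"
proof -
  have bl: "bounded_linear (S t)" if "t \<ge> 0" for t using S that by (simp add: c0_semigroup_def)
  define X where "X m = (\<Inter>t\<in>{0..inverse (real (Suc m))}. {x. norm (S t x) \<le> real m})" for m
  have cl: "closed (X m)" for m
    unfolding X_def by (intro closed_INT ballI closed_Collect_le continuous_intros linear_continuous_on bl) auto
  have "\<exists>m. x \<in> X m" for x
  proof -
    have "((\<lambda>t. norm (S t x)) \<longlongrightarrow> norm x) (at_right 0)"
      using S by (intro tendsto_norm) (simp add: c0_semigroup_def)
    hence "\<forall>\<^sub>F t in at_right 0. norm (S t x) < norm x + 1" by (rule order_tendstoD) simp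
    then obtain d where d: "d > 0" "\<And>t. 0 < t \<Longrightarrow> t < d \<Longrightarrow> norm (S t x) < norm x + 1"
      unfolding eventually_at_right_field by auto
    obtain k where k: "inverse (real (Suc k)) < d" using reals_Archimedean[OF d(1)] by blast
    obtain l where l: "norm x + 1 \<le> real l" using real_arch_simple by blast
    have "norm (S t x) \<le> real (max k l)" if t: "0 \<le> t" "t \<le> inverse (real (Suc (max k l)))" for t
    proof (cases "t = 0")
      case False
      have "inverse (real (Suc (max k l))) \<le> inverse (real (Suc k))" by (intro le_imp_inverse_le) auto
      thus ?thesis using d(2)[of t] t k l False by linarith
    qed (use S l in "simp add: c0_semigroup_def")
    thus ?thesis by (intro exI[of _ "max k l"]) (auto simp: X_def)
  qed
  hence "(\<Union>m. X m) = UNIV" by blast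
  moreover have "interior (\<Union>m. X m) = {}" if "\<And>m. interior (X m) = {}"
    using Met_TC.metric_Baire_category_alt[where 'a = 'a, of "range X"] cl that by (auto simp: complete_UNIV)
  ultimately obtain m where "interior (X m) \<noteq> {}" by fastforce
  then obtain x0 r where r: "r > 0" "cball x0 r \<subseteq> X m" by (meson equals0I mem_interior_cball)
  have "norm (S t x) \<le> max 1 (2 * real m / r) * norm x" if t: "0 \<le> t" "t \<le> inverse (real (Suc m))" for t x
  proof (cases "x = 0")
    case True
    thus ?thesis by (simp add: linear_0 bounded_linear.linear[OF bl[OF t(1)]])
  next
    case False
    interpret bounded_linear "S t" by (rule bl[OF t(1)])
    define y where "y = x0 + (r / norm x) *\<^sub>R x"
    have "y \<in> cball x0 r" "x0 \<in> cball x0 r" using r False by (auto simp: y_def dist_norm)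
    hence "y \<in> X m" "x0 \<in> X m" using r(2) by blast+
    hence "norm (S t y) \<le> m" "norm (S t x0) \<le> m" using t by (auto simp: X_def)
    moreover have "(r / norm x) *\<^sub>R S t x = S t y - S t x0" by (simp add: y_def add scaleR)
    ultimately have "norm ((r / norm x) *\<^sub>R S t x) \<le> 2 * m" using norm_triangle_ineq4[of "S t y" "S t x0"] by simp
    hence "norm (S t x) \<le> 2 * real m / r * norm x" using r False by (simp add: field_simps)
    also have "\<dots> \<le> max 1 (2 * real m / r) * norm x" by (intro mult_right_mono) auto
    finally show ?thesis .
  qed
  thus thesis using that[of "inverse (real (Suc m))" "max 1 (2 * real m / r)"] by auto
qed

lemma c0_semigroup_bounded:
  fixes S :: "real \<Rightarrow> 'a::banach \<Rightarrow> 'a"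
  assumes S: "c0_semigroup S"
  obtains C where "\<And>t x. 0 \<le> t \<Longrightarrow> t \<le> T \<Longrightarrow> norm (S t x) \<le> C * norm x"
proof -
  obtain \<delta> C where dC: "\<delta> > 0" "C \<ge> 1" "\<And>t x. 0 \<le> t \<Longrightarrow> t \<le> \<delta> \<Longrightarrow> norm (S t x) \<le> C * norm x"
    using c0_semigroup_locally_bounded[OF S] by blast
  have *: "norm (S t x) \<le> C ^ Suc n * norm x" if "0 \<le> t" "t \<le> real (Suc n) * \<delta>" for n t x using that
  proof (induction n arbitrary: t x)
    case 0
    thus ?case using dC by simp
  next
    case (Suc n)
    show ?case
    proof (cases "t \<le> \<delta>")
      case True
      hence "norm (S t x) \<le> C * norm x" using dC Suc by simp
      also have "\<dots> \<le> C ^ Suc (Suc n) * norm x"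
        using power_increasing[of 1 "Suc (Suc n)" C] dC by (intro mult_right_mono) auto
      finally show ?thesis .
    next
      case False
      have "S t x = S \<delta> (S (t - \<delta>) x)" using S False dC(1) unfolding c0_semigroup_def
        by (metis add.commute diff_add_cancel diff_ge_0_iff_ge less_imp_le not_le)
      hence "norm (S t x) \<le> C * norm (S (t - \<delta>) x)" using dC by simp
      also have "\<dots> \<le> C * (C ^ Suc n * norm x)"
        using False Suc.prems dC by (intro mult_left_mono Suc.IH) (auto simp: algebra_simps)
      finally show ?thesis by (simp add: mult.assoc)
    qed
  qed
  obtain n where "T / \<delta> \<le> real n" using real_arch_simple by blast
  hence "T \<le> real n * \<delta>" using dC(1) by (simp add: pos_divide_le_eq)
  hence "T \<le> real (Suc n) * \<delta>" using dC(1) by (simp add: algebra_simps)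
  thus thesis using that[of "C ^ Suc n"] * by (meson order_trans)
qed

lemma c0_semigroup_continuous:
  fixes S :: "real \<Rightarrow> 'a::banach \<Rightarrow> 'a"
  assumes S: "c0_semigroup S"
  shows "continuous_on {0..} (\<lambda>t. S t x)"
proof (rule continuous_onI)
  fix t e :: real assume t: "t \<in> {0..}" and "e > 0"
  obtain C where C: "\<And>s x. 0 \<le> s \<Longrightarrow> s \<le> t + 1 \<Longrightarrow> norm (S s x) \<le> C * norm x"
    using c0_semigroup_bounded[OF S] by blast
  have "((\<lambda>t. S t x) \<longlongrightarrow> x) (at_right 0)" using S by (simp add: c0_semigroup_def)
  hence "\<forall>\<^sub>F s in at_right 0. dist (S s x) x < e / (\<bar>C\<bar> + 1)"
    using \<open>e > 0\<close> by (intro tendstoD) auto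
  then obtain d where d: "d > 0" "\<And>s. 0 < s \<Longrightarrow> s < d \<Longrightarrow> dist (S s x) x < e / (\<bar>C\<bar> + 1)"
    unfolding eventually_at_right_field by auto
  have key: "dist (S (r + h) x) (S r x) \<le> e" if "0 \<le> r" "r \<le> t + 1" "0 \<le> h" "h < d" for r h
  proof (cases "h = 0")
    case False
    interpret bounded_linear "S r" using S that by (simp add: c0_semigroup_def)
    have "S (r + h) x - S r x = S r (S h x - x)" using S that by (simp add: c0_semigroup_def diff)
    hence "dist (S (r + h) x) (S r x) \<le> C * dist (S h x) x" using C[of r "S h x - x"] that by (simp add: dist_norm)
    also have "\<dots> \<le> (\<bar>C\<bar> + 1) * (e / (\<bar>C\<bar> + 1))" using d(2)[of h] that False by (intro mult_mono) auto
    finally show ?thesis by simp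
  qed (use \<open>e > 0\<close> in simp)
  show "\<exists>d>0. \<forall>x'\<in>{0..}. dist x' t < d \<longrightarrow> dist (S x' x) (S t x) \<le> e"
  proof (intro exI[of _ "min d 1"] conjI ballI impI)
    fix s assume s: "s \<in> {0..}" "dist s t < min d 1"
    show "dist (S s x) (S t x) \<le> e"
    proof (cases "s \<le> t")
      case True
      thus ?thesis using key[of s "t - s"] s t by (simp add: dist_real_def dist_commute)
    next
      case False
      thus ?thesis using key[of t "s - t"] s t by (simp add: dist_real_def)
    qed
  qed (use d in auto)
qed

lemma c0_semigroup_has_vector_derivative:
  fixes S :: "real \<Rightarrow> 'a::banach \<Rightarrow> 'a"
  assumes S: "c0_semigroup S" and gen: "((\<lambda>t. (S t x - x) /\<^sub>R t) \<longlongrightarrow> y) (at_right 0)" and t: "t > 0"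
  shows "((\<lambda>t. S t x) has_vector_derivative S t y) (at t)"
proof -
  obtain C where C: "\<And>s x. 0 \<le> s \<Longrightarrow> s \<le> t \<Longrightarrow> norm (S s x) \<le> C * norm x"
    using c0_semigroup_bounded[OF S] by blast
  define D where "D h = (S h x - x) /\<^sub>R h - y" for h
  have D: "(D \<longlongrightarrow> 0) (at_right 0)" using tendsto_diff[OF gen tendsto_const[of y]] by (simp add: D_def[abs_def])
  have "filterlim (\<lambda>h::real. \<bar>h\<bar>) (at_right 0) (at 0)"
    by (auto simp: filterlim_at eventually_at_filter intro!: tendsto_eq_intros)
  from filterlim_compose[OF D this] have D0: "((\<lambda>h. D \<bar>h\<bar>) \<longlongrightarrow> 0) (at 0)" .
  have "continuous_on {0<..} (\<lambda>r. S r y)" by (rule continuous_on_subset[OF c0_semigroup_continuous[OF S]]) auto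
  hence "isCont (\<lambda>r. S r y) t" using t by (simp add: continuous_on_eq_continuous_at[OF open_greaterThan])
  moreover have "((\<lambda>h. min t (t + h)) \<longlongrightarrow> t) (at 0)" by (auto intro!: tendsto_eq_intros)
  ultimately have Sy: "((\<lambda>h. S (min t (t + h)) y) \<longlongrightarrow> S t y) (at 0)" by (rule isCont_tendsto_compose)
  have "((\<lambda>h. \<bar>C\<bar> * norm (D \<bar>h\<bar>) + norm (S (min t (t + h)) y - S t y)) \<longlongrightarrow> \<bar>C\<bar> * norm (0 :: 'a) + norm (S t y - S t y)) (at 0)"
    by (intro tendsto_intros D0 Sy)
  hence lim: "((\<lambda>h. \<bar>C\<bar> * norm (D \<bar>h\<bar>) + norm (S (min t (t + h)) y - S t y)) \<longlongrightarrow> 0) (at 0)" by simp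
  have "((\<lambda>h. norm (S (t + h) x - S t x - h *\<^sub>R S t y) / norm h) \<longlongrightarrow> 0) (at 0)"
  proof (rule Lim_null_comparison[OF _ lim])
    have "\<forall>\<^sub>F h in at 0. dist h 0 < t" "\<forall>\<^sub>F h in at 0. h \<noteq> (0 :: real)"
      using t by (auto simp: eventually_at)
    thus "\<forall>\<^sub>F h in at 0. norm (norm (S (t + h) x - S t x - h *\<^sub>R S t y) / norm h) \<le>
        \<bar>C\<bar> * norm (D \<bar>h\<bar>) + norm (S (min t (t + h)) y - S t y)"
    proof eventually_elim
      case (elim h)
      \<comment> \<open>Both signs of \<open>h\<close> at once: the difference quotient at time
        \<open>0\<close> is propagated from the earlier of the two times.\<close>
      let ?r = "min t (t + h)"
      have r: "0 \<le> ?r" "?r \<le> t" "max t (t + h) = ?r + \<bar>h\<bar>" using elim t by auto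
      interpret bounded_linear "S ?r" using S r by (simp add: c0_semigroup_def)
      have "S (max t (t + h)) x = S ?r (S \<bar>h\<bar> x)" using S r(1) unfolding r(3) by (simp add: c0_semigroup_def)
      hence "S ?r (D \<bar>h\<bar>) + (S ?r y - S t y) = (S (max t (t + h)) x - S ?r x) /\<^sub>R \<bar>h\<bar> - S t y"
        by (simp add: D_def diff scaleR)
      also have "\<dots> = (S (t + h) x - S t x - h *\<^sub>R S t y) /\<^sub>R h"
        using elim(2) by (cases "h > 0") (auto simp: max_def min_def scaleR_diff_right)
      finally have "norm (S (t + h) x - S t x - h *\<^sub>R S t y) / norm h = norm (S ?r (D \<bar>h\<bar>) + (S ?r y - S t y))"
        by (simp add: divide_inverse_commute)
      also have "\<dots> \<le> C * norm (D \<bar>h\<bar>) + norm (S ?r y - S t y)"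
        by (rule norm_triangle_le) (use C[OF r(1,2)] in simp)
      also have "\<dots> \<le> \<bar>C\<bar> * norm (D \<bar>h\<bar>) + norm (S ?r y - S t y)"
        by (intro add_right_mono mult_right_mono) auto
      finally show ?case by simp
    qed
  qed
  thus ?thesis by (simp add: has_vector_derivative_def has_derivative_at bounded_linear_scaleR_left)
qed

section \<open>Symbols of the heat semigroup and of its time derivatives\<close>

text \<open>Here \<open>1 / b\<close> is the eigenvalue of the differential operator, so the factor
  \<open>1 / b ^ k\<close> stands, up to sign, for \<open>k\<close> time derivatives. Extended by
  \<open>0\<close> to \<open>b \<le> 0\<close> the symbol is smooth on the whole line, and the same
  function will supply the bump functions.\<close>

definition heat_symbol :: "real \<Rightarrow> nat \<Rightarrow> real \<Rightarrow> real" where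
  "heat_symbol t k b = (if b \<le> 0 then 0 else exp (- t / b) / b ^ k)"

lemma power_div_fact_le_exp: "0 \<le> y \<Longrightarrow> y ^ k / fact k \<le> exp (y::real)"
proof -
  assume y: "0 \<le> y"
  have "(\<Sum>n\<in>{k}. y ^ n /\<^sub>R fact n) \<le> (\<Sum>n. y ^ n /\<^sub>R fact n)"
    using y by (intro sum_le_suminf summable_exp_generic) auto
  thus ?thesis by (simp add: exp_def divide_inverse mult.commute)
qed

lemma heat_symbol_nonneg: "0 \<le> heat_symbol t k b" by (simp add: heat_symbol_def)

text \<open>With \<open>y = t / b\<close> this is \<open>y ^ k \<le> k! * exp y\<close>. The
  factorial is the growth of derivatives of a function that is analytic in time.\<close>

lemma heat_symbol_le:
  assumes "t > 0"
  shows "\<bar>heat_symbol t k b\<bar> \<le> fact k / t ^ k"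
proof (cases "b \<le> 0")
  case False
  hence b: "b > 0" by simp
  have "(t / b) ^ k / fact k * exp (- (t / b)) \<le> exp (t / b) * exp (- (t / b))"
    using b assms by (intro mult_right_mono power_div_fact_le_exp) auto
  hence "(t / b) ^ k / fact k * exp (- (t / b)) \<le> 1" by (simp add: exp_minus)
  hence "exp (- (t / b)) / b ^ k \<le> fact k / t ^ k" using b assms by (simp add: field_simps power_divide)
  thus ?thesis using b by (simp add: heat_symbol_def)
qed (use assms in "simp add: heat_symbol_def")

lemma heat_symbol_Suc: "b * heat_symbol t (Suc k) b = heat_symbol t k b" by (simp add: heat_symbol_def)

lemma heat_symbol_mult: "heat_symbol t k b * heat_symbol s l b = heat_symbol (t + s) (k + l) b"
  by (simp add: heat_symbol_def exp_add[symmetric] power_add diff_divide_distrib)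

lemma heat_symbol_0 [simp]: "heat_symbol t k 0 = 0" by (simp add: heat_symbol_def)

text \<open>Written as a polynomial times another symbol, so that the rule can be iterated. At
  \<open>0\<close> two powers of \<open>b\<close> are split off and the remaining symbol is
  bounded.\<close>

lemma heat_symbol_has_real_derivative:
  assumes e: "e > 0"
  shows "(heat_symbol e m has_real_derivative (e - real m * b) * heat_symbol e (m + 2) b) (at b)"
proof -
  consider "b < 0" | "b = 0" | "b > 0" by linarith
  thus ?thesis
  proof cases
    case 1
    have "\<forall>\<^sub>F x in nhds b. heat_symbol e m x = 0" using eventually_nhds_in_open[of "{..<0}" b] 1
      by (auto elim!: eventually_mono simp: heat_symbol_def)
    hence "(heat_symbol e m has_real_derivative 0) (at b)" by (subst DERIV_cong_ev[OF refl _ refl]) auto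
    thus ?thesis using 1 by (simp add: heat_symbol_def)
  next
    case 2
    have "((\<lambda>h. \<bar>h\<bar> * (fact (m + 2) / e ^ (m + 2))) \<longlongrightarrow> \<bar>0\<bar> * (fact (m + 2) / e ^ (m + 2))) (at (0::real))"
      by (intro tendsto_intros)
    hence lim: "((\<lambda>h. \<bar>h\<bar> * (fact (m + 2) / e ^ (m + 2))) \<longlongrightarrow> 0) (at (0::real))" by simp
    have "((\<lambda>h. (heat_symbol e m (0 + h) - heat_symbol e m 0) / h) \<longlongrightarrow> 0) (at 0)"
    proof (rule Lim_null_comparison[OF always_eventually lim], intro allI)
      fix h :: real
      have "heat_symbol e m h = h * (h * heat_symbol e (m + 2) h)"
        using heat_symbol_Suc[of h e m] heat_symbol_Suc[of h e "Suc m"] by (simp add: numeral_2_eq_2)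
      hence "norm ((heat_symbol e m (0 + h) - heat_symbol e m 0) / h) = \<bar>h\<bar> * \<bar>heat_symbol e (m + 2) h\<bar>"
        by (simp add: abs_mult)
      also have "\<dots> \<le> \<bar>h\<bar> * (fact (m + 2) / e ^ (m + 2))" by (intro mult_left_mono heat_symbol_le e) simp
      finally show "norm ((heat_symbol e m (0 + h) - heat_symbol e m 0) / h) \<le> \<bar>h\<bar> * (fact (m + 2) / e ^ (m + 2))" .
    qed
    thus ?thesis using 2 by (simp add: DERIV_def)
  next
    case 3
    have "\<forall>\<^sub>F x in nhds b. exp (- e / x) / x ^ m = heat_symbol e m x" using eventually_nhds_in_open[of "{0<..}" b] 3
      by (auto elim!: eventually_mono simp: heat_symbol_def)
    moreover have "((\<lambda>x. exp (- e / x) / x ^ m) has_real_derivative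
        (exp (- e / b) * (e / b^2) * b ^ m - exp (- e / b) * (real m * b ^ (m - 1))) / (b ^ m * b ^ m)) (at b)"
      using 3 by (auto intro!: derivative_eq_intros simp: power2_eq_square)
    moreover have "(exp (- e / b) * (e / b^2) * b ^ m - exp (- e / b) * (real m * b ^ (m - 1))) / (b ^ m * b ^ m) =
        (e - real m * b) * heat_symbol e (m + 2) b"
    proof (cases m)
      case 0
      thus ?thesis using 3 by (simp add: heat_symbol_def power2_eq_square)
    next
      case (Suc l)
      thus ?thesis using 3 by (simp add: heat_symbol_def field_simps power2_eq_square)
    qed
    ultimately show ?thesis by (simp add: DERIV_cong_ev[OF refl _ refl])
  qed
qed

lemma continuous_on_heat_symbol: "t > 0 \<Longrightarrow> continuous_on A (heat_symbol t k)"
  by (rule DERIV_continuous_on, rule has_field_derivative_at_within, rule heat_symbol_has_real_derivative)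

text \<open>The operator \<open>B\<close> to the power \<open>- k\<close> applied to the semigroup;
  it is bounded as soon as \<open>t > 0\<close>.\<close>

definition heat :: "('a \<Rightarrow> 'a) \<Rightarrow> real \<Rightarrow> real \<Rightarrow> nat \<Rightarrow> 'a \<Rightarrow> 'a::real_normed_vector" where
  "heat B M t k x = cfc B M (heat_symbol t k) x"

text \<open>At \<open>t = 0\<close> the symbol jumps at \<open>b = 0\<close>, so time zero is set
  apart. Negative times also give the identity, which keeps the orbits continuous on the whole
  line.\<close>

definition heat_semigroup :: "('a \<Rightarrow> 'a) \<Rightarrow> real \<Rightarrow> real \<Rightarrow> 'a \<Rightarrow> 'a::real_normed_vector" where
  "heat_semigroup B M t x = (if t \<le> 0 then x else heat B M t 0 x)"

lemma heat_semigroup_0 [simp]: "heat_semigroup B M 0 x = x" by (simp add: heat_semigroup_def)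

context positive_operator
begin

abbreviation "Ht \<equiv> heat_semigroup B M"
abbreviation "Hk \<equiv> heat B M"

lemma bounded_linear_heat: "t > 0 \<Longrightarrow> bounded_linear (Hk t k)"
  unfolding heat_def[abs_def] by (intro bounded_linear_cfc continuous_on_heat_symbol)

lemma norm_heat_le: "t > 0 \<Longrightarrow> norm (Hk t k x) \<le> fact k / t ^ k * norm x"
  unfolding heat_def by (intro norm_cfc_le continuous_on_heat_symbol heat_symbol_le)

lemma heat_heat: "t > 0 \<Longrightarrow> s > 0 \<Longrightarrow> Hk t k (Hk s l x) = Hk (t + s) (k + l) x"
  unfolding heat_def by (subst cfc_mult[symmetric]) (simp_all add: continuous_on_heat_symbol heat_symbol_mult)

lemma B_heat: "t > 0 \<Longrightarrow> B (Hk t (Suc k) x) = Hk t k x"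
  unfolding heat_def by (subst cfc_id[symmetric], subst cfc_mult[symmetric]) (simp_all add: continuous_on_heat_symbol heat_symbol_Suc)

lemma heat_sym: "t > 0 \<Longrightarrow> inner (Hk t k x) y = inner x (Hk t k y)"
  unfolding heat_def by (intro cfc_sym continuous_on_heat_symbol)

lemma bounded_linear_heat_semigroup: "bounded_linear (Ht t)"
  by (cases "t > 0") (simp_all add: heat_semigroup_def[abs_def] bounded_linear_heat bounded_linear_ident)

lemma linear_heat_semigroup: "linear (Ht t)" by (rule bounded_linear.linear[OF bounded_linear_heat_semigroup])

lemma norm_heat_semigroup_le: "norm (Ht t x) \<le> norm x"
  using norm_heat_le[of t 0 x] by (simp add: heat_semigroup_def)

lemma heat_semigroup_add:
  "t \<ge> 0 \<Longrightarrow> s \<ge> 0 \<Longrightarrow> Ht (t + s) x = Ht t (Ht s x)"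
  using heat_heat[of t s 0 0 x] by (auto simp: heat_semigroup_def)

lemma heat_semigroup_sym: "inner (Ht t x) y = inner x (Ht t y)" by (simp add: heat_semigroup_def heat_sym)

lemma B_heat_semigroup: "B (Ht t x) = Ht t (B x)"
proof (cases "t > 0")
  case True
  hence "B (Hk t 0 x) = Hk t 0 (B x)" unfolding heat_def by (subst (1 2) cfc_id[symmetric], subst (1 2) cfc_mult[symmetric])
      (simp_all add: continuous_on_heat_symbol mult.commute)
  thus ?thesis by (simp add: heat_semigroup_def)
qed (simp add: heat_semigroup_def)

lemma exp_minus_quadratic_bounds: "0 \<le> y \<Longrightarrow> 0 \<le> exp (- y) - 1 + y \<and> exp (- y) - 1 + y \<le> y^2 / (2::real)"
proof -
  assume y: "0 \<le> y"
  have "exp (- y) - 1 + y \<ge> 0" using exp_ge_add_one_self[of "- y"] by simp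
  moreover have "exp (- y) - 1 + y - y^2 / 2 \<le> exp (- 0) - 1 + 0 - 0^2 / 2"
  proof (rule DERIV_nonpos_imp_nonincreasing[OF y])
    fix x :: real assume "0 \<le> x"
    have "((\<lambda>y. exp (- y) - 1 + y - y^2 / 2) has_real_derivative (- exp (- x) + 1 - x)) (at x)"
      by (auto intro!: derivative_eq_intros)
    moreover have "- exp (- x) + 1 - x \<le> 0" using exp_ge_add_one_self[of "- x"] by simp
    ultimately show "\<exists>y. ((\<lambda>y. exp (- y) - 1 + y - y^2 / 2) has_real_derivative y) (at x) \<and> y \<le> 0" by blast
  qed
  ultimately show ?thesis by simp
qed

lemma heat_semigroup_B_minus_B_le:
  assumes t: "t > 0"
  shows "norm (Ht t (B x) - B x) \<le> t * norm x"
proof -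
  have f: "continuous_on {0..M} (\<lambda>b. heat_symbol t 0 b * b)" by (intro continuous_intros continuous_on_heat_symbol t)
  have "Ht t (B x) - B x = cfc B M (\<lambda>b. heat_symbol t 0 b * b - b) x"
    using t by (subst cfc_diff[OF f continuous_on_id], subst cfc_mult)
      (simp_all add: continuous_on_heat_symbol cfc_id heat_semigroup_def heat_def)
  also have "norm \<dots> \<le> t * norm x"
  proof (rule norm_cfc_le)
    show "continuous_on {0..M} (\<lambda>b. heat_symbol t 0 b * b - b)" by (intro continuous_intros f)
    fix b :: real assume "0 \<le> b"
    show "\<bar>heat_symbol t 0 b * b - b\<bar> \<le> t"
    proof (cases "b = 0")
      case False
      hence b: "b > 0" using \<open>0 \<le> b\<close> by simp
      have "exp (- t / b) \<le> 1" "exp (- t / b) \<ge> 1 - t / b" using exp_ge_add_one_self[of "- t / b"] t b by auto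
      hence "exp (- t / b) * b \<le> 1 * b" "exp (- t / b) * b \<ge> (1 - t / b) * b"
        using b by (auto intro!: mult_right_mono simp del: mult_le_cancel_right)
      thus ?thesis using b by (simp add: heat_symbol_def algebra_simps)
    qed (use t in "simp add: heat_symbol_def")
  qed
  finally show ?thesis .
qed

text \<open>For \<open>b > 0\<close> the symbol is \<open>b^2 / t\<close> times
  \<open>exp (- y) - 1 + y\<close> with \<open>y = t / b\<close>, hence at most
  \<open>t / 2\<close>. Two factors \<open>B\<close> are spent on this rate; density of the range
  will remove one of them.\<close>

lemma heat_semigroup_quotient_BB_le:
  assumes t: "t > 0"
  shows "norm ((Ht t (B (B x)) - B (B x)) /\<^sub>R t + B x) \<le> t / 2 * norm x"
proof -
  have c: "continuous_on {0..M} (heat_symbol t 0)" by (intro continuous_on_heat_symbol t)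
  have f: "continuous_on {0..M} (\<lambda>b. heat_symbol t 0 b * (b * b))" "continuous_on {0..M} (\<lambda>b::real. b * b)"
    by (intro continuous_intros c)+
  have BB: "cfc B M (\<lambda>b. b * b) x = B (B x)" by (subst cfc_mult) (simp_all add: cfc_id continuous_on_id)
  have "(Ht t (B (B x)) - B (B x)) /\<^sub>R t + B x =
      cfc B M (\<lambda>b. inverse t * (heat_symbol t 0 b * (b * b) - b * b) + b) x"
    using t by (subst cfc_add, (intro continuous_intros f)+, subst cfc_scale, (intro continuous_intros f)+,
        subst cfc_diff[OF f], subst cfc_mult[OF c f(2)]) (simp_all add: BB cfc_id heat_semigroup_def heat_def)
  also have "norm \<dots> \<le> t / 2 * norm x"
  proof (rule norm_cfc_le)
    show "continuous_on {0..M} (\<lambda>b. inverse t * (heat_symbol t 0 b * (b * b) - b * b) + b)" by (intro continuous_intros f)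
    fix b :: real assume "0 \<le> b"
    show "\<bar>inverse t * (heat_symbol t 0 b * (b * b) - b * b) + b\<bar> \<le> t / 2"
    proof (cases "b = 0")
      case False
      hence b: "b > 0" using \<open>0 \<le> b\<close> by simp
      have "inverse t * (heat_symbol t 0 b * (b * b) - b * b) + b = b * b / t * (exp (- (t / b)) - 1 + t / b)"
        using b t by (simp add: heat_symbol_def field_simps)
      moreover have "0 \<le> b * b / t * (exp (- (t / b)) - 1 + t / b)"
        using exp_minus_quadratic_bounds[of "t / b"] b t by (intro mult_nonneg_nonneg) auto
      moreover have "b * b / t * (exp (- (t / b)) - 1 + t / b) \<le> b * b / t * ((t / b)^2 / 2)"
        using exp_minus_quadratic_bounds[of "t / b"] b t by (intro mult_left_mono) auto
      moreover have "b * b / t * ((t / b)^2 / 2) = t / 2" using b t by (simp add: power2_eq_square)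
      ultimately show ?thesis by linarith
    qed (use t in "simp add: heat_symbol_def")
  qed
  finally show ?thesis .
qed

end

section \<open>Generator and uniqueness of the heat semigroup\<close>

locale injective_positive_operator = positive_operator +
  assumes inj: "B x = 0 \<Longrightarrow> x = 0"
begin

lemma closure_range_B: "closure (range B) = UNIV"
  using closure_range_symmetric_injective[OF lin sym inj] .

text \<open>The range of \<open>B\<close> is dense, so a rate on it together with a uniform bound
  gives strong convergence everywhere, without a rate.\<close>

lemma tendsto_from_range:
  fixes F :: "real \<Rightarrow> 'a \<Rightarrow> 'a"
  assumes lin: "\<And>t. t > 0 \<Longrightarrow> linear (F t)" and bd: "\<And>t x. t > 0 \<Longrightarrow> norm (F t x) \<le> C * norm x"
    and small: "\<And>t x. t > 0 \<Longrightarrow> norm (F t (B x)) \<le> t * (D * norm x)"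
  shows "((\<lambda>t. F t x) \<longlongrightarrow> 0) (at_right 0)"
proof (rule tendstoI)
  fix e :: real assume e: "e > 0"
  have "x \<in> closure (range B)" using closure_range_B by simp
  then obtain y where y: "dist (B y) x < e / (2 * (\<bar>C\<bar> + 1))"
    using e unfolding closure_approachable by (metis abs_ge_zero add_nonneg_pos divide_pos_pos imageE mult_pos_pos zero_less_numeral zero_less_one)
  define K where "K = \<bar>D\<bar> * norm y + 1"
  have K: "K > 0" unfolding K_def by (intro add_nonneg_pos) auto
  have "\<forall>\<^sub>F t in at_right 0. t \<in> {0<..<e / (2 * K)}" using e K by (intro eventually_at_right_real) auto
  thus "\<forall>\<^sub>F t in at_right 0. dist (F t x) 0 < e"
  proof eventually_elim
    case (elim t)
    hence t: "t > 0" "t * K < e / 2" using K by (auto simp: field_simps)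
    have "F t x = F t (x - B y) + F t (B y)" by (simp add: linear_diff[OF lin[OF t(1)]])
    hence "norm (F t x) \<le> norm (F t (x - B y)) + norm (F t (B y))" by (metis norm_triangle_ineq)
    also have "norm (F t (x - B y)) \<le> (\<bar>C\<bar> + 1) * norm (x - B y)"
      using bd[OF t(1), of "x - B y"] by (smt (verit) mult_right_mono norm_ge_zero)
    also have "\<dots> < (\<bar>C\<bar> + 1) * (e / (2 * (\<bar>C\<bar> + 1)))"
      using y by (intro mult_strict_left_mono) (auto simp: dist_norm norm_minus_commute)
    also have "\<dots> = e / 2"
    proof -
      have "\<bar>C\<bar> + 1 > 0" by linarith
      thus ?thesis by (simp add: field_simps)
    qed
    also have "norm (F t (B y)) \<le> t * K"
    proof -
      have "D * norm y \<le> K" unfolding K_def by (smt (verit) mult_right_mono norm_ge_zero)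
      thus ?thesis using small[OF t(1), of y] t(1) by (meson mult_left_mono less_imp_le order_trans)
    qed
    finally show ?case using t by simp
  qed
qed

lemma c0_semigroup_heat: "c0_semigroup (Ht)"
proof -
  have "((\<lambda>t. Ht t x - x) \<longlongrightarrow> 0) (at_right 0)" for x
  proof (rule tendsto_from_range[where C = 2 and D = 1])
    fix t :: real and x :: 'a assume t: "t > 0"
    show "linear (\<lambda>x. Ht t x - x)" by (intro linear_compose_sub linear_heat_semigroup linear_ident)
    show "norm (Ht t x - x) \<le> 2 * norm x" using norm_triangle_ineq4[of "Ht t x" x] norm_heat_semigroup_le[of t x] by simp
    show "norm (Ht t (B x) - B x) \<le> t * (1 * norm x)" using heat_semigroup_B_minus_B_le[OF t] by simp
  qed
  thus ?thesis unfolding c0_semigroup_def by (auto simp: bounded_linear_heat_semigroup heat_semigroup_add LIM_zero_iff)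
qed

lemma heat_semigroup_quotient:
  "((\<lambda>t. (Ht t (B y) - B y) /\<^sub>R t) \<longlongrightarrow> - y) (at_right 0)"
proof -
  have "((\<lambda>t. (Ht t (B y) - B y) /\<^sub>R t + y) \<longlongrightarrow> 0) (at_right 0)"
  proof (rule tendsto_from_range[where C = 2 and D = "1/2"])
    fix t :: real and x :: 'a assume t: "t > 0"
    show "linear (\<lambda>y. (Ht t (B y) - B y) /\<^sub>R t + y)" using linear_compose[OF lin linear_heat_semigroup[of t]]
      by (intro linear_compose_add linear_compose_scale_right linear_compose_sub lin linear_ident) (simp add: o_def)
    have "norm ((Ht t (B x) - B x) /\<^sub>R t) \<le> norm x" using heat_semigroup_B_minus_B_le[OF t, of x] t
      by (simp add: divide_inverse_commute[symmetric] pos_divide_le_eq mult.commute)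
    thus "norm ((Ht t (B x) - B x) /\<^sub>R t + x) \<le> 2 * norm x"
      using norm_triangle_ineq[of "(Ht t (B x) - B x) /\<^sub>R t" x] by linarith
    show "norm ((Ht t (B (B x)) - B (B x)) /\<^sub>R t + B x) \<le> t * (1 / 2 * norm x)"
      using heat_semigroup_quotient_BB_le[OF t, of x] by simp
  qed
  from tendsto_diff[OF this tendsto_const[of y]] show ?thesis by simp
qed

text \<open>That the generator has no larger domain is seen by applying \<open>B\<close> to the
  difference quotient of \<open>x\<close>: \<open>B\<close> commutes with the semigroup, and on the
  range of \<open>B\<close> the limit is already known.\<close>

lemma has_generator_heat:
  assumes A: "\<And>x y. A x y \<longleftrightarrow> x = B (- y)"
  shows "has_generator (Ht) A"
  unfolding has_generator_def
proof (intro allI iffI)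
  fix x y assume "A x y"
  thus "((\<lambda>t. (Ht t x - x) /\<^sub>R t) \<longlongrightarrow> y) (at_right 0)"
    using heat_semigroup_quotient[of "- y"] by (simp add: A)
next
  fix x y assume lim: "((\<lambda>t. (Ht t x - x) /\<^sub>R t) \<longlongrightarrow> y) (at_right 0)"
  interpret bounded_linear B by (rule bl)
  have "((\<lambda>t. B ((Ht t x - x) /\<^sub>R t)) \<longlongrightarrow> B y) (at_right 0)" by (rule tendsto[OF lim])
  hence "((\<lambda>t. (Ht t (B x) - B x) /\<^sub>R t) \<longlongrightarrow> B y) (at_right 0)"
    by (simp add: scaleR diff B_heat_semigroup)
  with heat_semigroup_quotient have "B y = - x" using tendsto_unique trivial_limit_at_right_real by blast
  thus "A x y" by (simp add: A neg)
qed

lemma heat_semigroup_has_vector_derivative: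
  "t > 0 \<Longrightarrow> ((\<lambda>t. Ht t (B x)) has_vector_derivative - Ht t x) (at t)"
  using c0_semigroup_has_vector_derivative[OF c0_semigroup_heat heat_semigroup_quotient, of t x]
  by (simp add: linear_neg[OF linear_heat_semigroup])

lemma continuous_on_heat_semigroup: "continuous_on {0..} (\<lambda>t. Ht t x)" by (rule c0_semigroup_continuous[OF c0_semigroup_heat])

text \<open>An energy argument. Any such \<open>S\<close> commutes with \<open>B\<close>; with
  \<open>v s = S s y - Ht s y\<close> the difference of the two orbits of \<open>B y\<close> is
  \<open>B (v s)\<close> and has derivative \<open>- v s\<close>, so its squared norm has derivative
  \<open>- 2 * inner (B (v s)) (v s)\<close>, which is not positive.\<close>

lemma heat_semigroup_unique:
  assumes S: "c0_semigroup S" "has_generator S A" and A: "\<And>x y. A x y \<longleftrightarrow> x = B (- y)" and t: "t \<ge> 0"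
  shows "S t x = Ht t x"
proof -
  have gen: "((\<lambda>h. (S h (B y) - B y) /\<^sub>R h) \<longlongrightarrow> - y) (at_right 0)" for y
    using S(2) A[of "B y" "- y"] by (simp add: has_generator_def)
  have com: "S s (B y) = B (S s y)" if s: "s \<ge> 0" for s y
  proof -
    interpret bounded_linear "S s" using S s by (simp add: c0_semigroup_def)
    have "((\<lambda>h. S s ((S h (B y) - B y) /\<^sub>R h)) \<longlongrightarrow> S s (- y)) (at_right 0)" by (rule tendsto[OF gen])
    moreover have "\<forall>\<^sub>F h in at_right 0. S s ((S h (B y) - B y) /\<^sub>R h) = (S h (S s (B y)) - S s (B y)) /\<^sub>R h"
      using eventually_at_right_less[of "0::real"]
    proof eventually_elim
      case (elim h)
      have "S s (S h (B y)) = S h (S s (B y))" using S(1) s elim unfolding c0_semigroup_def by (metis add.commute less_imp_le)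
      thus ?case by (simp add: diff scaleR)
    qed
    ultimately have "((\<lambda>h. (S h (S s (B y)) - S s (B y)) /\<^sub>R h) \<longlongrightarrow> S s (- y)) (at_right 0)"
      by (rule Lim_transform_eventually)
    thus ?thesis using S(2) A[of "S s (B y)" "S s (- y)"] by (simp add: has_generator_def neg)
  qed
  have "S t (B y) = Ht t (B y)" for y
  proof -
    define v where "v s = S s y - Ht s y" for s
    have w: "S s (B y) - Ht s (B y) = B (v s)" if "s \<ge> 0" for s
      using com[OF that] by (simp add: v_def linear_diff[OF lin] B_heat_semigroup)
    have "inner (S t (B y) - Ht t (B y)) (S t (B y) - Ht t (B y)) \<le> inner (S 0 (B y) - Ht 0 (B y)) (S 0 (B y) - Ht 0 (B y))"
    proof (rule DERIV_nonpos_imp_decreasing_open[OF t])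
      show "continuous_on {0..t} (\<lambda>s. inner (S s (B y) - Ht s (B y)) (S s (B y) - Ht s (B y)))"
        by (intro continuous_intros continuous_on_subset[OF c0_semigroup_continuous] S c0_semigroup_heat) auto
      fix s assume s: "0 < s" "s < t"
      have "((\<lambda>s. S s (B y) - Ht s (B y)) has_vector_derivative S s (- y) - Ht s (- y)) (at s)"
        by (intro has_vector_derivative_diff c0_semigroup_has_vector_derivative S c0_semigroup_heat gen heat_semigroup_quotient s)
      moreover have "S s (- y) - Ht s (- y) = - v s"
        using S s by (simp add: v_def c0_semigroup_def linear_neg[OF bounded_linear.linear] bounded_linear_heat_semigroup)
      ultimately have "((\<lambda>s. S s (B y) - Ht s (B y)) has_vector_derivative - v s) (at s)" by simp
      from bounded_bilinear.has_vector_derivative[OF bounded_bilinear_inner this this]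
      have "((\<lambda>s. inner (S s (B y) - Ht s (B y)) (S s (B y) - Ht s (B y))) has_real_derivative
          inner (B (v s)) (- v s) + inner (- v s) (B (v s))) (at s)"
        using w[of s] s by (simp add: has_real_derivative_iff_has_vector_derivative)
      thus "\<exists>z. ((\<lambda>s. inner (S s (B y) - Ht s (B y)) (S s (B y) - Ht s (B y))) has_real_derivative z) (at s) \<and> z \<le> 0"
        using pos[of "v s"] by (intro exI conjI) (auto simp: inner_commute)
    qed
    hence "(norm (S t (B y) - Ht t (B y)))^2 \<le> 0" using S(1) unfolding power2_norm_eq_inner by (simp add: c0_semigroup_def)
    thus ?thesis by simp
  qed
  hence "range B \<subseteq> {x. S t x = Ht t x}" by auto
  moreover have "closed {x. S t x = Ht t x}"
    using S t by (intro closed_Collect_eq linear_continuous_on bounded_linear_heat_semigroup) (auto simp: c0_semigroup_def)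
  ultimately have "closure (range B) \<subseteq> {x. S t x = Ht t x}" by (rule closure_minimal)
  thus ?thesis using closure_range_B by auto
qed

end

section \<open>Extrapolation in time\<close>

lemma abs_coeff_prod_linear_le:
  fixes a b :: "'i \<Rightarrow> real"
  assumes "finite J"
  shows "\<bar>coeff (\<Prod>j\<in>J. [:a j, b j:]) m\<bar> \<le> (\<Prod>j\<in>J. \<bar>a j\<bar> + \<bar>b j\<bar>)"
  using assms
proof (induction J arbitrary: m rule: finite_induct)
  case empty
  thus ?case by (cases m) (auto simp: one_pCons)
next
  case (insert j J)
  let ?q = "\<Prod>j\<in>J. [:a j, b j:]" and ?P = "\<Prod>j\<in>J. \<bar>a j\<bar> + \<bar>b j\<bar>"
  have "\<bar>coeff ([:a j, b j:] * ?q) m\<bar> \<le> \<bar>a j\<bar> * ?P + \<bar>b j\<bar> * ?P"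
  proof (cases m)
    case 0
    have "\<bar>a j\<bar> * \<bar>coeff ?q 0\<bar> \<le> \<bar>a j\<bar> * ?P" by (intro mult_left_mono insert) auto
    moreover have "0 \<le> \<bar>b j\<bar> * ?P" by (intro mult_nonneg_nonneg prod_nonneg) auto
    ultimately show ?thesis using 0 by (simp add: abs_mult coeff_mult_0)
  next
    case (Suc m')
    have "\<bar>a j\<bar> * \<bar>coeff ?q m\<bar> \<le> \<bar>a j\<bar> * ?P" "\<bar>b j\<bar> * \<bar>coeff ?q m'\<bar> \<le> \<bar>b j\<bar> * ?P"
      by (intro mult_left_mono insert; simp)+
    moreover have "coeff ([:a j, b j:] * ?q) m = a j * coeff ?q m + b j * coeff ?q m'" using Suc by (simp add: mult_pCons_left)
    ultimately show ?thesis using abs_triangle_ineq[of "a j * coeff ?q m" "b j * coeff ?q m'"] by (simp add: abs_mult)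
  qed
  thus ?case using insert by (simp add: algebra_simps)
qed

lemma prod_abs_diff_eq_fact:
  assumes "i \<le> n"
  shows "(\<Prod>j\<in>{..n} - {i}. \<bar>real i - real j\<bar>) = fact i * fact (n - i)"
proof -
  have split: "{..n} - {i} = {..<i} \<union> {i<..n}" using assms by auto
  have "(\<Prod>j\<in>{..n} - {i}. \<bar>real i - real j\<bar>) =
      (\<Prod>j<i. \<bar>real i - real j\<bar>) * (\<Prod>j\<in>{i<..n}. \<bar>real i - real j\<bar>)"
    unfolding split by (rule prod.union_disjoint) auto
  also have "(\<Prod>j<i. \<bar>real i - real j\<bar>) = (\<Prod>k\<in>{1..i}. real k)"
    by (rule prod.reindex_bij_witness[of _ "\<lambda>k. i - k" "\<lambda>j. i - j"]) auto
  also have "(\<Prod>j\<in>{i<..n}. \<bar>real i - real j\<bar>) = (\<Prod>k\<in>{1..n - i}. real k)"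
    by (rule prod.reindex_bij_witness[of _ "\<lambda>k. i + k" "\<lambda>j. j - i"]) auto
  finally show ?thesis by (simp add: fact_prod)
qed

text \<open>The weights are the coefficients of the Lagrange basis polynomials for the nodes \<open>i / n\<close>.\<close>

lemma extrapolation_weights:
  assumes n: "n > 0" and k: "k < n"
  obtains c :: "nat \<Rightarrow> real" where
    "\<And>j. 1 \<le> j \<Longrightarrow> j \<le> n \<Longrightarrow> (\<Sum>i\<le>n. c i * (real i / real n) ^ j) = (if j = Suc k then 1 else 0)"
    "(\<Sum>i\<le>n. \<bar>c i\<bar>) \<le> 12 ^ n"
proof -
  define x where "x i = real i / real n" for i
  have x_eq: "x i = x j \<longleftrightarrow> i = j" for i j using n by (simp add: x_def)
  define l where "l i = (\<Prod>j\<in>{..n} - {i}. [:- x j / (x i - x j), 1 / (x i - x j):])" for i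
  have l_eval: "poly (l i) (x m) = (if m = i then 1 else 0)" if "i \<le> n" "m \<le> n" for i m
  proof (cases "m = i")
    case True
    have "poly (l i) (x i) = (\<Prod>j\<in>{..n} - {i}. 1)" unfolding l_def poly_prod
      by (intro prod.cong refl) (auto simp: x_eq diff_divide_distrib[symmetric])
    thus ?thesis using True by simp
  next
    case False
    have "poly [:- x m / (x i - x m), 1 / (x i - x m):] (x m) = 0" by simp
    thus ?thesis unfolding l_def poly_prod using False that by (auto intro!: prod_zero bexI[of _ m])
  qed
  have l_deg: "degree (l i) \<le> n" if "i \<le> n" for i
  proof -
    have "degree (l i) \<le> (\<Sum>j\<in>{..n} - {i}. degree [:- x j / (x i - x j), 1 / (x i - x j):])"
      unfolding l_def by (rule order_trans[OF degree_prod_sum_le]) (simp_all add: o_def)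
    also have "\<dots> \<le> (\<Sum>j\<in>{..n} - {i}. 1)" by (intro sum_mono) (auto intro: order_trans[OF degree_pCons_le])
    also have "\<dots> = n" using that by simp
    finally show ?thesis .
  qed
  have interp: "(\<Sum>i\<le>n. smult (x i ^ j) (l i)) = monom 1 j" if "j \<le> n" for j
  proof (rule ccontr)
    let ?p = "(\<Sum>i\<le>n. smult (x i ^ j) (l i)) - monom 1 j"
    assume "\<not> ?thesis"
    hence p: "?p \<noteq> 0" by simp
    have "poly ?p (x m) = 0" if "m \<le> n" for m
    proof -
      have "(\<Sum>i\<le>n. x i ^ j * poly (l i) (x m)) = (\<Sum>i\<le>n. if i = m then x i ^ j else 0)"
        using that by (intro sum.cong) (auto simp: l_eval)
      thus ?thesis using that by (simp add: poly_sum poly_monom)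
    qed
    hence "x ` {..n} \<subseteq> {y. poly ?p y = 0}" by auto
    hence "card (x ` {..n}) \<le> card {y. poly ?p y = 0}" using poly_roots_finite[OF p] by (intro card_mono) auto
    also have "\<dots> \<le> degree ?p" by (rule card_poly_roots_bound[OF p])
    also have "\<dots> \<le> n"
      using that by (intro degree_diff_le degree_sum_le) (auto intro: order_trans[OF degree_smult_le] l_deg degree_monom_le[THEN order_trans])
    also have "card (x ` {..n}) = Suc n" by (subst card_image) (auto simp: inj_on_def x_eq)
    finally show False by simp
  qed
  define c where "c i = coeff (l i) (Suc k)" for i
  have "(\<Sum>i\<le>n. c i * x i ^ j) = (if j = Suc k then 1 else 0)" if "1 \<le> j" "j \<le> n" for j
  proof -
    have "coeff (\<Sum>i\<le>n. smult (x i ^ j) (l i)) (Suc k) = coeff (monom 1 j) (Suc k)" using interp[OF that(2)] by simp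
    thus ?thesis by (simp add: coeff_sum c_def mult.commute)
  qed
  \<comment> \<open>Each linear factor contributes at most \<open>2 * n / |i - j|\<close>, the
    denominators multiply to \<open>i! * (n - i)!\<close>, and summing the binomial coefficients
    leaves \<open>4 ^ n * n ^ n / n!\<close>, at most \<open>4 ^ n * exp n\<close>; finally
    \<open>exp 1 \<le> 3\<close>.\<close>
  moreover have "(\<Sum>i\<le>n. \<bar>c i\<bar>) \<le> 12 ^ n"
  proof -
    have "\<bar>c i\<bar> \<le> (2 * real n) ^ n / fact n * real (n choose i)" if i: "i \<le> n" for i
    proof -
      have "\<bar>c i\<bar> \<le> (\<Prod>j\<in>{..n} - {i}. \<bar>- x j / (x i - x j)\<bar> + \<bar>1 / (x i - x j)\<bar>)"
        unfolding c_def l_def by (rule abs_coeff_prod_linear_le) simp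
      also have "\<dots> \<le> (\<Prod>j\<in>{..n} - {i}. 2 * real n / \<bar>real i - real j\<bar>)"
      proof (intro prod_mono conjI)
        fix j assume j: "j \<in> {..n} - {i}"
        have "\<bar>- x j / (x i - x j)\<bar> + \<bar>1 / (x i - x j)\<bar> = (x j + 1) / \<bar>x i - x j\<bar>"
        proof -
          have "x j \<ge> 0" by (simp add: x_def)
          thus ?thesis by (simp add: add_divide_distrib)
        qed
        also have "\<dots> \<le> 2 / \<bar>x i - x j\<bar>" using j n by (intro divide_right_mono) (auto simp: x_def)
        also have "\<dots> = 2 * real n / \<bar>real i - real j\<bar>"
        proof -
          have "x i - x j = (real i - real j) / real n" by (simp add: x_def diff_divide_distrib)
          thus ?thesis using n by (simp only:) (simp add: abs_divide)
        qed
        finally show "\<bar>- x j / (x i - x j)\<bar> + \<bar>1 / (x i - x j)\<bar> \<le> 2 * real n / \<bar>real i - real j\<bar>" .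
      qed simp
      also have "\<dots> = (2 * real n) ^ n / (fact i * fact (n - i))" using i by (simp add: prod_dividef prod_abs_diff_eq_fact)
      also have "\<dots> = (2 * real n) ^ n / fact n * real (n choose i)" using i by (simp add: binomial_fact)
      finally show ?thesis .
    qed
    hence "(\<Sum>i\<le>n. \<bar>c i\<bar>) \<le> (\<Sum>i\<le>n. (2 * real n) ^ n / fact n * real (n choose i))"
      by (intro sum_mono) auto
    also have "\<dots> = (2 * real n) ^ n / fact n * 2 ^ n"
      by (simp only: sum_distrib_left[symmetric] of_nat_sum[symmetric] choose_row_sum of_nat_power of_nat_numeral)
    also have "\<dots> = 4 ^ n * (real n ^ n / fact n)"
    proof -
      have "(4::real) ^ n = 2 ^ n * 2 ^ n" by (simp add: power_mult_distrib[symmetric])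
      thus ?thesis by (simp add: power_mult_distrib)
    qed
    also have "\<dots> \<le> 4 ^ n * exp (real n)" by (intro mult_left_mono power_div_fact_le_exp) auto
    also have "exp (real n) = exp 1 ^ n" using exp_of_nat_mult[of n "1::real"] by simp
    also have "(4 :: real) ^ n * exp 1 ^ n \<le> 4 ^ n * 3 ^ n" by (intro mult_left_mono power_mono exp_le) auto
    also have "\<dots> = 12 ^ n" by (simp add: power_mult_distrib[symmetric])
    finally show ?thesis .
  qed
  ultimately show thesis using that unfolding x_def by blast
qed

text \<open>The exponential series in \<open>y\<close>, going back in time from \<open>L\<close>.
  The factor \<open>b\<close> appears since only a time integral of the observation is at hand:
  \<open>B (S s - S L)\<close> is the integral of the semigroup over \<open>[s, L]\<close>. The
  constant term is absent because the value at \<open>L\<close> is subtracted.\<close>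

lemma sums_exp_difference:
  fixes b L y :: real
  assumes "b > 0"
  shows "(\<lambda>j. y ^ Suc j / fact (Suc j) * heat_symbol L j b) sums (b * (heat_symbol (L - y) 0 b - heat_symbol L 0 b))"
proof -
  have "(\<lambda>j. (y / b) ^ j /\<^sub>R fact j) sums exp (y / b)" by (rule exp_converges)
  hence "(\<lambda>j. (y / b) ^ Suc j /\<^sub>R fact (Suc j)) sums (exp (y / b) - 1)"
    using sums_Suc_iff[of "\<lambda>j. (y / b) ^ j /\<^sub>R fact j"] by simp
  hence "(\<lambda>j. (b * exp (- L / b)) * ((y / b) ^ Suc j /\<^sub>R fact (Suc j))) sums ((b * exp (- L / b)) * (exp (y / b) - 1))"
    by (rule sums_mult)
  moreover have "(b * exp (- L / b)) * ((y / b) ^ Suc j /\<^sub>R fact (Suc j)) = y ^ Suc j / fact (Suc j) * heat_symbol L j b" for j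
    using assms by (simp add: heat_symbol_def power_divide del: fact_Suc) (simp add: divide_inverse mult_ac del: fact_Suc)
  moreover have "(b * exp (- L / b)) * (exp (y / b) - 1) = b * (heat_symbol (L - y) 0 b - heat_symbol L 0 b)"
    using assms by (simp add: heat_symbol_def right_diff_distrib exp_add[symmetric] diff_divide_distrib)
  ultimately show ?thesis by (simp only:)
qed

text \<open>Among the first \<open>n\<close> Taylor terms the weights keep only the wanted one. The
  rest is a geometric tail with ratio \<open>1 / 24\<close>; the choice \<open>r = L / 24\<close>
  beats the size \<open>12 ^ n\<close> of the weights and leaves \<open>1 / 2 ^ n\<close>.\<close>

lemma heat_symbol_extrapolation:
  fixes L r b :: real and c :: "nat \<Rightarrow> real"
  assumes L: "L > 0" and r: "r = L / 24" and n: "n > 0" and k: "k < n"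
    and c: "\<And>j. 1 \<le> j \<Longrightarrow> j \<le> n \<Longrightarrow> (\<Sum>i\<le>n. c i * (real i / real n) ^ j) = (if j = Suc k then 1 else 0)"
    and c12: "(\<Sum>i\<le>n. \<bar>c i\<bar>) \<le> 12 ^ n" and b: "b \<ge> 0"
  shows "\<bar>(\<Sum>i\<le>n. c i * (b * (heat_symbol (L - r * (real i / real n)) 0 b - heat_symbol L 0 b)))
      - r ^ Suc k / fact (Suc k) * heat_symbol L k b\<bar> \<le> L / 2 ^ n"
proof (cases "b = 0")
  case True
  thus ?thesis using L by (simp add: heat_symbol_def)
next
  case False
  hence b: "b > 0" using b by simp
  define x where "x i = real i / real n" for i
  define a where "a j = r ^ Suc j / fact (Suc j) * heat_symbol L j b" for j
  define s where "s j = (\<Sum>i\<le>n. c i * x i ^ Suc j)" for j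
  have a: "0 \<le> a j" "a j \<le> L * (1/24) ^ Suc j" for j
  proof -
    show "0 \<le> a j" using L r by (simp add: a_def heat_symbol_nonneg)
    have "a j \<le> r ^ Suc j / fact (Suc j) * (fact j / L ^ j)"
      unfolding a_def using heat_symbol_le[OF L, of j b] L r by (intro mult_left_mono) auto
    also have "\<dots> = L * (1/24) ^ Suc j / real (Suc j)"
    proof -
      have "fact j / fact (Suc j) = 1 / real (Suc j)" by (simp add: divide_simps)
      moreover have "r ^ Suc j / L ^ j = L * (1/24) ^ Suc j" using L by (simp add: r power_divide)
      moreover have "r ^ Suc j / fact (Suc j) * (fact j / L ^ j) = (r ^ Suc j / L ^ j) * (fact j / fact (Suc j))"
        by (simp del: fact_Suc power_Suc)
      ultimately show ?thesis by (simp only: times_divide_eq_right mult_1_right)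
    qed
    also have "\<dots> \<le> L * (1/24) ^ Suc j / 1" using L by (intro divide_left_mono) auto
    also have "\<dots> = L * (1/24) ^ Suc j" by simp
    finally show "a j \<le> L * (1/24) ^ Suc j" .
  qed
  have s_abs: "\<bar>s j\<bar> \<le> 12 ^ n" for j
  proof -
    have "\<bar>s j\<bar> \<le> (\<Sum>i\<le>n. \<bar>c i\<bar> * x i ^ Suc j)"
      unfolding s_def by (rule order_trans[OF sum_abs]) (simp add: abs_mult x_def)
    also have "\<dots> \<le> (\<Sum>i\<le>n. \<bar>c i\<bar> * 1)"
      using n by (intro sum_mono mult_left_mono power_le_one) (auto simp: x_def)
    finally show ?thesis using c12 by simp
  qed
  have s_low: "s j = (if j = k then 1 else 0)" if "j < n" for j using c[of "Suc j"] that by (simp add: s_def x_def)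
  have "(\<lambda>j. \<Sum>i\<le>n. c i * ((r * x i) ^ Suc j / fact (Suc j) * heat_symbol L j b)) sums
      (\<Sum>i\<le>n. c i * (b * (heat_symbol (L - r * x i) 0 b - heat_symbol L 0 b)))"
    by (intro sums_sum sums_mult sums_exp_difference b)
  moreover have "(\<Sum>i\<le>n. c i * ((r * x i) ^ Suc j / fact (Suc j) * heat_symbol L j b)) = a j * s j" for j
    unfolding a_def s_def sum_distrib_left by (intro sum.cong refl) (simp add: power_mult_distrib mult_ac del: fact_Suc)
  ultimately have sums: "(\<lambda>j. a j * s j) sums
      (\<Sum>i\<le>n. c i * (b * (heat_symbol (L - r * x i) 0 b - heat_symbol L 0 b)))" (is "_ sums ?D") by simp
  have "(\<Sum>j<n. a j * s j) = (\<Sum>j<n. if j = k then a j else 0)" by (intro sum.cong) (auto simp: s_low)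
  also have "\<dots> = a k" using k by simp
  finally have "(\<lambda>j. a (j + n) * s (j + n)) sums (?D - a k)" using sums_split_initial_segment[OF sums, of n] by simp
  hence eq: "?D - a k = (\<Sum>j. a (j + n) * s (j + n))" by (simp add: sums_iff)
  have g: "(\<lambda>j. 12 ^ n * (L * (1/24) ^ Suc n) * (1/24) ^ j) sums (12 ^ n * (L * (1/24) ^ Suc n) * (1 / (1 - 1/24)))"
    by (intro sums_mult geometric_sums) simp
  have le: "norm (a (j + n) * s (j + n)) \<le> 12 ^ n * (L * (1/24) ^ Suc n) * (1/24) ^ j" for j
  proof -
    have "norm (a (j + n) * s (j + n)) \<le> (L * (1/24) ^ Suc (j + n)) * 12 ^ n"
    proof -
      have "norm (a (j + n) * s (j + n)) = a (j + n) * \<bar>s (j + n)\<bar>" using a(1)[of "j + n"] by (simp add: abs_mult)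
      also have "\<dots> \<le> (L * (1/24) ^ Suc (j + n)) * 12 ^ n" using L by (intro mult_mono a s_abs) auto
      finally show ?thesis .
    qed
    thus ?thesis by (simp add: power_add mult_ac)
  qed
  have "\<bar>?D - a k\<bar> \<le> 12 ^ n * (L * (1/24) ^ Suc n) * (1 / (1 - 1/24))"
    unfolding eq real_norm_def[symmetric] using norm_suminf_le[OF le sums_summable[OF g]] g by (simp add: sums_iff)
  also have "\<dots> \<le> L / 2 ^ n"
  proof -
    have "(12::real) ^ n * (1/24) ^ n = 1 / 2 ^ n"
      using power_mult_distrib[of "12::real" "1/24" n] power_divide[of 1 "2::real" n] by simp
    hence "12 ^ n * (L * (1/24) ^ Suc n) * (1 / (1 - 1/24)) = L * (1 / 2 ^ n) / 23" by (simp add: field_simps)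
    thus ?thesis using L by (simp add: field_simps)
  qed
  finally show ?thesis by (simp add: a_def x_def)
qed

section \<open>Extrapolation for the semigroup\<close>

context injective_positive_operator
begin

lemma cfc_sum:
  assumes "finite I" "\<And>i. i \<in> I \<Longrightarrow> continuous_on {0..M} (f i)"
  shows "cfc B M (\<lambda>b. \<Sum>i\<in>I. f i b) x = (\<Sum>i\<in>I. cfc B M (f i) x)"
  using assms
proof (induction I rule: finite_induct)
  case empty
  thus ?case using cfc_const[of 0 x] by simp
next
  case (insert i I)
  thus ?case using cfc_add[of "f i" "\<lambda>b. \<Sum>i\<in>I. f i b" x] by (simp add: continuous_on_sum)
qed

text \<open>Carries the scalar estimate over to vectors, for any seminorm below the norm; later it
  is the \<open>L^1\<close> norm on the control interval. The observed differences are measured in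
  \<open>N\<close>, the extrapolation error in the full norm by the calculus.\<close>

lemma heat_extrapolation:
  fixes N :: "'a \<Rightarrow> real"
  assumes add: "\<And>x y. N (x + y) \<le> N x + N y" and scale: "\<And>c x. N (c *\<^sub>R x) = \<bar>c\<bar> * N x"
    and le: "\<And>x. N x \<le> norm x"
    and L: "L > 0" and r: "r = L / 24" and n: "n > 0"
    and m: "\<And>s. L - r \<le> s \<Longrightarrow> s \<le> L \<Longrightarrow> N (B (Ht s \<psi>) - B (Ht L \<psi>)) \<le> m"
  shows "N (Hk L k \<psi>) \<le> fact (Suc k) / r ^ Suc k * (12 ^ n * m + L / 2 ^ n * norm \<psi>)"
proof -
  have r0: "r > 0" using L r by simp
  have m0: "m \<ge> 0" using m[of L] r0 scale[of 0 0] by simp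
  show ?thesis
  proof (cases "k < n")
    case k: True
    obtain c where c: "\<And>j. 1 \<le> j \<Longrightarrow> j \<le> n \<Longrightarrow> (\<Sum>i\<le>n. c i * (real i / real n) ^ j) = (if j = Suc k then 1 else 0)"
      "(\<Sum>i\<le>n. \<bar>c i\<bar>) \<le> 12 ^ n" using extrapolation_weights[OF n k] by blast
    define t where "t i = L - r * (real i / real n)" for i
    have t: "L - r \<le> t i" "t i \<le> L" "t i > 0" if "i \<le> n" for i
    proof -
      have "0 \<le> real i / real n" "real i / real n \<le> 1" using that n by auto
      hence "r * (real i / real n) \<le> r" "0 \<le> r * (real i / real n)" using r0 mult_left_le[of "real i / real n" r] by auto
      thus "L - r \<le> t i" "t i \<le> L" "t i > 0" unfolding t_def using L r by linarith+
    qed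
    define D where "D i = B (Ht (t i) \<psi>) - B (Ht L \<psi>)" for i
    let ?f = "\<lambda>i b. b * (heat_symbol (t i) 0 b - heat_symbol L 0 b)"
    have f: "continuous_on {0..M} (?f i)" if "i \<le> n" for i by (intro continuous_intros continuous_on_heat_symbol t that L)
    have D: "cfc B M (?f i) \<psi> = D i" if "i \<le> n" for i
    proof -
      have "cfc B M (?f i) \<psi> = B (cfc B M (heat_symbol (t i) 0) \<psi> - cfc B M (heat_symbol L 0) \<psi>)" using t[OF that] L
        by (subst cfc_mult) (simp_all add: cfc_id cfc_diff continuous_on_heat_symbol continuous_on_diff)
      thus ?thesis using t[OF that] L by (simp add: D_def heat_semigroup_def heat_def linear_diff[OF lin])
    qed
    let ?g = "\<lambda>b. (\<Sum>i\<le>n. c i * ?f i b) - r ^ Suc k / fact (Suc k) * heat_symbol L k b"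
    have cf: "continuous_on {0..M} (\<lambda>b. c i * ?f i b)" if "i \<le> n" for i by (intro continuous_on_mult_left f that)
    have hk: "continuous_on {0..M} (heat_symbol L k)" by (rule continuous_on_heat_symbol[OF L])
    have g: "cfc B M ?g \<psi> = (\<Sum>i\<le>n. c i *\<^sub>R D i) - (r ^ Suc k / fact (Suc k)) *\<^sub>R Hk L k \<psi>"
    proof -
      have "cfc B M ?g \<psi> = cfc B M (\<lambda>b. \<Sum>i\<le>n. c i * ?f i b) \<psi> - cfc B M (\<lambda>b. r ^ Suc k / fact (Suc k) * heat_symbol L k b) \<psi>"
        by (rule cfc_diff[OF continuous_on_sum continuous_on_mult_left[OF hk]]) (use cf in auto)
      also have "cfc B M (\<lambda>b. \<Sum>i\<le>n. c i * ?f i b) \<psi> = (\<Sum>i\<le>n. cfc B M (\<lambda>b. c i * ?f i b) \<psi>)"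
        using cf by (intro cfc_sum) auto
      also have "\<dots> = (\<Sum>i\<le>n. c i *\<^sub>R D i)" using f D by (intro sum.cong refl) (simp add: cfc_scale)
      also have "cfc B M (\<lambda>b. r ^ Suc k / fact (Suc k) * heat_symbol L k b) \<psi> = (r ^ Suc k / fact (Suc k)) *\<^sub>R Hk L k \<psi>"
        unfolding heat_def by (rule cfc_scale[OF hk])
      finally show ?thesis .
    qed
    have gn: "norm (cfc B M ?g \<psi>) \<le> L / 2 ^ n * norm \<psi>"
    proof (rule norm_cfc_le)
      show "continuous_on {0..M} ?g" by (rule continuous_on_diff[OF continuous_on_sum continuous_on_mult_left[OF hk]]) (use cf in auto)
      fix b :: real assume "0 \<le> b"
      show "\<bar>?g b\<bar> \<le> L / 2 ^ n"
        unfolding t_def by (rule heat_symbol_extrapolation[OF L r n k c \<open>0 \<le> b\<close>])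
    qed
    have sumN: "N (\<Sum>i\<in>J. c i *\<^sub>R D i) \<le> (\<Sum>i\<in>J. \<bar>c i\<bar> * N (D i))" if "finite J" for J using that
    proof (induction J rule: finite_induct)
      case empty
      thus ?case using scale[of 0 0] by simp
    next
      case (insert i J)
      thus ?case using add[of "c i *\<^sub>R D i" "\<Sum>i\<in>J. c i *\<^sub>R D i"] by (simp add: scale)
    qed
    have "N ((r ^ Suc k / fact (Suc k)) *\<^sub>R Hk L k \<psi>) \<le> 12 ^ n * m + L / 2 ^ n * norm \<psi>"
    proof -
      have "(r ^ Suc k / fact (Suc k)) *\<^sub>R Hk L k \<psi> = (\<Sum>i\<le>n. c i *\<^sub>R D i) + (-1) *\<^sub>R cfc B M ?g \<psi>"
        unfolding g by simp
      hence "N ((r ^ Suc k / fact (Suc k)) *\<^sub>R Hk L k \<psi>) \<le> N (\<Sum>i\<le>n. c i *\<^sub>R D i) + N (cfc B M ?g \<psi>)"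
        using add[of "\<Sum>i\<le>n. c i *\<^sub>R D i" "(-1) *\<^sub>R cfc B M ?g \<psi>"] scale[of "-1" "cfc B M ?g \<psi>"] by simp
      also have "N (\<Sum>i\<le>n. c i *\<^sub>R D i) \<le> (\<Sum>i\<le>n. \<bar>c i\<bar> * m)"
        using t by (intro order_trans[OF sumN] sum_mono mult_left_mono) (auto simp: D_def intro!: m)
      also have "\<dots> \<le> 12 ^ n * m" unfolding sum_distrib_right[symmetric] using c(2) m0 by (intro mult_right_mono)
      finally show ?thesis using le[of "cfc B M ?g \<psi>"] gn by linarith
    qed
    hence "r ^ Suc k / fact (Suc k) * N (Hk L k \<psi>) \<le> 12 ^ n * m + L / 2 ^ n * norm \<psi>" using r0 by (simp only: scale) simp
    thus ?thesis using r0 by (simp add: field_simps del: fact_Suc power_Suc)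
  next
    \<comment> \<open>For \<open>k \<ge> n\<close> the weights give nothing, but the a priori bound
      is already below the error term, because \<open>24 ^ Suc k\<close> dominates
      \<open>2 ^ n\<close>.\<close>
    case False
    have "N (Hk L k \<psi>) \<le> fact k / L ^ k * norm \<psi>" using le norm_heat_le[OF L] by (rule order_trans)
    also have "\<dots> \<le> fact (Suc k) / r ^ Suc k * (L / 2 ^ n) * norm \<psi>"
    proof (intro mult_right_mono)
      have "(2::real) ^ n \<le> 2 ^ Suc k" using False by (intro power_increasing) auto
      also have "\<dots> \<le> 24 ^ Suc k" by (intro power_mono) auto
      also have "\<dots> \<le> 24 ^ Suc k * real (Suc k)" by simp
      finally have "fact k / L ^ k * 2 ^ n \<le> fact k / L ^ k * (24 ^ Suc k * real (Suc k))" using L by (intro mult_left_mono) auto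
      moreover have "fact (Suc k) / r ^ Suc k * (L / 2 ^ n) = fact k / L ^ k * (24 ^ Suc k * real (Suc k)) / 2 ^ n"
        using L by (simp add: r power_divide field_simps)
      ultimately show "fact k / L ^ k \<le> fact (Suc k) / r ^ Suc k * (L / 2 ^ n)"
        by (simp only: pos_le_divide_eq zero_less_power zero_less_numeral)
    qed simp
    also have "\<dots> \<le> fact (Suc k) / r ^ Suc k * (12 ^ n * m + L / 2 ^ n * norm \<psi>)"
      unfolding mult.assoc using m0 r0 by (intro mult_left_mono) auto
    finally show ?thesis .
  qed
qed

end

section \<open>The inverse of the divergence form operator\<close>

interpretation unit_leb: finite_measure U by (rule unit_leb_finite)

lemma space_unit_leb [simp]: "space U = {0<..<1}" by simp

lemma id_measurable_unit_leb [measurable]: "(\<lambda>x. x) \<in> borel_measurable U"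
  by (rule measurable_restrict_space1) (simp add: measurable_completion)

lemma sq_integrable_integrable:
  assumes "sq_integrable f"
  shows "integrable U f"
proof (rule Bochner_Integration.integrable_bound)
  show "integrable U (\<lambda>x. 1 + (norm (f x))^2)" using assms by (auto simp: sq_integrable_def)
  show "AE x in U. norm (f x) \<le> norm (1 + (norm (f x))^2)"
  proof (rule AE_I2)
    fix x
    have "0 \<le> (norm (f x) - 1)^2" by simp
    hence "2 * norm (f x) \<le> 1 + (norm (f x))^2" by (simp add: power2_diff)
    hence "norm (f x) \<le> 1 + (norm (f x))^2" using norm_ge_zero[of "f x"] by linarith
    thus "norm (f x) \<le> norm (1 + (norm (f x))^2)" by simp
  qed
qed (use assms in "simp add: sq_integrable_def")

lemma inner_L2_of: "sq_integrable f \<Longrightarrow> sq_integrable g \<Longrightarrow> inner (L2_of f) (L2_of g) = (LINT x|U. f x \<bullet> g x)"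
  by (simp add: L2_of_def inner_L2.abs_eq)

lemma rep_L2_of:
  assumes "sq_integrable f"
  shows "AE x in U. rep_L2 (L2_of f) x = f x"
proof -
  have "(norm (L2_of (\<lambda>x. rep_L2 (L2_of f) x - f x)))^2 = 0" using assms by (simp add: L2_of_diff sq_integrable_rep L2_of_rep)
  hence "(LINT x|U. (norm (rep_L2 (L2_of f) x - f x))^2) = 0"
    using assms by (simp only: norm_L2_of sq_integrable_diff sq_integrable_rep)
  hence "AE x in U. (norm (rep_L2 (L2_of f) x - f x))^2 = 0" using sq_integrable_diff[OF sq_integrable_rep assms, of "L2_of f"]
    by (subst (asm) integral_nonneg_eq_0_iff_AE) (auto simp: sq_integrable_def)
  thus ?thesis by eventually_elim simp
qed

lemma L2_of_eq_iff:
  assumes "sq_integrable f" "sq_integrable g"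
  shows "L2_of f = L2_of g \<longleftrightarrow> (AE x in U. f x = g x)"
proof
  assume "L2_of f = L2_of g"
  thus "AE x in U. f x = g x" using rep_L2_of[OF assms(1)] rep_L2_of[OF assms(2)] by (auto elim: eventually_elim2)
qed (rule L2_of_eqI[OF assms])

lemma rep_L2_add: "AE x in U. rep_L2 (F + G) x = rep_L2 F x + rep_L2 G x"
  using rep_L2_of[OF sq_integrable_add[OF sq_integrable_rep sq_integrable_rep], of F G]
  by (simp add: L2_of_add sq_integrable_rep L2_of_rep)

lemma rep_L2_scaleR: "AE x in U. rep_L2 (r *\<^sub>R F) x = r *\<^sub>R rep_L2 F x"
  using rep_L2_of[OF sq_integrable_scaleR[OF sq_integrable_rep], of r F] by (simp add: L2_of_scaleR sq_integrable_rep L2_of_rep)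

lemma rep_L2_measurable [measurable]: "rep_L2 F \<in> borel_measurable U"
  using sq_integrable_rep[of F] by (simp add: sq_integrable_def)

lemma rep_L2_integrable [simp]: "integrable U (rep_L2 F)" by (rule sq_integrable_integrable[OF sq_integrable_rep])

lemma integral_norm_rep_le: "(LINT x|U. norm (rep_L2 F x)) \<le> norm F"
proof (rule field_le_epsilon)
  fix e :: real assume "e > 0"
  hence c: "norm F + e > 0" by (simp add: add_nonneg_pos)
  have "(\<integral>\<^sup>+x. ennreal (norm (rep_L2 F x)) \<partial>U) \<le> ennreal (norm F + e)"
    by (rule nn_integral_norm_le[OF sq_integrable_rep c]) (use \<open>e > 0\<close> in "simp add: L2_of_rep")
  moreover have "(\<integral>\<^sup>+x. ennreal (norm (rep_L2 F x)) \<partial>U) = ennreal (LINT x|U. norm (rep_L2 F x))"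
    by (rule nn_integral_eq_integral) auto
  ultimately show "(LINT x|U. norm (rep_L2 F x)) \<le> norm F + e" using c by simp
qed

lemma norm_L2_of_bounded_le:
  assumes f: "f \<in> borel_measurable U" and b: "AE x in U. norm (f x) \<le> C" and "C \<ge> 0"
  shows "sq_integrable f" "norm (L2_of f) \<le> C"
proof -
  have int: "integrable U (\<lambda>x. (norm (f x))^2)"
    using f b by (intro unit_leb.integrable_const_bound[where B = "C^2"]) (auto elim!: eventually_mono intro: power_mono)
  thus sq: "sq_integrable f" using f by (simp add: sq_integrable_def)
  have "(norm (L2_of f))^2 \<le> (LINT x|U. C^2)" unfolding norm_L2_of[OF sq] using b
    by (intro integral_mono_AE int) (auto elim!: eventually_mono intro: power_mono)
  hence "(norm (L2_of f))^2 \<le> C^2" by (simp add: unit_leb_measure)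
  thus "norm (L2_of f) \<le> C" using \<open>C \<ge> 0\<close> by (rule power2_le_imp_le)
qed

section \<open>Primitives on the unit interval\<close>

definition prim :: "(real \<Rightarrow> complex) \<Rightarrow> real \<Rightarrow> complex" where
  "prim f x = (LINT y|U. indicator {..<x} y *\<^sub>R f y)"

lemma integrable_indicator_unit:
  fixes f :: "real \<Rightarrow> 'b::{banach, second_countable_topology}"
  assumes "integrable U f" "A \<in> sets borel"
  shows "integrable U (\<lambda>y. indicator A y *\<^sub>R f y)"
proof (rule Bochner_Integration.integrable_bound[OF assms(1)])
  have [measurable]: "f \<in> borel_measurable U" "A \<in> sets borel" using assms by auto
  show "(\<lambda>y. indicator A y *\<^sub>R f y) \<in> borel_measurable U" by measurable
qed (auto simp: indicator_def)

lemma AE_unit_leb_neq: "AE y in U. y \<noteq> x"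
proof -
  have "AE y in lborel. y \<noteq> x" by (rule AE_lborel_singleton)
  thus ?thesis by (intro AE_restrict_space_iff[THEN iffD2] eventually_mono[OF AE_completion]) auto
qed

lemma prim_cong: "AE y in U. f y = g y \<Longrightarrow> f \<in> borel_measurable U \<Longrightarrow> g \<in> borel_measurable U \<Longrightarrow> prim f x = prim g x"
  unfolding prim_def by (intro integral_cong_AE) (auto elim: eventually_mono)

lemma prim_diff_eq:
  assumes "integrable U f" "x \<le> y"
  shows "prim f y - prim f x = (LINT s|U. indicator {x..<y} s *\<^sub>R f s)"
proof -
  have "indicator {..<y} s *\<^sub>R f s - indicator {..<x} s *\<^sub>R f s = indicator {x..<y} s *\<^sub>R f s" for s
    using assms(2) by (auto simp: indicator_def)
  thus ?thesis unfolding prim_def using assms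
    by (subst Bochner_Integration.integral_diff[symmetric]) (auto intro: integrable_indicator_unit)
qed

lemma norm_prim_diff_le:
  assumes "integrable U f" "x \<le> y"
  shows "norm (prim f y - prim f x) \<le> (LINT s|U. indicator {x..<y} s * norm (f s))"
  unfolding prim_diff_eq[OF assms] by (rule order_trans[OF integral_norm_bound]) simp

lemma prim_0 [simp]: "prim f 0 = 0"
proof -
  have "(LINT y|U. indicator {..<0} y *\<^sub>R f y) = (LINT y|U. 0)" by (rule Bochner_Integration.integral_cong) auto
  thus ?thesis by (simp add: prim_def)
qed

lemma prim_1: "prim f 1 = (LINT y|U. f y)"
  unfolding prim_def by (rule Bochner_Integration.integral_cong) auto

lemma norm_prim_le:
  assumes "integrable U f"
  shows "norm (prim f x) \<le> (LINT y|U. norm (f y))"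
proof -
  have "norm (prim f x) \<le> (LINT y|U. norm (indicator {..<x} y *\<^sub>R f y))" unfolding prim_def by (rule integral_norm_bound)
  also have "\<dots> \<le> (LINT y|U. norm (f y))"
    by (intro integral_mono integrable_norm integrable_indicator_unit assms) (auto simp: indicator_def)
  finally show ?thesis .
qed

lemma prim_add:
  "integrable U f \<Longrightarrow> integrable U g \<Longrightarrow> prim (\<lambda>y. f y + g y) x = prim f x + prim g x"
  unfolding prim_def scaleR_add_right by (intro Bochner_Integration.integral_add integrable_indicator_unit) auto

lemma prim_scaleR:
  assumes "integrable U f"
  shows "prim (\<lambda>y. r *\<^sub>R f y) x = r *\<^sub>R prim f x"
proof -
  have "indicator {..<x} y *\<^sub>R r *\<^sub>R f y = r *\<^sub>R (indicator {..<x} y *\<^sub>R f y)" for y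
    by (simp add: scaleR_left_commute)
  moreover have "integrable U (\<lambda>y. indicator {..<x} y *\<^sub>R f y)" by (rule integrable_indicator_unit[OF assms]) simp
  ultimately show ?thesis unfolding prim_def by (simp only: integral_scaleR_right)
qed

lemma continuous_on_prim:
  assumes f: "integrable U f"
  shows "continuous_on A (prim f)"
proof (rule continuous_on_subset[OF _ subset_UNIV], subst continuous_on_sequentially, intro allI ballI impI)
  fix X :: "nat \<Rightarrow> real" and x assume "(\<forall>n. X n \<in> UNIV) \<and> X \<longlonglongrightarrow> x"
  hence X: "X \<longlonglongrightarrow> x" by simp
  have [measurable]: "f \<in> borel_measurable U" using f by auto
  have "(\<lambda>n. LINT y|U. indicator {..<X n} y *\<^sub>R f y) \<longlonglongrightarrow> (LINT y|U. indicator {..<x} y *\<^sub>R f y)"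
  proof (rule integral_dominated_convergence[where w = "\<lambda>y. norm (f y)"])
    show "AE y in U. (\<lambda>n. indicator {..<X n} y *\<^sub>R f y) \<longlonglongrightarrow> indicator {..<x} y *\<^sub>R f y"
      using AE_unit_leb_neq[of x]
    proof eventually_elim
      case (elim y)
      have "\<forall>\<^sub>F n in sequentially. indicator {..<X n} y = (indicator {..<x} y :: real)"
      proof (cases "y < x")
        case True
        thus ?thesis using order_tendstoD(1)[OF X True] by (auto elim: eventually_mono)
      next
        case False
        hence xy: "x < y" using elim by simp
        show ?thesis using order_tendstoD(2)[OF X xy] xy by (auto elim!: eventually_mono simp: indicator_def)
      qed
      thus ?case by (intro tendsto_eventually) (auto elim: eventually_mono)
    qed
  qed (use f in "auto simp: indicator_def")
  thus "(prim f \<circ> X) \<longlonglongrightarrow> prim f x" by (simp add: prim_def o_def)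
qed

lemma borel_measurable_prim [measurable]:
  assumes "integrable U f"
  shows "prim f \<in> borel_measurable U"
proof -
  have "prim f \<in> borel_measurable borel" by (rule borel_measurable_continuous_onI[OF continuous_on_prim[OF assms]])
  from measurable_compose[OF id_measurable_unit_leb this] show ?thesis .
qed

text \<open>Integration by parts without derivatives: the order of integration is exchanged over the
  triangle \<open>y < x\<close>.\<close>

lemma prim_inner_fubini:
  assumes g: "integrable U g" and h: "integrable U h"
  shows "(LINT x|U. prim g x \<bullet> h x) = (LINT y|U. g y \<bullet> (prim h 1 - prim h y))"
proof -
  interpret P: pair_sigma_finite U U ..
  have [measurable]: "g \<in> borel_measurable U" "h \<in> borel_measurable U" using g h by auto
  let ?F = "\<lambda>(x, y). indicator {..<x} y * (g y \<bullet> h x)"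
  have meas: "?F \<in> borel_measurable (U \<Otimes>\<^sub>M U)"
  proof -
    have "(\<lambda>p. if snd p < fst p then g (snd p) \<bullet> h (fst p) else 0) \<in> borel_measurable (U \<Otimes>\<^sub>M U)"
      by measurable
    thus ?thesis by (rule measurable_cong[THEN iffD1, rotated]) auto
  qed
  have int: "integrable (U \<Otimes>\<^sub>M U) ?F"
  proof (rule P.Fubini_integrable[OF meas])
    have "integrable U (\<lambda>x. (LINT y|U. norm (g y)) * norm (h x))" using h by simp
    thus "integrable U (\<lambda>x. LINT y|U. norm (?F (x, y)))"
    proof (rule Bochner_Integration.integrable_bound)
      show "(\<lambda>x. LINT y|U. norm (?F (x, y))) \<in> borel_measurable U" using meas by measurable
      have le: "(LINT y|U. norm (?F (x, y))) \<le> (LINT y|U. norm (g y) * norm (h x))" for x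
      proof (rule integral_mono')
        show "integrable U (\<lambda>y. norm (g y) * norm (h x))" using g by simp
        show "norm (?F (x, y)) \<le> norm (g y) * norm (h x)" for y
          using Cauchy_Schwarz_ineq2[of "g y" "h x"] by (auto simp: indicator_def)
      qed simp
      show "AE x in U. norm (LINT y|U. norm (?F (x, y))) \<le> norm ((LINT y|U. norm (g y)) * norm (h x))"
        using le by (intro AE_I2) simp
    qed
    show "AE x in U. integrable U (\<lambda>y. ?F (x, y))"
    proof (rule AE_I2)
      fix x
      have "integrable U (\<lambda>y. (indicator {..<x} y *\<^sub>R g y) \<bullet> h x)"
        using integrable_indicator_unit[OF g, of "{..<x}"] by (intro integrable_inner_left) auto
      thus "integrable U (\<lambda>y. ?F (x, y))" by simp
    qed
  qed
  have "(LINT x|U. prim g x \<bullet> h x) = (LINT x|U. LINT y|U. ?F (x, y))"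
  proof (rule Bochner_Integration.integral_cong[OF refl])
    fix x
    have "prim g x \<bullet> h x = (LINT y|U. (indicator {..<x} y *\<^sub>R g y) \<bullet> h x)"
      unfolding prim_def using integrable_indicator_unit[OF g, of "{..<x}"] by (intro integral_inner_left[symmetric]) auto
    thus "prim g x \<bullet> h x = (LINT y|U. ?F (x, y))" by simp
  qed
  also have "\<dots> = (LINT y|U. LINT x|U. ?F (x, y))" using P.Fubini_integral[of "\<lambda>x y. ?F (x, y)"] int by simp
  also have "\<dots> = (LINT y|U. g y \<bullet> (prim h 1 - prim h y))"
  proof (rule Bochner_Integration.integral_cong[OF refl])
    fix y assume "y \<in> space U"
    hence y: "y < 1" by simp
    have "(LINT x|U. ?F (x, y)) = (LINT x|U. g y \<bullet> (indicator {y..<1} x *\<^sub>R h x))"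
    proof (rule integral_cong_AE)
      show "AE x in U. ?F (x, y) = g y \<bullet> (indicator {y..<1} x *\<^sub>R h x)" using AE_unit_leb_neq[of y] AE_space
        by eventually_elim (auto simp: indicator_def)
      show "(\<lambda>x. ?F (x, y)) \<in> borel_measurable U"
      proof -
        have "(\<lambda>x. if y < x then g y \<bullet> h x else 0) \<in> borel_measurable U" by measurable
        thus ?thesis by (rule measurable_cong[THEN iffD1, rotated]) auto
      qed
    qed measurable
    also have "\<dots> = g y \<bullet> (LINT x|U. indicator {y..<1} x *\<^sub>R h x)"
      using integrable_indicator_unit[OF h, of "{y..<1}"] by (intro integral_inner_right) auto
    also have "(LINT x|U. indicator {y..<1} x *\<^sub>R h x) = prim h 1 - prim h y" using prim_diff_eq[OF h, of y 1] y by simp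
    finally show "(LINT x|U. ?F (x, y)) = g y \<bullet> (prim h 1 - prim h y)" .
  qed
  finally show ?thesis .
qed

lemma continuous_AE_eq_imp_eq:
  fixes f g :: "real \<Rightarrow> complex"
  assumes f: "continuous_on {0..1} f" and g: "continuous_on {0..1} g"
    and ae: "AE x in U. f x = g x" and y: "0 \<le> y" "y \<le> 1"
  shows "f y = g y"
proof -
  let ?C = "{x \<in> {0..1}. f x - g x = 0}"
  have cl: "closed ?C" using continuous_closed_preimage_constant[OF continuous_on_diff[OF f g], of 0] by simp
  have "AE x in lebesgue. x \<in> {0<..<1} \<longrightarrow> f x = g x" using ae by (simp add: AE_restrict_space_iff)
  hence "AE x in lebesgue. x \<in> {0<..<1} \<longrightarrow> x \<in> ?C" by eventually_elim auto
  hence "{0<..<1} \<subseteq> ?C" using mem_closed_if_AE_lebesgue_open[OF _ cl, of "{0<..<1}"] by auto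
  hence "closure {0<..<1} \<subseteq> ?C" using cl by (rule closure_minimal)
  thus ?thesis using y by auto
qed

lemma L2_dense_induct:
  assumes step: "\<And>q b. P (L2_step q b)" and add: "\<And>F G. P F \<Longrightarrow> P G \<Longrightarrow> P (F + G)"
    and scale: "\<And>r F. P F \<Longrightarrow> P (r *\<^sub>R F)" and zero: "P 0" and cl: "closed {F. P F}"
  shows "P F"
proof -
  have "P (sum_list (map (\<lambda>(p, q, b). of_rat p *\<^sub>R L2_step q b) l))" for l :: "(rat \<times> rat \<times> bool) list"
    by (induction l) (auto intro: zero add scale step)
  hence "L2_dense \<subseteq> {F. P F}" by (auto simp: L2_dense_def)
  hence "closure L2_dense \<subseteq> {F. P F}" using cl by (rule closure_minimal)
  thus ?thesis by (auto simp: closure_L2_dense)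
qed

text \<open>Pairing with an initial step function evaluates the primitive at its endpoint, and such
  step functions span a dense set.\<close>

lemma L2_eq_0_of_prim:
  assumes "\<And>x. 0 \<le> x \<Longrightarrow> x \<le> 1 \<Longrightarrow> prim (rep_L2 F) x = 0"
  shows "F = 0"
proof -
  have step: "inner F (L2_step q b) = 0" for q b
  proof -
    let ?x = "max 0 (min 1 (of_rat q))"
    have sq: "sq_integrable (\<lambda>x. indicator {..<of_rat q} x *\<^sub>R (if b then 1 else \<i>))"
      by (intro sq_integrable_indicator sets_unit_leb_borel) simp
    have "inner F (L2_step q b) = (LINT x|U. rep_L2 F x \<bullet> (indicator {..<of_rat q} x *\<^sub>R (if b then 1 else \<i>)))"
      using inner_L2_of[OF sq_integrable_rep sq, of F] by (simp add: L2_step_def L2_of_rep)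
    also have "\<dots> = (LINT x|U. (indicator {..<?x} x *\<^sub>R rep_L2 F x) \<bullet> (if b then 1 else \<i>))"
      by (rule Bochner_Integration.integral_cong) (auto simp: indicator_def)
    also have "\<dots> = prim (rep_L2 F) ?x \<bullet> (if b then 1 else \<i>)"
      unfolding prim_def using integrable_indicator_unit[OF rep_L2_integrable, of "{..<?x}" F] by (intro integral_inner_left) auto
    finally show ?thesis using assms[of ?x] by simp
  qed
  have "inner F F = 0" by (rule L2_dense_induct[where P = "\<lambda>G. inner F G = 0"])
      (auto simp: step inner_add_right intro!: closed_Collect_eq continuous_intros)
  thus ?thesis by simp
qed

lemma integral_unit_leb_const [simp]: "(LINT x|U. (c::'b::{banach, second_countable_topology})) = c" by (simp add: unit_leb_measure)

section \<open>The explicit solution operator\<close>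

text \<open>The equation \<open>- (c z')' = F\<close> is integrated by hand: the flux
  \<open>c z'\<close> is a constant minus the primitive of \<open>F\<close>, and
  \<open>z 1 = 0\<close> forces the constant to be this average of the primitive with weight
  \<open>1 / c\<close>.\<close>

definition mean_flux :: "(real \<Rightarrow> real) \<Rightarrow> L2 \<Rightarrow> complex" where
  "mean_flux c F = (LINT y|U. inverse (c y) *\<^sub>R prim (rep_L2 F) y) /\<^sub>R (LINT y|U. inverse (c y))"

definition flux :: "(real \<Rightarrow> real) \<Rightarrow> L2 \<Rightarrow> real \<Rightarrow> complex" where
  "flux c F x = mean_flux c F - prim (rep_L2 F) x"

text \<open>The coefficient enters only as \<open>1 / c\<close> under integrals; for this reason
  weak convergence of the inverse coefficients will suffice for homogenization.\<close>

definition sol :: "(real \<Rightarrow> real) \<Rightarrow> L2 \<Rightarrow> real \<Rightarrow> complex" where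
  "sol c F x = prim (\<lambda>y. inverse (c y) *\<^sub>R flux c F y) x"

definition inv_op :: "(real \<Rightarrow> real) \<Rightarrow> L2 \<Rightarrow> L2" where
  "inv_op c F = L2_of (sol c F)"

lemma norm_prim_rep_le: "norm (prim (rep_L2 F) x) \<le> norm F" by (rule order_trans[OF norm_prim_le integral_norm_rep_le]) simp

lemma prim_rep_add: "prim (rep_L2 (F + G)) x = prim (rep_L2 F) x + prim (rep_L2 G) x"
  by (subst prim_cong[OF rep_L2_add]) (auto simp: prim_add)

lemma prim_rep_scaleR: "prim (rep_L2 (r *\<^sub>R F)) x = r *\<^sub>R prim (rep_L2 F) x"
  by (subst prim_cong[OF rep_L2_scaleR]) (auto simp: prim_scaleR)

lemma integral_indicator_unit_leb:
  fixes x y :: real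
  assumes "x \<le> y"
  shows "(LINT s|U. indicator {x..<y} s :: real) \<le> y - x"
proof -
  have "(LINT s|U. indicator {x..<y} s :: real) = measure U ({x..<y} \<inter> {0<..<1})" by (simp add: Int_commute)
  also have "\<dots> = measure lebesgue ({x..<y} \<inter> {0<..<1})" by (subst measure_restrict_space) auto
  also have "\<dots> \<le> measure lebesgue {x..y}" by (rule measure_mono_fmeasurable) auto
  also have "\<dots> = y - x" using assms by simp
  finally show ?thesis .
qed

locale coefficient =
  fixes c :: "real \<Rightarrow> real" and K :: real
  assumes c_measurable [measurable]: "c \<in> borel_measurable U"
    and K: "1 \<le> K" and c_bounds: "AE x in U. 1 / K \<le> c x \<and> c x \<le> K"
begin

lemma inverse_c_bounds: "AE x in U. 1 / K \<le> inverse (c x) \<and> inverse (c x) \<le> K"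
  using c_bounds
proof eventually_elim
  case (elim x)
  have "0 < 1 / K" using K by simp
  hence "c x > 0" using elim by linarith
  thus ?case using elim K by (auto simp: field_simps)
qed

lemma inverse_c_pos: "AE x in U. 0 < inverse (c x)"
  using inverse_c_bounds
proof eventually_elim
  case (elim x)
  moreover have "0 < 1 / K" using K by simp
  ultimately show ?case by linarith
qed

lemma inverse_c_nonneg: "AE x in U. 0 \<le> inverse (c x)"
  using inverse_c_pos by eventually_elim (rule less_imp_le)

lemma inverse_c_integrable: "integrable U (\<lambda>x. inverse (c x))"
proof (rule unit_leb.integrable_const_bound[where B = K])
  show "AE x in U. norm (inverse (c x)) \<le> K"
    using inverse_c_bounds inverse_c_nonneg by eventually_elim (simp only: real_norm_def abs_of_nonneg)
qed measurable

lemma integral_inverse_c_pos: "0 < (LINT x|U. inverse (c x))"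
proof -
  have "(LINT x|U. 1 / K) \<le> (LINT x|U. inverse (c x))" using inverse_c_bounds by (intro integral_mono_AE inverse_c_integrable) auto
  moreover have "(LINT x|U. 1 / K) = 1 / K" by (rule integral_unit_leb_const)
  moreover have "0 < 1 / K" using K by simp
  ultimately show ?thesis by linarith
qed

lemma integrable_inverse_c_scaleR:
  fixes f :: "real \<Rightarrow> 'b::{banach, second_countable_topology}"
  assumes f: "f \<in> borel_measurable U" and b: "\<And>x. x \<in> {0<..<1} \<Longrightarrow> norm (f x) \<le> C"
  shows "integrable U (\<lambda>x. inverse (c x) *\<^sub>R f x)"
    and "AE x in U. norm (inverse (c x) *\<^sub>R f x) \<le> K * norm (f x)"
    and "norm (LINT x|U. inverse (c x) *\<^sub>R f x) \<le> (LINT x|U. inverse (c x)) * C"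
proof -
  note [measurable] = f
  have eq: "AE x in U. norm (inverse (c x) *\<^sub>R f x) = inverse (c x) * norm (f x)"
    using inverse_c_nonneg by eventually_elim (simp only: norm_scaleR abs_of_nonneg)
  show "AE x in U. norm (inverse (c x) *\<^sub>R f x) \<le> K * norm (f x)" using eq inverse_c_bounds
  proof eventually_elim
    case (elim x)
    thus ?case unfolding elim(1) by (intro mult_right_mono) auto
  qed
  have b2: "AE x in U. norm (inverse (c x) *\<^sub>R f x) \<le> inverse (c x) * C" using eq inverse_c_nonneg AE_space
  proof eventually_elim
    case (elim x)
    thus ?case unfolding elim(1) by (intro mult_left_mono b) auto
  qed
  show i: "integrable U (\<lambda>x. inverse (c x) *\<^sub>R f x)"
  proof (rule Bochner_Integration.integrable_bound)
    show "integrable U (\<lambda>x. inverse (c x) * C)" using inverse_c_integrable by simp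
    show "AE x in U. norm (inverse (c x) *\<^sub>R f x) \<le> norm (inverse (c x) * C)"
      using b2 by eventually_elim (metis abs_ge_self order_trans real_norm_def)
  qed measurable
  have "norm (LINT x|U. inverse (c x) *\<^sub>R f x) \<le> (LINT x|U. norm (inverse (c x) *\<^sub>R f x))"
    by (rule integral_norm_bound)
  also have "\<dots> \<le> (LINT x|U. inverse (c x) * C)"
    using b2 inverse_c_integrable i by (intro integral_mono_AE integrable_norm) auto
  finally show "norm (LINT x|U. inverse (c x) *\<^sub>R f x) \<le> (LINT x|U. inverse (c x)) * C" by simp
qed

lemma prim_rep_measurable: "prim (rep_L2 F) \<in> borel_measurable U" by (rule borel_measurable_prim) simp

lemma norm_mean_flux_le: "norm (mean_flux c F) \<le> norm F"
proof -
  have "norm (LINT x|U. inverse (c x) *\<^sub>R prim (rep_L2 F) x) \<le> (LINT x|U. inverse (c x)) * norm F"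
    by (rule integrable_inverse_c_scaleR(3)[OF prim_rep_measurable norm_prim_rep_le])
  thus ?thesis using integral_inverse_c_pos by (simp add: mean_flux_def divide_inverse_commute[symmetric] field_simps)
qed

lemma norm_flux_le: "norm (flux c F x) \<le> 2 * norm F"
  using norm_triangle_ineq4[of "mean_flux c F" "prim (rep_L2 F) x"] norm_mean_flux_le[of F] norm_prim_rep_le[of F x]
  by (simp add: flux_def)

lemma continuous_on_flux: "continuous_on A (flux c F)"
  unfolding flux_def[abs_def] by (intro continuous_intros continuous_on_prim) simp

lemma flux_measurable [measurable]: "flux c F \<in> borel_measurable U"
proof -
  have [measurable]: "prim (rep_L2 F) \<in> borel_measurable U" by (rule prim_rep_measurable)
  show ?thesis unfolding flux_def[abs_def] by measurable
qed

lemma flux_integrable: "integrable U (\<lambda>y. inverse (c y) *\<^sub>R flux c F y)"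
  by (rule integrable_inverse_c_scaleR(1)[OF flux_measurable norm_flux_le])

lemma integral_flux_eq_0: "(LINT y|U. inverse (c y) *\<^sub>R flux c F y) = 0"
proof -
  have i: "integrable U (\<lambda>y. inverse (c y) *\<^sub>R prim (rep_L2 F) y)"
    by (rule integrable_inverse_c_scaleR(1)[OF prim_rep_measurable norm_prim_rep_le])
  have "(LINT y|U. inverse (c y) *\<^sub>R flux c F y) =
      (LINT y|U. inverse (c y) *\<^sub>R mean_flux c F) - (LINT y|U. inverse (c y) *\<^sub>R prim (rep_L2 F) y)"
    unfolding flux_def scaleR_diff_right by (intro Bochner_Integration.integral_diff i integrable_scaleR_left inverse_c_integrable)
  also have "(LINT y|U. inverse (c y) *\<^sub>R mean_flux c F) = (LINT y|U. inverse (c y)) *\<^sub>R mean_flux c F"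
    using inverse_c_integrable by (intro integral_scaleR_left)
  finally show ?thesis using integral_inverse_c_pos by (simp add: mean_flux_def)
qed

lemma sol_0 [simp]: "sol c F 0 = 0" by (simp add: sol_def)

lemma sol_1 [simp]: "sol c F 1 = 0" by (simp add: sol_def prim_1 integral_flux_eq_0)

lemma continuous_on_sol: "continuous_on A (sol c F)"
  unfolding sol_def[abs_def] by (intro continuous_on_prim flux_integrable)

lemma sol_measurable [measurable]: "sol c F \<in> borel_measurable U"
  unfolding sol_def[abs_def] by (intro borel_measurable_prim flux_integrable)

lemma flux_norm_integrable: "integrable U (\<lambda>s. indicator {x..<y} s * norm (flux c F s))"
  by (rule unit_leb.integrable_const_bound[where B = "2 * norm F"]) (auto simp: indicator_def norm_flux_le)

lemma norm_sol_diff_le: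
  assumes "x \<le> y"
  shows "norm (sol c F y - sol c F x) \<le> K * (LINT s|U. indicator {x..<y} s * norm (flux c F s))"
proof -
  have "norm (sol c F y - sol c F x) \<le> (LINT s|U. indicator {x..<y} s * norm (inverse (c s) *\<^sub>R flux c F s))"
    unfolding sol_def by (rule norm_prim_diff_le[OF flux_integrable assms])
  also have "\<dots> \<le> (LINT s|U. K * (indicator {x..<y} s * norm (flux c F s)))"
  proof (rule integral_mono_AE)
    have "integrable U (\<lambda>s. indicator {x..<y} s *\<^sub>R norm (inverse (c s) *\<^sub>R flux c F s))"
      by (intro integrable_indicator_unit integrable_norm flux_integrable) simp
    thus "integrable U (\<lambda>s. indicator {x..<y} s * norm (inverse (c s) *\<^sub>R flux c F s))" by simp
    show "integrable U (\<lambda>s. K * (indicator {x..<y} s * norm (flux c F s)))"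
      by (intro integrable_mult_right flux_norm_integrable)
    show "AE s in U. indicator {x..<y} s * norm (inverse (c s) *\<^sub>R flux c F s) \<le> K * (indicator {x..<y} s * norm (flux c F s))"
      using integrable_inverse_c_scaleR(2)[of "flux c F", OF flux_measurable norm_flux_le]
      by eventually_elim (auto simp: indicator_def)
  qed
  finally show ?thesis by simp
qed

lemma norm_sol_lipschitz:
  assumes "x \<le> y"
  shows "norm (sol c F y - sol c F x) \<le> 2 * K * norm F * (y - x)"
proof -
  have "(LINT s|U. indicator {x..<y} s * norm (flux c F s)) \<le> (LINT s|U. indicator {x..<y} s * (2 * norm F))"
  proof (intro integral_mono flux_norm_integrable)
    show "integrable U (\<lambda>s. indicator {x..<y} s * (2 * norm F))"
      using integrable_indicator_unit[of "\<lambda>_. 2 * norm F" "{x..<y}"] by simp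
  qed (auto simp: indicator_def norm_flux_le)
  also have "\<dots> = (LINT s|U. indicator {x..<y} s) * (2 * norm F)" by simp
  also have "\<dots> \<le> (y - x) * (2 * norm F)" by (intro mult_right_mono integral_indicator_unit_leb assms) simp
  finally have "K * (LINT s|U. indicator {x..<y} s * norm (flux c F s)) \<le> K * ((y - x) * (2 * norm F))"
    using K by (intro mult_left_mono) auto
  thus ?thesis using norm_sol_diff_le[OF assms, of F] by (simp add: mult_ac)
qed

lemma norm_sol_le: "0 \<le> x \<Longrightarrow> x \<le> 1 \<Longrightarrow> norm (sol c F x) \<le> 2 * K * norm F"
proof -
  assume x: "0 \<le> x" "x \<le> 1"
  have "norm (sol c F x) \<le> 2 * K * norm F * x" using norm_sol_lipschitz[OF x(1), of F] by simp
  also have "\<dots> \<le> 2 * K * norm F * 1" using K x by (intro mult_left_mono) auto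
  finally show ?thesis by simp
qed

lemma sq_integrable_sol: "sq_integrable (sol c F)" by (rule sq_integrable_bounded[OF sol_measurable norm_sol_le]) auto

lemma norm_inv_op_le: "norm (inv_op c F) \<le> 2 * K * norm F"
  unfolding inv_op_def using norm_sol_le K by (intro norm_L2_of_bounded_le(2) sol_measurable AE_I2) auto

lemma mean_flux_add: "mean_flux c (F + G) = mean_flux c F + mean_flux c G"
  unfolding mean_flux_def prim_rep_add scaleR_add_right by (subst Bochner_Integration.integral_add)
    (auto simp: scaleR_add_right intro!: integrable_inverse_c_scaleR(1)[OF prim_rep_measurable norm_prim_rep_le])

lemma mean_flux_scaleR: "mean_flux c (r *\<^sub>R F) = r *\<^sub>R mean_flux c F"
  unfolding mean_flux_def prim_rep_scaleR scaleR_left_commute[of _ r] by (subst integral_scaleR_right)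
    (auto simp: scaleR_left_commute[of _ r] intro!: integrable_inverse_c_scaleR(1)[OF prim_rep_measurable norm_prim_rep_le])

lemma flux_add: "flux c (F + G) x = flux c F x + flux c G x" by (simp add: flux_def mean_flux_add prim_rep_add)

lemma flux_scaleR: "flux c (r *\<^sub>R F) x = r *\<^sub>R flux c F x"
  by (simp add: flux_def mean_flux_scaleR prim_rep_scaleR scaleR_diff_right)

lemma sol_add: "sol c (F + G) x = sol c F x + sol c G x"
  unfolding sol_def flux_add scaleR_add_right by (rule prim_add[OF flux_integrable flux_integrable])

lemma sol_scaleR: "sol c (r *\<^sub>R F) x = r *\<^sub>R sol c F x"
  unfolding sol_def flux_scaleR scaleR_left_commute[of _ r] by (rule prim_scaleR[OF flux_integrable])

lemma inv_op_add: "inv_op c (F + G) = inv_op c F + inv_op c G"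
  unfolding inv_op_def sol_add[abs_def] by (rule L2_of_add[OF sq_integrable_sol sq_integrable_sol])

lemma inv_op_scaleR: "inv_op c (r *\<^sub>R F) = r *\<^sub>R inv_op c F"
  unfolding inv_op_def sol_scaleR[abs_def] by (rule L2_of_scaleR[OF sq_integrable_sol])

lemma inverse_c_flux_integrable: "integrable U (\<lambda>y. inverse (c y) * (flux c F y \<bullet> flux c G y))"
proof -
  have "\<bar>flux c F x \<bullet> flux c G x\<bar> \<le> 2 * norm F * (2 * norm G)" for x
    by (rule order_trans[OF Cauchy_Schwarz_ineq2]) (intro mult_mono norm_flux_le; simp)
  thus ?thesis
    using integrable_inverse_c_scaleR(1)[of "\<lambda>y. flux c F y \<bullet> flux c G y" "2 * norm F * (2 * norm G)"] by simp
qed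

text \<open>The weighted mean of the flux vanishes, so Fubini's theorem turns the bilinear form of the
  solution operator into the weighted product of the fluxes.\<close>

lemma inner_inv_op: "inner (inv_op c F) G = (LINT y|U. inverse (c y) * (flux c F y \<bullet> flux c G y))"
proof -
  let ?q = "\<lambda>y. inverse (c y) *\<^sub>R flux c F y"
  have "inner (inv_op c F) G = (LINT x|U. sol c F x \<bullet> rep_L2 G x)"
    unfolding inv_op_def using inner_L2_of[OF sq_integrable_sol sq_integrable_rep, of F G] by (simp add: L2_of_rep)
  also have "\<dots> = (LINT y|U. ?q y \<bullet> (prim (rep_L2 G) 1 - prim (rep_L2 G) y))"
    unfolding sol_def[abs_def] by (rule prim_inner_fubini[OF flux_integrable rep_L2_integrable])
  also have "\<dots> = (LINT y|U. ?q y \<bullet> (prim (rep_L2 G) 1 - mean_flux c G) + inverse (c y) * (flux c F y \<bullet> flux c G y))"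
    by (rule Bochner_Integration.integral_cong) (auto simp: flux_def[of c G] inner_diff_right algebra_simps)
  also have "\<dots> = (LINT y|U. ?q y \<bullet> (prim (rep_L2 G) 1 - mean_flux c G)) + (LINT y|U. inverse (c y) * (flux c F y \<bullet> flux c G y))"
    by (intro Bochner_Integration.integral_add inverse_c_flux_integrable integrable_inner_left flux_integrable)
  also have "(LINT y|U. ?q y \<bullet> (prim (rep_L2 G) 1 - mean_flux c G)) = (LINT y|U. ?q y) \<bullet> (prim (rep_L2 G) 1 - mean_flux c G)"
    using flux_integrable by (rule integral_inner_left)
  finally show ?thesis by (simp add: integral_flux_eq_0)
qed

text \<open>Zero energy makes the continuous flux vanish identically. Its value at \<open>0\<close>
  is the constant of integration, so the primitive of \<open>F\<close> vanishes too.\<close>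

lemma inv_op_eq_0:
  assumes "inv_op c F = 0"
  shows "F = 0"
proof (rule L2_eq_0_of_prim)
  have "(LINT y|U. inverse (c y) * (flux c F y \<bullet> flux c F y)) = 0" using inner_inv_op[of F F] assms by simp
  moreover have "AE y in U. 0 \<le> inverse (c y) * (flux c F y \<bullet> flux c F y)"
    using inverse_c_nonneg by eventually_elim (simp del: inverse_nonnegative_iff_nonnegative)
  ultimately have "AE y in U. inverse (c y) * (flux c F y \<bullet> flux c F y) = 0"
    using inverse_c_flux_integrable[of F F] by (simp add: integral_nonneg_eq_0_iff_AE)
  hence ae: "AE y in U. flux c F y = 0" using inverse_c_pos by eventually_elim auto
  have flux0: "flux c F y = 0" if "0 \<le> y" "y \<le> 1" for y
    using continuous_AE_eq_imp_eq[OF continuous_on_flux continuous_on_const ae that] .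
  hence "mean_flux c F = 0" using flux0[of 0] by (simp add: flux_def)
  thus "prim (rep_L2 F) x = 0" if "0 \<le> x" "x \<le> 1" for x using flux0[OF that] by (simp add: flux_def)
qed

text \<open>The interval \<open>[0, 4 * K]\<close> depends on \<open>K\<close> alone, so all
  coefficients with the same bounds share one functional calculus, as \<open>tendsto_cfc\<close>
  demands.\<close>

sublocale injective_positive_operator "inv_op c" "4 * K"
proof (intro injective_positive_operator.intro positive_operator.intro injective_positive_operator_axioms.intro)
  show "bounded_linear (inv_op c)"
  proof (rule bounded_linear_intro[of _ "2 * K"])
    show "norm (inv_op c F) \<le> norm F * (2 * K)" for F using norm_inv_op_le[of F] by (simp add: mult.commute)
  qed (rule inv_op_add, rule inv_op_scaleR)
  show "inner (inv_op c F) G = inner F (inv_op c G)" for F G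
    by (subst (2) inner_commute) (simp add: inner_inv_op inner_commute[of "flux c F y" "flux c G y" for y])
  show "0 \<le> inner (inv_op c F) F" for F unfolding inner_inv_op using inverse_c_nonneg
    by (intro integral_nonneg_AE) (auto elim!: eventually_mono simp del: inverse_nonnegative_iff_nonnegative)
  show "inner (inv_op c F) F \<le> 4 * K * (norm F)^2" for F
  proof -
    have "inner (inv_op c F) F \<le> norm (inv_op c F) * norm F" by (rule norm_cauchy_schwarz)
    also have "\<dots> \<le> (2 * K * norm F) * norm F" by (intro mult_right_mono norm_inv_op_le) simp
    also have "\<dots> \<le> 4 * K * (norm F)^2" using K by (simp add: power2_eq_square mult_right_mono)
    finally show ?thesis .
  qed
  show "0 < 4 * K" using K by simp
  show "inv_op c F = 0 \<Longrightarrow> F = 0" for F by (rule inv_op_eq_0)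
qed

end

section \<open>Sideways Cauchy problem and observability\<close>

lemma power_abs_diff_has_integral:
  fixes K x x0 :: real
  shows "((\<lambda>s. (K * \<bar>s - x0\<bar>) ^ i / fact i) has_integral K ^ i * \<bar>x - x0\<bar> ^ Suc i / fact (Suc i)) {min x0 x..max x0 x}"
proof (cases "x0 \<le> x")
  case True
  have "((\<lambda>s. K ^ i * (s - x0) ^ i / fact i) has_integral
      (K ^ i * (x - x0) ^ Suc i / fact (Suc i) - K ^ i * (x0 - x0) ^ Suc i / fact (Suc i))) {x0..x}"
  proof (rule fundamental_theorem_of_calculus[OF True])
    fix s
    have "((\<lambda>s. K ^ i * (s - x0) ^ Suc i / fact (Suc i)) has_real_derivative
        K ^ i * (real (Suc i) * (s - x0) ^ i) / fact (Suc i)) (at s within {x0..x})" by (rule derivative_eq_intros | simp)+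
    moreover have "K ^ i * (real (Suc i) * (s - x0) ^ i) / fact (Suc i) = K ^ i * (s - x0) ^ i / fact i" by (simp add: divide_simps)
    ultimately show "((\<lambda>s. K ^ i * (s - x0) ^ Suc i / fact (Suc i)) has_vector_derivative K ^ i * (s - x0) ^ i / fact i) (at s within {x0..x})"
      by (simp add: has_real_derivative_iff_has_vector_derivative)
  qed
  hence "((\<lambda>s. K ^ i * (s - x0) ^ i / fact i) has_integral K ^ i * \<bar>x - x0\<bar> ^ Suc i / fact (Suc i)) {x0..x}"
    using True by simp
  thus ?thesis using True by (simp add: min_def max_def del: fact_Suc power_Suc)
      (erule has_integral_eq[rotated], simp add: power_mult_distrib)
next
  case False
  hence le: "x \<le> x0" by simp
  have "((\<lambda>s. K ^ i * (x0 - s) ^ i / fact i) has_integral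
      (- (K ^ i * (x0 - x0) ^ Suc i / fact (Suc i)) - - (K ^ i * (x0 - x) ^ Suc i / fact (Suc i)))) {x..x0}"
  proof (rule fundamental_theorem_of_calculus[OF le])
    fix s
    have "((\<lambda>s. - (K ^ i * (x0 - s) ^ Suc i / fact (Suc i))) has_real_derivative
        K ^ i * (real (Suc i) * (x0 - s) ^ i) / fact (Suc i)) (at s within {x..x0})" by (rule derivative_eq_intros | simp)+
    moreover have "K ^ i * (real (Suc i) * (x0 - s) ^ i) / fact (Suc i) = K ^ i * (x0 - s) ^ i / fact i" by (simp add: divide_simps)
    ultimately show "((\<lambda>s. - (K ^ i * (x0 - s) ^ Suc i / fact (Suc i))) has_vector_derivative K ^ i * (x0 - s) ^ i / fact i) (at s within {x..x0})"
      by (simp add: has_real_derivative_iff_has_vector_derivative)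
  qed
  hence "((\<lambda>s. K ^ i * (x0 - s) ^ i / fact i) has_integral K ^ i * \<bar>x - x0\<bar> ^ Suc i / fact (Suc i)) {x..x0}"
    using le by (simp add: abs_minus_commute)
  thus ?thesis using False by (simp add: min_def max_def del: fact_Suc power_Suc)
      (erule has_integral_eq[rotated], simp add: power_mult_distrib abs_minus_commute)
qed

text \<open>The even members of \<open>f\<close> will be the time derivatives of a solution and the odd members their
  fluxes, so that the Cauchy data at \<open>x0\<close> control the solution everywhere.\<close>

lemma sideways_bound:
  fixes f :: "nat \<Rightarrow> real \<Rightarrow> complex"
  assumes K: "K \<ge> 0" and cont: "\<And>j. continuous_on {0..1} (f j)"
    and step: "\<And>j x y. 0 \<le> x \<Longrightarrow> x \<le> y \<Longrightarrow> y \<le> 1 \<Longrightarrow>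
        norm (f j y - f j x) \<le> K * integral {x..y} (\<lambda>s. norm (f (Suc j) s))"
    and bound: "\<And>j x. 0 \<le> x \<Longrightarrow> x \<le> 1 \<Longrightarrow> norm (f j x) \<le> Y j"
    and x0: "0 \<le> x0" "x0 \<le> 1" and x: "0 \<le> x" "x \<le> 1"
  shows "norm (f j x) \<le> (\<Sum>i<N. norm (f (j + i) x0) * ((K * \<bar>x - x0\<bar>) ^ i / fact i))
      + Y (j + N) * ((K * \<bar>x - x0\<bar>) ^ N / fact N)" using x
proof (induction N arbitrary: j x)
  case 0
  thus ?case using bound by simp
next
  case (Suc N)
  let ?I = "{min x0 x..max x0 x}"
  let ?g = "\<lambda>s. (\<Sum>i<N. norm (f (Suc j + i) x0) * ((K * \<bar>s - x0\<bar>) ^ i / fact i)) + Y (Suc j + N) * ((K * \<bar>s - x0\<bar>) ^ N / fact N)"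
  have sub: "?I \<subseteq> {0..1}" using x0 Suc.prems by auto
  have "norm (f j x - f j x0) \<le> K * integral ?I (\<lambda>s. norm (f (Suc j) s))"
    using step[of x0 x j] step[of x x0 j] x0 Suc.prems by (cases "x0 \<le> x") (simp_all add: min_def max_def norm_minus_commute)
  also have "\<dots> \<le> K * ((\<Sum>i<N. norm (f (Suc j + i) x0) * (K ^ i * \<bar>x - x0\<bar> ^ Suc i / fact (Suc i)))
      + Y (Suc j + N) * (K ^ N * \<bar>x - x0\<bar> ^ Suc N / fact (Suc N)))"
  proof (rule mult_left_mono[OF _ K], rule has_integral_le)
    show "((\<lambda>s. norm (f (Suc j) s)) has_integral integral ?I (\<lambda>s. norm (f (Suc j) s))) ?I"
      by (intro integrable_integral integrable_continuous_interval continuous_intros continuous_on_subset[OF cont sub])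
    show "(?g has_integral ((\<Sum>i<N. norm (f (Suc j + i) x0) * (K ^ i * \<bar>x - x0\<bar> ^ Suc i / fact (Suc i)))
      + Y (Suc j + N) * (K ^ N * \<bar>x - x0\<bar> ^ Suc N / fact (Suc N)))) ?I"
      by (intro has_integral_add has_integral_sum has_integral_mult_right power_abs_diff_has_integral) simp
    show "norm (f (Suc j) s) \<le> ?g s" if "s \<in> ?I" for s using Suc.IH[of s "Suc j"] that sub by auto
  qed
  also have "\<dots> = (\<Sum>i<N. norm (f (Suc j + i) x0) * ((K * \<bar>x - x0\<bar>) ^ Suc i / fact (Suc i)))
      + Y (Suc j + N) * ((K * \<bar>x - x0\<bar>) ^ Suc N / fact (Suc N))"
    by (simp add: distrib_left sum_distrib_left power_mult_distrib mult_ac del: fact_Suc)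
  finally have "norm (f j x) \<le> norm (f j x0) + (\<Sum>i<N. norm (f (Suc j + i) x0) * ((K * \<bar>x - x0\<bar>) ^ Suc i / fact (Suc i)))
      + Y (Suc j + N) * ((K * \<bar>x - x0\<bar>) ^ Suc N / fact (Suc N))" using norm_triangle_sub[of "f j x" "f j x0"] by linarith
  thus ?case by (subst sum.lessThan_Suc_shift) (simp del: fact_Suc power_Suc)
qed

text \<open>Two steps in \<open>x\<close> cost one time derivative, so a factorial of half the index
  stands against the \<open>j!\<close> of the iterated integrals, and
  \<open>k! / (2 k)! \<le> 1 / k!\<close>. Pairs of terms are thus dominated by an exponential
  series, which gives the cost \<open>exp (C / r)\<close> typical of the heat equation.\<close>

lemma sideways_growth_sum_le:
  fixes K r :: real
  assumes K: "K \<ge> 0" and r: "0 < r"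
  shows "(\<Sum>j<N. fact (j div 2 + 2) / r ^ (j div 2 + 2) * (K ^ j / fact j)) \<le> 2 * (1 + K) / r^2 * exp (3 * K^2 / r)"
proof -
  let ?z = "\<lambda>j. fact (j div 2 + 2) / r ^ (j div 2 + 2) * (K ^ j / fact j)"
  have pos: "?z j \<ge> 0" for j using K r by simp
  have pair: "?z (2 * k) + ?z (Suc (2 * k)) \<le> 2 * (1 + K) / r^2 * ((3 * K^2 / r) ^ k / fact k)" for k
  proof -
    have fk: "fact k * fact k \<le> (fact (2 * k) :: real)"
    proof -
      have "fact k * fact k dvd (fact (k + k) :: nat)" by (rule fact_fact_dvd_fact)
      hence "fact k * fact k \<le> (fact (2 * k) :: nat)" by (intro dvd_imp_le) (auto simp: mult_2)
      thus ?thesis by (metis of_nat_fact of_nat_le_iff of_nat_mult)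
    qed
    \<comment> \<open>The shift by two in the factorial is absorbed into the base, at the price of
      the \<open>3\<close> in the exponent.\<close>
    have k3: "(real k + 1) * (real k + 2) \<le> 2 * 3 ^ k"
    proof (induction k)
      case (Suc k)
      show ?case
      proof (cases "k = 0")
        case False
        hence "2 \<le> 2 * real k * real k" using mult_mono[of 1 "real k" 1 "real k"] by simp
        hence "(real (Suc k) + 1) * (real (Suc k) + 2) \<le> 3 * ((real k + 1) * (real k + 2))"
          using False by (simp add: algebra_simps)
        thus ?thesis using Suc by simp
      qed simp
    qed simp
    let ?P = "fact (k + 2) / r ^ (k + 2)" and ?Q = "K ^ (2 * k) / fact (2 * k)"
    have "?z (Suc (2 * k)) \<le> ?P * (K * ?Q)"
    proof -
      have "K ^ Suc (2 * k) / fact (Suc (2 * k)) \<le> K ^ Suc (2 * k) / fact (2 * k)"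
        using K by (intro divide_left_mono mult_pos_pos fact_mono zero_le_power fact_gt_zero) simp_all
      hence "?P * (K ^ Suc (2 * k) / fact (Suc (2 * k))) \<le> ?P * (K * ?Q)" using r by (intro mult_left_mono) auto
      thus ?thesis by simp
    qed
    moreover have "?z (2 * k) = ?P * ?Q" by simp
    moreover have "(1 + K) * (P * Q) = P * Q + P * (K * Q)" for P Q :: real by (simp add: algebra_simps)
    ultimately have "?z (2 * k) + ?z (Suc (2 * k)) \<le> (1 + K) * (?P * ?Q)" by (simp only:)
    also have "?P * ?Q = ((real k + 1) * (real k + 2)) * (fact k / fact (2 * k)) * ((K^2 / r) ^ k / r^2)"
    proof -
      have "fact (k + 2) = (real k + 1) * (real k + 2) * fact k" by (simp add: algebra_simps)
      thus ?thesis by (simp add: power_divide power_add power_mult power2_eq_square del: fact_Suc)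
    qed
    also have "\<dots> \<le> (2 * 3 ^ k) * (1 / fact k) * ((K^2 / r) ^ k / r^2)"
    proof -
      have "(fact k / fact (2 * k) :: real) \<le> 1 / fact k" using fk by (simp add: field_simps)
      from mult_right_mono[OF mult_mono[OF k3 this], of "(K^2 / r) ^ k / r^2"] show ?thesis using r by simp
    qed
    also have "\<dots> = 2 / r^2 * ((3 * K^2 / r) ^ k / fact k)" by (simp add: power_divide power_mult_distrib mult_ac)
    finally have "?z (2 * k) + ?z (Suc (2 * k)) \<le> (1 + K) * (2 / r^2 * ((3 * K^2 / r) ^ k / fact k))"
      using K by (simp add: mult_left_mono)
    moreover have "(1 + K) * (2 / r^2 * X) = 2 * (1 + K) / r^2 * X" for X by simp
    ultimately show ?thesis by (simp only:)
  qed
  have "(\<Sum>j<N. ?z j) \<le> (\<Sum>j<2 * N. ?z j)" using pos by (intro sum_mono2) auto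
  also have "\<dots> = (\<Sum>k<N. ?z (2 * k) + ?z (Suc (2 * k)))" by (induction N) simp_all
  also have "\<dots> \<le> (\<Sum>k<N. 2 * (1 + K) / r^2 * ((3 * K^2 / r) ^ k / fact k))" by (intro sum_mono pair)
  also have "\<dots> = 2 * (1 + K) / r^2 * (\<Sum>k<N. (3 * K^2 / r) ^ k / fact k)" by (simp add: sum_distrib_left)
  also have "\<dots> \<le> 2 * (1 + K) / r^2 * exp (3 * K^2 / r)"
  proof (rule mult_left_mono)
    have "(\<Sum>k<N. (3 * K^2 / r) ^ k /\<^sub>R fact k) \<le> (\<Sum>k. (3 * K^2 / r) ^ k /\<^sub>R fact k)"
      using K r by (intro sum_le_suminf summable_exp_generic) auto
    thus "(\<Sum>k<N. (3 * K^2 / r) ^ k / fact k) \<le> exp (3 * K^2 / r)" by (simp add: exp_def divide_inverse mult.commute)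
  qed (use K in simp)
  finally show ?thesis .
qed

lemma integral_unit_leb_Icc:
  fixes g :: "real \<Rightarrow> real"
  assumes g: "continuous_on {0..1} g" and xy: "0 \<le> x" "x \<le> y" "y \<le> 1"
  shows "(LINT s|U. indicator {x..<y} s * g s) = integral {x..y} g"
proof -
  have [measurable]: "g \<in> borel_measurable U" by (intro continuous_imp_measurable_on_sets_lebesgue continuous_on_subset[OF g]) auto
  have "bounded (g ` {0..1})" by (intro compact_imp_bounded compact_continuous_image g) simp
  then obtain C where C: "\<And>s. s \<in> {0..1} \<Longrightarrow> norm (g s) \<le> C" unfolding bounded_iff by blast
  have int: "integrable U (\<lambda>s. indicator {x..<y} s * g s)"
  proof (rule unit_leb.integrable_const_bound[where B = C])
    show "AE s in U. norm (indicator {x..<y} s * g s) \<le> C"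
      using C order_trans[OF norm_ge_zero C] by (intro AE_I2) (force simp: indicator_def)
  qed measurable
  have "(LINT s|U. indicator {x..<y} s * g s) = integral {0<..<1} (\<lambda>s. indicator {x..<y} s * g s)"
    using int by (rule lebesgue_integral_eq_integral) simp
  also have "\<dots> = integral UNIV (\<lambda>s. if s \<in> {0<..<1} then indicator {x..<y} s * g s else 0)"
    by (rule integral_restrict_UNIV[symmetric])
  also have "\<dots> = integral UNIV (\<lambda>s. if s \<in> {x..y} then g s else 0)"
    by (rule integral_spike[of "{0, 1, x, y}"]) (use xy in "auto simp: indicator_def")
  also have "\<dots> = integral {x..y} g" by (rule integral_restrict_UNIV)
  finally show ?thesis .
qed

lemma integrable_indicator_mult:
  fixes f :: "real \<Rightarrow> real"
  assumes "integrable U f" "A \<in> sets borel"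
  shows "integrable U (\<lambda>y. indicator A y * f y)"
  using integrable_indicator_unit[OF assms] unfolding real_scaleR_def .

section \<open>The \<open>L^1\<close> norm on the control interval and interior estimates\<close>

definition loc_norm :: "real set \<Rightarrow> L2 \<Rightarrow> real" where
  "loc_norm I F = (LINT x|U. indicator I x * norm (rep_L2 F x))"

lemma loc_norm_integrable:
  assumes "I \<in> sets borel"
  shows "integrable U (\<lambda>x. indicator I x * norm (rep_L2 F x))"
  by (rule integrable_indicator_mult[OF integrable_norm[OF rep_L2_integrable] assms])

lemma loc_norm_nonneg: "0 \<le> loc_norm I F" by (simp add: loc_norm_def integral_nonneg_AE)

lemma loc_norm_le: "I \<in> sets borel \<Longrightarrow> loc_norm I F \<le> norm F"
  unfolding loc_norm_def by (rule order_trans[OF integral_mono integral_norm_rep_le])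
    (rule loc_norm_integrable, auto simp: indicator_def)

lemma loc_norm_add:
  assumes I: "I \<in> sets borel"
  shows "loc_norm I (F + G) \<le> loc_norm I F + loc_norm I G"
proof -
  have "loc_norm I (F + G) \<le> (LINT x|U. indicator I x * norm (rep_L2 F x) + indicator I x * norm (rep_L2 G x))"
    unfolding loc_norm_def
  proof (rule integral_mono_AE)
    show "AE x in U. indicator I x * norm (rep_L2 (F + G) x) \<le> indicator I x * norm (rep_L2 F x) + indicator I x * norm (rep_L2 G x)"
      using rep_L2_add[of F G] by eventually_elim (auto simp: indicator_def norm_triangle_ineq)
  qed (use I in "auto intro!: Bochner_Integration.integrable_add loc_norm_integrable")
  thus ?thesis using I by (simp add: loc_norm_def loc_norm_integrable)
qed

lemma loc_norm_scaleR:
  assumes I: "I \<in> sets borel"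
  shows "loc_norm I (r *\<^sub>R F) = \<bar>r\<bar> * loc_norm I F"
proof -
  note [measurable] = I
  have "loc_norm I (r *\<^sub>R F) = (LINT x|U. \<bar>r\<bar> * (indicator I x * norm (rep_L2 F x)))" unfolding loc_norm_def
  proof (rule integral_cong_AE)
    show "AE x in U. indicator I x * norm (rep_L2 (r *\<^sub>R F) x) = \<bar>r\<bar> * (indicator I x * norm (rep_L2 F x))"
      using rep_L2_scaleR[of r F] by eventually_elim simp
  qed measurable
  thus ?thesis by (simp add: loc_norm_def)
qed

lemma loc_norm_L2_of:
  assumes f: "sq_integrable f" and I: "I \<in> sets borel"
  shows "loc_norm I (L2_of f) = (LINT x|U. indicator I x * norm (f x))"
proof -
  note [measurable] = I sq_integrable_measurable[OF f]
  show ?thesis unfolding loc_norm_def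
  proof (rule integral_cong_AE)
    show "AE x in U. indicator I x * norm (rep_L2 (L2_of f) x) = indicator I x * norm (f x)"
      using rep_L2_of[OF f] by eventually_elim simp
  qed measurable
qed

lemma exists_small_value:
  fixes g :: "real \<Rightarrow> real"
  assumes g: "continuous_on {0..1} g" and xy: "0 \<le> x" "x \<le> y" "y \<le> 1"
  shows "\<exists>z\<in>{x..y}. g z * (y - x) \<le> (LINT s|U. indicator {x..<y} s * g s)"
proof -
  have g': "continuous_on {x..y} g" using xy by (intro continuous_on_subset[OF g]) auto
  obtain z where z: "z \<in> {x..y}" "\<And>s. s \<in> {x..y} \<Longrightarrow> g z \<le> g s"
    using continuous_attains_inf[OF _ _ g'] xy by auto
  have "integral {x..y} (\<lambda>s. g z) \<le> integral {x..y} g"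
    by (intro integral_le integrable_continuous_interval g' continuous_on_const z(2))
  thus ?thesis using z(1) xy integral_unit_leb_Icc[OF g xy] by (auto simp: mult.commute)
qed

lemma indicator_Ico_integral_le:
  fixes f :: "real \<Rightarrow> complex"
  assumes f: "integrable U f" and "i0 \<le> x" "y \<le> i1"
  shows "(LINT s|U. indicator {x..<y} s * norm (f s)) \<le> (LINT s|U. indicator {i0<..<i1} s * norm (f s))"
proof (rule integral_mono_AE)
  show "AE s in U. indicator {x..<y} s * norm (f s) \<le> indicator {i0<..<i1} s * norm (f s)"
    using AE_unit_leb_neq[of i0] by eventually_elim (use assms in "auto simp: indicator_def")
qed (auto intro!: integrable_indicator_mult integrable_norm f)

context coefficient
begin

lemma loc_norm_inv_op:
  "I \<in> sets borel \<Longrightarrow> loc_norm I (inv_op c G) = (LINT x|U. indicator I x * norm (sol c G x))"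
  unfolding inv_op_def by (rule loc_norm_L2_of[OF sq_integrable_sol])

lemma norm_flux_diff_le:
  assumes "x \<le> y"
  shows "norm (flux c G y - flux c G x) \<le> (LINT s|U. indicator {x..<y} s * norm (rep_L2 G s))"
  using norm_prim_diff_le[OF rep_L2_integrable assms, of G] by (simp add: flux_def norm_minus_commute)

lemma flux_oscillation:
  assumes xy: "x \<in> {i0..i1}" "y \<in> {i0..i1}"
  shows "norm (flux c G y - flux c G x) \<le> loc_norm {i0<..<i1} G"
proof -
  have le: "norm (flux c G y - flux c G x) \<le> loc_norm {i0<..<i1} G" if "i0 \<le> x" "y \<le> i1" "x \<le> y" for x y
    using norm_flux_diff_le[OF that(3), of G] indicator_Ico_integral_le[OF rep_L2_integrable that(1,2), of G]
    by (simp add: loc_norm_def)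
  show ?thesis using le[of x y] le[of y x] xy by (cases "x \<le> y") (auto simp: norm_minus_commute)
qed

lemma integral_inverse_c_le: "(LINT x|U. inverse (c x)) \<le> K"
proof -
  have "(LINT x|U. inverse (c x)) \<le> (LINT x|U. K)" using inverse_c_bounds by (intro integral_mono_AE inverse_c_integrable) auto
  thus ?thesis by (simp only: integral_unit_leb_const)
qed

lemma integral_indicator_inverse_c_ge:
  assumes xy: "0 \<le> x" "x \<le> y" "y \<le> 1"
  shows "(y - x) / K \<le> (LINT s|U. indicator {x..<y} s * inverse (c s))"
proof -
  have "(y - x) / K = integral {x..y} (\<lambda>s. 1 / K)" using xy by simp
  also have "\<dots> = (LINT s|U. indicator {x..<y} s * (1 / K))" using xy by (intro integral_unit_leb_Icc[symmetric]) auto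
  also have "\<dots> \<le> (LINT s|U. indicator {x..<y} s * inverse (c s))"
  proof (rule integral_mono_AE)
    show "AE s in U. indicator {x..<y} s * (1 / K) \<le> indicator {x..<y} s * inverse (c s)"
      using inverse_c_bounds by eventually_elim (auto simp: indicator_def)
  qed (rule integrable_indicator_mult; simp add: inverse_c_integrable)+
  finally show ?thesis .
qed

text \<open>An interior estimate of the Cauchy data by \<open>L^1\<close> norms. In each outer third
  of the interval the solution is small at some point, so the integral of flux over \<open>c\<close>
  between the two points is small. The flux oscillates by no more than the \<open>L^1\<close> norm
  of \<open>G\<close>; hence it is small on the whole interval, and then so is the solution.\<close>

lemma flux_sol_local_bound:
  assumes i: "0 \<le> i0" "i0 < i1" "i1 \<le> 1" and z: "z \<in> {i0..i1}"
  defines "I \<equiv> {i0<..<i1}" and "d \<equiv> (i1 - i0) / 3"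
  shows "norm (flux c G z) \<le> 4 * K ^ 3 / d^2 * (loc_norm I (inv_op c G) + loc_norm I G)"
    and "norm (sol c G z) \<le> 4 * K ^ 3 / d^2 * (loc_norm I (inv_op c G) + loc_norm I G)"
proof -
  define m1 where "m1 = loc_norm I G"
  define m where "m = loc_norm I (inv_op c G) + m1"
  have Ib: "I \<in> sets borel" by (simp add: I_def)
  have m: "0 \<le> m1" "m1 \<le> m" "loc_norm I (inv_op c G) \<le> m" by (simp_all add: m_def m1_def loc_norm_nonneg)
  have d: "0 < d" "d \<le> 1" "i1 = i0 + 3 * d" using i unfolding d_def by (simp, simp, algebra)
  have md: "m \<le> m / d" "0 \<le> m / d" using m d by (auto simp: pos_le_divide_eq mult_left_le)
  have small: "\<exists>x\<in>{u..u + d}. norm (sol c G x) \<le> m / d" if u: "i0 \<le> u" "u + d \<le> i1" for u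
  proof -
    have "continuous_on {0..1} (\<lambda>x. norm (sol c G x))" by (intro continuous_intros continuous_on_sol)
    from exists_small_value[OF this, of u "u + d"] obtain x where x: "x \<in> {u..u + d}"
      "norm (sol c G x) * d \<le> (LINT s|U. indicator {u..<u + d} s * norm (sol c G s))" using u i d by auto
    moreover have "(LINT s|U. indicator {u..<u + d} s * norm (sol c G s)) \<le> m"
      using indicator_Ico_integral_le[OF sq_integrable_integrable[OF sq_integrable_sol] u, of G] m(3)
      unfolding loc_norm_inv_op[OF Ib] unfolding I_def by linarith
    ultimately show ?thesis using d by (intro bexI[of _ x]) (simp_all add: pos_le_divide_eq)
  qed
  have fl: "norm (flux c G z) \<le> 3 * K^2 / d * (m / d)" if z: "z \<in> {i0..i1}" for z
  proof -
    obtain x where x: "x \<in> {i0..i0 + d}" "norm (sol c G x) \<le> m / d" using small[of i0] d by auto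
    have "\<exists>y\<in>{i1 - d..i1 - d + d}. norm (sol c G y) \<le> m / d" using d by (intro small) auto
    then obtain y where y: "y \<in> {i1 - d..i1}" "norm (sol c G y) \<le> m / d" by auto
    have xy: "d \<le> y - x" "x \<le> y" "0 \<le> x" "y \<le> 1" using x(1) y(1) d i by auto
    let ?a = "LINT s|U. indicator {x..<y} s * inverse (c s)"
    have ia: "integrable U (\<lambda>s. indicator {x..<y} s * inverse (c s))"
      by (rule integrable_indicator_mult[OF inverse_c_integrable]) simp
    have "d / K \<le> (y - x) / K" using xy K by (simp add: divide_right_mono)
    hence a: "d / K \<le> ?a" using integral_indicator_inverse_c_ge[OF xy(3,2,4)] by linarith
    let ?f = "\<lambda>s. indicator {x..<y} s *\<^sub>R (flux c G s - flux c G z)"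
    have fb: "norm (?f s) \<le> m1" for s
    proof (cases "s \<in> {x..<y}")
      case True
      hence "norm (flux c G s - flux c G z) \<le> m1" unfolding m1_def I_def using x(1) y(1) by (intro flux_oscillation z) auto
      thus ?thesis by (simp add: indicator_def m)
    qed (simp add: m)
    have "?f \<in> borel_measurable U" by measurable
    note f = integrable_inverse_c_scaleR[OF this fb]
    have "sol c G y - sol c G x = (LINT s|U. indicator {x..<y} s *\<^sub>R (inverse (c s) *\<^sub>R flux c G s))"
      unfolding sol_def by (rule prim_diff_eq[OF flux_integrable xy(2)])
    also have "\<dots> = (LINT s|U. (indicator {x..<y} s * inverse (c s)) *\<^sub>R flux c G z + inverse (c s) *\<^sub>R ?f s)"
      by (rule Bochner_Integration.integral_cong) (auto simp: algebra_simps)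
    also have "\<dots> = ?a *\<^sub>R flux c G z + (LINT s|U. inverse (c s) *\<^sub>R ?f s)"
      using ia f(1) by (subst Bochner_Integration.integral_add) (auto intro: integrable_scaleR_left)
    finally have eq: "?a *\<^sub>R flux c G z = sol c G y - sol c G x - (LINT s|U. inverse (c s) *\<^sub>R ?f s)" by simp
    have "norm (flux c G z) * (d / K) \<le> norm (?a *\<^sub>R flux c G z)"
      unfolding norm_scaleR mult.commute[of "\<bar>?a\<bar>"] using a by (intro mult_left_mono) auto
    also have "\<dots> \<le> norm (sol c G y) + norm (sol c G x) + norm (LINT s|U. inverse (c s) *\<^sub>R ?f s)"
      unfolding eq by (intro norm_diff_triple_le[OF refl]) auto
    also have "\<dots> \<le> m / d + m / d + K * (m / d)" using mult_mono[OF integral_inverse_c_le order_trans[OF m(2) md(1)]] K m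
      by (intro add_mono x(2) y(2) order_trans[OF f(3)]) auto
    also have "\<dots> \<le> 3 * K * (m / d)" using mult_right_mono[OF K md(2)] by simp
    finally show ?thesis using d K by (simp add: field_simps power2_eq_square)
  qed
  have "norm (flux c G z) \<le> 3 * K^2 / d * (m / d)" by (rule fl[OF z])
  also have "\<dots> \<le> 4 * K ^ 3 / d * (m / d)"
  proof (intro mult_right_mono divide_right_mono)
    show "3 * K^2 \<le> 4 * K ^ 3" using power_increasing[of 2 3 K] zero_le_power2[of K] K by linarith
  qed (use d md in simp_all)
  finally show "norm (flux c G z) \<le> 4 * K ^ 3 / d^2 * (loc_norm I (inv_op c G) + loc_norm I G)"
    by (simp add: m_def m1_def power2_eq_square)
  obtain x where x: "x \<in> {i0..i0 + d}" "norm (sol c G x) \<le> m / d" using small[of i0] d by auto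
  have osc: "norm (sol c G v - sol c G u) \<le> K * (3 * K^2 / d * (m / d))" if uv: "i0 \<le> u" "v \<le> i1" "u \<le> v" for u v
  proof -
    have "(LINT s|U. indicator {u..<v} s * norm (flux c G s)) \<le> (LINT s|U. 3 * K^2 / d * (m / d))"
    proof (rule integral_mono[OF flux_norm_integrable])
      show "indicator {u..<v} s * norm (flux c G s) \<le> 3 * K^2 / d * (m / d)" for s
        using fl[of s] uv mult_nonneg_nonneg[of "3 * K^2 / d" "m / d"] md d by (cases "s \<in> {u..<v}") auto
    qed simp
    hence "K * (LINT s|U. indicator {u..<v} s * norm (flux c G s)) \<le> K * (3 * K^2 / d * (m / d))"
      unfolding integral_unit_leb_const using K by (intro mult_left_mono) auto
    thus ?thesis using norm_sol_diff_le[OF uv(3), of G] by linarith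
  qed
  have "norm (sol c G z - sol c G x) \<le> K * (3 * K^2 / d * (m / d))"
    using osc[of x z] osc[of z x] x(1) z d by (cases "x \<le> z") (auto simp: norm_minus_commute)
  define R where "R = K ^ 3 / d * (m / d)"
  have R: "K * (3 * K^2 / d * (m / d)) = 3 * R" by (simp add: R_def power2_eq_square power3_eq_cube)
  have "norm (sol c G z) \<le> m / d + 3 * R"
    unfolding R[symmetric] using x(2) \<open>norm (sol c G z - sol c G x) \<le> _\<close> norm_triangle_sub[of "sol c G z" "sol c G x"] by linarith
  moreover have "1 \<le> K ^ 3 / d" using one_le_power[OF K, of 3] d by (simp add: pos_le_divide_eq)
  hence "1 * (m / d) \<le> R" unfolding R_def using md(2) by (rule mult_right_mono)
  ultimately have "norm (sol c G z) \<le> 4 * R" by simp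
  thus "norm (sol c G z) \<le> 4 * K ^ 3 / d^2 * (loc_norm I (inv_op c G) + loc_norm I G)"
    by (simp add: R_def m_def m1_def power2_eq_square)
qed

end

section \<open>Cauchy data of all time derivatives\<close>

text \<open>The index is raised by one because \<open>sol\<close> applies \<open>B\<close> once:
  with \<open>k = j div 2\<close>, the even member is the continuous representative of
  \<open>heat\<close> of order \<open>k\<close>, and the odd member is the flux of that
  function.\<close>

definition cauchy_chain :: "(real \<Rightarrow> real) \<Rightarrow> real \<Rightarrow> real \<Rightarrow> L2 \<Rightarrow> nat \<Rightarrow> real \<Rightarrow> complex" where
  "cauchy_chain c K t \<psi> j = (if even j then sol c (heat (inv_op c) (4 * K) t (Suc (j div 2)) \<psi>)
     else flux c (heat (inv_op c) (4 * K) t (Suc (j div 2)) \<psi>))"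

lemma tendsto_0_of_bounded_sums:
  fixes z :: "nat \<Rightarrow> real"
  assumes "\<And>j. 0 \<le> z j" "\<And>N. (\<Sum>j<N. z j) \<le> C"
  shows "z \<longlonglongrightarrow> 0"
proof -
  have "\<exists>N. \<forall>n\<ge>N. (\<Sum>j<n. z j) \<le> C" using assms by blast
  hence "summable z" using assms by (intro bounded_imp_summable[of z C]) (metis lessThan_Suc_atMost)+
  thus ?thesis by (rule summable_LIMSEQ_zero)
qed

lemma inner_sgn_self: "x \<bullet> sgn x = norm (x :: complex)"
  by (cases "x = 0") (simp_all add: sgn_div_norm power2_norm_eq_inner[symmetric] power2_eq_square)

text \<open>The sign of \<open>F\<close> on \<open>I\<close> is the bounded function that realizes
  the \<open>L^1\<close> norm of \<open>F\<close>; pairing with it turns norms of integrals into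
  scalar integrals.\<close>

lemma inner_loc_sgn:
  assumes I: "I \<in> sets borel"
  defines "\<sigma> F \<equiv> L2_of (\<lambda>x. indicator I x *\<^sub>R sgn (rep_L2 F x))"
  shows "inner G (\<sigma> F) \<le> loc_norm I G" and "inner F (\<sigma> F) = loc_norm I F"
proof -
  note [measurable] = I
  have sq: "sq_integrable (\<lambda>x. indicator I x *\<^sub>R sgn (rep_L2 F x))"
    by (rule sq_integrable_bounded[where c = 1]) (measurable, auto simp: indicator_def norm_sgn)
  have eq: "inner G (\<sigma> F) = (LINT x|U. indicator I x * (rep_L2 G x \<bullet> sgn (rep_L2 F x)))" for G
    using inner_L2_of[OF sq_integrable_rep sq, of G] by (simp add: \<sigma>_def L2_of_rep)
  have le: "rep_L2 G x \<bullet> sgn (rep_L2 F x) \<le> norm (rep_L2 G x)" for x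
    using norm_cauchy_schwarz[of "rep_L2 G x" "sgn (rep_L2 F x)"] mult_left_le[of "norm (sgn (rep_L2 F x))" "norm (rep_L2 G x)"]
    by (auto simp: norm_sgn split: if_splits)
  have int: "integrable U (\<lambda>x. indicator I x * (rep_L2 G x \<bullet> sgn (rep_L2 F x)))"
    using integrable_inner_sq[OF sq_integrable_rep sq, of G] by simp
  show "inner G (\<sigma> F) \<le> loc_norm I G" unfolding eq loc_norm_def
    by (intro integral_mono int loc_norm_integrable I) (auto simp: indicator_def le)
  show "inner F (\<sigma> F) = loc_norm I F" unfolding eq loc_norm_def by (simp add: inner_sgn_self)
qed

context coefficient
begin

abbreviation S :: "real \<Rightarrow> L2 \<Rightarrow> L2" where
  "S \<equiv> heat_semigroup (inv_op c) (4 * K)"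

abbreviation V :: "real \<Rightarrow> nat \<Rightarrow> L2 \<Rightarrow> L2" where
  "V \<equiv> heat (inv_op c) (4 * K)"

lemma continuous_on_cauchy_chain: "continuous_on A (cauchy_chain c K t \<psi> j)"
  by (simp add: cauchy_chain_def continuous_on_sol continuous_on_flux)

lemma integral_rep_inv_op:
  assumes A: "A \<in> sets borel"
  shows "(LINT s|U. indicator A s * norm (rep_L2 (inv_op c G) s)) = (LINT s|U. indicator A s * norm (sol c G s))"
  using loc_norm_inv_op[OF A, of G] by (simp add: loc_norm_def)

text \<open>A solution varies by the integral of its flux over \<open>c\<close>, a flux by the
  integral of the right-hand side, which is the next solution of the chain. Since
  \<open>1 \<le> K\<close>, the factor \<open>K\<close> covers both cases.\<close>

lemma cauchy_chain_step:
  assumes t: "t > 0" and xy: "0 \<le> x" "x \<le> y" "y \<le> 1"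
  shows "norm (cauchy_chain c K t \<psi> j y - cauchy_chain c K t \<psi> j x) \<le>
    K * integral {x..y} (\<lambda>s. norm (cauchy_chain c K t \<psi> (Suc j) s))"
proof (cases "even j")
  case True
  hence j: "Suc j div 2 = j div 2" by simp
  have "continuous_on {0..1} (\<lambda>s. norm (flux c (V t (Suc (j div 2)) \<psi>) s))"
    by (intro continuous_intros continuous_on_flux)
  from integral_unit_leb_Icc[OF this xy] show ?thesis
    using norm_sol_diff_le[OF xy(2), of "V t (Suc (j div 2)) \<psi>"] True j by (simp add: cauchy_chain_def)
next
  case False
  hence j: "Suc j div 2 = Suc (j div 2)" by presburger
  let ?G = "V t (Suc (Suc (j div 2))) \<psi>"
  have "continuous_on {0..1} (\<lambda>s. norm (sol c ?G s))" by (intro continuous_intros continuous_on_sol)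
  from integral_unit_leb_Icc[OF this xy]
  have eq: "(LINT s|U. indicator {x..<y} s * norm (rep_L2 (V t (Suc (j div 2)) \<psi>) s)) = integral {x..y} (\<lambda>s. norm (sol c ?G s))"
    using integral_rep_inv_op[of "{x..<y}" ?G] by (simp add: B_heat[OF t])
  have "norm (flux c (V t (Suc (j div 2)) \<psi>) y - flux c (V t (Suc (j div 2)) \<psi>) x) \<le> integral {x..y} (\<lambda>s. norm (sol c ?G s))"
    using norm_flux_diff_le[OF xy(2), of "V t (Suc (j div 2)) \<psi>"] by (simp add: eq)
  also have "\<dots> \<le> K * integral {x..y} (\<lambda>s. norm (sol c ?G s))"
  proof -
    have "0 \<le> integral {x..y} (\<lambda>s. norm (sol c ?G s))"
      by (intro integral_nonneg integrable_continuous_interval continuous_intros continuous_on_sol) auto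
    thus ?thesis using mult_right_mono[OF K] by simp
  qed
  finally show ?thesis using False j by (simp add: cauchy_chain_def)
qed

text \<open>A crude bound whose purpose is to make the remainder in \<open>sideways_bound\<close>
  disappear. Replacing \<open>t\<close> by \<open>min t 1\<close> allows the exponent to be raised
  by one.\<close>

lemma cauchy_chain_bound:
  assumes t: "t > 0" and x: "0 \<le> x" "x \<le> 1"
  shows "norm (cauchy_chain c K t \<psi> j x) \<le> 2 * K * norm \<psi> * (fact (j div 2 + 2) / min t 1 ^ (j div 2 + 2))"
proof -
  let ?k = "Suc (j div 2)" and ?r = "min t 1"
  have r: "0 < ?r" "?r \<le> 1" "?r \<le> t" using t by auto
  have "norm (V t ?k \<psi>) \<le> fact ?k / t ^ ?k * norm \<psi>" by (rule norm_heat_le[OF t])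
  also have "\<dots> \<le> fact (Suc ?k) / ?r ^ Suc ?k * norm \<psi>"
  proof (intro mult_right_mono frac_le)
    have "?r ^ Suc ?k \<le> ?r ^ ?k" using r by (intro power_decreasing) auto
    also have "\<dots> \<le> t ^ ?k" using r by (intro power_mono) auto
    finally show "?r ^ Suc ?k \<le> t ^ ?k" .
  qed (use r in "auto intro!: fact_mono simp del: fact_Suc")
  finally have V: "norm (V t ?k \<psi>) \<le> fact (Suc ?k) / ?r ^ Suc ?k * norm \<psi>" .
  have "norm (cauchy_chain c K t \<psi> j x) \<le> 2 * K * norm (V t ?k \<psi>)"
  proof (cases "even j")
    case True
    thus ?thesis using norm_sol_le[OF x, of "V t ?k \<psi>"] by (simp add: cauchy_chain_def)
  next
    case False
    have "norm (flux c (V t ?k \<psi>) x) \<le> 1 * (2 * norm (V t ?k \<psi>))" using norm_flux_le by simp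
    also have "\<dots> \<le> K * (2 * norm (V t ?k \<psi>))" using K by (intro mult_right_mono) auto
    finally show ?thesis using False by (simp add: cauchy_chain_def)
  qed
  also have "\<dots> \<le> 2 * K * (fact (Suc ?k) / ?r ^ Suc ?k * norm \<psi>)" using K by (intro mult_left_mono V) auto
  finally show ?thesis by (simp add: mult_ac del: fact_Suc power_Suc)
qed

text \<open>The number of sideways steps tends to infinity. The remainder is a multiple of the
  general term of the series in \<open>sideways_growth_sum_le\<close>, whose partial sums are
  bounded, and so tends to \<open>0\<close>.\<close>

lemma cauchy_chain_sup_bound:
  assumes t: "t > 0" and x: "0 \<le> x" "x \<le> 1" and x0: "0 \<le> x0" "x0 \<le> 1"
    and C: "\<And>N. (\<Sum>i<N. norm (cauchy_chain c K t \<psi> i x0) * (K ^ i / fact i)) \<le> C"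
  shows "norm (sol c (V t 1 \<psi>) x) \<le> C"
proof -
  let ?f = "cauchy_chain c K t \<psi>"
  let ?Y = "\<lambda>j. 2 * K * norm \<psi> * (fact (j div 2 + 2) / min t 1 ^ (j div 2 + 2))"
  have pw: "(K * \<bar>x - x0\<bar>) ^ i / fact i \<le> K ^ i / fact i" for i
    using x x0 K by (intro divide_right_mono power_mono) (auto intro: mult_left_le)
  have le: "norm (?f 0 x) \<le> C + 2 * K * norm \<psi> * (fact (N div 2 + 2) / min t 1 ^ (N div 2 + 2) * (K ^ N / fact N))" for N
  proof -
    have "norm (?f 0 x) \<le> (\<Sum>i<N. norm (?f (0 + i) x0) * ((K * \<bar>x - x0\<bar>) ^ i / fact i)) + ?Y (0 + N) * ((K * \<bar>x - x0\<bar>) ^ N / fact N)"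
      using K by (intro sideways_bound continuous_on_cauchy_chain cauchy_chain_step cauchy_chain_bound x x0 t) auto
    also have "\<dots> \<le> (\<Sum>i<N. norm (?f i x0) * (K ^ i / fact i)) + ?Y N * (K ^ N / fact N)"
      unfolding add_0 by (intro add_mono sum_mono mult_left_mono[OF pw]) (use t K in auto)
    finally show ?thesis using C[of N] by (simp add: mult.assoc)
  qed
  have "(\<lambda>N. fact (N div 2 + 2) / min t 1 ^ (N div 2 + 2) * (K ^ N / fact N)) \<longlonglongrightarrow> 0"
    by (rule tendsto_0_of_bounded_sums[OF _ sideways_growth_sum_le]) (use t K in auto)
  hence "(\<lambda>N. C + 2 * K * norm \<psi> * (fact (N div 2 + 2) / min t 1 ^ (N div 2 + 2) * (K ^ N / fact N))) \<longlonglongrightarrow> C + 2 * K * norm \<psi> * 0"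
    by (intro tendsto_intros)
  hence "norm (?f 0 x) \<le> C + 2 * K * norm \<psi> * 0" by (rule LIMSEQ_le_const) (use le in auto)
  thus ?thesis by (simp add: cauchy_chain_def)
qed

lemma S_eq_L2_of_sol: "t > 0 \<Longrightarrow> S t \<psi> = L2_of (sol c (V t 1 \<psi>))"
  using B_heat[of t 0 \<psi>] by (simp add: heat_semigroup_def inv_op_def)

lemma norm_S_le_sup:
  assumes t: "t > 0" and "0 \<le> C" and C: "\<And>x. 0 \<le> x \<Longrightarrow> x \<le> 1 \<Longrightarrow> norm (sol c (V t 1 \<psi>) x) \<le> C"
  shows "norm (S t \<psi>) \<le> C"
  unfolding S_eq_L2_of_sol[OF t] using assms by (intro norm_L2_of_bounded_le(2) AE_I2 sol_measurable) auto

lemma S_eq_0_of_chain: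
  assumes t: "t > 0" and x0: "0 \<le> x0" "x0 \<le> 1" and z: "\<And>j. cauchy_chain c K t \<psi> j x0 = 0"
  shows "S t \<psi> = 0"
  using norm_S_le_sup[OF t order_refl cauchy_chain_sup_bound[OF t _ _ x0]] z by simp

text \<open>Backward uniqueness by halving the time: the squared norm of
  \<open>S (t / 2) \<psi>\<close> is \<open>inner (S t \<psi>) \<psi>\<close>, and strong continuity
  at \<open>0\<close> ends the descent.\<close>

lemma S_injective:
  assumes t: "t \<ge> 0" and "S t \<psi> = 0"
  shows "\<psi> = 0"
proof -
  have z: "S (t / 2 ^ n) \<psi> = 0" for n
  proof (induction n)
    case (Suc n)
    have "(norm (S (t / 2 ^ Suc n) \<psi>))^2 = inner (S (t / 2 ^ Suc n) (S (t / 2 ^ Suc n) \<psi>)) \<psi>"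
      by (simp only: power2_norm_eq_inner heat_semigroup_sym)
    also have "S (t / 2 ^ Suc n) (S (t / 2 ^ Suc n) \<psi>) = S (t / 2 ^ n) \<psi>"
      using t by (subst heat_semigroup_add[symmetric]) (auto simp: field_simps)
    finally show ?case using Suc by simp
  qed (use assms in simp)
  have "(\<lambda>n. S (t / 2 ^ n) \<psi>) \<longlonglongrightarrow> S 0 \<psi>"
  proof (rule continuous_on_tendsto_compose[OF continuous_on_heat_semigroup])
    have "(\<lambda>n. t * (1 / 2) ^ n) \<longlonglongrightarrow> t * 0" by (intro tendsto_intros LIMSEQ_power_zero) simp
    thus "(\<lambda>n. t / 2 ^ n) \<longlonglongrightarrow> 0" by (simp add: power_divide)
  qed (use t in auto)
  hence "(\<lambda>n. 0) \<longlonglongrightarrow> \<psi>" by (simp add: z)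
  thus ?thesis by (simp add: LIMSEQ_const_iff)
qed

section \<open>Observability on one time interval and on all\<close>

lemma continuous_on_loc_norm_S:
  assumes I: "I \<in> sets borel"
  shows "continuous_on {0..} (\<lambda>t. loc_norm I (S t \<psi>))"
proof -
  have le: "loc_norm I F - loc_norm I G \<le> norm (F - G)" for F G
    using loc_norm_add[OF I, of "F - G" G] loc_norm_le[OF I, of "F - G"] by simp
  have "\<bar>loc_norm I F - loc_norm I G\<bar> \<le> norm (F - G)" for F G
    using le[of F G] le[of G F] by (simp add: norm_minus_commute)
  hence "continuous_on UNIV (loc_norm I)" unfolding continuous_on_iff by (metis dist_norm dist_real_def le_less_trans)
  thus ?thesis by (rule continuous_on_compose2[OF _ continuous_on_heat_semigroup]) auto
qed

text \<open>The difference on the left is the time integral of \<open>S u \<psi>\<close>. Testing it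
  with one fixed sign function reduces Minkowski's inequality to a scalar integral.\<close>

lemma loc_norm_primitive_le:
  assumes I: "I \<in> sets borel" and s: "0 < s" "s \<le> t"
  shows "loc_norm I (inv_op c (S s \<psi>) - inv_op c (S t \<psi>)) \<le> integral {s..t} (\<lambda>u. loc_norm I (S u \<psi>))"
proof -
  define D where "D = inv_op c (S s \<psi>) - inv_op c (S t \<psi>)"
  define \<sigma> where "\<sigma> = L2_of (\<lambda>x. indicator I x *\<^sub>R sgn (rep_L2 D x))"
  have "((\<lambda>u. inner (S u \<psi>) \<sigma>) has_integral (- inner (S t (inv_op c \<psi>)) \<sigma> - - inner (S s (inv_op c \<psi>)) \<sigma>)) {s..t}"
  proof (rule fundamental_theorem_of_calculus[OF s(2)])
    fix u assume u: "u \<in> {s..t}"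
    hence u0: "u > 0" using s by auto
    have "((\<lambda>u. - inner (S u (inv_op c \<psi>)) \<sigma>) has_vector_derivative - inner (- S u \<psi>) \<sigma>) (at u)"
      by (intro has_vector_derivative_minus bounded_linear.has_vector_derivative[OF bounded_linear_inner_left]
          heat_semigroup_has_vector_derivative u0)
    thus "((\<lambda>u. - inner (S u (inv_op c \<psi>)) \<sigma>) has_vector_derivative inner (S u \<psi>) \<sigma>) (at u within {s..t})"
      by (simp add: has_vector_derivative_at_within)
  qed
  hence *: "((\<lambda>u. inner (S u \<psi>) \<sigma>) has_integral inner D \<sigma>) {s..t}"
    by (simp add: D_def B_heat_semigroup inner_diff_left)
  have "continuous_on {s..t} (\<lambda>u. loc_norm I (S u \<psi>))"
    using s by (intro continuous_on_subset[OF continuous_on_loc_norm_S[OF I]]) auto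
  hence "((\<lambda>u. loc_norm I (S u \<psi>)) has_integral integral {s..t} (\<lambda>u. loc_norm I (S u \<psi>))) {s..t}"
    by (intro integrable_integral integrable_continuous_interval)
  from has_integral_le[OF * this] have "inner D \<sigma> \<le> integral {s..t} (\<lambda>u. loc_norm I (S u \<psi>))"
    using inner_loc_sgn(1)[OF I] by (simp add: \<sigma>_def)
  thus ?thesis using inner_loc_sgn(2)[OF I, of D] by (simp add: \<sigma>_def D_def)
qed

text \<open>Observability up to an error. The degree \<open>n\<close> of extrapolation stays free,
  because the cost \<open>12 ^ n\<close> of the observation and the gain \<open>2 ^ n\<close> on the
  error must be balanced against the next time interval.\<close>

lemma observability_step:
  assumes i: "0 \<le> i0" "i0 < i1" "i1 \<le> 1" and L: "0 < L" "L \<le> 1" and n: "n > 0"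
  defines "C0 \<equiv> 32 * K ^ 3 * (1 + K) / ((i1 - i0) / 3)^2 + 24 * (3 * K^2 + 1)"
  shows "norm (S L \<psi>) \<le> C0 * exp (C0 / L) *
    (12 ^ n * integral {0..L} (\<lambda>u. loc_norm {i0<..<i1} (S u \<psi>)) + norm \<psi> / 2 ^ n)"
proof -
  define I where "I = {i0<..<i1}"
  define d where "d = (i1 - i0) / 3"
  define r where "r = L / 24"
  define m where "m = integral {0..L} (\<lambda>u. loc_norm I (S u \<psi>))"
  define X where "X = 12 ^ n * m + L / 2 ^ n * norm \<psi>"
  \<comment> \<open>The first summand collects the interior estimate and the factor of the sideways
    sum; the second one is the exponent \<open>(3 * K^2 + 1) / r\<close> with
    \<open>r = L / 24\<close>, where \<open>1 / r^2 \<le> 2 * exp (1 / r)\<close> accounts for the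
    \<open>1\<close>.\<close>
  have C0: "32 * K ^ 3 * (1 + K) / ((i1 - i0) / 3)^2 \<le> C0" "24 * (3 * K^2 + 1) \<le> C0" "0 \<le> C0"
    using K by (simp_all add: C0_def)
  have I: "I \<in> sets borel" by (simp add: I_def)
  have r: "0 < r" "r \<le> 1" using L by (auto simp: r_def)
  have d: "d > 0" using i by (simp add: d_def)
  have N_int: "(\<lambda>u. loc_norm I (S u \<psi>)) integrable_on {0..L}"
    by (intro integrable_continuous_interval continuous_on_subset[OF continuous_on_loc_norm_S[OF I]]) auto
  have m0: "m \<ge> 0" unfolding m_def by (intro integral_nonneg N_int loc_norm_nonneg)
  have X0: "X \<ge> 0" using m0 L by (simp add: X_def)
  have prim_le: "loc_norm I (inv_op c (S s \<psi>) - inv_op c (S L \<psi>)) \<le> m" if s: "L - r \<le> s" "s \<le> L" for s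
  proof -
    have s0: "0 < s" using s L by (simp add: r_def)
    have "integral {s..L} (\<lambda>u. loc_norm I (S u \<psi>)) \<le> m" unfolding m_def using s0 s
      by (intro integral_subset_le N_int integrable_on_subinterval[OF N_int]) (auto simp: loc_norm_nonneg)
    thus ?thesis using loc_norm_primitive_le[OF I s0 s(2), of \<psi>] by linarith
  qed
  have Vk: "loc_norm I (V L k \<psi>) \<le> fact (Suc k) / r ^ Suc k * X" for k unfolding X_def
    by (rule heat_extrapolation[OF loc_norm_add[OF I] loc_norm_scaleR[OF I] loc_norm_le[OF I] L(1) r_def n prim_le])
  define x0 where "x0 = (i0 + i1) / 2"
  have x0: "x0 \<in> {i0..i1}" "0 \<le> x0" "x0 \<le> 1" using i by (auto simp: x0_def)
  let ?f = "cauchy_chain c K L \<psi>"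
  have f: "norm (?f j x0) \<le> 8 * K ^ 3 / d^2 * X * (fact (j div 2 + 2) / r ^ (j div 2 + 2))" for j
  proof -
    let ?k = "j div 2" and ?s = "loc_norm I (V L (j div 2) \<psi>) + loc_norm I (V L (Suc (j div 2)) \<psi>)"
    have "fact (Suc ?k) / r ^ Suc ?k \<le> fact (?k + 2) / r ^ (?k + 2)"
      using r by (intro frac_le power_decreasing fact_mono) (auto simp del: fact_Suc power_Suc)
    hence "fact (Suc ?k) / r ^ Suc ?k * X \<le> fact (?k + 2) / r ^ (?k + 2) * X" using X0 by (rule mult_right_mono)
    moreover have "u + v \<le> 2 * q" if "p \<le> q" "u \<le> p" "v \<le> q" for u v p q :: real using that by linarith
    ultimately have s: "?s \<le> 2 * (fact (?k + 2) / r ^ (?k + 2) * X)"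
      using Vk[of ?k] Vk[of "Suc ?k"] unfolding add_2_eq_Suc' by blast
    have "norm (?f j x0) \<le> 4 * K ^ 3 / d^2 * ?s" using flux_sol_local_bound[OF i x0(1), of "V L (Suc ?k) \<psi>"]
      by (auto simp: cauchy_chain_def B_heat[OF L(1)] I_def d_def)
    also have "\<dots> \<le> 4 * K ^ 3 / d^2 * (2 * (fact (?k + 2) / r ^ (?k + 2) * X))" using K by (intro mult_left_mono s) auto
    finally show ?thesis by (simp add: mult_ac del: fact_Suc power_Suc)
  qed
  define C where "C = 8 * K ^ 3 / d^2 * X * (2 * (1 + K) / r^2 * exp (3 * K^2 / r))"
  have "(\<Sum>j<N. norm (?f j x0) * (K ^ j / fact j)) \<le> C" for N
  proof -
    have "(\<Sum>j<N. norm (?f j x0) * (K ^ j / fact j)) \<le>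
        (\<Sum>j<N. 8 * K ^ 3 / d^2 * X * (fact (j div 2 + 2) / r ^ (j div 2 + 2)) * (K ^ j / fact j))"
      using K by (intro sum_mono mult_right_mono f) auto
    also have "\<dots> = 8 * K ^ 3 / d^2 * X * (\<Sum>j<N. fact (j div 2 + 2) / r ^ (j div 2 + 2) * (K ^ j / fact j))"
      by (simp only: sum_distrib_left mult.assoc)
    also have "\<dots> \<le> C" unfolding C_def using K r X0 by (intro mult_left_mono sideways_growth_sum_le) auto
    finally show ?thesis .
  qed
  hence "norm (S L \<psi>) \<le> C"
    using K X0 r by (intro norm_S_le_sup[OF L(1)] cauchy_chain_sup_bound[OF L(1) _ _ x0(2,3)]) (auto simp: C_def)
  also have "C = 16 * K ^ 3 * (1 + K) / d^2 * ((1 / r^2) * exp (3 * K^2 / r)) * X" by (simp add: C_def)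
  also have "\<dots> \<le> C0 * exp (C0 / L) * (12 ^ n * m + norm \<psi> / 2 ^ n)"
  proof (rule mult_mono)
    have "1 / r^2 \<le> 2 * exp (1 / r)" using power_div_fact_le_exp[of "1 / r" 2] r by (simp add: power_divide)
    hence "(1 / r^2) * exp (3 * K^2 / r) \<le> 2 * exp (1 / r) * exp (3 * K^2 / r)" by (rule mult_right_mono) simp
    also have "\<dots> = 2 * exp (24 * (3 * K^2 + 1) / L)" by (simp add: exp_add[symmetric] r_def algebra_simps add_divide_distrib)
    also have "\<dots> \<le> 2 * exp (C0 / L)" using C0(2) L by (simp add: divide_right_mono)
    finally have "16 * K ^ 3 * (1 + K) / d^2 * ((1 / r^2) * exp (3 * K^2 / r)) \<le> 16 * K ^ 3 * (1 + K) / d^2 * (2 * exp (C0 / L))"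
      using K by (intro mult_left_mono) auto
    also have "\<dots> = 32 * K ^ 3 * (1 + K) / d^2 * exp (C0 / L)" by simp
    also have "\<dots> \<le> C0 * exp (C0 / L)" using C0(1) by (intro mult_right_mono) (simp_all add: d_def)
    finally show "16 * K ^ 3 * (1 + K) / d^2 * ((1 / r^2) * exp (3 * K^2 / r)) \<le> C0 * exp (C0 / L)" .
    show "X \<le> 12 ^ n * m + norm \<psi> / 2 ^ n" using L by (simp add: X_def divide_right_mono mult_left_le_one_le)
    show "0 \<le> C0 * exp (C0 / L)" using C0(3) by simp
  qed (rule X0)
  finally show ?thesis by (simp add: m_def I_def)
qed

text \<open>The intervals shrink geometrically towards time \<open>0\<close>, with a ratio so close to \<open>1\<close> that the
  gain \<open>2 ^ n\<close> of one step outweighs the growth of \<open>12 ^ n\<close> in the next one.\<close>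

lemma observability_telescope:
  assumes i: "0 \<le> i0" "i0 < i1" "i1 \<le> 1" and \<tau>: "0 < \<tau>" "\<tau> \<le> 1"
  defines "C0 \<equiv> 32 * K ^ 3 * (1 + K) / ((i1 - i0) / 3)^2 + 24 * (3 * K^2 + 1)"
  shows "norm (S \<tau> \<psi>) \<le> 16 * C0 * exp (189 * C0 / \<tau>) * integral {0..\<tau>} (\<lambda>u. loc_norm {i0<..<i1} (S u \<psi>))"
proof -
  define N where "N u = loc_norm {i0<..<i1} (S u \<psi>)" for u
  define t where "t j = \<tau> * (8 / 9) ^ j" for j :: nat
  define L where "L j = t j - t (Suc j)" for j
  define F where "F j = norm (S (t j) \<psi>)" for j
  define P where "P j = integral {0..t j} N" for j
  define a where "a = 21 * C0"
  have C0: "C0 > 0" using K by (simp add: C0_def add_nonneg_pos)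
  hence a0: "a > 0" by (simp add: a_def)
  have t: "0 < t j" "t j \<le> 1" for j using \<tau> power_le_one[of "8 / 9 :: real" j] by (auto simp: t_def mult_le_one)
  have L_eq: "L j = \<tau> / 9 * (8 / 9) ^ j" for j by (simp add: L_def t_def algebra_simps)
  have L0: "0 < L j" for j unfolding L_eq using \<tau> by simp
  have L1: "L j \<le> 1" for j using t[of j] t[of "Suc j"] by (simp add: L_def)
  have L_Suc: "a / L (Suc j) = 9 / 8 * (a / L j)" for j by (simp add: L_eq)
  have cN: "continuous_on {0..} N" unfolding N_def by (rule continuous_on_loc_norm_S) simp
  hence N_int: "N integrable_on {u..v}" if "0 \<le> u" for u v
    using that by (intro integrable_continuous_interval) (auto intro: continuous_on_subset)
  have N0: "0 \<le> N u" for u by (simp add: N_def loc_norm_nonneg)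
  have step: "exp (- a / L j) * F j \<le> 16 * C0 * (P j - P (Suc j)) + exp (- a / L (Suc j)) * F (Suc j)" for j
  proof -
    \<comment> \<open>The size \<open>2 ^ n\<close> will be about \<open>exp x\<close>. The factor
      \<open>5\<close> satisfies two demands: \<open>1 + 4 * 5 = 21\<close> is the constant in
      \<open>a\<close>, as \<open>12 ^ n\<close> is at most \<open>16 * exp (4 * x)\<close>; and
      \<open>2 - 5\<close> is below \<open>- 21 / 8\<close>, the change of \<open>a / L\<close> on
      passing to the next interval.\<close>
    define x where "x = 5 * C0 / L j"
    define n where "n = nat \<lceil>x / ln 2\<rceil>"
    have "x / ln 2 > 0" using C0 L0 by (simp add: x_def)
    hence n: "n > 0" "x / ln 2 \<le> real n" "real n \<le> x / ln 2 + 1" unfolding n_def by linarith+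
    have "x \<le> real n * ln 2" "real n * ln 2 \<le> x + ln 2" using n(2,3) by (simp_all add: field_simps)
    hence "exp x \<le> exp (real n * ln 2)" "exp (real n * ln 2) \<le> exp (x + ln 2)" by simp_all
    hence e: "exp x \<le> 2 ^ n" "2 ^ n \<le> 2 * exp x" by (simp_all add: exp_of_nat_mult exp_add mult.commute)
    have tt: "t (Suc j) + L j = t j" by (simp add: L_def)
    have "integral {0..L j} (\<lambda>u. loc_norm {i0<..<i1} (S u (S (t (Suc j)) \<psi>))) = integral {0..L j} (N \<circ> (\<lambda>u. u + t (Suc j)))"
      using less_imp_le[OF t(1)] by (intro integral_cong) (simp add: N_def heat_semigroup_add)
    also have "\<dots> = integral {0 + t (Suc j)..L j + t (Suc j)} N"
      using less_imp_le[OF t(1)] by (intro integral_shift continuous_on_subset[OF cN]) auto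
    also have "\<dots> = P j - P (Suc j)"
      using Henstock_Kurzweil_Integration.integral_combine[where a = 0 and c = "t (Suc j)" and b = "t j" and f = N] t(1)[of "Suc j"] L0[of j] tt N_int[of 0 "t j"]
      by (simp add: P_def add.commute)
    finally have m: "integral {0..L j} (\<lambda>u. loc_norm {i0<..<i1} (S u (S (t (Suc j)) \<psi>))) = P j - P (Suc j)" .
    have m0: "P j - P (Suc j) \<ge> 0" unfolding m[symmetric] using cN less_imp_le[OF t(1)]
      by (intro integral_nonneg integrable_continuous_interval continuous_on_subset[OF continuous_on_loc_norm_S])
        (auto simp: loc_norm_nonneg)
    have "S (L j) (S (t (Suc j)) \<psi>) = S (t j) \<psi>"
      using L0[of j] t(1)[of "Suc j"] tt by (subst heat_semigroup_add[symmetric]) (auto simp: add.commute)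
    hence F: "F j \<le> C0 * exp (C0 / L j) * (12 ^ n * (P j - P (Suc j)) + F (Suc j) / 2 ^ n)"
      using observability_step[OF i L0 L1 n(1), of j "S (t (Suc j)) \<psi>"] by (simp add: m F_def C0_def)
    have p12: "C0 * exp (C0 / L j) * 12 ^ n \<le> 16 * C0 * exp (a / L j)"
    proof -
      have "(12::real) ^ n \<le> (2 ^ 4) ^ n" by (rule power_mono) auto
      also have "\<dots> = (2 ^ n) ^ 4" by (simp only: power_mult[symmetric] mult.commute)
      also have "\<dots> \<le> (2 * exp x) ^ 4" by (intro power_mono e) simp
      also have "\<dots> = 16 * exp (4 * x)" using exp_of_nat_mult[of 4 x] by (simp add: power_mult_distrib)
      finally have "C0 * exp (C0 / L j) * 12 ^ n \<le> C0 * exp (C0 / L j) * (16 * exp (4 * x))"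
        using C0 by (intro mult_left_mono) auto
      also have "\<dots> = 16 * C0 * exp (C0 / L j + 4 * x)" by (simp add: exp_add)
      also have "C0 / L j + 4 * x = a / L j" by (simp add: x_def a_def add_divide_distrib[symmetric])
      finally show ?thesis .
    qed
    have p2: "C0 * exp (C0 / L j) * (1 / 2 ^ n) \<le> exp (a / L j) * exp (- a / L (Suc j))"
    proof -
      have "C0 \<le> exp C0" using exp_ge_add_one_self[of C0] by linarith
      also have "\<dots> \<le> exp (C0 / L j)" using L0[of j] L1[of j] C0 mult_left_le[of "L j" C0] by (simp add: pos_le_divide_eq)
      finally have "C0 * exp (C0 / L j) * (1 / 2 ^ n) \<le> exp (C0 / L j) * exp (C0 / L j) * (1 / exp x)"
        using e(1) C0 by (intro mult_mono mult_right_mono divide_left_mono) auto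
      also have "\<dots> = exp (2 * (C0 / L j) - x)" by (simp add: exp_diff exp_add[symmetric])
      also have "\<dots> \<le> exp (a / L j - 9 / 8 * (a / L j))" using C0 L0[of j] by (simp add: x_def a_def field_simps)
      also have "\<dots> = exp (a / L j) * exp (- a / L (Suc j))" by (simp add: L_Suc exp_add[symmetric] minus_divide_left[symmetric])
      finally show ?thesis .
    qed
    have "F j \<le> (C0 * exp (C0 / L j) * 12 ^ n) * (P j - P (Suc j)) + (C0 * exp (C0 / L j) * (1 / 2 ^ n)) * F (Suc j)"
      using F by (simp add: algebra_simps)
    also have "\<dots> \<le> (16 * C0 * exp (a / L j)) * (P j - P (Suc j)) + (exp (a / L j) * exp (- a / L (Suc j))) * F (Suc j)"
      by (intro add_mono mult_right_mono p12 p2 m0) (simp add: F_def)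
    finally have "exp (- a / L j) * F j \<le> exp (- a / L j) * ((16 * C0 * exp (a / L j)) * (P j - P (Suc j)) + (exp (a / L j) * exp (- a / L (Suc j))) * F (Suc j))"
      by (rule mult_left_mono) simp
    also have "\<dots> = (exp (- a / L j) * exp (a / L j)) * (16 * C0 * (P j - P (Suc j)) + exp (- a / L (Suc j)) * F (Suc j))"
      by (simp add: algebra_simps)
    also have "exp (- a / L j) * exp (a / L j) = 1" by (simp add: exp_add[symmetric])
    finally show ?thesis by simp
  qed
  have tel: "exp (- a / L 0) * F 0 \<le> 16 * C0 * (P 0 - P j) + exp (- a / L j) * F j" for j
  proof (induction j)
    case (Suc j)
    thus ?case using step[of j] by (simp add: algebra_simps)
  qed simp
  have le: "exp (- a / L 0) * F 0 \<le> 16 * C0 * P 0 + L j / a * norm \<psi>" for j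
  proof -
    \<comment> \<open>The weight kills the last term of the telescope, where \<open>F j\<close> is
      merely bounded.\<close>
    have "exp (- a / L j) \<le> L j / a"
    proof -
      have "a / L j \<le> exp (a / L j)" using exp_ge_add_one_self[of "a / L j"] by linarith
      hence "1 / exp (a / L j) \<le> 1 / (a / L j)" using a0 L0[of j] by (intro divide_left_mono) auto
      thus ?thesis by (simp add: exp_minus divide_inverse mult.commute)
    qed
    hence "exp (- a / L j) * F j \<le> L j / a * norm \<psi>"
      using a0 L0[of j] norm_heat_semigroup_le[where t = "t j" and x = \<psi>] by (intro mult_mono) (auto simp: F_def)
    moreover have "0 \<le> P j" unfolding P_def by (intro integral_nonneg N_int N0) simp
    hence "16 * C0 * (P 0 - P j) \<le> 16 * C0 * P 0" using C0 by simp
    ultimately show ?thesis using tel[of j] by linarith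
  qed
  have "(\<lambda>j. 16 * C0 * P 0 + \<tau> / 9 * (8 / 9) ^ j / a * norm \<psi>) \<longlonglongrightarrow> 16 * C0 * P 0 + \<tau> / 9 * 0 / a * norm \<psi>"
    using a0 by (intro tendsto_intros LIMSEQ_power_zero) auto
  hence "exp (- a / L 0) * F 0 \<le> 16 * C0 * P 0 + \<tau> / 9 * 0 / a * norm \<psi>"
    by (rule LIMSEQ_le_const) (use le in "auto simp: L_eq")
  hence "exp (a / L 0) * (exp (- a / L 0) * F 0) \<le> exp (a / L 0) * (16 * C0 * P 0)" by (intro mult_left_mono) auto
  moreover have "exp (a / L 0) * (exp (- a / L 0) * F 0) = F 0" by (simp add: mult.assoc[symmetric] exp_add[symmetric])
  ultimately have "F 0 \<le> exp (a / L 0) * (16 * C0 * P 0)" by (simp only:)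
  \<comment> \<open>Since \<open>L 0 = \<tau> / 9\<close>, the exponent \<open>a / L 0\<close> is
    \<open>189 * C0 / \<tau>\<close>.\<close>
  thus ?thesis by (simp add: F_def t_def L_eq P_def N_def[abs_def] a_def mult_ac)
qed

end

text \<open>The constant is chosen before the coefficient, as the limit of vanishing
  \<open>\<epsilon>\<close> requires. Times above \<open>1\<close> are reduced to \<open>1\<close>
  by contractivity.\<close>

lemma heat_observability:
  assumes i: "0 \<le> i0" "i0 < i1" "i1 \<le> (1::real)" and \<tau>: "0 < \<tau>"
  obtains C where "C > 0" "\<And>c \<psi>. coefficient c K \<Longrightarrow> norm (heat_semigroup (inv_op c) (4 * K) \<tau> \<psi>) \<le>
    C * integral {0..\<tau>} (\<lambda>u. loc_norm {i0<..<i1} (heat_semigroup (inv_op c) (4 * K) u \<psi>))"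
proof -
  define C0 where "C0 = 32 * K ^ 3 * (1 + K) / ((i1 - i0) / 3)^2 + 24 * (3 * K^2 + 1)"
  define C where "C = max 1 (16 * C0 * exp (189 * C0 / min \<tau> 1))"
  have C: "C > 0" by (simp add: C_def)
  show thesis
  proof (rule that[OF C])
    fix c \<psi> assume "coefficient c K"
    then interpret coefficient c K .
    have N: "(\<lambda>u. loc_norm {i0<..<i1} (S u \<psi>)) integrable_on {0..v}" for v
      by (intro integrable_continuous_interval continuous_on_subset[OF continuous_on_loc_norm_S]) auto
    have "S \<tau> \<psi> = S (\<tau> - min \<tau> 1) (S (min \<tau> 1) \<psi>)"
      using \<tau> by (subst heat_semigroup_add[symmetric]) auto
    hence "norm (S \<tau> \<psi>) \<le> norm (S (min \<tau> 1) \<psi>)" using norm_heat_semigroup_le by simp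
    also have "\<dots> \<le> C * integral {0..min \<tau> 1} (\<lambda>u. loc_norm {i0<..<i1} (S u \<psi>))"
      using \<tau> by (intro order_trans[OF observability_telescope[OF i]] mult_right_mono integral_nonneg N)
        (auto simp: C_def C0_def loc_norm_nonneg)
    also have "\<dots> \<le> C * integral {0..\<tau>} (\<lambda>u. loc_norm {i0<..<i1} (S u \<psi>))"
      using C by (intro mult_left_mono integral_subset_le N) (auto simp: loc_norm_nonneg)
    finally show "norm (S \<tau> \<psi>) \<le> C * integral {0..\<tau>} (\<lambda>u. loc_norm {i0<..<i1} (S u \<psi>))" .
  qed
qed

section \<open>Weak derivatives\<close>

text \<open>A polynomial times a symbol of a polynomial: a class that contains the bump functions
  and is closed under differentiation, which makes smoothness of all orders an induction.\<close>

definition bump :: "real \<Rightarrow> real poly \<Rightarrow> real poly \<Rightarrow> nat \<Rightarrow> real \<Rightarrow> real" where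
  "bump e Y Q m x = poly Q x * heat_symbol e m (poly Y x)"

lemma bump_has_real_derivative:
  assumes e: "e > 0"
  shows "(bump e Y Q m has_real_derivative
    bump e Y (pderiv Q * Y^2 + Q * pderiv Y * ([:e:] - smult (real m) Y)) (m + 2) x) (at x)"
proof -
  have chain: "((\<lambda>x. heat_symbol e m (poly Y x)) has_real_derivative
      ((e - real m * poly Y x) * heat_symbol e (m + 2) (poly Y x)) * poly (pderiv Y) x) (at x)"
    by (rule DERIV_chain2[OF heat_symbol_has_real_derivative[OF e] poly_DERIV])
  have "((\<lambda>x. poly Q x * heat_symbol e m (poly Y x)) has_real_derivative
      poly Q x * (((e - real m * poly Y x) * heat_symbol e (m + 2) (poly Y x)) * poly (pderiv Y) x)
        + poly (pderiv Q) x * heat_symbol e m (poly Y x)) (at x)" by (rule DERIV_mult'[OF poly_DERIV chain])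
  moreover have "heat_symbol e m (poly Y x) = (poly Y x)^2 * heat_symbol e (m + 2) (poly Y x)"
    using heat_symbol_Suc[of "poly Y x" e m] heat_symbol_Suc[of "poly Y x" e "Suc m"] by (simp add: numeral_2_eq_2 mult.assoc)
  ultimately show ?thesis by (simp add: bump_def[abs_def] algebra_simps)
qed

lemma bump_higher_deriv:
  assumes e: "e > 0"
  shows "\<exists>R l. (deriv ^^ k) (bump e Y Q m) = bump e Y R l"
proof (induction k)
  case (Suc k)
  then obtain R l where R: "(deriv ^^ k) (bump e Y Q m) = bump e Y R l" by blast
  have "deriv (bump e Y R l) = bump e Y (pderiv R * Y^2 + R * pderiv Y * ([:e:] - smult (real l) Y)) (l + 2)"
    by (rule ext, rule DERIV_imp_deriv, rule bump_has_real_derivative[OF e])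
  thus ?case using R by auto
qed auto

lemma bump_diff_higher_deriv:
  assumes e: "e1 > 0" "e2 > 0"
  shows "(deriv ^^ k) (\<lambda>x. p * bump e1 Y1 Q1 m1 x - q * bump e2 Y2 Q2 m2 x) =
    (\<lambda>x. p * (deriv ^^ k) (bump e1 Y1 Q1 m1) x - q * (deriv ^^ k) (bump e2 Y2 Q2 m2) x)"
proof (induction k)
  case (Suc k)
  obtain R1 l1 R2 l2 where R: "(deriv ^^ k) (bump e1 Y1 Q1 m1) = bump e1 Y1 R1 l1" "(deriv ^^ k) (bump e2 Y2 Q2 m2) = bump e2 Y2 R2 l2"
    using bump_higher_deriv[OF e(1)] bump_higher_deriv[OF e(2)] by meson
  have "deriv (\<lambda>x. p * bump e1 Y1 R1 l1 x - q * bump e2 Y2 R2 l2 x) =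
      (\<lambda>x. p * deriv (bump e1 Y1 R1 l1) x - q * deriv (bump e2 Y2 R2 l2) x)" by (rule ext, rule DERIV_imp_deriv)
      (auto intro!: derivative_eq_intros bump_has_real_derivative e
        simp: DERIV_imp_deriv[OF bump_has_real_derivative[OF e(1)]] DERIV_imp_deriv[OF bump_has_real_derivative[OF e(2)]])
  thus ?case using Suc R by simp
qed simp

text \<open>Positive exactly between \<open>u\<close> and \<open>v\<close> for \<open>u < v\<close>.
  As \<open>e\<close> decreases to \<open>0\<close> the function increases to the indicator, because
  there the symbol is \<open>exp (- e / b)\<close>.\<close>

definition bump_on :: "real \<Rightarrow> real \<Rightarrow> real \<Rightarrow> real \<Rightarrow> real" where
  "bump_on e u v x = heat_symbol e 0 ((x - u) * (v - x))"

lemma bump_on_eq: "bump_on e u v = bump e ([:- u, 1:] * [:v, -1:]) 1 0"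
proof (rule ext)
  fix x
  have "poly ([:- u, 1:] * [:v, -1:]) x = (x - u) * (v - x)" by (simp only: poly_mult) simp
  thus "bump_on e u v x = bump e ([:- u, 1:] * [:v, -1:]) 1 0 x" by (simp only: bump_on_def bump_def poly_1 mult_1)
qed

lemma continuous_on_bump_on: "e > 0 \<Longrightarrow> continuous_on A (bump_on e u v)"
  unfolding bump_on_eq by (rule DERIV_continuous_on, rule has_field_derivative_at_within, rule bump_has_real_derivative)

lemma bump_on_zero: "u \<le> v \<Longrightarrow> x \<le> u \<or> v \<le> x \<Longrightarrow> bump_on e u v x = 0"
  by (auto simp: bump_on_def heat_symbol_def mult_nonneg_nonpos mult_nonneg_nonpos2 mult_nonpos_nonneg)

lemma bump_on_pos: "u < x \<Longrightarrow> x < v \<Longrightarrow> 0 < bump_on e u v x"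
  using mult_pos_pos[of "x - u" "v - x"] by (simp add: bump_on_def heat_symbol_def not_le)

lemma bump_on_bounds: "e \<ge> 0 \<Longrightarrow> 0 \<le> bump_on e u v x \<and> bump_on e u v x \<le> 1"
  by (auto simp: bump_on_def heat_symbol_def)

lemma tendsto_bump_on:
  assumes "u < v"
  shows "(\<lambda>n. bump_on (inverse (real (Suc n))) u v x) \<longlonglongrightarrow> indicator {u<..<v} x"
proof (cases "u < x \<and> x < v")
  case True
  hence y: "(x - u) * (v - x) > 0" by simp
  have "(\<lambda>n. exp (- inverse (real (Suc n)) / ((x - u) * (v - x)))) \<longlonglongrightarrow> exp (- 0 / ((x - u) * (v - x)))"
    by (intro tendsto_intros LIMSEQ_inverse_real_of_nat) (use True in auto)
  moreover have "((x - u) * (v - x) \<le> 0) = False" using y by (simp only: not_le[symmetric] not_False_eq_True)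
  moreover have "indicator {u<..<v} x = (1::real)" using True by simp
  ultimately show ?thesis by (simp only: bump_on_def heat_symbol_def if_False power_0 div_by_1) simp
next
  case False
  thus ?thesis using bump_on_zero[of u v x] assms by (auto simp: indicator_def)
qed

lemma integral_bump_on_pos:
  assumes "e > 0" "0 \<le> u" "u < v" "v \<le> 1"
  shows "0 < integral {0..1} (bump_on e u v)"
proof -
  have i: "(bump_on e u v) integrable_on {0..1}" by (intro integrable_continuous_interval continuous_on_bump_on assms)
  have "integral {0..1} (bump_on e u v) \<noteq> 0"
  proof
    assume "integral {0..1} (bump_on e u v) = 0"
    hence "\<forall>x\<in>{0..1}. bump_on e u v x = 0"
      using integral_eq_0_iff[of 0 1 "bump_on e u v"] bump_on_bounds[of e u v] assms by (simp add: continuous_on_bump_on)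
    thus False using bump_on_pos[of u "(u + v) / 2" v e] assms by force
  qed
  moreover have "0 \<le> integral {0..1} (bump_on e u v)" by (intro integral_nonneg i) (use bump_on_bounds assms in auto)
  ultimately show ?thesis by simp
qed

text \<open>Differences of normalised bumps have mean zero, so their primitives are test functions.\<close>

lemma test_function_of_bumps:
  assumes e: "e1 > 0" "e2 > 0" and u: "0 < u1" "u1 < v1" "v1 < 1" "0 < u2" "u2 < v2" "v2 < 1"
    and pq: "p * integral {0..1} (bump_on e1 u1 v1) = q * integral {0..1} (bump_on e2 u2 v2)"
  defines "g \<equiv> \<lambda>x. p * bump_on e1 u1 v1 x - q * bump_on e2 u2 v2 x"
  obtains \<phi> where "test_function \<phi>" "deriv \<phi> = g"
proof -
  define \<phi> where "\<phi> x = integral {0..x} g" for x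
  define m where "m = min u1 u2"
  define M where "M = max v1 v2"
  have mM: "0 < m" "m < M" "M < 1" using u by (auto simp: m_def M_def)
  have cont: "continuous_on A g" for A unfolding g_def by (intro continuous_intros continuous_on_bump_on e)
  have g0: "g x = 0" if "x \<le> m \<or> M \<le> x" for x using that u by (auto simp: g_def bump_on_zero m_def M_def)
  have \<phi>0: "\<phi> x = 0" if "x \<le> m" for x
  proof -
    have "integral {0..x} g = integral {0..x} (\<lambda>_. 0)" using that by (intro integral_cong g0) auto
    thus ?thesis by (simp add: \<phi>_def)
  qed
  have int: "g integrable_on {a..b}" for a b by (intro integrable_continuous_interval cont)
  have i01: "integral {0..1} g = 0" unfolding g_def
    by (subst Henstock_Kurzweil_Integration.integral_diff; (intro integrable_continuous_interval continuous_intros continuous_on_bump_on e)?)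
      (simp add: pq)
  have \<phi>1: "\<phi> x = 0" if "M \<le> x" for x
  proof -
    have z: "integral {M..b} g = 0" if "M \<le> b" for b
    proof -
      have "integral {M..b} g = integral {M..b} (\<lambda>_. 0)" by (intro integral_cong g0) auto
      thus ?thesis by simp
    qed
    have s: "integral {0..b} g = integral {0..M} g" if "M \<le> b" for b
      using Henstock_Kurzweil_Integration.integral_combine[where a = 0 and c = M and b = b and f = g] mM that int z[OF that] by simp
    show ?thesis using s[OF that] s[of 1] i01 mM by (simp add: \<phi>_def)
  qed
  have \<phi>': "(\<phi> has_real_derivative g x) (at x)" for x
  proof (cases "x < m")
    case True
    have "\<forall>\<^sub>F y in nhds x. \<phi> y = 0"
      using eventually_nhds_in_open[of "{..<m}" x] True by (auto elim!: eventually_mono simp: \<phi>0)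
    hence "(\<phi> has_real_derivative 0) (at x)" by (subst DERIV_cong_ev[OF refl _ refl]) auto
    thus ?thesis using True g0 by simp
  next
    case False
    hence x: "0 < x" "x < x + 1" using mM by auto
    have "(\<phi> has_real_derivative g x) (at x within {0..x + 1})"
      unfolding \<phi>_def[abs_def] by (rule integral_has_real_derivative[OF cont]) (use x in auto)
    thus ?thesis using x by (simp add: at_within_Icc_at)
  qed
  have d\<phi>: "deriv \<phi> = g" by (rule ext, rule DERIV_imp_deriv, rule \<phi>')
  have "(deriv ^^ k) \<phi> differentiable_on UNIV" for k
  proof (cases k)
    case 0
    thus ?thesis using \<phi>' by (auto simp: differentiable_on_def real_differentiable_def)
  next
    case (Suc k')
    let ?b1 = "bump e1 ([:- u1, 1:] * [:v1, -1:]) 1 0" and ?b2 = "bump e2 ([:- u2, 1:] * [:v2, -1:]) 1 0"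
    obtain R1 l1 R2 l2 where R: "(deriv ^^ k') ?b1 = bump e1 ([:- u1, 1:] * [:v1, -1:]) R1 l1"
        "(deriv ^^ k') ?b2 = bump e2 ([:- u2, 1:] * [:v2, -1:]) R2 l2"
      using bump_higher_deriv[OF e(1)] bump_higher_deriv[OF e(2)] by meson
    have "(deriv ^^ k) \<phi> = (\<lambda>x. p * (deriv ^^ k') ?b1 x - q * (deriv ^^ k') ?b2 x)"
      unfolding Suc funpow_Suc_right o_apply d\<phi> g_def bump_on_eq by (simp only: bump_diff_higher_deriv[OF e])
    moreover have "(\<lambda>x. p * bump e1 ([:- u1, 1:] * [:v1, -1:]) R1 l1 x - q * bump e2 ([:- u2, 1:] * [:v2, -1:]) R2 l2 x) differentiable_on UNIV"
    proof (intro differentiable_on_diff differentiable_on_mult differentiable_on_const)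
      show "bump e1 ([:- u1, 1:] * [:v1, -1:]) R1 l1 differentiable_on UNIV" "bump e2 ([:- u2, 1:] * [:v2, -1:]) R2 l2 differentiable_on UNIV"
        using bump_has_real_derivative[OF e(1)] bump_has_real_derivative[OF e(2)]
        unfolding differentiable_on_def real_differentiable_def by blast+
    qed
    ultimately show ?thesis unfolding R by simp
  qed
  moreover have "closure {x. \<phi> x \<noteq> 0} \<subseteq> {0<..<1}"
  proof -
    have "closure {x. \<phi> x \<noteq> 0} \<subseteq> {m..M}"
    proof (intro closure_minimal subsetI)
      fix x assume "x \<in> {x. \<phi> x \<noteq> 0}"
      thus "x \<in> {m..M}" using \<phi>0[of x] \<phi>1[of x] by (cases "x \<le> m"; cases "M \<le> x") auto
    qed simp
    thus ?thesis using mM by auto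
  qed
  ultimately have "test_function \<phi>" by (simp add: test_function_def)
  thus thesis using d\<phi> by (rule that)
qed

lemma test_functionD:
  assumes "test_function \<phi>"
  shows "(\<phi> has_real_derivative deriv \<phi> x) (at x)" "continuous_on A (deriv \<phi>)" "continuous_on A \<phi>" "\<phi> 0 = 0" "\<phi> 1 = 0"
proof -
  have d: "(deriv ^^ k) \<phi> differentiable_on UNIV" for k using assms by (simp add: test_function_def)
  have "\<phi> differentiable (at x)" for x using d[of 0] by (simp add: differentiable_on_def)
  thus "(\<phi> has_real_derivative deriv \<phi> x) (at x)" using DERIV_deriv_iff_real_differentiable by blast
  have "continuous_on UNIV ((deriv ^^ k) \<phi>)" for k by (rule differentiable_imp_continuous_on[OF d])
  from continuous_on_subset[OF this[of 1] subset_UNIV] continuous_on_subset[OF this[of 0] subset_UNIV]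
  show "continuous_on A (deriv \<phi>)" "continuous_on A \<phi>" by simp_all
  have "closure {x. \<phi> x \<noteq> 0} \<subseteq> {0<..<1}" using assms by (simp add: test_function_def)
  hence "x \<in> {0<..<1}" if "\<phi> x \<noteq> 0" for x using that closure_subset[of "{x. \<phi> x \<noteq> 0}"] by auto
  thus "\<phi> 0 = 0" "\<phi> 1 = 0" by force+
qed

section \<open>Test functions and the lemma of du Bois-Reymond\<close>

lemma continuous_measurable_unit_leb:
  "continuous_on {0..1} f \<Longrightarrow> f \<in> borel_measurable U"
  by (rule continuous_imp_measurable_on_sets_lebesgue[OF continuous_on_subset]) auto

lemma continuous_scaleR_integrable:
  fixes g :: "real \<Rightarrow> real" and f :: "real \<Rightarrow> complex"
  assumes g: "continuous_on {0..1} g" and f: "integrable U f"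
  shows "integrable U (\<lambda>x. g x *\<^sub>R f x)"
proof -
  have [measurable]: "g \<in> borel_measurable U" "f \<in> borel_measurable U" using continuous_measurable_unit_leb[OF g] f by auto
  have "bounded (g ` {0..1})" by (intro compact_imp_bounded compact_continuous_image g) simp
  then obtain C where C: "\<And>s. s \<in> {0..1} \<Longrightarrow> norm (g s) \<le> C" unfolding bounded_iff by blast
  show ?thesis
  proof (rule Bochner_Integration.integrable_bound)
    show "integrable U (\<lambda>x. C * norm (f x))" using f by simp
    show "AE x in U. norm (g x *\<^sub>R f x) \<le> norm (C * norm (f x))"
    proof (rule AE_I2)
      fix x assume "x \<in> space U"
      hence "norm (g x) \<le> C" using C by simp
      hence "norm (g x) * norm (f x) \<le> C * norm (f x)" by (rule mult_right_mono) simp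
      also have "\<dots> \<le> norm (C * norm (f x))" by simp
      finally show "norm (g x *\<^sub>R f x) \<le> norm (C * norm (f x))" by simp
    qed
  qed measurable
qed

lemma prim_deriv_test_function:
  assumes \<phi>: "test_function \<phi>" and y: "0 \<le> y" "y \<le> 1"
  shows "prim (\<lambda>x. deriv \<phi> x *\<^sub>R z) y = \<phi> y *\<^sub>R z"
proof -
  note td = test_functionD[OF \<phi>]
  have "((\<lambda>x. deriv \<phi> x) has_integral (\<phi> y - \<phi> 0)) {0..y}"
    using y td(1) by (intro fundamental_theorem_of_calculus)
      (auto simp: has_real_derivative_iff_has_vector_derivative[symmetric] intro: has_field_derivative_at_within)
  hence i: "integral {0..y} (deriv \<phi>) = \<phi> y" using td(4) by (simp add: integral_unique)
  have int: "integrable U (\<lambda>x. indicator {0..<y} x * deriv \<phi> x)"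
  proof (rule integrable_indicator_mult)
    have "integrable U (\<lambda>x. deriv \<phi> x *\<^sub>R (1 :: complex))" by (rule continuous_scaleR_integrable[OF td(2)]) simp
    hence "integrable U (\<lambda>x. Re (deriv \<phi> x *\<^sub>R (1 :: complex)))" by (rule integrable_Re)
    thus "integrable U (deriv \<phi>)" by simp
  qed simp
  have "prim (\<lambda>x. deriv \<phi> x *\<^sub>R z) y = (LINT x|U. (indicator {0..<y} x * deriv \<phi> x) *\<^sub>R z)"
    unfolding prim_def by (rule Bochner_Integration.integral_cong) (auto simp: indicator_def)
  also have "\<dots> = (LINT x|U. indicator {0..<y} x * deriv \<phi> x) *\<^sub>R z" using int by (intro integral_scaleR_left)
  also have "(LINT x|U. indicator {0..<y} x * deriv \<phi> x) = \<phi> y" using integral_unit_leb_Icc[OF td(2) order_refl y] i by simp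
  finally show ?thesis .
qed

lemma integral_deriv_test_function: "test_function \<phi> \<Longrightarrow> (LINT x|U. deriv \<phi> x *\<^sub>R (z::complex)) = 0"
  using prim_deriv_test_function[of \<phi> 1 z] test_functionD(5)[of \<phi>] by (simp add: prim_1)

lemma prim_integration_by_parts:
  assumes \<phi>: "test_function \<phi>" and f: "integrable U f"
  shows "(LINT x|U. deriv \<phi> x *\<^sub>R prim f x) = - (LINT x|U. \<phi> x *\<^sub>R f x)"
proof -
  note td = test_functionD[OF \<phi>]
  have pint: "integrable U (prim f)" by (rule unit_leb.integrable_const_bound[where B = "LINT y|U. norm (f y)"])
      (auto intro: norm_prim_le[OF f] borel_measurable_prim[OF f])
  have i1: "integrable U (\<lambda>x. deriv \<phi> x *\<^sub>R prim f x)" by (rule continuous_scaleR_integrable[OF td(2) pint])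
  have i2: "integrable U (\<lambda>x. \<phi> x *\<^sub>R f x)" by (rule continuous_scaleR_integrable[OF td(3) f])
  have "(LINT x|U. deriv \<phi> x *\<^sub>R prim f x) \<bullet> z = - (LINT x|U. \<phi> x *\<^sub>R f x) \<bullet> z" for z
  proof -
    have h: "integrable U (\<lambda>x. deriv \<phi> x *\<^sub>R z)" by (rule continuous_scaleR_integrable[OF td(2)]) simp
    have "(LINT x|U. deriv \<phi> x *\<^sub>R prim f x) \<bullet> z = (LINT x|U. (deriv \<phi> x *\<^sub>R prim f x) \<bullet> z)"
      using i1 by (intro integral_inner_left[symmetric])
    also have "\<dots> = (LINT x|U. prim f x \<bullet> (deriv \<phi> x *\<^sub>R z))" by simp
    also have "\<dots> = (LINT y|U. f y \<bullet> (prim (\<lambda>x. deriv \<phi> x *\<^sub>R z) 1 - prim (\<lambda>x. deriv \<phi> x *\<^sub>R z) y))"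
      by (rule prim_inner_fubini[OF f h])
    also have "\<dots> = (LINT y|U. - ((\<phi> y *\<^sub>R f y) \<bullet> z))"
      by (rule Bochner_Integration.integral_cong) (auto simp: prim_deriv_test_function[OF \<phi>] td(5))
    also have "\<dots> = - ((LINT y|U. \<phi> y *\<^sub>R f y) \<bullet> z)"
      using i2 by (subst integral_minus) (simp add: integral_inner_left del: inner_scaleR_left)
    finally show ?thesis by simp
  qed
  thus ?thesis by (metis vector_eq_rdot)
qed

text \<open>All normalized bumps give \<open>r\<close> the same mean \<open>k\<close>, since their
  differences are derivatives of test functions. Then \<open>r - k\<close> integrates to
  \<open>0\<close> against each bump and, letting the bumps sharpen, over each interval inside
  \<open>(0,1)\<close>.\<close>

lemma du_Bois_Reymond:
  assumes r: "sq_integrable r" and z: "\<And>\<phi>. test_function \<phi> \<Longrightarrow> (LINT x|U. deriv \<phi> x *\<^sub>R r x) = 0"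
  obtains k where "AE x in U. r x = k"
proof -
  have ri: "integrable U r" by (rule sq_integrable_integrable[OF r])
  define A where "A e u v = (LINT x|U. bump_on e u v x *\<^sub>R r x) /\<^sub>R integral {0..1} (bump_on e u v)" for e u v
  \<comment> \<open>The mean against one reference bump; every interior interval would define the
    same number.\<close>
  define k where "k = A 1 (1/3) (2/3)"
  have bi: "integrable U (\<lambda>x. bump_on e u v x *\<^sub>R f x)" if "e > 0" "integrable U f" for e u v and f :: "real \<Rightarrow> complex"
    by (rule continuous_scaleR_integrable[OF continuous_on_bump_on]) (use that in auto)
  have A_eq: "A e u v = k" if e: "e > 0" and u: "0 < u" "u < v" "v < 1" for e u v
  proof -
    let ?p = "inverse (integral {0..1} (bump_on e u v))" and ?q = "inverse (integral {0..1} (bump_on 1 (1/3) (2/3)))"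
    have "?p * integral {0..1} (bump_on e u v) = ?q * integral {0..1} (bump_on 1 (1/3) (2/3))"
      using integral_bump_on_pos[of e u v] integral_bump_on_pos[of 1 "1/3" "2/3"] e u by simp
    then obtain \<phi> where \<phi>: "test_function \<phi>" "deriv \<phi> = (\<lambda>x. ?p * bump_on e u v x - ?q * bump_on 1 (1/3) (2/3) x)"
      by (rule test_function_of_bumps[rotated 8]) (use e u in auto)
    have "0 = (LINT x|U. ?p *\<^sub>R (bump_on e u v x *\<^sub>R r x) - ?q *\<^sub>R (bump_on 1 (1/3) (2/3) x *\<^sub>R r x))"
      using z[OF \<phi>(1)] unfolding \<phi>(2) by (simp only: scaleR_diff_left scaleR_scaleR)
    also have "\<dots> = A e u v - k" using bi[OF e ri, of u v] bi[OF zero_less_one ri, of "1/3" "2/3"] unfolding A_def k_def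
      by (subst Bochner_Integration.integral_diff) (simp_all only: integrable_scaleR_right integral_scaleR_right simp_thms)
    finally show ?thesis by simp
  qed
  define R where "R x = r x - k" for x
  have Rsq: "sq_integrable R" unfolding R_def by (intro sq_integrable_diff r sq_integrable_bounded[where c = "norm k"]) auto
  have Ri: "integrable U R" by (rule sq_integrable_integrable[OF Rsq])
  note [measurable] = sq_integrable_measurable[OF Rsq]
  have zero: "(LINT x|U. bump_on e u v x *\<^sub>R R x) = 0" if e: "e > 0" and u: "0 < u" "u < v" "v < 1" for e u v
  proof -
    have b: "integral {0..1} (bump_on e u v) > 0" using integral_bump_on_pos[of e u v] e u by simp
    have "(LINT x|U. bump_on e u v x *\<^sub>R R x) =
        (LINT x|U. bump_on e u v x *\<^sub>R r x) - (LINT x|U. bump_on e u v x *\<^sub>R k)"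
      unfolding R_def scaleR_diff_right using bi[OF e ri] bi[OF e, of "\<lambda>_. k"]
      by (intro Bochner_Integration.integral_diff) auto
    also have "(LINT x|U. bump_on e u v x *\<^sub>R r x) = integral {0..1} (bump_on e u v) *\<^sub>R k"
      using A_eq[OF e u] b by (simp add: A_def) (metis (no_types) b divideR_right less_numeral_extra(3))
    also have "(LINT x|U. bump_on e u v x *\<^sub>R k) = integral {0..1} (bump_on e u v) *\<^sub>R k"
    proof -
      have "integrable U (\<lambda>x. Re (bump_on e u v x *\<^sub>R (1 :: complex)))" by (rule integrable_Re, rule bi[OF e]) simp
      hence i: "integrable U (bump_on e u v)" by simp
      have "(LINT x|U. bump_on e u v x) = (LINT x|U. indicator {0..<1} x * bump_on e u v x)"
        by (rule Bochner_Integration.integral_cong) auto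
      also have "\<dots> = integral {0..1} (bump_on e u v)" by (intro integral_unit_leb_Icc continuous_on_bump_on e) auto
      finally show ?thesis using i by (simp add: integral_scaleR_left)
    qed
    finally show ?thesis by simp
  qed
  have ind: "(LINT x|U. indicator {u<..<v} x *\<^sub>R R x) = 0" if u: "0 < u" "u < v" "v < 1" for u v
  proof -
    have "(\<lambda>n. LINT x|U. bump_on (inverse (real (Suc n))) u v x *\<^sub>R R x) \<longlonglongrightarrow> (LINT x|U. indicator {u<..<v} x *\<^sub>R R x)"
    proof (rule integral_dominated_convergence[where w = "\<lambda>x. norm (R x)"])
      show "AE x in U. (\<lambda>n. bump_on (inverse (real (Suc n))) u v x *\<^sub>R R x) \<longlonglongrightarrow> indicator {u<..<v} x *\<^sub>R R x"
        by (intro AE_I2 tendsto_scaleR tendsto_bump_on u tendsto_const)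
      show "AE x in U. norm (bump_on (inverse (real (Suc n))) u v x *\<^sub>R R x) \<le> norm (R x)" for n
        using bump_on_bounds[of "inverse (real (Suc n))" u v] by (intro AE_I2) (auto intro: mult_left_le_one_le)
      show "(\<lambda>x. bump_on (inverse (real (Suc n))) u v x *\<^sub>R R x) \<in> borel_measurable U" for n
        using bi[OF _ Ri, of "inverse (real (Suc n))" u v] by auto
    qed (use Ri in auto)
    thus ?thesis using zero[OF _ u] by (simp add: LIMSEQ_const_iff)
  qed
  have const: "prim R v = prim R u" if u: "0 < u" "u < v" "v < 1" for u v
  proof -
    have "prim R v - prim R u = (LINT x|U. indicator {u<..<v} x *\<^sub>R R x)" unfolding prim_diff_eq[OF Ri less_imp_le[OF u(2)]]
    proof (rule integral_cong_AE)
      show "AE x in U. indicator {u..<v} x *\<^sub>R R x = indicator {u<..<v} x *\<^sub>R R x"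
        using AE_unit_leb_neq[of u] by eventually_elim (auto simp: indicator_def)
    qed measurable
    thus ?thesis using ind[OF u] by simp
  qed
  have "prim R x = 0" if x: "0 \<le> x" "x \<le> 1" for x
  proof -
    have c: "continuous_on {0..1} (prim R)" by (rule continuous_on_prim[OF Ri])
    have half: "prim R y = prim R (1/2)" if "0 < y" "y < 1" for y
    proof (cases y "1/2 :: real" rule: linorder_cases)
      case less
      thus ?thesis using const[of y "1/2"] that by simp
    next
      case greater
      thus ?thesis using const[of "1/2" y] that by simp
    qed (simp only:)
    have cl: "closure {0<..<1 :: real} = {0..1}" by simp
    have *: "prim R y = prim R (1/2)" if "y \<in> {0..1}" for y
    proof (rule continuous_constant_on_closure[where f = "prim R" and S = "{0<..<1}"])
      show "continuous_on (closure {0<..<1 :: real}) (prim R)" using c by (simp only: cl)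
      show "y \<in> closure {0<..<1}" using that by (simp only: cl)
      show "prim R x = prim R (1/2)" if "x \<in> {0<..<1}" for x using that half[of x] by (simp only: greaterThanLessThan_iff)
    qed
    show ?thesis using *[of x] *[of 0] x prim_0[of R] by simp
  qed
  moreover have "prim (rep_L2 (L2_of R)) x = prim R x" for x by (rule prim_cong[OF rep_L2_of[OF Rsq]]) auto
  ultimately have "L2_of R = 0" by (intro L2_eq_0_of_prim) simp
  hence "L2_of R = L2_of (\<lambda>x. 0)" by (simp add: L2_of_zero)
  hence "AE x in U. R x = 0" by (simp only: L2_of_eq_iff[OF Rsq sq_integrable_zero])
  thus thesis by (intro that[of k]) (auto simp: R_def)
qed

lemma sq_integrable_AE_bounded_scaleR:
  assumes [measurable]: "b \<in> borel_measurable U" and b: "AE x in U. \<bar>b x\<bar> \<le> C" and f: "sq_integrable f"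
  shows "sq_integrable (\<lambda>x. b x *\<^sub>R f x)"
proof -
  note [measurable] = sq_integrable_measurable[OF f]
  show ?thesis
  proof (rule sq_integrableI)
    show "integrable U (\<lambda>x. (norm (b x *\<^sub>R f x))^2)"
    proof (rule Bochner_Integration.integrable_bound)
      show "integrable U (\<lambda>x. C^2 * (norm (f x))^2)" using f by (simp add: sq_integrable_def)
      show "AE x in U. norm ((norm (b x *\<^sub>R f x))^2) \<le> norm (C^2 * (norm (f x))^2)" using b
      proof eventually_elim
        case (elim x)
        have "(norm (b x *\<^sub>R f x))^2 = \<bar>b x\<bar>^2 * (norm (f x))^2" by (simp add: power_mult_distrib)
        also have "\<dots> \<le> C^2 * (norm (f x))^2" by (intro mult_right_mono power_mono elim) auto
        finally show ?case by simp
      qed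
    qed measurable
  qed measurable
qed

section \<open>Identification of the differential operator with the inverse of
  \<open>inv_op\<close>\<close>

lemma weak_deriv_prim:
  assumes w: "weak_deriv F G"
  obtains k where "AE x in U. rep_L2 F x = k + prim (rep_L2 G) x"
proof -
  have psq: "sq_integrable (prim (rep_L2 G))"
    by (rule sq_integrable_bounded[where c = "norm G"]) (auto intro: norm_prim_rep_le borel_measurable_prim)
  have sq: "sq_integrable (\<lambda>x. rep_L2 F x - prim (rep_L2 G) x)" by (rule sq_integrable_diff[OF sq_integrable_rep psq])
  obtain k where "AE x in U. rep_L2 F x - prim (rep_L2 G) x = k"
  proof (rule du_Bois_Reymond[OF sq])
    fix \<phi> assume \<phi>: "test_function \<phi>"
    note td = test_functionD[OF \<phi>]
    have "(LINT x|U. deriv \<phi> x *\<^sub>R (rep_L2 F x - prim (rep_L2 G) x)) =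
        (LINT x|U. deriv \<phi> x *\<^sub>R rep_L2 F x) - (LINT x|U. deriv \<phi> x *\<^sub>R prim (rep_L2 G) x)"
      unfolding scaleR_diff_right by (rule Bochner_Integration.integral_diff; rule continuous_scaleR_integrable[OF td(2)])
        (simp_all add: sq_integrable_integrable[OF psq])
    also have "\<dots> = 0" using w \<phi> by (simp add: weak_deriv_def prim_integration_by_parts[OF \<phi>])
    finally show "(LINT x|U. deriv \<phi> x *\<^sub>R (rep_L2 F x - prim (rep_L2 G) x)) = 0" .
  qed
  hence "AE x in U. rep_L2 F x = k + prim (rep_L2 G) x" by eventually_elim (simp add: algebra_simps)
  thus thesis by (rule that)
qed

lemma weak_deriv_of_prim:
  assumes F: "AE x in U. rep_L2 F x = k + prim (rep_L2 G) x"
  shows "weak_deriv F G"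
  unfolding weak_deriv_def
proof (intro allI impI)
  fix \<phi> assume \<phi>: "test_function \<phi>"
  note td = test_functionD[OF \<phi>]
  note [measurable] = continuous_measurable_unit_leb[OF td(2)] borel_measurable_prim[OF rep_L2_integrable, of G]
  have psq: "sq_integrable (prim (rep_L2 G))" by (rule sq_integrable_bounded[where c = "norm G"]) (auto intro: norm_prim_rep_le)
  have "(LINT x|U. deriv \<phi> x *\<^sub>R rep_L2 F x) = (LINT x|U. deriv \<phi> x *\<^sub>R k + deriv \<phi> x *\<^sub>R prim (rep_L2 G) x)"
    by (rule integral_cong_AE) (use F in "auto elim!: eventually_mono simp: scaleR_add_right")
  also have "\<dots> = (LINT x|U. deriv \<phi> x *\<^sub>R k) + (LINT x|U. deriv \<phi> x *\<^sub>R prim (rep_L2 G) x)"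
    by (rule Bochner_Integration.integral_add; rule continuous_scaleR_integrable[OF td(2)])
      (simp_all add: sq_integrable_integrable[OF psq])
  finally show "(LINT x|U. deriv \<phi> x *\<^sub>R rep_L2 F x) = - (LINT x|U. \<phi> x *\<^sub>R rep_L2 G x)"
    by (simp add: integral_deriv_test_function[OF \<phi>] prim_integration_by_parts[OF \<phi>])
qed

context coefficient
begin

lemma abs_c_le: "AE x in U. \<bar>c x\<bar> \<le> K" and abs_inverse_c_le: "AE x in U. \<bar>inverse (c x)\<bar> \<le> K"
  and c_neq_0: "AE x in U. c x \<noteq> 0"
proof -
  have *: "AE x in U. 0 < c x \<and> c x \<le> K \<and> inverse (c x) \<le> K" using c_bounds inverse_c_bounds
  proof eventually_elim
    case (elim x)
    have "0 < 1 / K" using K by simp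
    thus ?case using elim by linarith
  qed
  show "AE x in U. \<bar>c x\<bar> \<le> K" using * by eventually_elim simp
  show "AE x in U. \<bar>inverse (c x)\<bar> \<le> K" using * by eventually_elim simp
  show "AE x in U. c x \<noteq> 0" using * by eventually_elim simp
qed

lemma sq_integrable_flux: "sq_integrable (flux c F)" by (rule sq_integrable_bounded[where c = "2 * norm F"]) (auto intro: norm_flux_le)

lemma divergence_op_inv_op: "divergence_op c (inv_op c F) (- F)"
proof -
  define q where "q x = inverse (c x) *\<^sub>R flux c F x" for x
  have q: "sq_integrable q"
    unfolding q_def by (rule sq_integrable_AE_bounded_scaleR[OF _ abs_inverse_c_le sq_integrable_flux]) measurable
  note [measurable] = sq_integrable_measurable[OF q]
  have repF: "AE x in U. rep_L2 (inv_op c F) x = sol c F x" unfolding inv_op_def by (rule rep_L2_of[OF sq_integrable_sol])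
  have repG: "AE x in U. rep_L2 (L2_of q) x = q x" by (rule rep_L2_of[OF q])
  have "sol c F x = prim (rep_L2 (L2_of q)) x" for x
    unfolding sol_def q_def[symmetric] by (rule prim_cong[symmetric, OF repG]) measurable
  hence w1: "weak_deriv (inv_op c F) (L2_of q)" by (intro weak_deriv_of_prim[where k = 0]) (use repF in simp)
  have Qsq: "sq_integrable (\<lambda>x. c x *\<^sub>R rep_L2 (L2_of q) x)"
    by (rule sq_integrable_AE_bounded_scaleR[OF _ abs_c_le sq_integrable_rep]) measurable
  have "AE x in U. rep_L2 (L2_of (\<lambda>x. c x *\<^sub>R rep_L2 (L2_of q) x)) x = mean_flux c F + prim (rep_L2 (- F)) x"
    using rep_L2_of[OF Qsq] repG c_neq_0 by eventually_elim (use prim_rep_scaleR[of "-1" F] in "simp add: q_def flux_def")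
  hence w2: "weak_deriv (L2_of (\<lambda>x. c x *\<^sub>R rep_L2 (L2_of q) x)) (- F)" by (rule weak_deriv_of_prim)
  have "inv_op c F \<in> H1_0" unfolding H1_0_def H1_def using w1 repF continuous_on_sol[of "{0..1}" F]
    by (auto intro!: exI[of _ "sol c F"])
  thus ?thesis unfolding divergence_op_def using w1 w2 by blast
qed

text \<open>Integrating both weak derivatives leaves two constants: the boundary value at
  \<open>0\<close> makes the first one vanish, the one at \<open>1\<close> turns the second into the
  mean flux.\<close>

lemma inv_op_of_divergence_op:
  assumes "divergence_op c F H"
  shows "F = inv_op c (- H)"
proof -
  define G0 where "G0 = - H"
  obtain G w where w1: "weak_deriv F G" and w2: "weak_deriv (L2_of (\<lambda>x. c x *\<^sub>R rep_L2 G x)) H"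
    and w: "continuous_on {0..1} w" "w 0 = 0" "w 1 = 0" "AE x in U. rep_L2 F x = w x"
    using assms unfolding divergence_op_def H1_0_def by auto
  obtain k1 where k1: "AE x in U. rep_L2 F x = k1 + prim (rep_L2 G) x" by (rule weak_deriv_prim[OF w1])
  obtain k2 where k2: "AE x in U. rep_L2 (L2_of (\<lambda>x. c x *\<^sub>R rep_L2 G x)) x = k2 + prim (rep_L2 H) x"
    by (rule weak_deriv_prim[OF w2])
  have Qsq: "sq_integrable (\<lambda>x. c x *\<^sub>R rep_L2 G x)"
    by (rule sq_integrable_AE_bounded_scaleR[OF _ abs_c_le sq_integrable_rep]) measurable
  have w_eq: "w x = k1 + prim (rep_L2 G) x" if "0 \<le> x" "x \<le> 1" for x
  proof (rule continuous_AE_eq_imp_eq[OF w(1) _ _ that])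
    show "continuous_on {0..1} (\<lambda>x. k1 + prim (rep_L2 G) x)" by (intro continuous_intros continuous_on_prim) simp
    show "AE x in U. w x = k1 + prim (rep_L2 G) x" using w(4) k1 by eventually_elim simp
  qed
  have k1_0: "k1 = 0" using w_eq[of 0] w(2) by simp
  have G_int: "(LINT x|U. rep_L2 G x) = 0" using w_eq[of 1] w(3) k1_0 by (simp add: prim_1)
  have G0H: "prim (rep_L2 G0) x = - prim (rep_L2 H) x" for x using prim_rep_scaleR[of "-1" H x] by (simp add: G0_def)
  have G: "AE x in U. rep_L2 G x = inverse (c x) *\<^sub>R k2 - inverse (c x) *\<^sub>R prim (rep_L2 G0) x"
    using rep_L2_of[OF Qsq] k2 c_neq_0
  proof eventually_elim
    case (elim x)
    hence "c x *\<^sub>R rep_L2 G x = k2 - prim (rep_L2 G0) x" by (simp add: G0H)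
    hence "inverse (c x) *\<^sub>R (c x *\<^sub>R rep_L2 G x) = inverse (c x) *\<^sub>R (k2 - prim (rep_L2 G0) x)" by simp
    thus ?case using elim by (simp add: scaleR_diff_right)
  qed
  have [measurable]: "prim (rep_L2 G0) \<in> borel_measurable U" by (rule prim_rep_measurable)
  have "0 = (LINT x|U. inverse (c x) *\<^sub>R k2 - inverse (c x) *\<^sub>R prim (rep_L2 G0) x)"
    unfolding G_int[symmetric] by (rule integral_cong_AE[OF _ _ G]) measurable
  also have "\<dots> = (LINT x|U. inverse (c x)) *\<^sub>R k2 - (LINT x|U. inverse (c x) *\<^sub>R prim (rep_L2 G0) x)"
    using inverse_c_integrable integrable_inverse_c_scaleR(1)[OF prim_rep_measurable norm_prim_rep_le, of G0]
    by (subst Bochner_Integration.integral_diff) (simp_all add: integral_scaleR_left)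
  finally have "(LINT x|U. inverse (c x) *\<^sub>R prim (rep_L2 G0) x) = (LINT x|U. inverse (c x)) *\<^sub>R k2" by simp
  hence k2_eq: "k2 = mean_flux c G0" using integral_inverse_c_pos by (simp add: mean_flux_def)
  have "prim (rep_L2 G) x = sol c G0 x" for x unfolding sol_def
  proof (rule prim_cong)
    show "AE x in U. rep_L2 G x = inverse (c x) *\<^sub>R flux c G0 x"
      using G by eventually_elim (simp add: flux_def k2_eq scaleR_diff_right)
  qed measurable
  hence "AE x in U. rep_L2 F x = sol c G0 x" using k1 k1_0 by simp
  hence "L2_of (rep_L2 F) = L2_of (sol c G0)" by (rule L2_of_eqI[OF sq_integrable_rep sq_integrable_sol])
  thus ?thesis by (simp add: L2_of_rep inv_op_def G0_def)
qed

theorem divergence_op_iff: "divergence_op c F H \<longleftrightarrow> F = inv_op c (- H)"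
proof
  show "divergence_op c F H" if "F = inv_op c (- H)" using divergence_op_inv_op[of "- H"] that by simp
qed (rule inv_op_of_divergence_op)

end

section \<open>Homogenization\<close>

lemma AE_lebesgue_affine:
  fixes m :: real
  assumes "AE x in lebesgue. P x" and m: "m \<noteq> 0"
  shows "AE x in lebesgue. P (m * x + d)"
proof -
  obtain N where N: "N \<in> null_sets lebesgue" "{x \<in> space lebesgue. \<not> P x} \<subseteq> N"
    using assms(1) by (auto simp: eventually_ae_filter)
  have sub: "{x. \<not> P (m * x + d)} \<subseteq> (\<lambda>x. inverse m *\<^sub>R x + (- d / m)) ` N"
  proof
    fix x assume "x \<in> {x. \<not> P (m * x + d)}"
    hence "m * x + d \<in> N" using N(2) by auto
    thus "x \<in> (\<lambda>x. inverse m *\<^sub>R x + (- d / m)) ` N" by (rule rev_image_eqI) (use m in "simp add: field_simps")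
  qed
  have "negligible N" using N(1) by (simp add: negligible_iff_null_sets)
  hence "negligible ((\<lambda>x. inverse m *\<^sub>R x + (- d / m)) ` N)"
    by (intro negligible_differentiable_image_negligible) (auto intro!: derivative_intros)
  hence "(\<lambda>x. inverse m *\<^sub>R x + (- d / m)) ` N \<in> null_sets lebesgue" by (simp add: negligible_iff_null_sets)
  thus ?thesis by (rule AE_I') (use sub in auto)
qed

lemma inverse_coefficient_bounds:
  fixes K x :: real
  assumes "K > 0" "1 / K \<le> x" "x \<le> K"
  shows "1 / K \<le> inverse x" "inverse x \<le> K" "x > 0"
proof -
  have "0 < 1 / K" using assms by simp
  thus "x > 0" using assms by linarith
  thus "1 / K \<le> inverse x" "inverse x \<le> K" using assms by (auto simp: field_simps)
qed

locale periodic_coefficient =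
  fixes a :: "real \<Rightarrow> real" and K :: real
  assumes a_measurable [measurable]: "a \<in> borel_measurable lebesgue"
    and a_periodic: "AE x in lebesgue. a (x + 1) = a x"
    and K_pos: "0 < K" and a_bounds: "AE x in lebesgue. 1 / K \<le> a x \<and> a x \<le> K"
begin

lemma K_ge_1: "1 \<le> K"
proof -
  have "\<exists>x. 1 / K \<le> a x \<and> a x \<le> K"
  proof (rule ccontr)
    assume "\<not> ?thesis"
    hence "AE x in lebesgue :: real measure. False" by (intro eventually_mono[OF a_bounds]) auto
    thus False by (simp add: trivial_limit_def[symmetric] ae_filter_eq_bot_iff)
  qed
  hence "1 / K \<le> K" by auto
  hence "1 \<le> K^2" using K_pos by (simp add: field_simps power2_eq_square)
  thus ?thesis using K_pos power2_le_imp_le[of 1 K] by simp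
qed

definition b :: "real \<Rightarrow> real" where "b y = inverse (a y)"

lemma b_measurable [measurable]: "b \<in> borel_measurable lebesgue"
  unfolding b_def by measurable

lemma b_bounds: "AE y in lebesgue. 0 \<le> b y \<and> 1 / K \<le> b y \<and> b y \<le> K"
  using a_bounds
proof eventually_elim
  case (elim y)
  thus ?case using inverse_coefficient_bounds[OF K_pos, of "a y"] by (auto simp: b_def)
qed

lemma b_periodic: "AE y in lebesgue. b (y + 1) = b y"
  using a_periodic by eventually_elim (simp add: b_def)

lemma scaled_measurable [measurable]: "(\<lambda>x. a (m * x)) \<in> borel_measurable lebesgue"
  using measurable_compose[OF lebesgue_measurable_scaling[of m] a_measurable] by simp

lemma b_integrable_Icc: "integrable (lebesgue_on {u..v}) b"
proof -
  interpret finite_measure "lebesgue_on {u..v}" by (rule finite_measure_lebesgue_on) simp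
  show ?thesis
  proof (rule integrable_const_bound[where B = K])
    have "AE y in lebesgue_on {u..v}. 0 \<le> b y \<and> 1 / K \<le> b y \<and> b y \<le> K"
      using b_bounds by (subst AE_restrict_space_iff) auto
    thus "AE y in lebesgue_on {u..v}. norm (b y) \<le> K" by eventually_elim simp
  qed (intro measurable_restrict_space1 b_measurable)
qed

lemma b_integrable_on: "b integrable_on {u..v}"
  using b_integrable_Icc by (rule integrable_on_lebesgue_on) simp

lemma integral_b_bounds:
  assumes "u \<le> v"
  shows "(v - u) / K \<le> integral {u..v} b" "integral {u..v} b \<le> K * (v - u)"
proof -
  interpret finite_measure "lebesgue_on {u..v}" by (rule finite_measure_lebesgue_on) simp
  have ae: "AE y in lebesgue_on {u..v}. 0 \<le> b y \<and> 1 / K \<le> b y \<and> b y \<le> K"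
    using b_bounds by (subst AE_restrict_space_iff) auto
  have eq: "integral {u..v} b = (LINT y|lebesgue_on {u..v}. b y)"
    by (rule lebesgue_integral_eq_integral[OF b_integrable_Icc, symmetric]) simp
  have meas: "measure (lebesgue_on {u..v}) {u..v} = v - u" using assms by (simp add: measure_restrict_space)
  have "(LINT y|lebesgue_on {u..v}. 1 / K) \<le> (LINT y|lebesgue_on {u..v}. b y)"
    by (rule integral_mono_AE[OF _ b_integrable_Icc]) (use ae in "auto elim: eventually_mono")
  thus "(v - u) / K \<le> integral {u..v} b" by (simp add: eq meas)
  have "(LINT y|lebesgue_on {u..v}. b y) \<le> (LINT y|lebesgue_on {u..v}. K)"
    by (rule integral_mono_AE[OF b_integrable_Icc]) (use ae in "auto elim: eventually_mono")
  thus "integral {u..v} b \<le> K * (v - u)" by (simp add: eq meas mult.commute)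
qed

lemma integral_b_shift:
  assumes "0 \<le> x"
  shows "integral {0..x + 1} b = integral {0..1} b + integral {0..x} b"
proof -
  have "integral {0..x} b = integral {0..x} (\<lambda>y. b (y + 1))"
  proof -
    obtain N where N: "N \<in> null_sets lebesgue" "{y. b (y + 1) \<noteq> b y} \<subseteq> N"
      using b_periodic by (auto simp: eventually_ae_filter subset_eq)
    hence neg: "negligible N" by (simp add: negligible_iff_null_sets)
    show ?thesis by (rule integral_spike[OF neg]) (use N in auto)
  qed
  also have "\<dots> = integral {1..x + 1} b"
  proof -
    have "(b has_integral integral {1..x + 1} b) (cbox 1 (x + 1))" using b_integrable_on by (simp add: integrable_integral)
    from has_integral_affinity'[OF this zero_less_one, of 1] show ?thesis by (simp add: integral_unique)
  qed
  finally show ?thesis using Henstock_Kurzweil_Integration.integral_combine[OF _ _ b_integrable_on, of 0 1 "x + 1"] assms by simp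
qed

text \<open>By periodicity the discrepancy depends only on the fractional part of \<open>x\<close>,
  and for that part both terms lie in \<open>[0, K]\<close>.\<close>

lemma integral_b_linear:
  assumes "0 \<le> x"
  shows "\<bar>integral {0..x} b - x * integral {0..1} b\<bar> \<le> K"
proof -
  define m where "m = integral {0..1} b"
  have m: "0 \<le> m" "m \<le> K" using integral_b_bounds[of 0 1] K_pos by (auto simp: m_def intro: order_trans[rotated])
  have shift: "integral {0..y + real n} b = integral {0..y} b + real n * m" if "0 \<le> y" for y n
  proof (induction n)
    case (Suc n)
    have "integral {0..(y + real n) + 1} b = m + integral {0..y + real n} b"
      unfolding m_def by (rule integral_b_shift) (use that in simp)
    thus ?case using Suc by (simp add: algebra_simps)
  qed simp
  define n where "n = nat \<lfloor>x\<rfloor>"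
  define y where "y = x - real n"
  have n: "real n = of_int \<lfloor>x\<rfloor>" using assms by (simp add: n_def)
  hence y: "0 \<le> y" "y \<le> 1" "x = y + real n" unfolding y_def by linarith+
  have "integral {0..x} b - x * m = integral {0..y} b - y * m" using shift[OF y(1), of n] y(3) by (simp add: algebra_simps)
  moreover have "0 \<le> integral {0..y} b" "integral {0..y} b \<le> K"
  proof -
    have "0 \<le> y / K" using y K_pos by simp
    thus "0 \<le> integral {0..y} b" using integral_b_bounds(1)[OF y(1)] by simp
    have "K * y \<le> K * 1" using y K_pos by (intro mult_left_mono) auto
    thus "integral {0..y} b \<le> K" using integral_b_bounds(2)[OF y(1)] by simp
  qed
  moreover have "0 \<le> y * m" "y * m \<le> K" using y m mult_mono[of y 1 m K] by auto
  ultimately show ?thesis unfolding m_def by linarith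
qed

lemma integral_inverse_a: "(LINT y|lebesgue_on {0..1}. 1 / a y) = integral {0..1} b"
  using lebesgue_integral_eq_integral[OF b_integrable_Icc, of 0 1] by (simp add: b_def[abs_def] inverse_eq_divide)

text \<open>The harmonic mean obeys the same bounds as \<open>a\<close>, so the limit problem
  belongs to the same class and shares all constants.\<close>

lemma coefficient_coef:
  assumes "\<epsilon> \<ge> 0"
  shows "coefficient (coef a \<epsilon>) K"
proof (cases "\<epsilon> = 0")
  case True
  have "1 / K \<le> integral {0..1} b" "integral {0..1} b \<le> K" using integral_b_bounds[of 0 1] by auto
  note * = inverse_coefficient_bounds[OF K_pos this]
  have eq: "coef a \<epsilon> = (\<lambda>x. inverse (integral {0..1} b))" by (simp add: coef_def fun_eq_iff True integral_inverse_a)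
  show ?thesis by unfold_locales (use * K_ge_1 in "simp_all add: eq")
next
  case False
  have eq: "coef a \<epsilon> = (\<lambda>x. a (inverse \<epsilon> * x))" using False by (simp add: coef_def fun_eq_iff field_simps)
  have "AE x in lebesgue. 1 / K \<le> a (inverse \<epsilon> * x + 0) \<and> a (inverse \<epsilon> * x + 0) \<le> K"
    by (rule AE_lebesgue_affine[OF a_bounds]) (use False in simp)
  hence "AE x in U. 1 / K \<le> a (inverse \<epsilon> * x) \<and> a (inverse \<epsilon> * x) \<le> K"
    by (subst AE_restrict_space_iff) auto
  thus ?thesis by unfold_locales (auto simp: eq K_ge_1 intro: measurable_restrict_space1 scaled_measurable)
qed

lemma integral_inverse_coef:
  assumes x: "0 \<le> x" "x \<le> 1" and e: "\<epsilon> > 0"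
  shows "(LINT y|U. indicator {..<x} y * inverse (coef a \<epsilon> y)) = \<epsilon> * integral {0..x / \<epsilon>} b"
proof -
  interpret coefficient "coef a \<epsilon>" K by (rule coefficient_coef) (use e in simp)
  have int: "integrable U (\<lambda>y. indicator {..<x} y * inverse (coef a \<epsilon> y))"
    by (rule integrable_indicator_mult[OF inverse_c_integrable]) simp
  have "(b has_integral integral {0..x / \<epsilon>} b) (cbox 0 (x / \<epsilon>))"
    using b_integrable_on by (simp add: integrable_integral)
  from has_integral_affinity'[OF this, of "inverse \<epsilon>" 0] e
  have "((\<lambda>y. b (inverse \<epsilon> *\<^sub>R y + 0)) has_integral (integral {0..x / \<epsilon>} b /\<^sub>R inverse \<epsilon> ^ DIM(real)))
      (cbox ((0 - 0) /\<^sub>R inverse \<epsilon>) ((x / \<epsilon> - 0) /\<^sub>R inverse \<epsilon>))"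
    by (simp only: positive_imp_inverse_positive)
  moreover have "b (inverse \<epsilon> *\<^sub>R y + 0) = b (y / \<epsilon>)" for y by (simp add: divide_inverse mult.commute)
  moreover have "(0 - 0) /\<^sub>R inverse \<epsilon> = (0 :: real)" "(x / \<epsilon> - 0) /\<^sub>R inverse \<epsilon> = x" using e by simp_all
  ultimately have "((\<lambda>y. b (y / \<epsilon>)) has_integral \<epsilon> * integral {0..x / \<epsilon>} b) {0..x}" by simp
  hence "integral {0..x} (\<lambda>y. b (y / \<epsilon>)) = \<epsilon> * integral {0..x / \<epsilon>} b" by (rule integral_unique)
  moreover have "(LINT y|U. indicator {..<x} y * inverse (coef a \<epsilon> y)) = integral {0..x} (\<lambda>y. b (y / \<epsilon>))"
  proof -
    have "(LINT y|U. indicator {..<x} y * inverse (coef a \<epsilon> y)) = integral {0<..<1} (\<lambda>y. indicator {..<x} y * inverse (coef a \<epsilon> y))"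
      using int by (rule lebesgue_integral_eq_integral) simp
    also have "\<dots> = integral UNIV (\<lambda>y. if y \<in> {0<..<1} then indicator {..<x} y * inverse (coef a \<epsilon> y) else 0)"
      by (rule integral_restrict_UNIV[symmetric])
    also have "\<dots> = integral UNIV (\<lambda>y. if y \<in> {0..x} then b (y / \<epsilon>) else 0)"
      by (rule integral_spike[of "{0, 1, x}"]) (use x e in "auto simp: indicator_def coef_def b_def")
    finally show ?thesis by (simp only: integral_restrict_UNIV)
  qed
  ultimately show ?thesis by simp
qed

text \<open>After the substitution \<open>y / \<epsilon>\<close> the bounded discrepancy of
  \<open>integral_b_linear\<close> is multiplied by \<open>\<epsilon>\<close>.\<close>

lemma inverse_coef_primitive_tendsto:
  assumes x: "0 \<le> x" "x \<le> 1" and e: "\<And>n. e n > 0" "e \<longlonglongrightarrow> 0"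
  shows "(\<lambda>n. LINT y|U. indicator {..<x} y * inverse (coef a (e n) y))
     \<longlonglongrightarrow> (LINT y|U. indicator {..<x} y * inverse (coef a 0 y))"
proof -
  define m where "m = integral {0..1} b"
  have lim: "(LINT y|U. indicator {..<x} y * inverse (coef a 0 y)) = x * m"
  proof -
    have "(LINT y|U. indicator {..<x} y * inverse (coef a 0 y)) = (LINT y|U. indicator {..<x} y) * m"
      by (simp add: coef_def integral_inverse_a m_def)
    also have "(LINT y|U. indicator {..<x} y :: real) = (LINT y|U. indicator {0..<x} y * 1)"
      by (rule Bochner_Integration.integral_cong) (auto simp: indicator_def)
    also have "\<dots> = integral {0..x} (\<lambda>_. 1)" by (rule integral_unit_leb_Icc) (use x in auto)
    finally show ?thesis using x by simp
  qed
  have bd: "norm (e n * integral {0..x / e n} b - x * m) \<le> e n * K" for n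
  proof -
    have "\<bar>integral {0..x / e n} b - (x / e n) * m\<bar> \<le> K"
      unfolding m_def by (rule integral_b_linear) (use x e(1)[of n] in simp)
    hence "e n * \<bar>integral {0..x / e n} b - (x / e n) * m\<bar> \<le> e n * K" using e(1)[of n] by (intro mult_left_mono) auto
    moreover have "e n * \<bar>integral {0..x / e n} b - (x / e n) * m\<bar> = \<bar>e n * integral {0..x / e n} b - x * m\<bar>"
      using e(1)[of n] abs_mult[of "e n" "integral {0..x / e n} b - (x / e n) * m"] by (simp add: right_diff_distrib)
    ultimately show ?thesis by (simp only: real_norm_def)
  qed
  have "(\<lambda>n. e n * integral {0..x / e n} b - x * m) \<longlonglongrightarrow> 0"
    by (rule Lim_null_comparison[OF always_eventually tendsto_mult_left_zero[OF e(2), of K]]) (use bd in blast)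
  hence "(\<lambda>n. e n * integral {0..x / e n} b) \<longlonglongrightarrow> x * m" by (rule LIM_zero_cancel)
  thus ?thesis unfolding lim using integral_inverse_coef[OF x e(1)] by simp
qed

end

section \<open>From weakly convergent inverse coefficients to strongly convergent semigroups\<close>

lemma (in coefficient) positive_operator_inv_op: "positive_operator (inv_op c) (4 * K)" by (rule positive_operator_axioms)

text \<open>Convergence of the primitives is weak convergence of \<open>1 / c\<close> tested on
  initial intervals, the natural notion for homogenization in one dimension.\<close>

locale coefficient_sequence =
  fixes c :: "nat \<Rightarrow> real \<Rightarrow> real" and c0 :: "real \<Rightarrow> real" and K :: real
  assumes coeff: "\<And>n. coefficient (c n) K" and coeff0: "coefficient c0 K"
    and primitive_tendsto: "\<And>x. 0 \<le> x \<Longrightarrow> x \<le> 1 \<Longrightarrow>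
      (\<lambda>n. LINT y|U. indicator {..<x} y * inverse (c n y)) \<longlonglongrightarrow> (LINT y|U. indicator {..<x} y * inverse (c0 y))"
begin

lemma difference_bound: "AE y in U. \<bar>inverse (c n y) - inverse (c0 y)\<bar> \<le> K"
  using coefficient.inverse_c_bounds[OF coeff, of n] coefficient.inverse_c_bounds[OF coeff0]
    coefficient.inverse_c_nonneg[OF coeff, of n] coefficient.inverse_c_nonneg[OF coeff0] by eventually_elim linarith

lemma inverse_measurable [measurable]:
  "(\<lambda>y. inverse (c n y)) \<in> borel_measurable U" "(\<lambda>y. inverse (c0 y)) \<in> borel_measurable U"
  using coefficient.c_measurable[OF coeff, of n] coefficient.c_measurable[OF coeff0] by auto

lemma difference_integrable:
  assumes f: "sq_integrable f"
  shows "integrable U (\<lambda>y. (inverse (c n y) - inverse (c0 y)) *\<^sub>R f y)"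
  by (rule sq_integrable_integrable[OF sq_integrable_AE_bounded_scaleR[OF _ difference_bound f]]) measurable

text \<open>A direction \<open>e\<close> is carried along because the inner product of
  \<open>L2\<close> is real; the choices \<open>1\<close> and \<open>\<i>\<close> recover the
  complex integral.\<close>

definition D :: "nat \<Rightarrow> complex \<Rightarrow> L2" where
  "D n e = L2_of (\<lambda>y. (inverse (c n y) - inverse (c0 y)) *\<^sub>R e)"

lemma sq_integrable_D: "sq_integrable (\<lambda>y. (inverse (c n y) - inverse (c0 y)) *\<^sub>R (e :: complex))"
  by (rule sq_integrable_AE_bounded_scaleR[OF _ difference_bound sq_integrable_bounded[where c = "norm e"]]) auto

lemma norm_D_le: "norm (D n e) \<le> K * norm e"
  unfolding D_def
proof (rule norm_L2_of_bounded_le(2)[OF sq_integrable_measurable[OF sq_integrable_D]])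
  show "AE y in U. norm ((inverse (c n y) - inverse (c0 y)) *\<^sub>R e) \<le> K * norm e"
    using difference_bound[of n] by eventually_elim (simp add: mult_right_mono)
qed (use coefficient.K[OF coeff0] in simp)

lemma inner_D:
  assumes f: "sq_integrable f"
  shows "inner (D n e) (L2_of f) = (LINT y|U. (inverse (c n y) - inverse (c0 y)) *\<^sub>R f y) \<bullet> e"
proof -
  have "inner (D n e) (L2_of f) = (LINT y|U. ((inverse (c n y) - inverse (c0 y)) *\<^sub>R f y) \<bullet> e)"
    unfolding D_def inner_L2_of[OF sq_integrable_D f] by (rule Bochner_Integration.integral_cong) (simp_all add: inner_commute)
  also have "\<dots> = (LINT y|U. (inverse (c n y) - inverse (c0 y)) *\<^sub>R f y) \<bullet> e"
    by (rule integral_inner_left[OF difference_integrable[OF f]])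
  finally show ?thesis .
qed

lemma D_step: "(\<lambda>n. inner (D n e) (L2_step q b)) \<longlonglongrightarrow> 0"
proof -
  define x where "x = max 0 (min 1 (of_rat q :: real))"
  define z :: complex where "z = (if b then 1 else \<i>)"
  let ?p = "\<lambda>c. LINT y|U. indicator {..<x} y * inverse (c y :: real)"
  have sq: "sq_integrable (\<lambda>x. indicator {..<of_rat q} x *\<^sub>R z)"
    by (rule sq_integrable_bounded[where c = "norm z"]) (auto simp: indicator_def)
  have int: "integrable U (\<lambda>y. indicator {..<x} y * inverse (c n y))"
     "integrable U (\<lambda>y. indicator {..<x} y * inverse (c0 y))" for n
    by (auto intro!: integrable_indicator_mult coefficient.inverse_c_integrable coeff coeff0)
  have eq: "inner (D n e) (L2_step q b) = ((?p (c n) - ?p c0) *\<^sub>R z) \<bullet> e" for n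
  proof -
    have "(LINT y|U. (inverse (c n y) - inverse (c0 y)) *\<^sub>R (indicator {..<of_rat q} y *\<^sub>R z)) =
        (LINT y|U. (indicator {..<x} y * inverse (c n y) - indicator {..<x} y * inverse (c0 y)) *\<^sub>R z)"
      by (rule Bochner_Integration.integral_cong) (auto simp: indicator_def x_def)
    also have "\<dots> = (?p (c n) - ?p c0) *\<^sub>R z" unfolding Bochner_Integration.integral_diff[OF int(1) int(2), symmetric]
      by (intro integral_scaleR_left Bochner_Integration.integrable_diff int)
    finally show ?thesis unfolding L2_step_def z_def[symmetric] inner_D[OF sq] by (simp only:)
  qed
  have "(\<lambda>n. ?p (c n) - ?p c0) \<longlonglongrightarrow> 0" by (rule LIM_zero[OF primitive_tendsto]) (auto simp: x_def)
  from tendsto_inner[OF tendsto_scaleR[OF this tendsto_const[of z]] tendsto_const[of e]]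
  show ?thesis unfolding eq by simp
qed

text \<open>Weak convergence passes from step functions to all of \<open>L2\<close>, as the norms of
  \<open>D n e\<close> are bounded.\<close>

lemma D_tendsto_0: "(\<lambda>n. inner (D n e) F) \<longlonglongrightarrow> 0"
proof (induction F rule: L2_dense_induct)
  show "closed {F. (\<lambda>n. inner (D n e) F) \<longlonglongrightarrow> 0}" unfolding closed_sequential_limits
  proof (intro allI impI CollectI LIMSEQ_I)
    fix X F and r :: real assume "(\<forall>k. X k \<in> {F. (\<lambda>n. inner (D n e) F) \<longlonglongrightarrow> 0}) \<and> X \<longlonglongrightarrow> F" and r: "r > 0"
    hence X: "\<And>k. (\<lambda>n. inner (D n e) (X k)) \<longlonglongrightarrow> 0" and lim: "X \<longlonglongrightarrow> F" by auto
    define C where "C = K * norm e + 1"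
    have C: "C > 0" using coefficient.K[OF coeff0] by (simp add: C_def add_nonneg_pos)
    obtain k where k: "norm (F - X k) < r / (2 * C)" using LIMSEQ_D[OF lim, of "r / (2 * C)"] r C by (auto simp: norm_minus_commute)
    obtain N where N: "\<And>n. n \<ge> N \<Longrightarrow> \<bar>inner (D n e) (X k)\<bar> < r / 2" using LIMSEQ_D[OF X, of "r / 2"] r by auto
    have "norm (inner (D n e) F - 0) < r" if "n \<ge> N" for n
    proof -
      have "\<bar>inner (D n e) (F - X k)\<bar> \<le> norm (D n e) * norm (F - X k)" by (rule Cauchy_Schwarz_ineq2)
      also have "\<dots> \<le> C * (r / (2 * C))" using norm_D_le[of n e] k C by (intro mult_mono) (auto simp: C_def)
      also have "\<dots> = r / 2" using C by simp
      finally show ?thesis using N[OF that] unfolding inner_diff_right real_norm_def diff_0_right by linarith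
    qed
    thus "\<exists>N. \<forall>n\<ge>N. norm (inner (D n e) F - 0) < r" by blast
  qed
  show "(\<lambda>n. inner (D n e) (F + G)) \<longlonglongrightarrow> 0" if "(\<lambda>n. inner (D n e) F) \<longlonglongrightarrow> 0" "(\<lambda>n. inner (D n e) G) \<longlonglongrightarrow> 0" for F G
    using tendsto_add[OF that] by (simp add: inner_add_right)
  show "(\<lambda>n. inner (D n e) (r *\<^sub>R F)) \<longlonglongrightarrow> 0" if "(\<lambda>n. inner (D n e) F) \<longlonglongrightarrow> 0" for r F
    using tendsto_mult[OF tendsto_const that, of r] by simp
qed (simp_all add: D_step)

lemma inverse_coefficient_tendsto:
  assumes f: "sq_integrable f"
  shows "(\<lambda>n. LINT y|U. inverse (c n y) *\<^sub>R f y) \<longlonglongrightarrow> (LINT y|U. inverse (c0 y) *\<^sub>R f y)"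
proof (rule LIM_zero_cancel)
  have int: "integrable U (\<lambda>y. inverse (c n y) *\<^sub>R f y)" "integrable U (\<lambda>y. inverse (c0 y) *\<^sub>R f y)" for n
    by (rule sq_integrable_integrable[OF sq_integrable_AE_bounded_scaleR[OF inverse_measurable(1) _ f]],
        rule coefficient.abs_inverse_c_le[OF coeff])
      (rule sq_integrable_integrable[OF sq_integrable_AE_bounded_scaleR[OF inverse_measurable(2) _ f]],
        rule coefficient.abs_inverse_c_le[OF coeff0])
  show "(\<lambda>n. (LINT y|U. inverse (c n y) *\<^sub>R f y) - (LINT y|U. inverse (c0 y) *\<^sub>R f y)) \<longlonglongrightarrow> 0"
    using D_tendsto_0[of 1 "L2_of f"] D_tendsto_0[of \<i> "L2_of f"]
    unfolding inner_D[OF f] scaleR_diff_left Bochner_Integration.integral_diff[OF int]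
    by (simp add: tendsto_complex_iff inner_complex_def)
qed

lemma mean_flux_tendsto: "(\<lambda>n. mean_flux (c n) F) \<longlonglongrightarrow> mean_flux c0 F"
proof -
  have psq: "sq_integrable (prim (rep_L2 F))"
    by (rule sq_integrable_bounded[where c = "norm F"]) (auto intro: norm_prim_rep_le borel_measurable_prim)
  have eq: "(LINT y|U. indicator {..<1} y * f y) = (LINT y|U. f y)" for f :: "real \<Rightarrow> real"
    by (rule Bochner_Integration.integral_cong) auto
  have "(\<lambda>n. LINT y|U. inverse (c n y)) \<longlonglongrightarrow> (LINT y|U. inverse (c0 y))"
    using primitive_tendsto[of 1] by (simp add: eq)
  thus ?thesis unfolding mean_flux_def by (intro tendsto_scaleR tendsto_inverse inverse_coefficient_tendsto psq)
      (use coefficient.integral_inverse_c_pos[OF coeff0] in simp_all)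
qed

text \<open>Isolates the dependence on the coefficient: integrals of \<open>1 / c'\<close> against
  functions independent of it, and the mean flux as a factor.\<close>

lemma sol_eq_integrals:
  assumes c: "coefficient c' K"
  shows "sol c' F x = (LINT y|U. inverse (c' y) *\<^sub>R (indicator {..<x} y *\<^sub>R 1)) * mean_flux c' F
     - (LINT y|U. inverse (c' y) *\<^sub>R (indicator {..<x} y *\<^sub>R prim (rep_L2 F) y))"
proof -
  interpret coefficient c' K by (rule c)
  have [measurable]: "prim (rep_L2 F) \<in> borel_measurable U" by (rule prim_rep_measurable)
  have i1: "integrable U (\<lambda>y. inverse (c' y) *\<^sub>R (indicator {..<x} y *\<^sub>R (1 :: complex)))"
    by (rule integrable_inverse_c_scaleR(1)[where C = 1]) (auto simp: indicator_def)
  have i2: "integrable U (\<lambda>y. inverse (c' y) *\<^sub>R (indicator {..<x} y *\<^sub>R prim (rep_L2 F) y))"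
    by (rule integrable_inverse_c_scaleR(1)[where C = "norm F"]) (auto simp: indicator_def norm_prim_rep_le)
  have "sol c' F x = (LINT y|U. (inverse (c' y) *\<^sub>R (indicator {..<x} y *\<^sub>R 1)) * mean_flux c' F
      - inverse (c' y) *\<^sub>R (indicator {..<x} y *\<^sub>R prim (rep_L2 F) y))" unfolding sol_def prim_def flux_def
    by (rule Bochner_Integration.integral_cong) (auto simp: indicator_def scaleR_diff_right)
  also have "\<dots> = (LINT y|U. (inverse (c' y) *\<^sub>R (indicator {..<x} y *\<^sub>R 1)) * mean_flux c' F)
      - (LINT y|U. inverse (c' y) *\<^sub>R (indicator {..<x} y *\<^sub>R prim (rep_L2 F) y))"
    using i1 i2 by (intro Bochner_Integration.integral_diff integrable_mult_left)
  finally show ?thesis by (simp only: integral_mult_left_zero)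
qed

lemma sol_tendsto: "(\<lambda>n. sol (c n) F x) \<longlonglongrightarrow> sol c0 F x"
proof -
  have [measurable]: "prim (rep_L2 F) \<in> borel_measurable U" by (rule borel_measurable_prim) simp
  have "sq_integrable (\<lambda>y. indicator {..<x} y *\<^sub>R (1 :: complex))"
    by (rule sq_integrable_bounded[where c = 1]) (auto simp: indicator_def)
  moreover have "sq_integrable (\<lambda>y. indicator {..<x} y *\<^sub>R prim (rep_L2 F) y)"
    by (rule sq_integrable_bounded[where c = "norm F"]) (auto simp: indicator_def norm_prim_rep_le)
  ultimately show ?thesis unfolding sol_eq_integrals[OF coeff] sol_eq_integrals[OF coeff0]
    by (intro tendsto_diff tendsto_mult inverse_coefficient_tendsto mean_flux_tendsto)
qed

text \<open>Weak convergence of the coefficients becomes strong convergence of the operators, since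
  solutions converge at every point under a common bound.\<close>

lemma inv_op_tendsto: "(\<lambda>n. inv_op (c n) F) \<longlonglongrightarrow> inv_op c0 F"
  unfolding inv_op_def by (rule L2_of_dominated_convergence[where g = "\<lambda>_. 2 * K * norm F"])
    (auto intro!: coefficient.sq_integrable_sol coeff coeff0 sol_tendsto coefficient.norm_sol_le)

lemma semigroup_tendsto:
  assumes t: "t \<ge> 0"
  shows "(\<lambda>n. heat_semigroup (inv_op (c n)) (4 * K) t z) \<longlonglongrightarrow> heat_semigroup (inv_op c0) (4 * K) t z"
proof (cases "t = 0")
  case False
  have "(\<lambda>n. cfc (inv_op (c n)) (4 * K) (heat_symbol t 0) z) \<longlonglongrightarrow> cfc (inv_op c0) (4 * K) (heat_symbol t 0) z"
  proof (rule tendsto_cfc[OF _ _ inv_op_tendsto])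
    show "positive_operator (inv_op (c n)) (4 * K)" for n by (rule coefficient.positive_operator_inv_op[OF coeff])
    show "positive_operator (inv_op c0) (4 * K)" by (rule coefficient.positive_operator_inv_op[OF coeff0])
    show "continuous_on {0..4 * K} (heat_symbol t 0)" by (rule continuous_on_heat_symbol) (use False t in simp)
  qed
  thus ?thesis using False t by (simp add: heat_semigroup_def heat_def)
qed simp

end

lemma (in periodic_coefficient) coefficient_sequence_coef:
  assumes "\<And>n. e n > 0" "e \<longlonglongrightarrow> 0"
  shows "coefficient_sequence (\<lambda>n. coef a (e n)) (coef a 0) K"
proof (rule coefficient_sequence.intro)
  show "coefficient (coef a (e n)) K" for n by (rule coefficient_coef) (simp add: less_imp_le assms(1))
qed (auto intro!: coefficient_coef inverse_coef_primitive_tendsto assms)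

section \<open>Controls and mild solutions\<close>

lemma measurable_AE_eq_lebesgue_on:
  fixes f g :: "'a::euclidean_space \<Rightarrow> 'b::topological_space"
  assumes g: "g \<in> borel_measurable (lebesgue_on S)" and S: "S \<in> sets lebesgue"
    and ae: "AE x in lebesgue_on S. f x = g x"
  shows "f \<in> borel_measurable (lebesgue_on S)"
proof (rule measurableI)
  fix A :: "'b set" assume A: "A \<in> sets borel"
  have "AE x in lebesgue. x \<in> S \<longrightarrow> f x = g x" using ae S by (subst (asm) AE_restrict_space_iff) auto
  then obtain N where N: "N \<in> null_sets lebesgue" "{x. \<not> (x \<in> S \<longrightarrow> f x = g x)} \<subseteq> N"
    by (auto simp: eventually_ae_filter)
  have gA: "g -` A \<inter> S \<in> sets lebesgue" using measurable_sets[OF g A] S by (simp add: sets_restrict_space_iff)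
  have "f -` A \<inter> S \<inter> N \<in> null_sets lebesgue" by (rule null_sets_completion_subset[OF _ N(1)]) auto
  hence "(g -` A \<inter> S - N) \<union> (f -` A \<inter> S \<inter> N) \<in> sets lebesgue"
    by (intro sets.Un sets.Diff gA null_setsD2[OF N(1)]) (rule null_setsD2)
  also have "(g -` A \<inter> S - N) \<union> (f -` A \<inter> S \<inter> N) = f -` A \<inter> S"
  proof -
    have "f x = g x" if "x \<in> S" "x \<notin> N" for x using N(2) that by auto
    thus ?thesis by auto
  qed
  finally have "f -` A \<inter> S \<in> sets lebesgue" .
  thus "f -` A \<inter> space (lebesgue_on S) \<in> sets (lebesgue_on S)" using S by (simp add: sets_restrict_space_iff)
qed simp

text \<open>In a separable metric space an open set is a countable union of balls. For maps into
  \<open>L2\<close> the distances to a fixed point are parameter integrals, whose measurability is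
  known.\<close>

lemma borel_measurable_dist_iff:
  fixes f :: "'a \<Rightarrow> 'b::{metric_space, second_countable_topology}"
  assumes f: "\<And>d. (\<lambda>x. dist (f x) d) \<in> borel_measurable M"
  shows "f \<in> borel_measurable M"
proof (rule borel_measurableI)
  fix G :: "'b set" assume G: "open G"
  obtain D :: "'b set" where D: "countable D" "\<And>X. open X \<Longrightarrow> X \<noteq> {} \<Longrightarrow> \<exists>d\<in>D. d \<in> X"
    by (rule countable_dense_setE) blast
  define P where "P = {(d, n). d \<in> D \<and> ball d (inverse (real (Suc n))) \<subseteq> G}"
  have cP: "countable P" by (rule countable_subset[of _ "D \<times> UNIV"]) (use D(1) in "auto simp: P_def")
  have "G = (\<Union>(d, n)\<in>P. {y. dist y d < inverse (real (Suc n))})"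
  proof (intro equalityI subsetI)
    fix y assume "y \<in> G"
    then obtain e where e: "e > 0" "ball y e \<subseteq> G" using G open_contains_ball by blast
    obtain n where n: "inverse (real (Suc n)) < e / 2" using reals_Archimedean[of "e / 2"] e(1) by auto
    obtain d where d: "d \<in> D" "d \<in> ball y (inverse (real (Suc n)))" using D(2)[of "ball y (inverse (real (Suc n)))"] by auto
    have "ball d (inverse (real (Suc n))) \<subseteq> ball y e"
    proof
      fix x assume "x \<in> ball d (inverse (real (Suc n)))"
      thus "x \<in> ball y e" using dist_triangle[of y x d] d(2) n by simp
    qed
    hence "(d, n) \<in> P" using d e by (auto simp: P_def)
    moreover have "dist y d < inverse (real (Suc n))" using d(2) by simp
    ultimately show "y \<in> (\<Union>(d, n)\<in>P. {y. dist y d < inverse (real (Suc n))})" by blast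
  qed (auto simp: P_def dist_commute)
  hence "f -` G \<inter> space M = (\<Union>(d, n)\<in>P. {x \<in> space M. dist (f x) d < inverse (real (Suc n))})" by auto
  moreover have "(\<Union>(d, n)\<in>P. {x \<in> space M. dist (f x) d < inverse (real (Suc n))}) \<in> sets M"
  proof (rule sets.countable_UN''[OF cP])
    show "(case p of (d, n) \<Rightarrow> {x \<in> space M. dist (f x) d < inverse (real (Suc n))}) \<in> sets M" for p
      using f by (cases p) simp
  qed
  ultimately show "f -` G \<inter> space M \<in> sets M" by simp
qed

lemma AE_lebesgue_prod:
  fixes P :: "real \<times> real \<Rightarrow> bool"
  assumes "AE p in lebesgue. P p"
  shows "AE s in lebesgue. AE x in lebesgue. P (s, x)"
proof -
  have "AE p in lborel. P p" using assms by (simp add: AE_completion_iff)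
  hence "AE p in lborel \<Otimes>\<^sub>M lborel. P p" by (subst lborel_prod)
  hence "AE s in lborel. AE x in lborel. P (s, x)" by (rule lborel_pair.AE_pair)
  thus ?thesis by (simp add: AE_completion_iff)
qed

lemma AE_lebesgue_on_subset:
  assumes "AE x in lebesgue_on T. P x" "S \<subseteq> T" "S \<in> sets lebesgue" "T \<in> sets lebesgue"
  shows "AE x in lebesgue_on S. P x"
  using assms by (auto simp: AE_restrict_space_iff elim: eventually_mono)

lemma L2_of_AE_eq:
  assumes g: "sq_integrable g" and ae: "AE x in U. f x = g x"
  shows "sq_integrable f" "L2_of f = L2_of g"
proof -
  have f: "f \<in> borel_measurable U" by (rule measurable_AE_eq_lebesgue_on[OF sq_integrable_measurable[OF g] _ ae]) simp
  have "integrable U (\<lambda>x. (norm (f x))^2) \<longleftrightarrow> integrable U (\<lambda>x. (norm (g x))^2)"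
    using f sq_integrable_measurable[OF g] ae by (intro integrable_cong_AE) (auto elim: eventually_mono)
  thus sf: "sq_integrable f" using f g by (simp add: sq_integrable_def)
  show "L2_of f = L2_of g" by (rule L2_of_eqI[OF sf g ae])
qed

text \<open>Sections of a Lebesgue measurable function of two variables are measurable only for
  almost every parameter; a Borel representative has measurable sections throughout.\<close>

lemma complex_borel_representative:
  fixes u :: "'a::euclidean_space \<Rightarrow> complex"
  assumes u: "u \<in> borel_measurable lebesgue"
  obtains v where "v \<in> borel_measurable borel" "AE x in lebesgue. u x = v x"
proof -
  have "(\<lambda>x. Re (u x)) \<in> borel_measurable (completion lborel)" "(\<lambda>x. Im (u x)) \<in> borel_measurable (completion lborel)"
    using u by auto
  then obtain f g where f: "f \<in> borel_measurable lborel" "AE x in lborel. Re (u x) = f x"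
    and g: "g \<in> borel_measurable lborel" "AE x in lborel. Im (u x) = g x"
    using completion_ex_borel_measurable_real by blast
  show thesis
  proof (rule that[of "\<lambda>x. Complex (f x) (g x)"])
    have [measurable]: "f \<in> borel_measurable borel" "g \<in> borel_measurable borel" using f(1) g(1) by auto
    have "(\<lambda>x. complex_of_real (f x) + \<i> * complex_of_real (g x)) \<in> borel_measurable borel" by measurable
    thus "(\<lambda>x. Complex (f x) (g x)) \<in> borel_measurable borel" by (simp add: Complex_eq)
    show "AE x in lebesgue. u x = Complex (f x) (g x)"
      unfolding AE_completion_iff using f(2) g(2) by eventually_elim (simp add: complex_eq_iff)
  qed
qed

section \<open>Controls as sources with values in \<open>L2\<close>\<close>

locale control_cylinder =
  fixes i0 i1 \<tau> :: real
  assumes i0: "0 \<le> i0" and i01: "i0 < i1" and i1: "i1 \<le> 1" and \<tau>_pos: "0 < \<tau>"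
begin

abbreviation I :: "real set" where "I \<equiv> {i0<..<i1}"
abbreviation Q :: "(real \<times> real) measure" where "Q \<equiv> cylinder \<tau> I"
abbreviation J :: "real measure" where "J \<equiv> lebesgue_on {0<..<\<tau>}"

definition admissible :: "real \<Rightarrow> (real \<times> real \<Rightarrow> complex) set" where
  "admissible R = {u \<in> borel_measurable Q. AE p in Q. norm (u p) \<le> R}"

lemma cylinder_sets [simp]: "{0<..<\<tau>} \<times> I \<in> sets lebesgue"
  by (rule sets_completionI_sets) (simp only: sets_lborel, intro borel_open open_Times open_greaterThanLessThan)

lemma finite_measure_Q: "finite_measure Q"
proof (rule finite_measure_lebesgue_on)
  have "bounded ({0<..<\<tau>} \<times> I)" by (intro bounded_Times) auto
  thus "{0<..<\<tau>} \<times> I \<in> lmeasurable" by (intro bounded_set_imp_lmeasurable) auto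
qed

lemma finite_measure_J: "finite_measure J" by (rule finite_measure_lebesgue_on) simp

lemma AE_cylinder:
  assumes "AE p in Q. P p"
  shows "AE s in J. AE x in U. x \<in> I \<longrightarrow> P (s, x)"
proof -
  have "AE p in lebesgue. p \<in> {0<..<\<tau>} \<times> I \<longrightarrow> P p"
    using assms by (subst (asm) AE_restrict_space_iff) auto
  hence "AE s in lebesgue. AE x in lebesgue. (s, x) \<in> {0<..<\<tau>} \<times> I \<longrightarrow> P (s, x)"
    by (rule AE_lebesgue_prod)
  hence "AE s in lebesgue. s \<in> {0<..<\<tau>} \<longrightarrow> (AE x in U. x \<in> I \<longrightarrow> P (s, x))"
  proof eventually_elim
    case (elim s)
    show ?case
    proof
      assume "s \<in> {0<..<\<tau>}"
      hence "AE x in lebesgue. x \<in> {0<..<1} \<longrightarrow> x \<in> I \<longrightarrow> P (s, x)"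
        by (intro eventually_mono[OF elim]) auto
      thus "AE x in U. x \<in> I \<longrightarrow> P (s, x)" by (subst AE_restrict_space_iff) auto
    qed
  qed
  thus ?thesis by (subst AE_restrict_space_iff) auto
qed

lemma admissible_representative:
  assumes u: "u \<in> admissible R" and R: "R \<ge> 0"
  obtains v where "v \<in> borel_measurable borel" "\<And>p. norm (v p) \<le> R" "AE p in Q. u p = v p"
proof -
  have um: "u \<in> borel_measurable Q" and ub: "AE p in Q. norm (u p) \<le> R" using u by (auto simp: admissible_def)
  have "(\<lambda>p. if p \<in> {0<..<\<tau>} \<times> I then u p else 0) \<in> borel_measurable lebesgue"
    using borel_measurable_if_I[OF um] by simp
  then obtain w where w: "w \<in> borel_measurable borel" "AE p in lebesgue. (if p \<in> {0<..<\<tau>} \<times> I then u p else 0) = w p"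
    by (rule complex_borel_representative)
  show thesis
  proof (rule that[of "\<lambda>p. if norm (w p) \<le> R then w p else 0"])
    note [measurable] = w(1)
    show "(\<lambda>p. if norm (w p) \<le> R then w p else 0) \<in> borel_measurable borel" by measurable
    have "AE p in Q. p \<in> {0<..<\<tau>} \<times> I \<longrightarrow> u p = w p"
      using w(2) by (subst AE_restrict_space_iff) (auto elim: eventually_mono)
    thus "AE p in Q. u p = (if norm (w p) \<le> R then w p else 0)" using ub AE_space by eventually_elim auto
  qed (use R in auto)
qed

lemma section_measurable:
  fixes v :: "real \<times> real \<Rightarrow> 'b::topological_space"
  assumes "v \<in> borel_measurable borel"
  shows "(\<lambda>x. v (s, x)) \<in> borel_measurable U"
proof (rule measurable_compose[OF id_measurable_unit_leb measurable_compose[OF _ assms]])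
  show "(\<lambda>x. (s, x)) \<in> borel \<rightarrow>\<^sub>M (borel :: (real \<times> real) measure)" by (simp add: borel_prod[symmetric])
qed

lemma sq_integrable_section:
  assumes v: "v \<in> borel_measurable borel" "\<And>p. norm (v p) \<le> R"
  shows "sq_integrable (\<lambda>x. indicator I x *\<^sub>R (v :: real \<times> real \<Rightarrow> complex) (s, x))"
proof (rule sq_integrable_bounded[where c = R])
  note [measurable] = section_measurable[OF v(1)]
  show "(\<lambda>x. indicator I x *\<^sub>R v (s, x)) \<in> borel_measurable U" by measurable
  show "norm (indicator I x *\<^sub>R v (s, x)) \<le> R" for x
    using v(2)[of "(s, x)"] order_trans[OF norm_ge_zero v(2)[of "(s, x)"]] by (simp add: indicator_def)
qed

lemma source_borel:
  assumes v: "v \<in> borel_measurable borel" "\<And>p. norm (v p) \<le> R"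
  shows "source I v \<in> borel_measurable borel"
proof (rule borel_measurable_dist_iff)
  fix d :: L2
  note sq = sq_integrable_section[OF v]
  have "(\<lambda>p. (fst p, snd p)) \<in> borel \<Otimes>\<^sub>M U \<rightarrow>\<^sub>M (borel :: (real \<times> real) measure)"
    unfolding borel_prod[symmetric]
    by (intro measurable_Pair measurable_fst measurable_compose[OF measurable_snd id_measurable_unit_leb])
  from measurable_compose[OF this v(1)] have [measurable]: "v \<in> borel_measurable (borel \<Otimes>\<^sub>M U)" by simp
  have [measurable]: "(\<lambda>p. snd p) \<in> borel_measurable (borel \<Otimes>\<^sub>M U)"
    by (rule measurable_compose[OF measurable_snd id_measurable_unit_leb])
  have [measurable]: "(\<lambda>p. rep_L2 d (snd p)) \<in> borel_measurable (borel \<Otimes>\<^sub>M U)"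
    by (rule measurable_compose[OF measurable_snd rep_L2_measurable])
  have "(\<lambda>s. LINT x|U. (norm (indicator I x *\<^sub>R v (s, x)))^2) \<in> borel_measurable borel"
    by (rule unit_leb.borel_measurable_lebesgue_integral) (simp add: case_prod_beta', measurable)
  moreover have "(\<lambda>s. LINT x|U. (indicator I x *\<^sub>R v (s, x)) \<bullet> rep_L2 d x) \<in> borel_measurable borel"
    by (rule unit_leb.borel_measurable_lebesgue_integral) (simp add: case_prod_beta', measurable)
  moreover have "dist (source I v s) d =
      sqrt ((LINT x|U. (norm (indicator I x *\<^sub>R v (s, x)))^2)
        - 2 * (LINT x|U. (indicator I x *\<^sub>R v (s, x)) \<bullet> rep_L2 d x) + (norm d)^2)" for s
  proof -
    have "(norm (source I v s - d))^2 = (norm (source I v s))^2 - 2 * inner (source I v s) d + (norm d)^2"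
      by (simp add: power2_norm_eq_inner inner_diff_left inner_diff_right inner_commute)
    moreover have "inner (source I v s) d = (LINT x|U. (indicator I x *\<^sub>R v (s, x)) \<bullet> rep_L2 d x)"
      unfolding source_def using inner_L2_of[OF sq sq_integrable_rep, of s d] by (simp add: L2_of_rep)
    moreover have "(norm (source I v s))^2 = (LINT x|U. (norm (indicator I x *\<^sub>R v (s, x)))^2)"
      unfolding source_def by (rule norm_L2_of[OF sq])
    ultimately show ?thesis by (simp add: dist_norm real_sqrt_unique[symmetric])
  qed
  ultimately show "(\<lambda>s. dist (source I v s) d) \<in> borel_measurable borel" by simp
qed

lemma source_AE_eq:
  assumes v: "v \<in> borel_measurable borel" "\<And>p. norm (v p) \<le> R" and ae: "AE p in Q. u p = v p"
  shows "AE s in J. sq_integrable (\<lambda>x. indicator I x *\<^sub>R u (s, x)) \<and> source I u s = source I v s"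
  using AE_cylinder[OF ae]
proof eventually_elim
  case (elim s)
  have eq: "AE x in U. indicator I x *\<^sub>R u (s, x) = indicator I x *\<^sub>R v (s, x)"
    using elim by eventually_elim (auto simp: indicator_def)
  show ?case unfolding source_def by (intro conjI L2_of_AE_eq[OF sq_integrable_section[OF v] eq])
qed

lemma
  assumes u: "u \<in> admissible R" and R: "R \<ge> 0"
  shows source_measurable: "source I u \<in> borel_measurable J"
    and norm_source_le: "AE s in J. norm (source I u s) \<le> R"
    and sq_integrable_source: "AE s in J. sq_integrable (\<lambda>x. indicator I x *\<^sub>R u (s, x))"
proof -
  obtain v where v: "v \<in> borel_measurable borel" "\<And>p. norm (v p) \<le> R" "AE p in Q. u p = v p"
    by (rule admissible_representative[OF u R]) blast
  note ae = source_AE_eq[OF v]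
  have "source I v \<in> borel_measurable J"
    using source_borel[OF v(1,2)] by (intro measurable_restrict_space1 measurable_completion) simp
  thus "source I u \<in> borel_measurable J" by (rule measurable_AE_eq_lebesgue_on) (use ae in "auto elim: eventually_mono")
  have le: "norm (source I v s) \<le> R" for s unfolding source_def
    by (rule norm_L2_of_bounded_le(2)[OF sq_integrable_measurable[OF sq_integrable_section[OF v(1,2)]] _ R])
      (use v(2) R in "auto simp: indicator_def")
  show "AE s in J. norm (source I u s) \<le> R" using ae by eventually_elim (simp add: le)
  show "AE s in J. sq_integrable (\<lambda>x. indicator I x *\<^sub>R u (s, x))" using ae by eventually_elim simp
qed

lemma source_combination:
  assumes u: "u \<in> admissible R" and v: "v \<in> admissible R'" and R: "R \<ge> 0" "R' \<ge> 0"
  shows "AE s in J. source I (\<lambda>p. a *\<^sub>R u p + b *\<^sub>R v p) s = a *\<^sub>R source I u s + b *\<^sub>R source I v s"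
  using sq_integrable_source[OF u R(1)] sq_integrable_source[OF v R(2)]
proof eventually_elim
  case (elim s)
  have "source I (\<lambda>p. a *\<^sub>R u p + b *\<^sub>R v p) s =
      L2_of (\<lambda>x. a *\<^sub>R (indicator I x *\<^sub>R u (s, x)) + b *\<^sub>R (indicator I x *\<^sub>R v (s, x)))"
    unfolding source_def by (intro arg_cong[where f = L2_of] ext) (simp add: indicator_def)
  also have "\<dots> = a *\<^sub>R source I u s + b *\<^sub>R source I v s"
    unfolding L2_of_add[OF sq_integrable_scaleR[OF elim(1)] sq_integrable_scaleR[OF elim(2)]]
      L2_of_scaleR[OF elim(1)] L2_of_scaleR[OF elim(2)] source_def ..
  finally show ?case .
qed

lemma source_tendsto:
  assumes u: "\<And>k. u k \<in> admissible R" and v: "v \<in> admissible R" and R: "R \<ge> 0"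
    and lim: "AE p in Q. (\<lambda>k. u k p) \<longlonglongrightarrow> v p"
  shows "AE s in J. (\<lambda>k. source I (u k) s) \<longlonglongrightarrow> source I v s"
proof -
  have "AE p in Q. (\<lambda>k. u k p) \<longlonglongrightarrow> v p \<and> (\<forall>k. norm (u k p) \<le> R)"
    using lim u by (simp add: admissible_def AE_all_countable)
  note AE_cylinder[OF this]
  moreover have "AE s in J. \<forall>k. sq_integrable (\<lambda>x. indicator I x *\<^sub>R u k (s, x))"
    using sq_integrable_source[OF u R] by (simp add: AE_all_countable)
  moreover note sq_integrable_source[OF v R]
  ultimately show ?thesis
  proof eventually_elim
    case (elim s)
    \<comment> \<open>The points at which convergence and bound hold; cutting off outside makes them
      hold everywhere, as \<open>L2_of_dominated_convergence\<close> requires.\<close>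
    define G where "G x \<longleftrightarrow> x \<in> I \<and> (\<lambda>k. u k (s, x)) \<longlonglongrightarrow> v (s, x) \<and> (\<forall>k. norm (u k (s, x)) \<le> R)" for x
    define f where "f k x = (if G x then u k (s, x) else 0)" for k x
    define h where "h x = (if G x then v (s, x) else 0)" for x
    have f_eq: "AE x in U. f k x = indicator I x *\<^sub>R u k (s, x)" for k
      using elim(1) by eventually_elim (auto simp: f_def G_def indicator_def)
    have h_eq: "AE x in U. h x = indicator I x *\<^sub>R v (s, x)"
      using elim(1) by eventually_elim (auto simp: h_def G_def indicator_def)
    note fL = L2_of_AE_eq[OF elim(2)[rule_format] f_eq] and hL = L2_of_AE_eq[OF elim(3) h_eq]
    have "(\<lambda>k. L2_of (f k)) \<longlonglongrightarrow> L2_of h"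
    proof (rule L2_of_dominated_convergence[where g = "\<lambda>_. R", OF fL(1) hL(1)])
      show "(\<lambda>k. f k x) \<longlonglongrightarrow> h x" for x by (cases "G x") (simp_all add: f_def h_def, simp add: G_def)
      show "norm (f k x) \<le> R" for k x using R by (auto simp: f_def G_def)
    qed simp
    thus ?case unfolding fL(2) hL(2) by (simp add: source_def)
  qed
qed

end

section \<open>Regularity of the semigroup and of the adjoint state\<close>

context positive_operator
begin

lemma norm_diff_heat_semigroup_le:
  "norm (Ht t x - Ht t y) \<le> norm (x - y)" using norm_heat_semigroup_le[of t "x - y"]
  by (simp add: linear_diff[OF linear_heat_semigroup])

lemma heat_semigroup_heat:
  "t \<ge> 0 \<Longrightarrow> s > 0 \<Longrightarrow> Ht t (Hk s k x) = Hk (t + s) k x"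
  using heat_heat[of t s 0 k x] by (auto simp: heat_semigroup_def)

end

context injective_positive_operator
begin

lemma continuous_heat_semigroup_UNIV: "continuous_on UNIV (\<lambda>t. Ht t x)"
proof -
  have "continuous_on UNIV (\<lambda>t. Ht (max 0 t) x)"
    by (rule continuous_on_compose2[OF continuous_on_heat_semigroup]) (auto intro!: continuous_intros)
  moreover have "Ht (max 0 t) x = Ht t x" for t by (auto simp: heat_semigroup_def max_def)
  ultimately show ?thesis by simp
qed

text \<open>Contractivity reduces joint continuity to strong continuity; its use is the
  measurability of \<open>S (r - s) (f s)\<close> in \<open>s\<close>.\<close>

lemma continuous_heat_semigroup_joint: "continuous_on UNIV (\<lambda>p. Ht (fst p) (snd p))"
proof (rule continuous_at_imp_continuous_on, rule ballI)
  fix p0 :: "real \<times> 'a"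
  have "isCont (\<lambda>t. Ht t (snd p0)) (fst p0)"
    using continuous_heat_semigroup_UNIV[of "snd p0"] by (simp only: continuous_on_eq_continuous_at[OF open_UNIV] UNIV_I ball_UNIV)
  hence lim: "((\<lambda>p. Ht (fst p) (snd p0)) \<longlongrightarrow> Ht (fst p0) (snd p0)) (at p0)"
    by (rule isCont_tendsto_compose) (intro tendsto_intros)
  have "((\<lambda>p. norm (snd p - snd p0) + norm (Ht (fst p) (snd p0) - Ht (fst p0) (snd p0)))
      \<longlongrightarrow> norm (snd p0 - snd p0) + norm (Ht (fst p0) (snd p0) - Ht (fst p0) (snd p0))) (at p0)"
    by (intro tendsto_intros lim)
  hence z: "((\<lambda>p. norm (snd p - snd p0) + norm (Ht (fst p) (snd p0) - Ht (fst p0) (snd p0))) \<longlongrightarrow> 0) (at p0)"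
    by simp
  have "norm (Ht (fst p) (snd p) - Ht (fst p0) (snd p0)) \<le>
      norm (snd p - snd p0) + norm (Ht (fst p) (snd p0) - Ht (fst p0) (snd p0))" for p
    using norm_diff_heat_semigroup_le[of "fst p" "snd p" "snd p0"] by (intro norm_diff_triangle_le[of _ "Ht (fst p) (snd p0)"]) auto
  hence "((\<lambda>p. Ht (fst p) (snd p) - Ht (fst p0) (snd p0)) \<longlongrightarrow> 0) (at p0)"
    by (intro Lim_null_comparison[OF always_eventually z] allI)
  thus "isCont (\<lambda>p. Ht (fst p) (snd p)) p0" unfolding isCont_def by (rule LIM_zero_cancel)
qed

text \<open>Half of the time is spent on regularity, with \<open>y = Hk (t / 2) (Suc k) x\<close>;
  on the other half the derivative of the orbit of \<open>B y\<close> is known.\<close>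

lemma heat_has_vector_derivative:
  assumes t: "t > 0"
  shows "((\<lambda>t. Hk t k x) has_vector_derivative - Hk t (Suc k) x) (at t)"
proof -
  define r where "r = t / 2"
  define y where "y = Hk r (Suc k) x"
  have r: "0 < r" "r < t" using t by (auto simp: r_def)
  have "((\<lambda>s. s - r) has_vector_derivative 1) (at t)" by (auto intro!: derivative_eq_intros)
  moreover have "((\<lambda>s. Ht s (B y)) has_vector_derivative - Ht (t - r) y) (at (t - r))"
    using r by (intro heat_semigroup_has_vector_derivative) simp
  ultimately have "((\<lambda>s. Ht s (B y)) \<circ> (\<lambda>s. s - r) has_vector_derivative 1 *\<^sub>R (- Ht (t - r) y)) (at t)"
    by (rule vector_diff_chain_at)
  moreover have "Ht (t - r) y = Hk t (Suc k) x" unfolding y_def using r heat_semigroup_heat[of "t - r" r "Suc k" x] by simp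
  ultimately have "((\<lambda>s. Ht (s - r) (B y)) has_vector_derivative - Hk t (Suc k) x) (at t)" by (simp add: o_def)
  thus ?thesis
  proof (rule has_vector_derivative_transform_within_open[of _ _ _ "{r<..}"])
    show "Ht (s - r) (B y) = Hk s k x" if "s \<in> {r<..}" for s
      unfolding y_def using B_heat[OF r(1), of k x] heat_semigroup_heat[of "s - r" r k x] that r by simp
  qed (use r in auto)
qed

lemma continuous_on_heat: "continuous_on {0<..} (\<lambda>t. Hk t k x)"
  by (intro continuous_at_imp_continuous_on ballI has_vector_derivative_continuous[OF heat_has_vector_derivative]) simp

end

context coefficient
begin

text \<open>The representative of \<open>S t \<psi>\<close> that is jointly continuous for
  \<open>t > 0\<close>; it gives a meaning to values at single points and to sections in
  time.\<close>

definition kernel :: "L2 \<Rightarrow> real \<times> real \<Rightarrow> complex" where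
  "kernel \<psi> p = sol c (V (fst p) 1 \<psi>) (snd p)"

lemma norm_sol_diff_le_arg:
  assumes "0 \<le> x" "x \<le> 1"
  shows "norm (sol c F x - sol c G x) \<le> 2 * K * norm (F - G)"
  using norm_sol_le[OF assms, of "F - G"] sol_add[of "F - G" G x] by simp

lemma continuous_on_kernel: "continuous_on ({0<..} \<times> {0..1}) (kernel \<psi>)"
proof (rule continuous_on_sequentiallyI)
  fix p :: "nat \<Rightarrow> real \<times> real" and q
  assume p: "\<forall>n. p n \<in> {0<..} \<times> {0..1}" and q: "q \<in> {0<..} \<times> {0..1}" and lim: "p \<longlonglongrightarrow> q"
  have fp: "fst (p n) > 0" "0 \<le> snd (p n)" "snd (p n) \<le> 1" for n using p[rule_format, of n] by (auto simp: mem_Times_iff)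
  have fq: "fst q > 0" "0 \<le> snd q" "snd q \<le> 1" using q by (auto simp: mem_Times_iff)
  have lv: "(\<lambda>n. V (fst (p n)) 1 \<psi>) \<longlonglongrightarrow> V (fst q) 1 \<psi>"
    by (rule continuous_on_tendsto_compose[OF continuous_on_heat tendsto_fst[OF lim]]) (use fp fq in auto)
  have ls: "(\<lambda>n. sol c (V (fst q) 1 \<psi>) (snd (p n))) \<longlonglongrightarrow> sol c (V (fst q) 1 \<psi>) (snd q)"
    by (rule continuous_on_tendsto_compose[OF continuous_on_sol[of UNIV] tendsto_snd[OF lim]]) auto
  have "(\<lambda>n. 2 * K * norm (V (fst (p n)) 1 \<psi> - V (fst q) 1 \<psi>)) \<longlonglongrightarrow> 2 * K * norm (V (fst q) 1 \<psi> - V (fst q) 1 \<psi>)"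
    by (intro tendsto_intros lv)
  hence z: "(\<lambda>n. 2 * K * norm (V (fst (p n)) 1 \<psi> - V (fst q) 1 \<psi>)) \<longlonglongrightarrow> 0" by simp
  have "(\<lambda>n. sol c (V (fst (p n)) 1 \<psi>) (snd (p n)) - sol c (V (fst q) 1 \<psi>) (snd (p n))) \<longlonglongrightarrow> 0"
    by (rule Lim_null_comparison[OF always_eventually z]) (use norm_sol_diff_le_arg[OF fp(2,3)] in blast)
  from tendsto_add[OF this ls] show "(\<lambda>n. kernel \<psi> (p n)) \<longlonglongrightarrow> kernel \<psi> q"
    by (simp add: kernel_def)
qed

lemma rep_S_kernel: "t > 0 \<Longrightarrow> AE x in U. rep_L2 (S t \<psi>) x = kernel \<psi> (t, x)"
  unfolding S_eq_L2_of_sol kernel_def fst_conv snd_conv by (rule rep_L2_of[OF sq_integrable_sol])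

lemma loc_norm_S_kernel:
  assumes "A \<in> sets borel" "t > 0"
  shows "loc_norm A (S t \<psi>) = (LINT x|U. indicator A x * norm (kernel \<psi> (t, x)))"
  unfolding S_eq_L2_of_sol[OF assms(2)] kernel_def fst_conv snd_conv by (rule loc_norm_L2_of[OF sq_integrable_sol assms(1)])

end

section \<open>Null controls through Duhamel's formula\<close>

lemma Linf_norm_le_iff:
  assumes "u \<in> borel_measurable M" "R \<ge> 0"
  shows "Linf_norm M u \<le> ennreal R \<longleftrightarrow> (AE p in M. norm (u p) \<le> R)"
proof
  assume le: "Linf_norm M u \<le> ennreal R"
  have "AE p in M. ennreal (norm (u p)) \<le> Linf_norm M u" unfolding Linf_norm_def by (rule esssup_AE)
  thus "AE p in M. norm (u p) \<le> R"
  proof eventually_elim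
    case (elim p)
    hence "ennreal (norm (u p)) \<le> ennreal R" using le by (rule order_trans)
    thus ?case using assms(2) by (simp add: ennreal_le_iff)
  qed
next
  have m: "(\<lambda>p. ennreal (norm (u p))) \<in> borel_measurable M" using assms(1) by measurable
  assume "AE p in M. norm (u p) \<le> R"
  hence "AE p in M. ennreal (norm (u p)) \<le> ennreal R" by eventually_elim (rule ennreal_leI)
  thus "Linf_norm M u \<le> ennreal R" unfolding Linf_norm_def by (rule esssup_I[OF m])
qed

locale control_system = coefficient c K + control_cylinder i0 i1 \<tau> for c K i0 i1 \<tau>
begin

definition final :: "(real \<times> real \<Rightarrow> complex) \<Rightarrow> L2" where
  "final u = (LINT s|J. S (\<tau> - s) (source I u s))"

lemma propagated_measurable:
  assumes f: "f \<in> borel_measurable (lebesgue_on A)"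
  shows "(\<lambda>s. S (r - s) (f s)) \<in> borel_measurable (lebesgue_on A)"
proof -
  have s: "(\<lambda>s. r - s) \<in> borel_measurable (lebesgue_on A)" by (intro measurable_restrict_space1 measurable_completion) simp
  have "(\<lambda>s. (r - s, f s)) \<in> lebesgue_on A \<rightarrow>\<^sub>M (borel :: (real \<times> L2) measure)"
    unfolding borel_prod[symmetric] by (intro measurable_Pair s f)
  from measurable_compose[OF this borel_measurable_continuous_onI[OF continuous_heat_semigroup_joint]]
  show ?thesis by simp
qed

lemma propagated_integrable:
  assumes u: "u \<in> admissible R" and R: "R \<ge> 0" and t: "t \<le> \<tau>"
  shows "integrable (lebesgue_on {0<..<t}) (\<lambda>s. S (r - s) (source I u s))"
proof -
  interpret finite_measure "lebesgue_on {0<..<t}" by (rule finite_measure_lebesgue_on) simp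
  show ?thesis
  proof (rule integrable_const_bound[where B = R])
    have "AE s in lebesgue_on {0<..<t}. norm (source I u s) \<le> R"
      by (rule AE_lebesgue_on_subset[OF norm_source_le[OF u R]]) (use t in auto)
    thus "AE s in lebesgue_on {0<..<t}. norm (S (r - s) (source I u s)) \<le> R"
      by eventually_elim (rule order_trans[OF norm_heat_semigroup_le])
    show "(\<lambda>s. S (r - s) (source I u s)) \<in> borel_measurable (lebesgue_on {0<..<t})"
      by (rule propagated_measurable, rule measurable_restrict_mono[OF source_measurable[OF u R]]) (use t in auto)
  qed
qed

text \<open>The semigroup in \<open>mild_solution\<close> is only said to exist. By
  \<open>heat_semigroup_unique\<close> it is the heat semigroup, and null controllability becomes a
  single equation at time \<open>\<tau>\<close>.\<close>

lemma mild_solution_iff: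
  assumes u: "u \<in> admissible R" and R: "R \<ge> 0"
  shows "(\<exists>z. mild_solution (divergence_op c) \<tau> z0 (source I u) z \<and> z \<tau> = 0) \<longleftrightarrow> S \<tau> z0 + final u = 0"
proof
  assume "\<exists>z. mild_solution (divergence_op c) \<tau> z0 (source I u) z \<and> z \<tau> = 0"
  then obtain z T where z: "z \<tau> = 0" and T: "c0_semigroup T" "has_generator T (divergence_op c)"
    and eq: "z \<tau> = T \<tau> z0 + (LINT s|J. T (\<tau> - s) (source I u s))"
    unfolding mild_solution_def using \<tau>_pos by auto
  have T_eq: "T t x = S t x" if "t \<ge> 0" for t x by (rule heat_semigroup_unique[OF T divergence_op_iff that])
  have "(LINT s|J. T (\<tau> - s) (source I u s)) = final u"
    unfolding final_def by (rule Bochner_Integration.integral_cong) (auto simp: T_eq)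
  thus "S \<tau> z0 + final u = 0" using eq z T_eq[of \<tau>] \<tau>_pos by simp
next
  assume eq: "S \<tau> z0 + final u = 0"
  define z where "z t = S t z0 + (LINT s|lebesgue_on {0<..<t}. S (t - s) (source I u s))" for t
  have "mild_solution (divergence_op c) \<tau> z0 (source I u) z" unfolding mild_solution_def
    by (intro exI[of _ S] conjI ballI c0_semigroup_heat has_generator_heat propagated_integrable[OF u R] divergence_op_iff)
      (auto simp: z_def)
  moreover have "z \<tau> = 0" using eq by (simp add: z_def final_def)
  ultimately show "\<exists>z. mild_solution (divergence_op c) \<tau> z0 (source I u) z \<and> z \<tau> = 0" by blast
qed

lemma inner_final:
  assumes u: "u \<in> admissible R" and R: "R \<ge> 0"
  shows "inner \<psi> (final u) = (LINT s|J. inner (S (\<tau> - s) \<psi>) (source I u s))"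
  unfolding final_def using propagated_integrable[OF u R order_refl]
  by (subst integral_inner_right[symmetric]) (simp_all add: heat_semigroup_sym)

text \<open>The quantifier over \<open>F\<close> stands inside: the exceptional set of times must
  not depend on \<open>F\<close>, because \<open>F\<close> will be
  \<open>S (\<tau> - s) \<psi>\<close>, which varies with \<open>s\<close>.\<close>

lemma inner_source_le:
  assumes u: "u \<in> admissible R" and R: "R \<ge> 0"
  shows "AE s in J. \<forall>F. inner F (source I u s) \<le> R * loc_norm I F"
proof -
  have "AE p in Q. norm (u p) \<le> R" using u by (simp add: admissible_def)
  from AE_cylinder[OF this] sq_integrable_source[OF u R] show ?thesis
  proof eventually_elim
    case (elim s)
    show ?case
    proof
      fix F
      have "inner F (source I u s) = (LINT x|U. rep_L2 F x \<bullet> (indicator I x *\<^sub>R u (s, x)))"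
        unfolding source_def using inner_L2_of[OF sq_integrable_rep elim(2), of F] by (simp add: L2_of_rep)
      also have "\<dots> \<le> (LINT x|U. R * (indicator I x * norm (rep_L2 F x)))"
      proof (rule integral_mono_AE)
        show "integrable U (\<lambda>x. rep_L2 F x \<bullet> (indicator I x *\<^sub>R u (s, x)))"
          by (rule integrable_inner_sq[OF sq_integrable_rep elim(2)])
        show "integrable U (\<lambda>x. R * (indicator I x * norm (rep_L2 F x)))"
          by (intro integrable_mult_right loc_norm_integrable) simp
        show "AE x in U. rep_L2 F x \<bullet> (indicator I x *\<^sub>R u (s, x)) \<le> R * (indicator I x * norm (rep_L2 F x))"
          using elim(1)
        proof eventually_elim
          case (elim x)
          show ?case
          proof (cases "x \<in> I")
            case True
            have "rep_L2 F x \<bullet> u (s, x) \<le> norm (rep_L2 F x) * norm (u (s, x))" by (rule norm_cauchy_schwarz)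
            also have "\<dots> \<le> norm (rep_L2 F x) * R" using elim True by (intro mult_left_mono) auto
            finally show ?thesis using True by (simp add: mult.commute)
          qed simp
        qed
      qed
      finally show "inner F (source I u s) \<le> R * loc_norm I F" by (simp add: loc_norm_def)
    qed
  qed
qed

text \<open>The \<open>L^1\<close> norm over the cylinder of the adjoint state with final datum
  \<open>\<psi>\<close>, written in reversed time.\<close>

definition mass :: "L2 \<Rightarrow> real" where
  "mass \<psi> = integral {0..\<tau>} (\<lambda>r. loc_norm I (S r \<psi>))"

lemma loc_norm_S_integrable_on: "0 \<le> u \<Longrightarrow> (\<lambda>r. loc_norm I (S r \<psi>)) integrable_on {u..v}"
  by (intro integrable_continuous_interval continuous_on_subset[OF continuous_on_loc_norm_S]) auto

lemma mass_nonneg: "0 \<le> mass \<psi>"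
  unfolding mass_def by (intro integral_nonneg loc_norm_S_integrable_on loc_norm_nonneg) simp

text \<open>The reflection \<open>s \<mapsto> t + \<tau> - s\<close> maps
  \<open>{t<..<\<tau>}\<close> to itself. The case \<open>t = 0\<close> serves duality, a positive
  \<open>t\<close> the comparison of costs.\<close>

lemma
  assumes "0 \<le> t" "t \<le> \<tau>"
  shows integrable_loc_norm_reflected: "integrable (lebesgue_on {t<..<\<tau>}) (\<lambda>s. loc_norm I (S (t + \<tau> - s) \<psi>))"
    and integral_loc_norm_reflected:
      "(LINT s|lebesgue_on {t<..<\<tau>}. loc_norm I (S (t + \<tau> - s) \<psi>)) = integral {t..\<tau>} (\<lambda>r. loc_norm I (S r \<psi>))"
proof -
  have c: "continuous_on {t..\<tau>} (\<lambda>s. loc_norm I (S (t + \<tau> - s) \<psi>))"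
    by (rule continuous_on_compose2[OF continuous_on_loc_norm_S[of I]]) (use assms in "auto intro!: continuous_intros")
  interpret finite_measure "lebesgue_on {t<..<\<tau>}" by (rule finite_measure_lebesgue_on) simp
  show i: "integrable (lebesgue_on {t<..<\<tau>}) (\<lambda>s. loc_norm I (S (t + \<tau> - s) \<psi>))"
  proof (rule integrable_const_bound[where B = "norm \<psi>"])
    show "(\<lambda>s. loc_norm I (S (t + \<tau> - s) \<psi>)) \<in> borel_measurable (lebesgue_on {t<..<\<tau>})"
      by (intro continuous_imp_measurable_on_sets_lebesgue continuous_on_subset[OF c]) auto
    show "AE s in lebesgue_on {t<..<\<tau>}. norm (loc_norm I (S (t + \<tau> - s) \<psi>)) \<le> norm \<psi>"
      using order_trans[OF loc_norm_le[of I] norm_heat_semigroup_le] loc_norm_nonneg[of I] by (intro AE_I2) simp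
  qed
  have "(LINT s|lebesgue_on {t<..<\<tau>}. loc_norm I (S (t + \<tau> - s) \<psi>)) = integral {t<..<\<tau>} (\<lambda>s. loc_norm I (S (t + \<tau> - s) \<psi>))"
    using i by (rule lebesgue_integral_eq_integral) simp
  also have "\<dots> = integral {t..\<tau>} (\<lambda>s. loc_norm I (S (t + \<tau> - s) \<psi>))"
    by (rule integral_open_interval_real[symmetric])
  also have "\<dots> = integral {t..\<tau>} (\<lambda>r. loc_norm I (S r \<psi>))"
  proof -
    have "((\<lambda>r. loc_norm I (S r \<psi>)) has_integral integral {t..\<tau>} (\<lambda>r. loc_norm I (S r \<psi>))) (cbox t \<tau>)"
      using loc_norm_S_integrable_on[OF assms(1), of \<psi> \<tau>] by (simp add: integrable_integral)
    from has_integral_affinity[OF this, of "-1" "t + \<tau>"] assms show ?thesis by (simp add: integral_unique algebra_simps)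
  qed
  finally show "(LINT s|lebesgue_on {t<..<\<tau>}. loc_norm I (S (t + \<tau> - s) \<psi>)) = integral {t..\<tau>} (\<lambda>r. loc_norm I (S r \<psi>))" .
qed

end

section \<open>Unique continuation\<close>

text \<open>Rolle's theorem between \<open>t0\<close>, itself a zero by continuity, and the zeros
  near it.\<close>

lemma derivative_zeros_accumulate:
  fixes f f' :: "real \<Rightarrow> real"
  assumes d: "\<And>t. t > 0 \<Longrightarrow> (f has_real_derivative f' t) (at t)" and t0: "t0 > 0"
    and lim: "t0 islimpt {t. t > 0 \<and> f t = 0}"
  shows "f t0 = 0" "t0 islimpt {t. t > 0 \<and> f' t = 0}"
proof -
  have cont: "isCont f t" if "t > 0" for t using DERIV_isCont[OF d[OF that]] .
  obtain X where X: "\<And>n. X n > 0" "\<And>n. f (X n) = 0" "X \<longlonglongrightarrow> t0"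
    using lim unfolding islimpt_sequential by auto
  have "(\<lambda>n. f (X n)) \<longlonglongrightarrow> f t0" by (rule isCont_tendsto_compose[OF cont[OF t0] X(3)])
  thus z: "f t0 = 0" by (simp add: X(2) LIMSEQ_const_iff)
  show "t0 islimpt {t. t > 0 \<and> f' t = 0}" unfolding islimpt_approachable
  proof (intro allI impI)
    fix e :: real assume "e > 0"
    then obtain y where y: "y > 0" "f y = 0" "y \<noteq> t0" "dist y t0 < e" using lim unfolding islimpt_approachable by blast
    define a where "a = min y t0"
    define b where "b = max y t0"
    have ab: "a < b" "a > 0" "f a = f b" using y t0 z by (auto simp: a_def b_def min_def max_def)
    obtain s where s: "a < s" "s < b" "(f has_real_derivative 0) (at s)"
    proof -
      have "\<exists>s. a < s \<and> s < b \<and> (f has_real_derivative 0) (at s)"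
      proof (rule Rolle[OF ab(1,3)])
        show "continuous_on {a..b} f" using ab(2) by (intro continuous_at_imp_continuous_on ballI cont) auto
        show "f differentiable (at x)" if "a < x" "x < b" for x using d[of x] that ab(2) by (auto simp: real_differentiable_def)
      qed
      thus thesis using that by blast
    qed
    have "f' s = 0" using DERIV_unique[OF d s(3)] s(1) ab(2) by simp
    moreover have "s \<noteq> t0" "dist s t0 < e" "s > 0"
      using s(1,2) y(4) ab(2) by (auto simp: a_def b_def min_def max_def dist_real_def split: if_splits)
    ultimately show "\<exists>x'\<in>{t. t > 0 \<and> f' t = 0}. x' \<noteq> t0 \<and> dist x' t0 < e" by blast
  qed
qed

text \<open>The identity theorem for a real analytic function given together with its derivatives.
  The set \<open>Z\<close> of zeros of infinite order is closed by continuity and open by Taylor's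
  formula, hence the whole half line once it contains \<open>t0\<close>, which it does by Rolle's
  theorem.\<close>

lemma analytic_chain_zero:
  fixes h :: "nat \<Rightarrow> real \<Rightarrow> real"
  assumes d: "\<And>j t. t > 0 \<Longrightarrow> (h j has_real_derivative h (Suc j) t) (at t)"
    and bd: "\<And>j t. t > 0 \<Longrightarrow> \<bar>h j t\<bar> \<le> C * (fact (Suc j) / t ^ Suc j)"
    and t0: "t0 > 0" "t0 islimpt {t. t > 0 \<and> h 0 t = 0}" and t: "t > 0"
  shows "h j t = 0"
proof -
  define Z where "Z = {s. 0 < s \<and> (\<forall>j. h j s = 0)}"
  have mem: "s \<in> Z" if s: "s > 0" "s islimpt {t. t > 0 \<and> h 0 t = 0}" for s
  proof -
    have "s islimpt {t. t > 0 \<and> h j t = 0}" for j by (induction j) (use s in "auto intro: derivative_zeros_accumulate(2)[OF d]")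
    thus ?thesis using derivative_zeros_accumulate(1)[OF d s(1)] s(1) by (auto simp: Z_def)
  qed
  have C: "C \<ge> 0"
  proof -
    have "0 \<le> C * (fact (Suc 0) / 1 ^ Suc 0)" using bd[of 1 0] abs_ge_zero[of "h 0 1"] by linarith
    thus ?thesis by simp
  qed
  \<comment> \<open>Within \<open>s / 4\<close> of \<open>s\<close> the intermediate point of
    Taylor's formula is at least \<open>3 * s / 4\<close>, so the remainder is at most a multiple of
    \<open>Suc n * (1 / 3) ^ n\<close>.\<close>
  have near: "h 0 x = 0" if s: "s \<in> Z" and x: "\<bar>x - s\<bar> < s / 4" for s x
  proof -
    have s0: "s > 0" "\<And>j. h j s = 0" using s by (auto simp: Z_def)
    have "\<bar>h 0 x\<bar> \<le> C * (4 / (3 * s)) * (real (Suc n) * (1/3) ^ n)" if n: "n > 0" for n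
    proof (cases "x = s")
      case False
      have "\<exists>r. (if x < s then x < r \<and> r < s else s < r \<and> r < x) \<and>
          h 0 x = (\<Sum>m<n. h m s / fact m * (x - s) ^ m) + h n r / fact n * (x - s) ^ n"
      proof (rule Taylor[OF n, where a = "3 * s / 4" and b = "5 * s / 4"])
        show "\<forall>m t. m < n \<and> 3 * s / 4 \<le> t \<and> t \<le> 5 * s / 4 \<longrightarrow> (h m has_real_derivative h (Suc m) t) (at t)"
          using s0(1) by (intro allI impI d) (auto intro: less_le_trans[of 0 "3 * s / 4"])
        show "3 * s / 4 \<le> s" "s \<le> 5 * s / 4" using s0(1) by linarith+
        show "3 * s / 4 \<le> x" "x \<le> 5 * s / 4" using x by (simp_all add: abs_if split: if_splits)
      qed (use False in simp_all)
      then obtain r where r: "if x < s then x < r \<and> r < s else s < r \<and> r < x" "h 0 x = h n r / fact n * (x - s) ^ n"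
        using s0(2) by auto
      have r34: "r \<ge> 3 * s / 4" "r > 0" using r(1) x s0(1) by (auto simp: abs_if split: if_splits)
      have "\<bar>h 0 x\<bar> = \<bar>h n r\<bar> / fact n * \<bar>x - s\<bar> ^ n" by (simp add: r(2) abs_mult power_abs)
      also have "\<dots> \<le> (C * (fact (Suc n) / r ^ Suc n)) / fact n * (s / 4) ^ n"
        using x C r34(2) by (intro mult_mono divide_right_mono bd power_mono) auto
      also have "\<dots> = C * real (Suc n) * ((1 / r) ^ Suc n * (s / 4) ^ n)"
      proof -
        have gen: "(a * (q * F / p)) / F * w = a * q * (1 / p * w)" if "F \<noteq> 0" for a q F p w :: real
          using that by (cases "p = 0") (simp_all add: field_simps)
        show ?thesis unfolding fact_Suc power_one_over by (rule gen) simp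
      qed
      also have "\<dots> \<le> C * real (Suc n) * ((4 / (3 * s)) ^ Suc n * (s / 4) ^ n)"
      proof (intro mult_left_mono mult_right_mono power_mono)
        show "1 / r \<le> 4 / (3 * s)" using r34 s0(1) by (simp add: field_simps)
      qed (use r34 C s0(1) in auto)
      also have "(4 / (3 * s)) ^ Suc n * (s / 4) ^ n = 4 / (3 * s) * (4 / (3 * s) * (s / 4)) ^ n"
        by (simp only: power_Suc power_mult_distrib mult.assoc)
      also have "4 / (3 * s) * (s / 4) = 1 / 3" using s0(1) by simp
      finally show ?thesis by (simp only: mult_ac)
    qed (use s0 C in simp)
    moreover have "(\<lambda>n. C * (4 / (3 * s)) * (real (Suc n) * (1/3) ^ n)) \<longlonglongrightarrow> C * (4 / (3 * s)) * 0"
    proof (intro tendsto_intros)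
      have "(\<lambda>n. real n * (1/3) ^ n + (1/3 :: real) ^ n) \<longlonglongrightarrow> 0 + 0"
        by (intro tendsto_add powser_times_n_limit_0 LIMSEQ_realpow_zero) auto
      thus "(\<lambda>n. real (Suc n) * (1/3) ^ n) \<longlonglongrightarrow> 0" by (simp add: algebra_simps)
    qed
    ultimately have "\<bar>h 0 x\<bar> \<le> 0"
      by (intro LIMSEQ_le_const[where X = "\<lambda>n. C * (4 / (3 * s)) * (real (Suc n) * (1/3) ^ n)"] exI[of _ 1]) auto
    thus ?thesis by simp
  qed
  have nbhd: "x \<in> Z" if s: "s \<in> Z" and x: "\<bar>x - s\<bar> < s / 4" for s x
  proof (rule mem)
    show x0: "x > 0" using x s by (auto simp: Z_def abs_if split: if_splits)
    have "x islimpt ball s (s / 4)" using x s by (intro open_imp_islimpt) (auto simp: dist_real_def abs_minus_commute)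
    moreover have "ball s (s / 4) \<subseteq> {t. t > 0 \<and> h 0 t = 0}"
    proof
      fix y assume "y \<in> ball s (s / 4)"
      hence y: "\<bar>y - s\<bar> < s / 4" by (simp add: dist_real_def abs_minus_commute)
      hence "y > 0" using s by (auto simp: Z_def abs_if split: if_splits)
      thus "y \<in> {t. t > 0 \<and> h 0 t = 0}" using near[OF s y] by simp
    qed
    ultimately show "x islimpt {t. t > 0 \<and> h 0 t = 0}" by (rule islimpt_subset)
  qed
  have "openin (top_of_set {0<..}) Z" unfolding openin_contains_ball
  proof (intro conjI ballI)
    show "Z \<subseteq> {0<..}" by (auto simp: Z_def)
    fix s assume s: "s \<in> Z"
    hence "s > 0" by (simp add: Z_def)
    moreover have "ball s (s / 4) \<inter> {0<..} \<subseteq> Z" using nbhd[OF s] by (auto simp: dist_real_def abs_minus_commute)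
    ultimately show "\<exists>e>0. ball s e \<inter> {0<..} \<subseteq> Z" by (intro exI[of _ "s / 4"]) simp
  qed
  moreover have "closedin (top_of_set {0<..}) Z"
  proof -
    have "closedin (top_of_set {0<..}) {s \<in> {0<..}. h j s = 0}" for j
      by (intro continuous_closedin_preimage_constant continuous_at_imp_continuous_on ballI DERIV_isCont[OF d]) auto
    hence "closedin (top_of_set {0<..}) (\<Inter>j. {s \<in> {0<..}. h j s = 0})" by (intro closedin_Inter) auto
    moreover have "(\<Inter>j. {s \<in> {0<..}. h j s = 0}) = Z" by (auto simp: Z_def)
    ultimately show ?thesis by simp
  qed
  moreover have "connected {0::real<..}" by simp
  ultimately have "Z = {} \<or> Z = {0<..}" unfolding connected_clopen by blast
  moreover have "Z \<noteq> {}" using mem[OF t0] by blast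
  ultimately have "t \<in> Z" using t by simp
  thus ?thesis by (simp add: Z_def)
qed

context coefficient
begin

lemma bounded_linear_sol:
  assumes "0 \<le> x" "x \<le> 1"
  shows "bounded_linear (\<lambda>F. sol c F x)" by (rule bounded_linear_intro[where K = "2 * K"])
    (use norm_sol_le[OF assms] in "auto simp: sol_add sol_scaleR mult.commute")

text \<open>At fixed \<open>x\<close> the solution is analytic in time and each time derivative
  raises the order of \<open>V\<close> with a change of sign, hence the factor
  \<open>(-1) ^ j\<close>. Scalar products with all \<open>z\<close> reduce the claim to real
  functions.\<close>

lemma sol_heat_zero:
  assumes x: "0 \<le> x" "x \<le> 1" and t0: "t0 > 0" "t0 islimpt {t. t > 0 \<and> kernel \<psi> (t, x) = 0}" and t: "t > 0"
  shows "sol c (V t (Suc j) \<psi>) x = 0"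
proof -
  have "inner (sol c (V t (Suc j) \<psi>) x) z = 0" for z
  proof -
    define h where "h j t = (-1) ^ j * inner (sol c (V t (Suc j) \<psi>) x) z" for j t
    have "h j t = 0"
    proof (rule analytic_chain_zero[of h "2 * K * norm \<psi> * norm z" t0, OF _ _ t0(1) _ t])
      show "(h j has_real_derivative h (Suc j) s) (at s)" if s: "s > 0" for j s
      proof -
        have "((\<lambda>t. sol c (V t (Suc j) \<psi>) x) has_vector_derivative sol c (- V s (Suc (Suc j)) \<psi>) x) (at s)"
          by (rule bounded_linear.has_vector_derivative[OF bounded_linear_sol[OF x] heat_has_vector_derivative[OF s]])
        from bounded_linear.has_vector_derivative[OF bounded_linear_inner_left this, of z]
        have "((\<lambda>t. inner (sol c (V t (Suc j) \<psi>) x) z) has_real_derivative inner (sol c (- V s (Suc (Suc j)) \<psi>) x) z) (at s)"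
          by (simp add: has_real_derivative_iff_has_vector_derivative)
        from DERIV_cmult[OF this, of "(-1) ^ j"] show ?thesis
          using sol_scaleR[of "-1" "V s (Suc (Suc j)) \<psi>" x] by (simp add: h_def[abs_def])
      qed
      show "\<bar>h j s\<bar> \<le> 2 * K * norm \<psi> * norm z * (fact (Suc j) / s ^ Suc j)" if s: "s > 0" for j s
      proof -
        have "\<bar>h j s\<bar> \<le> norm (sol c (V s (Suc j) \<psi>) x) * norm z"
          unfolding h_def using Cauchy_Schwarz_ineq2 by (simp add: abs_mult power_abs)
        also have "\<dots> \<le> (2 * K * (fact (Suc j) / s ^ Suc j * norm \<psi>)) * norm z"
          using K by (intro mult_right_mono order_trans[OF norm_sol_le[OF x]] mult_left_mono norm_heat_le s) auto
        finally show ?thesis by (simp only: mult_ac)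
      qed
      show "t0 islimpt {t. t > 0 \<and> h 0 t = 0}" by (rule islimpt_subset[OF t0(2)]) (auto simp: h_def kernel_def)
    qed
    thus ?thesis by (simp add: h_def)
  qed
  thus ?thesis using inner_eq_zero_iff by blast
qed

text \<open>With a merely measurable coefficient the solution has no classical derivative, so the
  argument uses the continuous flux. If its value \<open>f0\<close> at \<open>x0\<close> were not
  zero, its component along \<open>f0\<close> would be positive nearby, and the integral of flux
  over \<open>c\<close> from \<open>x0\<close> to a nearby zero could not vanish.\<close>

lemma flux_zero:
  assumes x0: "0 \<le> x0" "x0 \<le> 1" and lim: "x0 islimpt {x. 0 \<le> x \<and> x \<le> 1 \<and> sol c F x = 0}"
  shows "sol c F x0 = 0" "flux c F x0 = 0"
proof -
  obtain X where X: "\<And>n. 0 \<le> X n" "\<And>n. X n \<le> 1" "\<And>n. sol c F (X n) = 0" "\<And>n. X n \<noteq> x0" "X \<longlonglongrightarrow> x0"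
    using lim unfolding islimpt_sequential by auto
  have "(\<lambda>n. sol c F (X n)) \<longlonglongrightarrow> sol c F x0"
    by (rule continuous_on_tendsto_compose[OF continuous_on_sol[of UNIV] X(5)]) auto
  thus z: "sol c F x0 = 0" by (simp add: X(3) LIMSEQ_const_iff)
  show "flux c F x0 = 0"
  proof (rule ccontr)
    assume f0: "flux c F x0 \<noteq> 0"
    define f0 where "f0 = flux c F x0"
    have pos: "inner f0 f0 > 0" using f0 by (simp add: f0_def)
    have "continuous_on UNIV (\<lambda>y. inner (flux c F y) f0)" by (intro continuous_intros continuous_on_flux)
    hence "((\<lambda>y. inner (flux c F y) f0) \<longlongrightarrow> inner f0 f0) (at x0)" by (auto simp: continuous_on_def f0_def)
    hence "\<forall>\<^sub>F y in at x0. inner f0 f0 / 2 < inner (flux c F y) f0" by (rule order_tendstoD) (use pos in simp)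
    then obtain e where e: "e > 0" "\<And>y. y \<noteq> x0 \<Longrightarrow> dist y x0 < e \<Longrightarrow> inner f0 f0 / 2 < inner (flux c F y) f0"
      unfolding eventually_at by auto
    obtain n where n: "dist (X n) x0 < e" using LIMSEQ_D[OF X(5) e(1)] by (auto simp: dist_norm)
    define a where "a = min (X n) x0"
    define b where "b = max (X n) x0"
    have ab: "0 \<le> a" "a < b" "b \<le> 1" using X(1,2,4)[of n] x0 by (auto simp: a_def b_def min_def max_def)
    have eq: "sol c F b = sol c F a" using z X(3)[of n] by (auto simp: a_def b_def min_def max_def)
    have near: "inner f0 f0 / 2 < inner (flux c F y) f0" if "a \<le> y" "y < b" for y
    proof (cases "y = x0")
      case False
      thus ?thesis using that n by (intro e(2)) (auto simp: a_def b_def min_def max_def dist_real_def split: if_splits)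
    qed (use pos in "simp add: f0_def")
    define g where "g y = indicator {a..<b} y *\<^sub>R (inverse (c y) *\<^sub>R flux c F y)" for y
    have gi: "integrable U g" unfolding g_def using flux_integrable by (rule integrable_indicator_unit) simp
    have "0 = sol c F b - sol c F a" using eq by simp
    also have "\<dots> = (LINT y|U. g y)" unfolding sol_def g_def by (rule prim_diff_eq[OF flux_integrable]) (use ab in simp)
    finally have "(LINT y|U. inner (g y) f0) = 0" using gi by (subst integral_inner_left) auto
    moreover have "(LINT y|U. indicator {a..<b} y * (1 / K * (inner f0 f0 / 2))) \<le> (LINT y|U. inner (g y) f0)"
    proof (rule integral_mono_AE)
      show "integrable U (\<lambda>y. indicator {a..<b} y * (1 / K * (inner f0 f0 / 2)))" by (rule integrable_indicator_mult) auto
      show "integrable U (\<lambda>y. inner (g y) f0)" using gi by (rule integrable_inner_left[rotated])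
      show "AE y in U. indicator {a..<b} y * (1 / K * (inner f0 f0 / 2)) \<le> inner (g y) f0" using inverse_c_bounds inverse_c_nonneg
      proof eventually_elim
        case (elim y)
        show ?case
        proof (cases "y \<in> {a..<b}")
          case True
          have "1 / K * (inner f0 f0 / 2) \<le> inverse (c y) * inner (flux c F y) f0"
            using elim near[of y] True pos by (intro mult_mono) auto
          thus ?thesis using True by (simp add: g_def)
        qed (simp add: g_def)
      qed
    qed
    moreover have "(LINT y|U. indicator {a..<b} y * (1 / K * (inner f0 f0 / 2))) = (b - a) * (1 / K * (inner f0 f0 / 2))"
      by (subst integral_unit_leb_Icc) (use ab in auto)
    moreover have "(b - a) * (1 / K * (inner f0 f0 / 2)) > 0" using ab K pos by (intro mult_pos_pos) auto
    ultimately show False by linarith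
  qed
qed

text \<open>Zeros that accumulate in time at one \<open>x\<close> spread to all times and all orders
  of \<open>V\<close>. Accumulation in \<open>x\<close> then makes both Cauchy data vanish at
  \<open>x0\<close>, for every order; sideways and backward uniqueness do the rest.\<close>

lemma kernel_unique_continuation:
  assumes lim: "x0 islimpt X" and X: "X \<subseteq> {0..1}"
    and z: "\<And>x. x \<in> X \<Longrightarrow> \<exists>t0>0. t0 islimpt {t. t > 0 \<and> kernel \<psi> (t, x) = 0}"
  shows "\<psi> = 0"
proof (rule S_injective[where t = 1])
  have x0: "x0 \<in> {0..1}" using islimpt_subset[OF lim X] closed_limpt[of "{0..1::real}"] by simp
  have "x0 islimpt {x. 0 \<le> x \<and> x \<le> 1 \<and> sol c (V 1 (Suc j) \<psi>) x = 0}" for j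
  proof (rule islimpt_subset[OF lim], rule subsetI)
    fix x assume "x \<in> X"
    then obtain t0 where "t0 > 0" "t0 islimpt {t. t > 0 \<and> kernel \<psi> (t, x) = 0}" using z by blast
    thus "x \<in> {x. 0 \<le> x \<and> x \<le> 1 \<and> sol c (V 1 (Suc j) \<psi>) x = 0}"
      using \<open>x \<in> X\<close> X sol_heat_zero[of x t0 \<psi> 1 j] by auto
  qed
  note fz = flux_zero[OF _ _ this]
  show "S 1 \<psi> = 0" by (rule S_eq_0_of_chain[where ?x0.0 = x0]) (use x0 fz in "auto simp: cauchy_chain_def")
qed simp

end

section \<open>Duality\<close>

context control_cylinder
begin

lemma admissible_combination:
  assumes "u \<in> admissible R" "v \<in> admissible R'"
  shows "(\<lambda>p. a *\<^sub>R u p + b *\<^sub>R v p) \<in> admissible (\<bar>a\<bar> * R + \<bar>b\<bar> * R')"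
proof -
  have m: "u \<in> borel_measurable Q" "v \<in> borel_measurable Q" and b: "AE p in Q. norm (u p) \<le> R" "AE p in Q. norm (v p) \<le> R'"
    using assms by (auto simp: admissible_def)
  note [measurable] = m
  have "AE p in Q. norm (a *\<^sub>R u p + b *\<^sub>R v p) \<le> \<bar>a\<bar> * R + \<bar>b\<bar> * R'" using b
  proof eventually_elim
    case (elim p)
    have "norm (a *\<^sub>R u p + b *\<^sub>R v p) \<le> \<bar>a\<bar> * norm (u p) + \<bar>b\<bar> * norm (v p)"
      using norm_triangle_ineq[of "a *\<^sub>R u p" "b *\<^sub>R v p"] by simp
    thus ?case using mult_left_mono[OF elim(1), of "\<bar>a\<bar>"] mult_left_mono[OF elim(2), of "\<bar>b\<bar>"] by linarith
  qed
  thus ?thesis unfolding admissible_def by (auto intro: m)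
qed

lemma admissible_mono: "u \<in> admissible R \<Longrightarrow> R \<le> R' \<Longrightarrow> u \<in> admissible R'"
  unfolding admissible_def by (auto elim: eventually_mono)

lemma admissible_zero: "R \<ge> 0 \<Longrightarrow> (\<lambda>_. 0) \<in> admissible R" by (simp add: admissible_def)

lemma admissible_limit:
  assumes u: "\<And>k. u k \<in> admissible R" and v: "v \<in> borel_measurable Q" and lim: "AE p in Q. (\<lambda>k. u k p) \<longlonglongrightarrow> v p"
  shows "v \<in> admissible R"
proof -
  have "AE p in Q. \<forall>k. norm (u k p) \<le> R" using u by (simp add: AE_all_countable admissible_def)
  hence "AE p in Q. norm (v p) \<le> R" using lim
  proof eventually_elim
    case (elim p)
    show ?case by (rule LIMSEQ_le_const2[OF tendsto_norm[OF elim(2)]]) (use elim(1) in blast)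
  qed
  thus ?thesis using v by (simp add: admissible_def)
qed

lemma admissible_midpoint:
  assumes "u \<in> admissible R" "v \<in> admissible R"
  shows "(\<lambda>p. (1/2) *\<^sub>R (u p + v p)) \<in> admissible R"
  using admissible_combination[OF assms, of "1/2" "1/2"] by (simp add: scaleR_add_right)

text \<open>Stands for closed convex sets of functions. Midpoints and limits almost everywhere are
  the two closure properties that the minimal-norm construction requires.\<close>

definition stable :: "((real \<times> real \<Rightarrow> complex) \<Rightarrow> bool) \<Rightarrow> bool" where
  "stable P \<longleftrightarrow> (\<forall>u v. P u \<longrightarrow> P v \<longrightarrow> P (\<lambda>p. (1/2) *\<^sub>R (u p + v p))) \<and>
     (\<forall>u v. (\<forall>k. P (u k)) \<longrightarrow> v \<in> borel_measurable Q \<longrightarrow> (AE p in Q. (\<lambda>k. u k p) \<longlonglongrightarrow> v p) \<longrightarrow> P v)"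

lemma stable_admissible: "stable (\<lambda>w. w \<in> admissible R)"
  unfolding stable_def by (blast intro: admissible_midpoint admissible_limit)

lemma stable_le:
  assumes mid: "\<And>u v. u \<in> admissible R \<Longrightarrow> v \<in> admissible R \<Longrightarrow> F (\<lambda>p. (1/2) *\<^sub>R (u p + v p)) \<le> (F u + F v) / 2"
    and lim: "\<And>u v. (\<And>k. u k \<in> admissible R) \<Longrightarrow> v \<in> admissible R \<Longrightarrow> AE p in Q. (\<lambda>k. u k p) \<longlonglongrightarrow> v p \<Longrightarrow>
      (\<lambda>k. F (u k)) \<longlonglongrightarrow> (F v :: real)"
  shows "stable (\<lambda>w. w \<in> admissible R \<and> F w \<le> e)"
  unfolding stable_def
proof (intro conjI allI impI)
  fix u v assume "u \<in> admissible R \<and> F u \<le> e" "v \<in> admissible R \<and> F v \<le> e"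
  thus "(\<lambda>p. (1/2) *\<^sub>R (u p + v p)) \<in> admissible R" "F (\<lambda>p. (1/2) *\<^sub>R (u p + v p)) \<le> e"
    using mid[of u v] admissible_midpoint[of u R v] by auto
next
  fix u v assume u: "\<forall>k. u k \<in> admissible R \<and> F (u k) \<le> e"
    and v: "v \<in> borel_measurable Q" "AE p in Q. (\<lambda>k. u k p) \<longlonglongrightarrow> v p"
  show va: "v \<in> admissible R" by (rule admissible_limit[OF _ v]) (use u in blast)
  show "F v \<le> e" by (rule LIMSEQ_le_const2[OF lim[OF _ va v(2)]]) (use u in blast)+
qed

text \<open>A replacement for weak compactness: bounded sequences have a common point in all closed convex sets that
  eventually contain them.\<close>

lemma weak_cluster:
  assumes u: "\<And>n. u n \<in> admissible R"
  obtains v where "\<And>P. stable P \<Longrightarrow> \<forall>\<^sub>F n in sequentially. P (u n) \<Longrightarrow> P v"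
proof -
  \<comment> \<open>This plays the part of the closed convex hull of the tail of \<open>u\<close>
    from index \<open>k\<close> on.\<close>
  define C where "C k = {w. \<forall>P. stable P \<longrightarrow> (\<forall>n\<ge>k. P (u n)) \<longrightarrow> P w}" for k :: nat
  have C0: "w \<in> admissible R" if "w \<in> C 0" for w
    using that stable_admissible[of R] u unfolding C_def by (auto simp only: mem_Collect_eq)
  have "(\<Inter>k. C k) \<noteq> {}"
  proof (rule nested_convex_functions_nonempty[OF finite_measure_Q, where R = R])
    show "C k \<noteq> {}" for k unfolding C_def by blast
    show "C (Suc k) \<subseteq> C k" for k unfolding C_def by (auto dest: Suc_leD)
    show "(\<lambda>p. (1/2) *\<^sub>R (v p + w p)) \<in> C k" if "v \<in> C k" "w \<in> C k" for k v w
      using that unfolding C_def stable_def by blast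
    show "w \<in> C k" if v: "\<And>n. v n \<in> C k" "w \<in> borel_measurable Q" "AE p in Q. (\<lambda>n. v n p) \<longlonglongrightarrow> w p" for k v w
      unfolding C_def mem_Collect_eq
    proof (intro allI impI)
      fix P assume P: "stable P" "\<forall>n\<ge>k. P (u n)"
      have "P (v n)" for n using v(1)[of n] P unfolding C_def by blast
      thus "P w" using P(1) v(2,3) unfolding stable_def by blast
    qed
  qed (use C0 in "auto simp: admissible_def")
  then obtain v where "\<And>k. v \<in> C k" by blast
  thus thesis by (intro that[of v]) (auto simp: C_def eventually_sequentially)
qed

end

section \<open>The reachable set and its support function\<close>

context control_system
begin

lemma final_combination:
  assumes u: "u \<in> admissible R" and v: "v \<in> admissible R'" and R: "R \<ge> 0" "R' \<ge> 0"
  shows "final (\<lambda>p. a *\<^sub>R u p + b *\<^sub>R v p) = a *\<^sub>R final u + b *\<^sub>R final v"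
proof -
  note iu = propagated_integrable[OF u R(1) order_refl, of \<tau>] and iv = propagated_integrable[OF v R(2) order_refl, of \<tau>]
  note lin = linear_heat_semigroup
  have uv: "(\<lambda>p. a *\<^sub>R u p + b *\<^sub>R v p) \<in> admissible (\<bar>a\<bar> * R + \<bar>b\<bar> * R')" by (rule admissible_combination[OF u v])
  have "final (\<lambda>p. a *\<^sub>R u p + b *\<^sub>R v p) = (LINT s|J. a *\<^sub>R S (\<tau> - s) (source I u s) + b *\<^sub>R S (\<tau> - s) (source I v s))"
    unfolding final_def
  proof (rule integral_cong_AE)
    show "AE s in J. S (\<tau> - s) (source I (\<lambda>p. a *\<^sub>R u p + b *\<^sub>R v p) s) = a *\<^sub>R S (\<tau> - s) (source I u s) + b *\<^sub>R S (\<tau> - s) (source I v s)"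
      using source_combination[OF u v R, of a b] by eventually_elim (simp add: linear_add[OF lin] linear_scale[OF lin])
    show "(\<lambda>s. S (\<tau> - s) (source I (\<lambda>p. a *\<^sub>R u p + b *\<^sub>R v p) s)) \<in> borel_measurable J"
      by (rule propagated_measurable[OF source_measurable[OF uv]]) (use R in simp)
  qed (use iu iv in auto)
  also have "\<dots> = a *\<^sub>R final u + b *\<^sub>R final v"
    unfolding final_def using iu iv by (subst Bochner_Integration.integral_add) auto
  finally show ?thesis .
qed

lemma final_midpoint:
  assumes "u \<in> admissible R" "v \<in> admissible R" "R \<ge> 0"
  shows "final (\<lambda>p. (1/2) *\<^sub>R (u p + v p)) = (1/2) *\<^sub>R final u + (1/2) *\<^sub>R final v"
  using final_combination[OF assms(1,2,3,3), of "1/2" "1/2"] by (simp add: scaleR_add_right)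

lemma final_tendsto:
  assumes u: "\<And>k. u k \<in> admissible R" and v: "v \<in> admissible R" and R: "R \<ge> 0"
    and lim: "AE p in Q. (\<lambda>k. u k p) \<longlonglongrightarrow> v p"
  shows "(\<lambda>k. final (u k)) \<longlonglongrightarrow> final v"
  unfolding final_def
proof (rule integral_dominated_convergence[where w = "\<lambda>_. R"])
  interpret finite_measure J by (rule finite_measure_J)
  show "(\<lambda>s. S (\<tau> - s) (source I v s)) \<in> borel_measurable J"
    by (rule propagated_measurable[OF source_measurable[OF v R]])
  show "(\<lambda>s. S (\<tau> - s) (source I (u k) s)) \<in> borel_measurable J" for k
    by (rule propagated_measurable[OF source_measurable[OF u R]])
  show "integrable J (\<lambda>_. R)" by simp
  show "AE s in J. (\<lambda>k. S (\<tau> - s) (source I (u k) s)) \<longlonglongrightarrow> S (\<tau> - s) (source I v s)"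
    using source_tendsto[OF u v R lim] by eventually_elim (rule bounded_linear.tendsto[OF bounded_linear_heat_semigroup])
  show "AE s in J. norm (S (\<tau> - s) (source I (u k) s)) \<le> R" for k
    using norm_source_le[OF u R, of k] by eventually_elim (rule order_trans[OF norm_heat_semigroup_le])
qed

lemma inner_final_integrable:
  assumes u: "u \<in> admissible R" and R: "R \<ge> 0"
  shows "integrable J (\<lambda>s. inner (S (\<tau> - s) \<psi>) (source I u s))"
  using integrable_inner_right[of \<psi> J "\<lambda>s. S (\<tau> - s) (source I u s)"] propagated_integrable[OF u R order_refl]
  by (simp add: heat_semigroup_sym)

lemma inner_final_le:
  assumes u: "u \<in> admissible R" and R: "R \<ge> 0"
  shows "inner \<psi> (final u) \<le> R * mass \<psi>"
proof -
  have "inner \<psi> (final u) \<le> (LINT s|J. R * loc_norm I (S (\<tau> - s) \<psi>))" unfolding inner_final[OF u R]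
  proof (rule integral_mono_AE)
    show "integrable J (\<lambda>s. inner (S (\<tau> - s) \<psi>) (source I u s))" by (rule inner_final_integrable[OF u R])
    show "integrable J (\<lambda>s. R * loc_norm I (S (\<tau> - s) \<psi>))"
      using integrable_loc_norm_reflected[of 0 \<psi>] \<tau>_pos by simp
    show "AE s in J. inner (S (\<tau> - s) \<psi>) (source I u s) \<le> R * loc_norm I (S (\<tau> - s) \<psi>)"
      using inner_source_le[OF u R] by eventually_elim blast
  qed
  thus ?thesis using integral_loc_norm_reflected[of 0 \<psi>] \<tau>_pos by (simp add: mass_def)
qed

lemma kernel_section_measurable [measurable]: "(\<lambda>x. kernel \<psi> (t, x)) \<in> borel_measurable U"
  unfolding kernel_def fst_conv snd_conv by (rule sol_measurable)

lemma continuous_on_backward_kernel: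
  "T \<le> \<tau> \<Longrightarrow> continuous_on ({0<..<T} \<times> I) (\<lambda>p. kernel \<psi> (T - fst p, snd p))"
  by (rule continuous_on_compose2[OF continuous_on_kernel]) (use i0 i1 in "auto intro!: continuous_intros")

text \<open>The sign of the adjoint state: among controls of size one supported in \<open>E\<close>,
  it has the largest pairing with that state. For duality \<open>E\<close> is everything and
  \<open>T = \<tau>\<close>; for the bang-bang property \<open>E\<close> is the deficient set and
  \<open>T < \<tau>\<close>.\<close>

definition steering :: "real \<Rightarrow> (real \<times> real) set \<Rightarrow> L2 \<Rightarrow> real \<times> real \<Rightarrow> complex" where
  "steering T E \<psi> p = indicator (E \<inter> {0<..<T} \<times> I) p *\<^sub>R sgn (kernel \<psi> (T - fst p, snd p))"

lemma backward_kernel_borel: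
  assumes "T \<le> \<tau>"
  shows "(\<lambda>p. indicator ({0<..<T} \<times> I) p *\<^sub>R kernel \<psi> (T - fst p, snd p)) \<in> borel_measurable borel"
  by (rule borel_measurable_continuous_on_indicator[OF _ continuous_on_backward_kernel[OF assms]])
    (intro borel_open open_Times open_greaterThanLessThan)

lemma steering_borel:
  assumes "T \<le> \<tau>" and [measurable]: "E \<in> sets borel"
  shows "steering T E \<psi> \<in> borel_measurable borel"
proof -
  define g where "g p = indicator ({0<..<T} \<times> I) p *\<^sub>R kernel \<psi> (T - fst p, snd p)" for p
  have [measurable]: "g \<in> borel_measurable borel" unfolding g_def by (rule backward_kernel_borel[OF assms(1)])
  have "steering T E \<psi> = (\<lambda>p. indicator E p *\<^sub>R (g p /\<^sub>R norm (g p)))"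
    by (auto simp: fun_eq_iff steering_def g_def indicator_def sgn_div_norm)
  thus ?thesis by simp
qed

lemma norm_steering_le: "norm (steering T E \<psi> p) \<le> 1" by (simp add: steering_def indicator_def norm_sgn)

lemma steering_admissible:
  assumes "T \<le> \<tau>" "E \<in> sets borel"
  shows "steering T E \<psi> \<in> admissible 1"
  unfolding admissible_def using steering_borel[OF assms, of \<psi>] norm_steering_le
  by (auto intro!: measurable_restrict_space1 measurable_completion)

lemma inner_steering:
  assumes T: "T \<le> \<tau>" and E: "E \<in> sets borel" and s: "0 < s" "s < T"
  shows "inner (S (T - s) \<psi>) (source I (steering T E \<psi>) s) =
    (LINT x|U. indicator I x * (indicator E (s, x) * norm (kernel \<psi> (T - s, x))))"
proof -
  note sq = sq_integrable_section[OF steering_borel[OF T E] norm_steering_le, of \<psi> s]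
  have [measurable]: "(\<lambda>x. indicator I x *\<^sub>R steering T E \<psi> (s, x)) \<in> borel_measurable U"
    by (rule sq_integrable_measurable[OF sq])
  have [measurable]: "(\<lambda>x. indicator E (s, x) :: real) \<in> borel_measurable U"
    by (rule section_measurable[OF borel_measurable_indicator[OF E]])
  have "inner (S (T - s) \<psi>) (source I (steering T E \<psi>) s) =
      (LINT x|U. rep_L2 (S (T - s) \<psi>) x \<bullet> (indicator I x *\<^sub>R steering T E \<psi> (s, x)))"
    unfolding source_def using inner_L2_of[OF sq_integrable_rep sq, of "S (T - s) \<psi>"] by (simp add: L2_of_rep)
  also have "\<dots> = (LINT x|U. indicator I x * (indicator E (s, x) * norm (kernel \<psi> (T - s, x))))"
  proof (rule integral_cong_AE)
    show "AE x in U. rep_L2 (S (T - s) \<psi>) x \<bullet> (indicator I x *\<^sub>R steering T E \<psi> (s, x)) =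
        indicator I x * (indicator E (s, x) * norm (kernel \<psi> (T - s, x)))"
      using rep_S_kernel[of "T - s" \<psi>] s by (auto simp: steering_def indicator_def inner_sgn_self elim!: eventually_mono)
  qed measurable
  finally show ?thesis .
qed

text \<open>Equality in \<open>inner_final_le\<close>: thus \<open>R * mass \<psi>\<close> is the
  support function of the image of \<open>admissible R\<close> under \<open>final\<close>.\<close>

lemma inner_final_steering: "inner \<psi> (final (steering \<tau> UNIV \<psi>)) = mass \<psi>"
proof -
  have "inner \<psi> (final (steering \<tau> UNIV \<psi>)) = (LINT s|J. inner (S (\<tau> - s) \<psi>) (source I (steering \<tau> UNIV \<psi>) s))"
    by (rule inner_final[OF steering_admissible]) auto
  also have "\<dots> = (LINT s|J. loc_norm I (S (0 + \<tau> - s) \<psi>))"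
    by (rule Bochner_Integration.integral_cong) (auto simp: inner_steering loc_norm_S_kernel)
  also have "\<dots> = mass \<psi>" unfolding mass_def by (rule integral_loc_norm_reflected) (use \<tau>_pos in auto)
  finally show ?thesis .
qed

text \<open>A cluster point of the controls, in the sense of \<open>weak_cluster\<close>, is mapped
  by \<open>final\<close> into every neighbourhood of \<open>y\<close>, as staying within distance
  \<open>e\<close> of \<open>y\<close> is a stable property.\<close>

lemma closed_final_admissible:
  assumes R: "R \<ge> 0"
  shows "closed (final ` admissible R)"
  unfolding closed_sequential_limits
proof (intro allI impI)
  fix Y y assume "(\<forall>n. Y n \<in> final ` admissible R) \<and> Y \<longlonglongrightarrow> y"
  hence Y: "\<And>n. Y n \<in> final ` admissible R" "Y \<longlonglongrightarrow> y" by auto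
  then obtain u where u: "\<And>n. u n \<in> admissible R" "\<And>n. Y n = final (u n)" by (auto simp: image_iff) metis
  obtain v where v: "\<And>P. stable P \<Longrightarrow> \<forall>\<^sub>F n in sequentially. P (u n) \<Longrightarrow> P v" by (rule weak_cluster[of u, OF u(1)]) blast
  have va: "v \<in> admissible R" by (rule v[OF stable_admissible]) (simp add: u)
  have "norm (final v - y) \<le> 0 + e" if "e > 0" for e
  proof -
    have "v \<in> admissible R \<and> norm (final v - y) \<le> e"
    proof (rule v[OF stable_le])
      fix u v assume a: "u \<in> admissible R" "v \<in> admissible R"
      have "final (\<lambda>p. (1/2) *\<^sub>R (u p + v p)) - y = (1/2) *\<^sub>R (final u - y) + (1/2) *\<^sub>R (final v - y)"
        unfolding final_midpoint[OF a R] using scaleR_half_double[of y, unfolded scaleR_add_right] by (simp add: algebra_simps)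
      thus "norm (final (\<lambda>p. (1/2) *\<^sub>R (u p + v p)) - y) \<le> (norm (final u - y) + norm (final v - y)) / 2"
        using norm_triangle_ineq[of "(1/2) *\<^sub>R (final u - y)" "(1/2) *\<^sub>R (final v - y)"] by simp
    next
      show "(\<lambda>k. norm (final (u k) - y)) \<longlonglongrightarrow> norm (final v - y)"
        if "\<And>k. u k \<in> admissible R" "v \<in> admissible R" "AE p in Q. (\<lambda>k. u k p) \<longlonglongrightarrow> v p" for u v
        by (rule tendsto_norm[OF tendsto_diff[OF final_tendsto[OF that(1,2) R that(3)] tendsto_const]])
    next
      show "\<forall>\<^sub>F n in sequentially. u n \<in> admissible R \<and> norm (final (u n) - y) \<le> e"
        using tendstoD[OF Y(2) that] by eventually_elim (simp add: u dist_norm)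
    qed
    thus ?thesis by simp
  qed
  hence "norm (final v - y) \<le> 0" by (rule field_le_epsilon)
  hence "y = final v" by simp
  thus "y \<in> final ` admissible R" using va by blast
qed

lemma convex_final_admissible:
  assumes R: "R \<ge> 0"
  shows "convex (final ` admissible R)"
proof (rule convexI)
  fix x y a b assume "x \<in> final ` admissible R" "y \<in> final ` admissible R" and ab: "0 \<le> a" "0 \<le> b" "a + b = (1::real)"
  then obtain u v where u: "u \<in> admissible R" "x = final u" and v: "v \<in> admissible R" "y = final v" by blast
  have "(\<lambda>p. a *\<^sub>R u p + b *\<^sub>R v p) \<in> admissible R"
    using admissible_combination[OF u(1) v(1), of a b] ab by (simp add: distrib_right[symmetric])
  thus "a *\<^sub>R x + b *\<^sub>R y \<in> final ` admissible R"
    unfolding u(2) v(2) final_combination[OF u(1) v(1) R R, symmetric] by blast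
qed

definition dual :: "L2 \<Rightarrow> real \<Rightarrow> bool" where
  "dual z0 R \<longleftrightarrow> (\<forall>\<psi>. - inner (S \<tau> \<psi>) z0 \<le> R * mass \<psi>)"

definition controls :: "L2 \<Rightarrow> real \<Rightarrow> (real \<times> real \<Rightarrow> complex) set" where
  "controls z0 R = {u \<in> admissible R. S \<tau> z0 + final u = 0}"

lemma controls_imp_dual:
  assumes "u \<in> controls z0 R" and R: "R \<ge> 0"
  shows "dual z0 R"
  unfolding dual_def
proof
  fix \<psi>
  have u: "u \<in> admissible R" "final u = - S \<tau> z0" using assms(1) by (auto simp: controls_def add_eq_0_iff)
  show "- inner (S \<tau> \<psi>) z0 \<le> R * mass \<psi>"
    using inner_final_le[OF u(1) R, of \<psi>] by (simp add: u(2) heat_semigroup_sym)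
qed

lemma mass_scaleR: "mass (r *\<^sub>R \<psi>) = \<bar>r\<bar> * mass \<psi>"
  unfolding mass_def by (simp add: linear_scale[OF linear_heat_semigroup] loc_norm_scaleR)

text \<open>If the target were outside the closed convex reachable set, some \<open>\<psi>\<close>
  would separate them; the steering control of \<open>\<psi>\<close> attains the support function
  and contradicts \<open>dual\<close>.\<close>

lemma dual_imp_controls:
  assumes d: "dual z0 R" and R: "R \<ge> 0"
  shows "controls z0 R \<noteq> {}"
proof -
  have "- S \<tau> z0 \<in> final ` admissible R"
  proof (rule ccontr)
    assume "- S \<tau> z0 \<notin> final ` admissible R"
    moreover have "final ` admissible R \<noteq> {}" using admissible_zero[OF R] by blast
    ultimately obtain \<psi> b where \<psi>: "\<And>k. k \<in> final ` admissible R \<Longrightarrow> inner \<psi> k \<le> b" "b < inner \<psi> (- S \<tau> z0)"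
      using closed_convex_separation[OF closed_final_admissible[OF R] convex_final_admissible[OF R]] by blast
    have st: "steering \<tau> UNIV \<psi> \<in> admissible 1" by (rule steering_admissible) auto
    have "(\<lambda>p. R *\<^sub>R steering \<tau> UNIV \<psi> p + 0 *\<^sub>R steering \<tau> UNIV \<psi> p) \<in> admissible R"
      using admissible_combination[OF st st, of R 0] R by simp
    from \<psi>(1)[OF imageI[OF this]] have "R * mass \<psi> \<le> b"
      unfolding final_combination[OF st st zero_le_one zero_le_one] using inner_final_steering[of \<psi>] by simp
    moreover have "inner \<psi> (- S \<tau> z0) \<le> R * mass \<psi>" using d by (simp add: dual_def heat_semigroup_sym)
    ultimately show False using \<psi>(2) by linarith
  qed
  then obtain u where "u \<in> admissible R" "final u = - S \<tau> z0" by auto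
  thus ?thesis by (auto simp: controls_def)
qed

end

section \<open>Bang-bang property\<close>

lemma (in control_cylinder) AE_cylinder_of_lborel: "AE p in lborel. P p \<Longrightarrow> AE p in Q. P p"
  by (subst AE_restrict_space_iff) (auto simp: AE_completion_iff elim: eventually_mono)

lemma (in control_cylinder) uniform_observability:
  assumes t: "0 < t" "t \<le> \<tau>"
  obtains C where "C > 0" "\<And>c \<psi>. control_system c K i0 i1 \<tau> \<Longrightarrow>
    norm (heat_semigroup (inv_op c) (4 * K) t \<psi>) \<le> C * control_system.mass c K i0 i1 \<tau> \<psi>"
proof -
  obtain C where C: "C > 0" "\<And>c \<psi>. coefficient c K \<Longrightarrow> norm (heat_semigroup (inv_op c) (4 * K) t \<psi>) \<le>
    C * integral {0..t} (\<lambda>u. loc_norm I (heat_semigroup (inv_op c) (4 * K) u \<psi>))"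
    by (rule heat_observability[OF i0 i01 i1 t(1)]) blast
  show thesis
  proof (rule that[OF C(1)])
    fix c \<psi> assume "control_system c K i0 i1 \<tau>"
    then interpret n: control_system c K i0 i1 \<tau> .
    have "integral {0..t} (\<lambda>u. loc_norm I (n.S u \<psi>)) \<le> n.mass \<psi>"
      unfolding n.mass_def using t by (intro integral_subset_le n.loc_norm_S_integrable_on) (auto intro: loc_norm_nonneg)
    thus "norm (n.S t \<psi>) \<le> C * n.mass \<psi>"
      using C(1) by (intro order_trans[OF C(2)[OF n.coefficient_axioms]] mult_left_mono) auto
  qed
qed

context control_system
begin

text \<open>For all but finitely many \<open>x\<close> in \<open>I\<close> the time section of
  \<open>E\<close> has to be null: otherwise infinitely many sections contain uncountably many zeros
  of the kernel, zeros accumulate in time and in space, and unique continuation gives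
  \<open>v = 0\<close>.\<close>

lemma kernel_zero_on_set:
  assumes T: "T \<le> \<tau>" and E: "E \<in> sets borel" "E \<subseteq> {0<..<T} \<times> I"
    and zero: "AE s in lborel. AE x in lborel. (s, x) \<in> E \<longrightarrow> kernel v (T - s, x) = 0"
    and v: "v \<noteq> 0"
  shows "AE p in lborel. p \<notin> E"
proof -
  define g where "g p = indicator ({0<..<T} \<times> I) p *\<^sub>R kernel v (T - fst p, snd p)" for p
  have [measurable]: "g \<in> borel_measurable borel" unfolding g_def by (rule backward_kernel_borel[OF T])
  note [measurable] = E(1)
  \<comment> \<open>The exceptional points are collected in a Borel set, so that the order of the
    two almost-everywhere quantifiers may be exchanged.\<close>
  define B where "B = {p. p \<in> E \<and> g p \<noteq> 0}"
  have B: "B \<in> sets borel" unfolding B_def by measurable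
  have Bp: "{p \<in> space (lborel \<Otimes>\<^sub>M lborel). (fst p, snd p) \<notin> B} \<in> sets (lborel \<Otimes>\<^sub>M lborel)"
    unfolding lborel_prod using borel_comp[OF B] by (simp add: Compl_eq)
  have Ep: "{p \<in> space (lborel \<Otimes>\<^sub>M lborel). (fst p, snd p) \<notin> E} \<in> sets (lborel \<Otimes>\<^sub>M lborel)"
    unfolding lborel_prod using borel_comp[OF E(1)] by (simp add: Compl_eq)
  have notB: "(s, x) \<notin> B" if "(s, x) \<in> E \<longrightarrow> kernel v (T - s, x) = 0" for s x
    using that E(2) by (auto simp: B_def g_def)
  have "AE s in lborel. AE x in lborel. (s, x) \<notin> B" using zero by eventually_elim (auto elim!: eventually_mono notB)
  hence Bx: "AE x in lborel. AE s in lborel. (s, x) \<notin> B" using lborel_pair.AE_commute[OF Bp] by simp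
  define X where "X = {x \<in> I. \<not> (AE s in lborel. (s, x) \<notin> E) \<and> (AE s in lborel. (s, x) \<notin> B)}"
  have "finite X"
  proof (rule ccontr)
    assume inf: "infinite X"
    have X01: "X \<subseteq> {0..1}" using i0 i1 by (auto simp: X_def)
    obtain x0 where x0: "x0 islimpt X" using Heine_Borel_imp_Bolzano_Weierstrass[OF compact_Icc inf X01] by blast
    have "v = 0"
    proof (rule kernel_unique_continuation[OF x0 X01])
      fix x assume x: "x \<in> X"
      define D where "D = {s. (s, x) \<in> E \<and> (s, x) \<notin> B}"
      \<comment> \<open>Times kept away from \<open>T\<close>, so that the zeros accumulate at a
        strictly positive time \<open>T - s0\<close>, where the kernel is analytic.\<close>
      define D' where "D' n = D \<inter> {0..T - inverse (real (Suc n))}" for n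
      have DE: "0 < s \<and> s < T \<and> kernel v (T - s, x) = 0" if "s \<in> D" for s
        using that E(2) by (auto simp: D_def B_def g_def)
      have "\<exists>n. infinite (D' n)"
      proof (rule ccontr)
        assume "\<nexists>n. infinite (D' n)"
        hence "countable (\<Union>n. D' n)" by (intro countable_UN) (auto intro: countable_finite)
        moreover have "D \<subseteq> (\<Union>n. D' n)"
        proof
          fix s assume s: "s \<in> D"
          then obtain n where "inverse (real (Suc n)) < T - s" using reals_Archimedean[of "T - s"] DE by auto
          hence "s \<in> D' n" using s DE[OF s] by (simp add: D'_def)
          thus "s \<in> (\<Union>n. D' n)" by blast
        qed
        ultimately have "countable D" by (rule countable_subset[rotated])
        hence "AE s in lborel. s \<notin> D" by (intro AE_not_in countable_imp_null_set_lborel)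
        moreover have "AE s in lborel. (s, x) \<notin> B" using x by (simp add: X_def)
        ultimately have "AE s in lborel. (s, x) \<notin> E" by eventually_elim (simp add: D_def)
        thus False using x by (simp add: X_def)
      qed
      then obtain n where n: "infinite (D' n)" by blast
      obtain s0 where s0: "s0 \<in> {0..T - inverse (real (Suc n))}" "s0 islimpt D' n"
        using Heine_Borel_imp_Bolzano_Weierstrass[OF compact_Icc n, of 0 "T - inverse (real (Suc n))"] by (auto simp: D'_def)
      have "inverse (real (Suc n)) > 0" by simp
      moreover have "s0 \<le> T - inverse (real (Suc n))" using s0(1) by (simp only: atLeastAtMost_iff)
      ultimately have pos: "T - s0 > 0" by linarith
      have "T - s0 islimpt {t. t > 0 \<and> kernel v (t, x) = 0}" unfolding islimpt_approachable
      proof (intro allI impI)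
        fix e :: real assume "e > 0"
        then obtain s where s: "s \<in> D' n" "s \<noteq> s0" "dist s s0 < e" using s0(2) unfolding islimpt_approachable by blast
        hence "s \<in> D" by (simp add: D'_def)
        thus "\<exists>t\<in>{t. t > 0 \<and> kernel v (t, x) = 0}. t \<noteq> T - s0 \<and> dist t (T - s0) < e"
          using DE[of s] s(2,3) by (intro bexI[of _ "T - s"]) (auto simp: dist_real_def)
      qed
      thus "\<exists>t0>0. t0 islimpt {t. t > 0 \<and> kernel v (t, x) = 0}" using pos by blast
    qed
    thus False using v by simp
  qed
  hence "AE x in lborel. x \<notin> X" by (intro AE_not_in finite_imp_null_set_lborel)
  hence "AE x in lborel. AE s in lborel. (s, x) \<notin> E" using Bx
  proof eventually_elim
    case (elim x)
    show ?case
    proof (cases "x \<in> I")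
      case False
      thus ?thesis using E(2) by (intro AE_I2) auto
    qed (use elim in "simp add: X_def")
  qed
  hence "AE s in lborel. AE x in lborel. (s, x) \<notin> E" using lborel_pair.AE_commute[OF Ep] by simp
  hence "AE p in lborel \<Otimes>\<^sub>M lborel. p \<notin> E" using Ep by (intro lborel_pair.AE_pair_measure) simp_all
  thus ?thesis unfolding lborel_prod .
qed

section \<open>The cost of null control\<close>

lemma observability:
  assumes "0 < t" "t \<le> \<tau>"
  obtains C where "C > 0" "\<And>\<psi>. norm (S t \<psi>) \<le> C * mass \<psi>"
  by (rule uniform_observability[OF assms, of K]) (use control_system_axioms in blast)

definition cost :: "L2 \<Rightarrow> real" where
  "cost z0 = Inf {R. 0 \<le> R \<and> dual z0 R}"

text \<open>Observability at time \<open>\<tau>\<close> is what makes the cost finite.\<close>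

lemma dual_set_nonempty: "{R. 0 \<le> R \<and> dual z0 R} \<noteq> {}"
proof -
  obtain C where C: "C > 0" "\<And>\<psi>. norm (S \<tau> \<psi>) \<le> C * mass \<psi>" by (rule observability[OF \<tau>_pos order_refl]) blast
  have "- inner (S \<tau> \<psi>) z0 \<le> (C * norm z0) * mass \<psi>" for \<psi>
  proof -
    have "- inner (S \<tau> \<psi>) z0 \<le> norm (S \<tau> \<psi>) * norm z0" using Cauchy_Schwarz_ineq2[of "S \<tau> \<psi>" z0] by linarith
    also have "\<dots> \<le> (C * mass \<psi>) * norm z0" by (intro mult_right_mono C) simp
    finally show ?thesis by (simp add: mult_ac)
  qed
  hence "C * norm z0 \<in> {R. 0 \<le> R \<and> dual z0 R}" using C(1) by (simp add: dual_def)
  thus ?thesis by blast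
qed

lemma cost_nonneg: "0 \<le> cost z0"
  unfolding cost_def by (rule cInf_greatest[OF dual_set_nonempty]) simp

lemma cost_le: "0 \<le> R \<Longrightarrow> dual z0 R \<Longrightarrow> cost z0 \<le> R"
  unfolding cost_def by (rule cInf_lower) (auto intro: bdd_belowI[of _ 0])

text \<open>The infimum is attained, as for each \<open>\<psi>\<close> the inequality is a closed
  condition on \<open>R\<close>.\<close>

lemma dual_cost: "dual z0 (cost z0)"
  unfolding dual_def
proof
  fix \<psi>
  have d: "- inner (S \<tau> \<psi>) z0 \<le> R * mass \<psi>" if "R \<in> {R. 0 \<le> R \<and> dual z0 R}" for R
    using that by (simp add: dual_def)
  show "- inner (S \<tau> \<psi>) z0 \<le> cost z0 * mass \<psi>"
  proof (cases "mass \<psi> = 0")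
    case True
    obtain R where "R \<in> {R. 0 \<le> R \<and> dual z0 R}" using dual_set_nonempty by blast
    from d[OF this] True show ?thesis by simp
  next
    case False
    hence m: "mass \<psi> > 0" using mass_nonneg[of \<psi>] by simp
    have "- inner (S \<tau> \<psi>) z0 / mass \<psi> \<le> cost z0"
      unfolding cost_def by (rule cInf_greatest[OF dual_set_nonempty]) (use d m in "simp add: field_simps")
    thus ?thesis using m by (simp only: pos_divide_le_eq)
  qed
qed

lemma controls_cost_nonempty: "controls z0 (cost z0) \<noteq> {}" by (rule dual_imp_controls[OF dual_cost cost_nonneg])

text \<open>At cost zero, testing with \<open>- S \<tau> z0\<close> would give
  \<open>S \<tau> z0 = 0\<close>, which backward uniqueness excludes.\<close>

lemma cost_pos:
  assumes "z0 \<noteq> 0"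
  shows "0 < cost z0"
proof (rule ccontr)
  assume "\<not> 0 < cost z0"
  hence "dual z0 0" using dual_cost[of z0] cost_nonneg[of z0] by simp
  hence "- inner (S \<tau> (- S \<tau> z0)) z0 \<le> 0" unfolding dual_def by (metis mult_zero_left)
  hence "inner (S \<tau> z0) (S \<tau> z0) \<le> 0" by (simp add: linear_neg[OF linear_heat_semigroup] heat_semigroup_sym)
  hence "S \<tau> z0 = 0" using inner_ge_zero[of "S \<tau> z0"] inner_eq_zero_iff[of "S \<tau> z0"] by linarith
  hence "z0 = 0" by (rule S_injective[rotated]) (use \<tau>_pos in simp)
  thus False using assms by simp
qed

text \<open>Below the cost the dual inequality fails for some \<open>\<psi>\<close>. Its mass is
  positive, since otherwise observability would make \<open>S \<tau> \<psi>\<close> vanish, and so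
  it can be normalized.\<close>

lemma almost_maximizer:
  assumes "0 \<le> R" "R < cost z0"
  obtains \<psi> where "mass \<psi> = 1" "R < - inner (S \<tau> \<psi>) z0"
proof -
  have "\<not> dual z0 R" using cost_le[of R z0] assms by auto
  then obtain \<psi> where \<psi>: "R * mass \<psi> < - inner (S \<tau> \<psi>) z0" by (auto simp: dual_def not_le)
  obtain C where C: "C > 0" "\<And>\<psi>. norm (S \<tau> \<psi>) \<le> C * mass \<psi>" by (rule observability[OF \<tau>_pos order_refl]) blast
  have "mass \<psi> \<noteq> 0"
  proof
    assume "mass \<psi> = 0"
    hence "S \<tau> \<psi> = 0" using C(2)[of \<psi>] by simp
    thus False using \<psi> \<open>mass \<psi> = 0\<close> by simp
  qed
  hence m: "mass \<psi> > 0" using mass_nonneg[of \<psi>] by simp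
  show thesis
  proof (rule that[of "inverse (mass \<psi>) *\<^sub>R \<psi>"])
    show "mass (inverse (mass \<psi>) *\<^sub>R \<psi>) = 1" using m by (simp add: mass_scaleR)
    have "inverse (mass \<psi>) * (R * mass \<psi>) < inverse (mass \<psi>) * (- inner (S \<tau> \<psi>) z0)"
      using \<psi> m by (intro mult_strict_left_mono) auto
    moreover have "inverse (mass \<psi>) * (R * mass \<psi>) = R" using m by simp
    ultimately show "R < - inner (S \<tau> (inverse (mass \<psi>) *\<^sub>R \<psi>)) z0"
      by (simp add: linear_scale[OF linear_heat_semigroup])
  qed
qed

text \<open>On the deficient set \<open>E\<close> there is room for \<open>w + \<delta> * h\<close>
  with any \<open>h\<close> of size one supported in \<open>E\<close>. Testing this with an almost
  maximizer \<open>\<psi>\<close> of mass one shows that the pairing of \<open>\<psi>\<close> with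
  \<open>final h\<close> is almost nonpositive. The vectors \<open>S \<eta> \<psi>\<close> are
  bounded by observability, and a limit \<open>v\<close> keeps both facts: it is not zero, and no
  \<open>h\<close> has a positive pairing with its evolution. Taking the sign of that evolution for
  \<open>h\<close> makes the evolution vanish on \<open>E\<close>.\<close>

lemma deficient_set_null:
  assumes z0: "z0 \<noteq> 0" and w: "w \<in> controls z0 (cost z0)" "w \<in> borel_measurable borel"
    and d: "\<delta> > 0" and \<eta>: "0 < \<eta>" "\<eta> < \<tau>"
  shows "AE p in lborel. p \<notin> {p. p \<in> {0<..<\<tau> - \<eta>} \<times> I \<and> norm (w p) \<le> cost z0 - \<delta>}"
proof -
  define N where "N = cost z0"
  define T where "T = \<tau> - \<eta>"
  have T: "0 < T" "T \<le> \<tau>" "T < \<tau>" using \<eta> by (auto simp: T_def)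
  define E where "E = {p. p \<in> {0<..<T} \<times> I \<and> norm (w p) \<le> N - \<delta>}"
  have N: "N > 0" unfolding N_def by (rule cost_pos[OF z0])
  have wa: "w \<in> admissible N" and wf: "final w = - S \<tau> z0" using w(1) by (auto simp: controls_def N_def add_eq_0_iff)
  have [measurable]: "w \<in> borel_measurable borel" by fact
  have rect: "{0<..<T} \<times> I \<in> sets borel" by (intro borel_open open_Times open_greaterThanLessThan)
  have "E = ({0<..<T} \<times> I) \<inter> {p. norm (w p) \<le> N - \<delta>}" by (auto simp: E_def)
  also have "\<dots> \<in> sets borel" by (intro sets.Int rect) measurable
  finally have E: "E \<in> sets borel" .
  have E_sub: "E \<subseteq> {0<..<T} \<times> I" by (auto simp: E_def)
  obtain C where C: "C > 0" "\<And>\<psi>. norm (S \<eta> \<psi>) \<le> C * mass \<psi>"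
    by (rule observability[of \<eta>]) (use \<eta> in auto)
  define G where "G = {h \<in> admissible 1. \<forall>p. p \<notin> E \<longrightarrow> h p = 0}"
  \<comment> \<open>The effect of \<open>h\<close> at time \<open>T\<close>, the factor
    \<open>S \<eta>\<close> being left to the test vector: since \<open>h\<close> vanishes from time
    \<open>T\<close> on,
    \<open>inner (S \<eta> \<psi>) (F h) = inner \<psi> (final h)\<close>.\<close>
  define F where "F h = (LINT s|J. S (T - s) (source I h s))" for h
  have Fi: "integrable J (\<lambda>s. S (T - s) (source I h s))" if "h \<in> G" for h
    using that by (intro propagated_integrable[of h 1]) (auto simp: G_def)
  have source_0: "source I h s = 0" if "h \<in> G" "s \<ge> T" for h s
  proof -
    have "(s, x) \<notin> E" for x using that(2) E_sub by auto
    hence "h (s, x) = 0" for x using that(1) by (simp add: G_def)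
    thus ?thesis by (simp add: source_def L2_of_zero)
  qed
  have inner_F: "inner v (F h) = (LINT s|J. inner (S (T - s) v) (source I h s))" if "h \<in> G" for h v
    unfolding F_def using Fi[OF that] by (subst integral_inner_right[symmetric]) (simp_all add: heat_semigroup_sym)
  \<comment> \<open>The conditions wanted of \<open>v\<close>, with a slack that tends to
    \<open>0\<close>; each set contains a regularized almost maximizer, and a common point serves as
    weak limit.\<close>
  define Km where "Km m = cball 0 C \<inter> {v. inner (S T z0) v \<le> inverse (real (Suc m)) - N}
      \<inter> (\<Inter>h\<in>G. {v. inner (\<delta> *\<^sub>R F h) v \<le> inverse (real (Suc m))})" for m
  have "(\<Inter>m. Km m) \<noteq> {}"
  proof (rule Inter_nested_closed_convex_nonempty[where R = C])
    show "closed (Km m)" for m unfolding Km_def by (intro closed_Int closed_INT closed_cball closed_halfspace_le ballI)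
    show "convex (Km m)" for m unfolding Km_def by (intro convex_Int convex_INT convex_cball convex_halfspace_le)
    show "Km (Suc m) \<subseteq> Km m" for m
    proof -
      have "inverse (real (Suc (Suc m))) \<le> inverse (real (Suc m))" by (rule le_imp_inverse_le) auto
      thus ?thesis unfolding Km_def by (force intro: order_trans)
    qed
    show "norm v \<le> C" if "v \<in> Km 0" for v using that by (simp add: Km_def)
    show "Km m \<noteq> {}" for m
    proof -
      have "0 \<le> max 0 (N - inverse (real (Suc m)))" "max 0 (N - inverse (real (Suc m))) < cost z0" using N by (auto simp: N_def)
      then obtain \<psi> where \<psi>: "mass \<psi> = 1" "max 0 (N - inverse (real (Suc m))) < - inner (S \<tau> \<psi>) z0"
        by (rule almost_maximizer)
      have lo: "N - inverse (real (Suc m)) < - inner (S \<tau> \<psi>) z0" using \<psi>(2) by linarith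
      have "S \<eta> \<psi> \<in> Km m" unfolding Km_def
      proof (intro IntI INT_I)
        show "S \<eta> \<psi> \<in> cball 0 C" using C(2)[of \<psi>] \<psi>(1) by simp
        have "S \<tau> \<psi> = S T (S \<eta> \<psi>)" using heat_semigroup_add[of T \<eta> \<psi>] T \<eta> by (simp add: T_def)
        hence "inner (S \<tau> \<psi>) z0 = inner (S T z0) (S \<eta> \<psi>)"
          by (simp add: heat_semigroup_sym) (metis heat_semigroup_sym inner_commute)
        thus "S \<eta> \<psi> \<in> {v. inner (S T z0) v \<le> inverse (real (Suc m)) - N}" using lo by simp
        fix h assume h: "h \<in> G"
        have ha: "h \<in> admissible 1" "\<And>p. p \<notin> E \<Longrightarrow> h p = 0" using h by (auto simp: G_def)
        have "inner (S \<eta> \<psi>) (F h) = (LINT s|J. inner (S (\<tau> - s) \<psi>) (source I h s))" unfolding inner_F[OF h]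
        proof (rule Bochner_Integration.integral_cong[OF refl])
          fix s show "inner (S (T - s) (S \<eta> \<psi>)) (source I h s) = inner (S (\<tau> - s) \<psi>) (source I h s)"
          proof (cases "s < T")
            case True
            thus ?thesis using heat_semigroup_add[of "T - s" \<eta> \<psi>] \<eta> by (simp add: T_def)
          qed (simp add: source_0[OF h])
        qed
        also have "\<dots> = inner \<psi> (final h)" by (rule inner_final[OF ha(1) zero_le_one, symmetric])
        finally have eq: "inner (S \<eta> \<psi>) (F h) = inner \<psi> (final h)" .
        have "(\<lambda>p. 1 *\<^sub>R w p + \<delta> *\<^sub>R h p) \<in> admissible N"
        proof -
          have m: "(\<lambda>p. 1 *\<^sub>R w p + \<delta> *\<^sub>R h p) \<in> borel_measurable Q"
            using admissible_combination[OF wa ha(1), of 1 \<delta>] by (simp add: admissible_def)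
          have "AE p in Q. norm (w p) \<le> N" "AE p in Q. norm (h p) \<le> 1" using wa ha(1) by (auto simp: admissible_def)
          hence "AE p in Q. norm (1 *\<^sub>R w p + \<delta> *\<^sub>R h p) \<le> N"
          proof eventually_elim
            case (elim p)
            show ?case
            proof (cases "p \<in> E")
              case True
              have "norm (w p + \<delta> *\<^sub>R h p) \<le> norm (w p) + \<delta> * norm (h p)"
                using norm_triangle_ineq[of "w p" "\<delta> *\<^sub>R h p"] d by simp
              moreover have "\<delta> * norm (h p) \<le> \<delta> * 1" using elim d by (intro mult_left_mono) auto
              moreover have "norm (w p) \<le> N - \<delta>" using True by (simp add: E_def)
              ultimately show ?thesis by simp
            qed (use elim ha(2) in simp)
          qed
          thus ?thesis using m by (simp add: admissible_def)
        qed
        from inner_final_le[OF this, of \<psi>] N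
        have "inner \<psi> (final w) + \<delta> * inner \<psi> (final h) \<le> N"
          unfolding final_combination[OF wa ha(1) less_imp_le[OF N] zero_le_one] by (simp add: \<psi>(1) inner_add_right)
        moreover have "inner \<psi> (final w) = - inner (S \<tau> \<psi>) z0" by (simp add: wf heat_semigroup_sym)
        ultimately show "S \<eta> \<psi> \<in> {v. inner (\<delta> *\<^sub>R F h) v \<le> inverse (real (Suc m))}"
          using lo eq by (simp add: inner_commute)
      qed
      thus ?thesis by blast
    qed
  qed
  then obtain v where v: "\<And>m. v \<in> Km m" by blast
  have lim: "x \<le> a" if "\<And>m. x \<le> inverse (real (Suc m)) + a" for x a :: real
  proof (rule field_le_epsilon)
    fix e :: real assume "e > 0"
    then obtain m where "inverse (real (Suc m)) < e" using reals_Archimedean by blast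
    thus "x \<le> a + e" using that[of m] by simp
  qed
  have "inner (S T z0) v \<le> - N" by (rule lim) (use v in "simp add: Km_def")
  hence v0: "v \<noteq> 0" using N by auto
  have Fle: "inner v (F h) \<le> 0" if h: "h \<in> G" for h
  proof -
    have "inner (\<delta> *\<^sub>R F h) v \<le> 0" by (rule lim) (use v h in "simp add: Km_def")
    thus ?thesis using d by (simp add: inner_commute mult_le_0_iff)
  qed
  define h where "h = steering T E v"
  have hG: "h \<in> G" unfolding G_def h_def using steering_admissible[OF T(2) E, of v] by (auto simp: steering_def)
  define f where "f s = inner (S (T - s) v) (source I h s)" for s
  have f_eq: "f s = (LINT x|U. indicator I x * (indicator E (s, x) * norm (kernel v (T - s, x))))" if "0 < s" "s < T" for s
    unfolding f_def h_def by (rule inner_steering[OF T(2) E that])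
  have f0: "0 \<le> f s" if "0 < s" for s
  proof (cases "s < T")
    case True
    show ?thesis unfolding f_eq[OF that True] by (intro integral_nonneg_AE AE_I2) simp
  qed (simp add: f_def source_0[OF hG])
  have fi: "integrable J f" unfolding f_def using integrable_inner_right[of v J "\<lambda>s. S (T - s) (source I h s)"] Fi[OF hG]
    by (simp add: heat_semigroup_sym)
  have f0': "AE s in J. 0 \<le> f s" by (rule AE_I2) (simp add: f0)
  have "(LINT s|J. f s) \<le> 0" using Fle[OF hG] inner_F[OF hG, of v] by (simp add: f_def)
  moreover have "0 \<le> (LINT s|J. f s)" by (rule integral_nonneg_AE[OF f0'])
  ultimately have "(LINT s|J. f s) = 0" by simp
  hence "AE s in J. f s = 0" using integral_nonneg_eq_0_iff_AE[OF fi f0'] by simp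
  hence "AE s in lborel. s \<in> {0<..<\<tau>} \<longrightarrow> f s = 0"
    by (subst (asm) AE_restrict_space_iff) (simp_all add: AE_completion_iff)
  hence "AE s in lborel. AE x in lborel. (s, x) \<in> E \<longrightarrow> kernel v (T - s, x) = 0"
  proof eventually_elim
    case (elim s)
    show ?case
    proof (cases "0 < s \<and> s < T")
      case True
      have [measurable]: "(\<lambda>x. indicator E (s, x) :: real) \<in> borel_measurable U"
        by (rule section_measurable[OF borel_measurable_indicator[OF E]])
      have "integrable U (\<lambda>x. indicator I x * (indicator E (s, x) * norm (kernel v (T - s, x))))"
      proof (rule unit_leb.integrable_const_bound[where B = "2 * K * norm (V (T - s) 1 v)"])
        show "AE x in U. norm (indicator I x * (indicator E (s, x) * norm (kernel v (T - s, x)))) \<le> 2 * K * norm (V (T - s) 1 v)"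
        proof (rule AE_I2)
          fix x assume "x \<in> space U"
          hence "norm (kernel v (T - s, x)) \<le> 2 * K * norm (V (T - s) 1 v)"
            unfolding kernel_def fst_conv snd_conv by (intro norm_sol_le) auto
          thus "norm (indicator I x * (indicator E (s, x) * norm (kernel v (T - s, x)))) \<le> 2 * K * norm (V (T - s) 1 v)"
            using order_trans[OF norm_ge_zero] K by (auto simp: indicator_def)
        qed
      qed measurable
      moreover have "(LINT x|U. indicator I x * (indicator E (s, x) * norm (kernel v (T - s, x)))) = 0"
        using elim True T f_eq[of s] by simp
      ultimately have "AE x in U. indicator I x * (indicator E (s, x) * norm (kernel v (T - s, x))) = 0"
        by (subst (asm) integral_nonneg_eq_0_iff_AE) auto
      hence "AE x in lborel. x \<in> {0<..<1} \<longrightarrow> indicator I x * (indicator E (s, x) * norm (kernel v (T - s, x))) = 0"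
        by (subst (asm) AE_restrict_space_iff) (simp_all add: AE_completion_iff)
      thus ?thesis
      proof eventually_elim
        case (elim x)
        show ?case
        proof
          assume x: "(s, x) \<in> E"
          hence "x \<in> I" using E_sub by auto
          thus "kernel v (T - s, x) = 0" using elim x i0 i1 by simp
        qed
      qed
    next
      case False
      hence "(s, x) \<notin> E" for x using E_sub by auto
      thus ?thesis by simp
    qed
  qed
  from kernel_zero_on_set[OF T(2) E E_sub this v0] show ?thesis by (simp only: E_def N_def T_def)
qed

theorem bang_bang:
  assumes z0: "z0 \<noteq> 0" and u: "u \<in> controls z0 (cost z0)"
  shows "AE p in Q. norm (u p) = cost z0"
proof -
  define N where "N = cost z0"
  have N: "N > 0" unfolding N_def by (rule cost_pos[OF z0])
  have ua: "u \<in> admissible N" and uf: "S \<tau> z0 + final u = 0" using u by (auto simp: controls_def N_def)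
  obtain w where w: "w \<in> borel_measurable borel" "\<And>p. norm (w p) \<le> N" "AE p in Q. u p = w p"
    by (rule admissible_representative[OF ua less_imp_le[OF N]]) blast
  have wa: "w \<in> admissible N" using w by (auto simp: admissible_def intro!: measurable_restrict_space1 measurable_completion)
  have "final w = final u" unfolding final_def
  proof (rule integral_cong_AE)
    show "AE s in J. S (\<tau> - s) (source I w s) = S (\<tau> - s) (source I u s)" using source_AE_eq[OF w] by eventually_elim simp
  qed (auto intro!: propagated_measurable source_measurable[OF wa] source_measurable[OF ua] less_imp_le[OF N])
  hence wc: "w \<in> controls z0 (cost z0)" using wa uf by (simp add: controls_def N_def)
  \<comment> \<open>Countably many deficient sets, with \<open>\<delta> = 1 / (k + 1)\<close> and
    \<open>\<eta> = \<tau> / (m + 2)\<close>; the \<open>2\<close> keeps \<open>\<eta>\<close> below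
    \<open>\<tau>\<close>.\<close>
  have "AE p in lborel. \<forall>k m. p \<notin> {p. p \<in> {0<..<\<tau> - \<tau> * inverse (real (Suc (Suc m)))} \<times> I \<and> norm (w p) \<le> cost z0 - inverse (real (Suc k))}"
    unfolding AE_all_countable
  proof (intro allI deficient_set_null[OF z0 wc w(1)])
    fix m :: nat
    have "inverse (real (Suc (Suc m))) < 1" by (rule inverse_less_1_iff[THEN iffD2]) simp
    thus "\<tau> * inverse (real (Suc (Suc m))) < \<tau>" using \<tau>_pos by simp
  qed (use \<tau>_pos in auto)
  hence "AE p in Q. \<forall>k m. p \<notin> {p. p \<in> {0<..<\<tau> - \<tau> * inverse (real (Suc (Suc m)))} \<times> I \<and> norm (w p) \<le> cost z0 - inverse (real (Suc k))}"
    by (rule AE_cylinder_of_lborel)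
  thus ?thesis using w(3) AE_space
  proof eventually_elim
    case (elim p)
    obtain s x where p: "p = (s, x)" "0 < s" "s < \<tau>" "x \<in> I" using elim(3) by auto
    obtain m where m: "inverse (real (Suc m)) < (\<tau> - s) / \<tau>" using reals_Archimedean[of "(\<tau> - s) / \<tau>"] p \<tau>_pos by auto
    have "inverse (real (Suc (Suc m))) \<le> inverse (real (Suc m))" by (rule le_imp_inverse_le) auto
    hence "inverse (real (Suc (Suc m))) < (\<tau> - s) / \<tau>" using m by linarith
    hence "s < \<tau> - \<tau> * inverse (real (Suc (Suc m)))" using \<tau>_pos by (simp only: pos_less_divide_eq mult.commute less_diff_eq add.commute)
    hence gt: "cost z0 - inverse (real (Suc k)) < norm (w p)" for k using elim(1)[rule_format, of m k] p by auto
    have "cost z0 \<le> norm (w p)"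
    proof (rule field_le_epsilon)
      fix e :: real assume "e > 0"
      then obtain k where "inverse (real (Suc k)) < e" using reals_Archimedean by blast
      thus "cost z0 \<le> norm (w p) + e" using gt[of k] by simp
    qed
    thus ?case using w(2)[of p] elim(2) by (simp add: N_def)
  qed
qed

theorem optimal_control_unique:
  assumes z0: "z0 \<noteq> 0" and u: "u \<in> controls z0 (cost z0)" and v: "v \<in> controls z0 (cost z0)"
  shows "AE p in Q. v p = u p"
proof -
  have a: "u \<in> admissible (cost z0)" "v \<in> admissible (cost z0)" "S \<tau> z0 + final u = 0" "S \<tau> z0 + final v = 0"
    using u v by (auto simp: controls_def)
  have f: "final u = - S \<tau> z0" "final v = - S \<tau> z0" using a(3,4) by (simp_all add: add_eq_0_iff)
  have "(1/2) *\<^sub>R final u + (1/2) *\<^sub>R final v = - S \<tau> z0"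
    unfolding f by (rule scaleR_half_double[unfolded scaleR_add_right])
  hence "(\<lambda>p. (1/2) *\<^sub>R (u p + v p)) \<in> controls z0 (cost z0)"
    unfolding controls_def using admissible_midpoint[OF a(1,2)] final_midpoint[OF a(1,2) cost_nonneg] by simp
  from bang_bang[OF z0 this] bang_bang[OF z0 u] bang_bang[OF z0 v] show ?thesis
  proof eventually_elim
    case (elim p)
    have "(norm (v p - u p))^2 = 2 * (norm (u p))^2 + 2 * (norm (v p))^2 - 4 * (norm ((1/2) *\<^sub>R (u p + v p)))^2"
      by (simp only: power2_norm_eq_inner) (simp add: inner_diff inner_add inner_commute algebra_simps)
    thus ?case using elim by simp
  qed
qed

end

section \<open>Convergence of optimal controls\<close>

context control_system
begin

lemma Linf_admissible:
  assumes "u \<in> Linf Q"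
  obtains R where "R \<ge> 0" "Linf_norm Q u = ennreal R" "u \<in> admissible R"
proof -
  have u: "u \<in> borel_measurable Q" "Linf_norm Q u < \<infinity>" using assms by (auto simp: Linf_def)
  then obtain R where R: "R \<ge> 0" "Linf_norm Q u = ennreal R" by (cases "Linf_norm Q u") auto
  have "AE p in Q. norm (u p) \<le> R" using Linf_norm_le_iff[OF u(1) R(1)] R(2) by simp
  thus thesis using R u by (intro that) (simp_all add: admissible_def)
qed

lemma admissible_Linf:
  assumes "u \<in> admissible R" "R \<ge> 0"
  shows "u \<in> Linf Q" "Linf_norm Q u \<le> ennreal R"
proof -
  have u: "u \<in> borel_measurable Q" "AE p in Q. norm (u p) \<le> R" using assms by (auto simp: admissible_def)
  show le: "Linf_norm Q u \<le> ennreal R" using Linf_norm_le_iff[OF u(1) assms(2)] u(2) by simp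
  thus "u \<in> Linf Q" using u(1) by (auto simp: Linf_def intro: le_less_trans)
qed

context
  fixes a \<epsilon> assumes c_eq: "c = coef a \<epsilon>"
begin

lemma null_controls_iff: "u \<in> null_controls a I \<tau> z0 \<epsilon> \<longleftrightarrow> u \<in> Linf Q \<and> S \<tau> z0 + final u = 0"
proof (cases "u \<in> Linf Q")
  case True
  obtain R where R: "R \<ge> 0" "Linf_norm Q u = ennreal R" "u \<in> admissible R" by (rule Linf_admissible[OF True])
  show ?thesis using mild_solution_iff[OF R(3,1), of z0] True by (simp add: null_controls_def c_eq)
qed (simp add: null_controls_def)

lemma controls_null_controls: "R \<ge> 0 \<Longrightarrow> u \<in> controls z0 R \<Longrightarrow> u \<in> null_controls a I \<tau> z0 \<epsilon>"
  by (auto simp: null_controls_iff controls_def intro: admissible_Linf)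

lemma optimal_norm_eq: "optimal_norm a I \<tau> z0 \<epsilon> = ennreal (cost z0)"
proof (rule antisym)
  obtain u where u: "u \<in> controls z0 (cost z0)" using controls_cost_nonempty by blast
  have "optimal_norm a I \<tau> z0 \<epsilon> \<le> Linf_norm Q u"
    unfolding optimal_norm_def by (rule INF_lower[OF controls_null_controls[OF cost_nonneg u]])
  also have "\<dots> \<le> ennreal (cost z0)" using u by (intro admissible_Linf cost_nonneg) (simp add: controls_def)
  finally show "optimal_norm a I \<tau> z0 \<epsilon> \<le> ennreal (cost z0)" .
  show "ennreal (cost z0) \<le> optimal_norm a I \<tau> z0 \<epsilon>" unfolding optimal_norm_def
  proof (rule INF_greatest)
    fix u assume "u \<in> null_controls a I \<tau> z0 \<epsilon>"
    hence u: "u \<in> Linf Q" "S \<tau> z0 + final u = 0" by (auto simp: null_controls_iff)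
    obtain R where R: "R \<ge> 0" "Linf_norm Q u = ennreal R" "u \<in> admissible R" by (rule Linf_admissible[OF u(1)])
    have "u \<in> controls z0 R" using R u by (simp add: controls_def)
    thus "ennreal (cost z0) \<le> Linf_norm Q u" unfolding R(2) by (intro ennreal_leI cost_le R(1) controls_imp_dual[OF _ R(1)])
  qed
qed

lemma norm_optimal_iff: "norm_optimal a I \<tau> z0 \<epsilon> u \<longleftrightarrow> u \<in> controls z0 (cost z0)"
proof
  assume "norm_optimal a I \<tau> z0 \<epsilon> u"
  hence u: "u \<in> Linf Q" "S \<tau> z0 + final u = 0" "Linf_norm Q u = ennreal (cost z0)"
    by (auto simp: norm_optimal_def null_controls_iff optimal_norm_eq)
  have m: "u \<in> borel_measurable Q" using u(1) by (simp add: Linf_def)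
  have "AE p in Q. norm (u p) \<le> cost z0" using u(3) by (intro iffD1[OF Linf_norm_le_iff[OF m cost_nonneg]]) simp
  thus "u \<in> controls z0 (cost z0)" using m u(2) by (simp add: controls_def admissible_def)
next
  assume u: "u \<in> controls z0 (cost z0)"
  note nc = controls_null_controls[OF cost_nonneg u]
  have "Linf_norm Q u \<le> ennreal (cost z0)" using u by (intro admissible_Linf cost_nonneg) (simp add: controls_def)
  moreover have "ennreal (cost z0) \<le> Linf_norm Q u"
    unfolding optimal_norm_eq[symmetric] optimal_norm_def by (rule INF_lower[OF nc])
  ultimately show "norm_optimal a I \<tau> z0 \<epsilon> u" unfolding norm_optimal_def optimal_norm_eq using nc by simp
qed

end

section \<open>Comparison of costs for different coefficients\<close>

definition state :: "L2 \<Rightarrow> (real \<times> real \<Rightarrow> complex) \<Rightarrow> real \<Rightarrow> L2" where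
  "state z0 u t = S t z0 + (LINT s|lebesgue_on {0<..<t}. S (t - s) (source I u s))"

text \<open>Testing the state at time \<open>t\<close> with \<open>S r \<psi>\<close> lets it evolve
  freely for a further time \<open>r\<close>. Only \<open>r + t\<close> enters the integrand, so the
  pairs \<open>(\<tau>, \<eta>)\<close> and \<open>(\<eta>, \<tau>)\<close> can be compared.\<close>

lemma inner_propagated_integral:
  assumes u: "u \<in> admissible R" "R \<ge> 0" and t: "0 \<le> t" "t \<le> \<tau>" and r: "r \<ge> 0"
  shows "inner (S r \<psi>) (state z0 u t) =
    inner \<psi> (S (r + t) z0) + (LINT s|lebesgue_on {0<..<t}. inner (S (r + t - s) \<psi>) (source I u s))"
proof -
  have "inner (S r \<psi>) (LINT s|lebesgue_on {0<..<t}. S (t - s) (source I u s)) =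
      (LINT s|lebesgue_on {0<..<t}. inner (S r \<psi>) (S (t - s) (source I u s)))"
    using propagated_integrable[OF u t(2)] by (simp add: integral_inner_right)
  also have "\<dots> = (LINT s|lebesgue_on {0<..<t}. inner (S (r + t - s) \<psi>) (source I u s))"
  proof (rule Bochner_Integration.integral_cong[OF refl])
    fix s assume "s \<in> space (lebesgue_on {0<..<t})"
    hence "S (t - s + r) \<psi> = S (t - s) (S r \<psi>)" using r by (intro heat_semigroup_add) auto
    moreover have "t - s + r = r + t - s" by simp
    ultimately have eq: "S (r + t - s) \<psi> = S (t - s) (S r \<psi>)" by (simp only:)
    show "inner (S r \<psi>) (S (t - s) (source I u s)) = inner (S (r + t - s) \<psi>) (source I u s)"
      unfolding eq by (rule heat_semigroup_sym[symmetric])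
  qed
  finally show ?thesis unfolding state_def inner_add_right using r t by (simp add: heat_semigroup_sym heat_semigroup_add)
qed

lemma integral_split:
  fixes f :: "real \<Rightarrow> real"
  assumes t: "0 < t" "t < \<tau>" and f: "integrable J f"
  shows "integrable (lebesgue_on {t<..<\<tau>}) f"
    "(LINT s|J. f s) = (LINT s|lebesgue_on {0<..<t}. f s) + (LINT s|lebesgue_on {t<..<\<tau>}. f s)"
proof -
  have i: "integrable (lebesgue_on A) f" if "A \<subseteq> {0<..<\<tau>}" "A \<in> sets lebesgue" for A
    using set_integrable_subset[of lebesgue "{0<..<\<tau>}" f A] f that by (simp add: integrable_restrict_space set_integrable_def)
  have i1: "integrable (lebesgue_on {0<..<t}) f" and i2: "integrable (lebesgue_on {t<..<\<tau>}) f" using t by (intro i; auto)+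
  show "integrable (lebesgue_on {t<..<\<tau>}) f" by (rule i2)
  have "integral {0<..<t} f + integral {t<..<\<tau>} f = integral ({0<..<t} \<union> {t<..<\<tau>}) f"
    by (intro integral_Un[symmetric] integrable_on_lebesgue_on i1 i2) auto
  also have "\<dots> = integral {0<..<\<tau>} f"
    by (rule integral_spike_set) (use t in "auto intro!: negligible_subset[OF negligible_sing[of t]]")
  finally show "(LINT s|J. f s) = (LINT s|lebesgue_on {0<..<t}. f s) + (LINT s|lebesgue_on {t<..<\<tau>}. f s)"
    using f i1 i2 by (simp add: lebesgue_integral_eq_integral)
qed

text \<open>In primal terms the control is run from time \<open>\<eta>\<close> on, as if the system
  started at \<open>state z0 u \<eta>\<close>; it arrives at \<open>state z0 u \<tau>\<close> with a
  time \<open>\<eta>\<close> to spare. The wrong start costs \<open>C1\<close> times its norm. The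
  residue evolves freely during the spare time and is then paired with
  \<open>S \<eta> \<psi>\<close> instead of \<open>\<psi>\<close>, so that it costs
  \<open>C2\<close> times its norm.\<close>

lemma cost_perturbation:
  assumes u: "u \<in> admissible R" "R \<ge> 0" and \<eta>: "0 < \<eta>" "\<eta> < \<tau>"
    and C: "C1 \<ge> 0" "C2 \<ge> 0" "\<And>\<psi>. norm (S \<tau> \<psi>) \<le> C1 * mass \<psi>" "\<And>\<psi>. norm (S \<eta> \<psi>) \<le> C2 * mass \<psi>"
  shows "cost z0 \<le> R + C1 * norm (z0 - state z0 u \<eta>) + C2 * norm (state z0 u \<tau>)"
proof (rule cost_le)
  define R' where "R' = R + C1 * norm (z0 - state z0 u \<eta>) + C2 * norm (state z0 u \<tau>)"
  show "0 \<le> R + C1 * norm (z0 - state z0 u \<eta>) + C2 * norm (state z0 u \<tau>)"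
    using u(2) C by (intro add_nonneg_nonneg mult_nonneg_nonneg) auto
  have "- inner (S \<tau> \<psi>) z0 \<le> R' * mass \<psi>" for \<psi>
  proof -
    define f where "f s = inner (S (\<tau> + \<eta> - s) \<psi>) (source I u s)" for s
    have fi: "integrable J f"
      unfolding f_def using integrable_inner_right[of \<psi> J "\<lambda>s. S (\<tau> + \<eta> - s) (source I u s)"]
        propagated_integrable[OF u order_refl] by (simp add: heat_semigroup_sym)
    note split = integral_split[OF \<eta> fi]
    have e1: "inner (S \<tau> \<psi>) (state z0 u \<eta>) = inner \<psi> (S (\<tau> + \<eta>) z0) + (LINT s|lebesgue_on {0<..<\<eta>}. f s)"
      unfolding f_def by (rule inner_propagated_integral[OF u]) (use \<eta> in auto)
    have e2: "inner (S \<eta> \<psi>) (state z0 u \<tau>) = inner \<psi> (S (\<tau> + \<eta>) z0) + (LINT s|J. f s)"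
      unfolding f_def using inner_propagated_integral[OF u, of \<tau> \<eta> \<psi> z0] \<eta> by (simp add: add.commute)
    have tail: "(LINT s|lebesgue_on {\<eta><..<\<tau>}. f s) \<le> R * mass \<psi>"
    proof -
      have "AE s in lebesgue_on {\<eta><..<\<tau>}. \<forall>F. inner F (source I u s) \<le> R * loc_norm I F"
        by (rule AE_lebesgue_on_subset[OF inner_source_le[OF u]]) (use \<eta> in auto)
      hence "(LINT s|lebesgue_on {\<eta><..<\<tau>}. f s) \<le> (LINT s|lebesgue_on {\<eta><..<\<tau>}. R * loc_norm I (S (\<eta> + \<tau> - s) \<psi>))"
        using \<eta> by (intro integral_mono_AE split(1) integrable_mult_right integrable_loc_norm_reflected)
          (auto simp: f_def add.commute elim!: eventually_mono)
      also have "\<dots> = R * integral {\<eta>..\<tau>} (\<lambda>r. loc_norm I (S r \<psi>))"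
        using integral_loc_norm_reflected[of \<eta> \<psi>] \<eta> by simp
      also have "\<dots> \<le> R * mass \<psi>" unfolding mass_def using \<eta> u(2)
        by (intro mult_left_mono integral_subset_le loc_norm_S_integrable_on) (auto intro: loc_norm_nonneg)
      finally show ?thesis .
    qed
    have "- inner (S \<tau> \<psi>) (z0 - state z0 u \<eta>) \<le> norm (S \<tau> \<psi>) * norm (z0 - state z0 u \<eta>)"
      using Cauchy_Schwarz_ineq2[of "S \<tau> \<psi>" "z0 - state z0 u \<eta>"] by linarith
    also have "\<dots> \<le> C1 * mass \<psi> * norm (z0 - state z0 u \<eta>)" by (intro mult_right_mono C) simp
    finally have a: "- inner (S \<tau> \<psi>) (z0 - state z0 u \<eta>) \<le> C1 * mass \<psi> * norm (z0 - state z0 u \<eta>)" .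
    have "- inner (S \<eta> \<psi>) (state z0 u \<tau>) \<le> norm (S \<eta> \<psi>) * norm (state z0 u \<tau>)"
      using Cauchy_Schwarz_ineq2[of "S \<eta> \<psi>" "state z0 u \<tau>"] by linarith
    also have "\<dots> \<le> C2 * mass \<psi> * norm (state z0 u \<tau>)" by (intro mult_right_mono C) simp
    finally have b: "- inner (S \<eta> \<psi>) (state z0 u \<tau>) \<le> C2 * mass \<psi> * norm (state z0 u \<tau>)" .
    have "- inner (S \<tau> \<psi>) z0 = - inner (S \<tau> \<psi>) (z0 - state z0 u \<eta>) - inner (S \<eta> \<psi>) (state z0 u \<tau>)
        + (LINT s|lebesgue_on {\<eta><..<\<tau>}. f s)" using e1 e2 split(2) by (simp add: inner_diff_right)
    also have "\<dots> \<le> C1 * mass \<psi> * norm (z0 - state z0 u \<eta>) + C2 * mass \<psi> * norm (state z0 u \<tau>) + R * mass \<psi>"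
      using a b tail by linarith
    also have "\<dots> = R' * mass \<psi>" by (simp add: R'_def algebra_simps)
    finally show ?thesis .
  qed
  thus "dual z0 (R + C1 * norm (z0 - state z0 u \<eta>) + C2 * norm (state z0 u \<tau>))" by (simp add: dual_def R'_def)
qed

lemma norm_state_diff_le:
  assumes u: "u \<in> admissible R" "R \<ge> 0" and t: "0 \<le> t" "t \<le> \<tau>"
  shows "norm (z0 - state z0 u t) \<le> norm (z0 - S t z0) + R * t"
proof -
  interpret finite_measure "lebesgue_on {0<..<t}" by (rule finite_measure_lebesgue_on) simp
  have ae: "AE s in lebesgue_on {0<..<t}. norm (S (t - s) (source I u s)) \<le> R"
  proof (rule eventually_mono)
    show "AE s in lebesgue_on {0<..<t}. norm (source I u s) \<le> R"
      by (rule AE_lebesgue_on_subset[OF norm_source_le[OF u]]) (use t in auto)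
  qed (rule order_trans[OF norm_heat_semigroup_le])
  have "norm (LINT s|lebesgue_on {0<..<t}. S (t - s) (source I u s)) \<le> (LINT s|lebesgue_on {0<..<t}. R)"
    by (rule order_trans[OF integral_norm_bound integral_mono_AE[OF integrable_norm[OF propagated_integrable[OF u t(2)]] _ ae]]) simp
  also have "\<dots> = R * t" using t by (simp add: measure_restrict_space)
  finally have "norm (LINT s|lebesgue_on {0<..<t}. S (t - s) (source I u s)) \<le> R * t" .
  moreover have eq: "z0 - state z0 u t = (z0 - S t z0) - (LINT s|lebesgue_on {0<..<t}. S (t - s) (source I u s))"
    by (simp add: state_def)
  ultimately show ?thesis unfolding eq by (intro order_trans[OF norm_triangle_ineq4] add_left_mono)
qed

end

section \<open>Weak limits of optimal controls\<close>

context control_cylinder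
begin

lemma admissible_inner_integrable:
  assumes "u \<in> admissible R" "v \<in> admissible R'" "0 \<le> R" "0 \<le> R'"
  shows "integrable Q (\<lambda>p. u p \<bullet> v p)" "AE p in Q. norm (u p \<bullet> v p) \<le> R * R'"
proof -
  interpret finite_measure Q by (rule finite_measure_Q)
  have [measurable]: "u \<in> borel_measurable Q" "v \<in> borel_measurable Q" using assms by (auto simp: admissible_def)
  have "AE p in Q. norm (u p) \<le> R" "AE p in Q. norm (v p) \<le> R'" using assms by (auto simp: admissible_def)
  thus b: "AE p in Q. norm (u p \<bullet> v p) \<le> R * R'"
  proof eventually_elim
    case (elim p)
    have "norm (u p \<bullet> v p) \<le> norm (u p) * norm (v p)" by (simp add: Cauchy_Schwarz_ineq2)
    also have "\<dots> \<le> R * R'" using elim assms by (intro mult_mono) auto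
    finally show ?case .
  qed
  show "integrable Q (\<lambda>p. u p \<bullet> v p)" by (rule integrable_const_bound[OF b]) measurable
qed

definition volume :: real where "volume = measure Q ({0<..<\<tau>} \<times> I)"

lemma integral_Q_const: "(LINT p|Q. (r::real)) = r * volume" by (simp add: volume_def)

end

locale control_sequence = coefficient_sequence c c0 K + control_cylinder i0 i1 \<tau>
  for c c0 K i0 i1 \<tau> +
  fixes z0 :: L2
  assumes z0: "z0 \<noteq> 0"
begin

lemma sys: "control_system (c n) K i0 i1 \<tau>" by (intro control_system.intro coeff control_cylinder_axioms)

sublocale lim: control_system c0 K i0 i1 \<tau> by (intro control_system.intro coeff0 control_cylinder_axioms)

abbreviation Sn :: "nat \<Rightarrow> real \<Rightarrow> L2 \<Rightarrow> L2" where
  "Sn n \<equiv> heat_semigroup (inv_op (c n)) (4 * K)"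
abbreviation S0 :: "real \<Rightarrow> L2 \<Rightarrow> L2" where
  "S0 \<equiv> heat_semigroup (inv_op c0) (4 * K)"
abbreviation cost_n :: "nat \<Rightarrow> real" where
  "cost_n n \<equiv> control_system.cost (c n) K i0 i1 \<tau> z0"
abbreviation cost_0 :: real where
  "cost_0 \<equiv> lim.cost z0"
abbreviation state_n :: "nat \<Rightarrow> (real \<times> real \<Rightarrow> complex) \<Rightarrow> real \<Rightarrow> L2" where
  "state_n n \<equiv> control_system.state (c n) K i0 i1 z0"

lemma cost_0_pos: "cost_0 > 0" and cost_n_pos: "cost_n n > 0"
  using control_system.cost_pos[OF lim.control_system_axioms z0] control_system.cost_pos[OF sys z0] by auto

lemma state_tendsto:
  assumes u: "u \<in> admissible R" "R \<ge> 0" and t: "0 \<le> t" "t \<le> \<tau>"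
  shows "(\<lambda>n. state_n n u t) \<longlonglongrightarrow> lim.state z0 u t"
proof -
  have "(\<lambda>n. LINT s|lebesgue_on {0<..<t}. Sn n (t - s) (source I u s)) \<longlonglongrightarrow>
      (LINT s|lebesgue_on {0<..<t}. S0 (t - s) (source I u s))"
  proof (rule integral_dominated_convergence[where w = "\<lambda>_. R"])
    interpret finite_measure "lebesgue_on {0<..<t}" by (rule finite_measure_lebesgue_on) simp
    show "integrable (lebesgue_on {0<..<t}) (\<lambda>_. R)" by simp
    show "(\<lambda>s. S0 (t - s) (source I u s)) \<in> borel_measurable (lebesgue_on {0<..<t})"
      by (rule borel_measurable_integrable[OF lim.propagated_integrable[OF u t(2)]])
    show "(\<lambda>s. Sn n (t - s) (source I u s)) \<in> borel_measurable (lebesgue_on {0<..<t})" for n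
      by (rule borel_measurable_integrable[OF control_system.propagated_integrable[OF sys u t(2)]])
    show "AE s in lebesgue_on {0<..<t}. (\<lambda>n. Sn n (t - s) (source I u s)) \<longlonglongrightarrow> S0 (t - s) (source I u s)"
      by (intro AE_I2 semigroup_tendsto) simp
    have ae: "AE s in lebesgue_on {0<..<t}. norm (source I u s) \<le> R"
      by (rule AE_lebesgue_on_subset[OF norm_source_le[OF u]]) (use t in auto)
    show "AE s in lebesgue_on {0<..<t}. norm (Sn n (t - s) (source I u s)) \<le> R" for n using ae
      by eventually_elim (rule order_trans[OF positive_operator.norm_heat_semigroup_le[OF coefficient.positive_operator_inv_op[OF coeff]]])
  qed
  thus ?thesis unfolding control_system.state_def[OF sys] lim.state_def by (intro tendsto_add semigroup_tendsto t(1))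
qed

lemma observability_n:
  assumes "0 < t" "t \<le> \<tau>"
  obtains C where "C > 0" "\<And>n \<psi>. norm (Sn n t \<psi>) \<le> C * control_system.mass (c n) K i0 i1 \<tau> \<psi>"
  by (rule uniform_observability[OF assms, of K]) (use sys in blast)

text \<open>The optimal control of the limit problem is tried for every \<open>n\<close>. The order
  of choices matters: \<open>\<eta>\<close> is fixed by the limit system and \<open>C1\<close>, then
  \<open>C2\<close> depends on \<open>\<eta>\<close>, and only then is \<open>n\<close> taken
  large.\<close>

lemma eventually_cost_le:
  assumes \<delta>: "\<delta> > 0"
  shows "\<forall>\<^sub>F n in sequentially. cost_n n \<le> cost_0 + \<delta>"
proof -
  obtain u where u: "u \<in> lim.controls z0 cost_0" using lim.controls_cost_nonempty by blast
  have ua: "u \<in> admissible cost_0" "0 \<le> cost_0" using u cost_0_pos by (auto simp: lim.controls_def)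
  have fin: "lim.state z0 u \<tau> = 0" using u by (simp add: lim.state_def lim.controls_def lim.final_def)
  obtain C1 where C1: "C1 > 0" "\<And>n \<psi>. norm (Sn n \<tau> \<psi>) \<le> C1 * control_system.mass (c n) K i0 i1 \<tau> \<psi>"
    by (rule observability_n[OF \<tau>_pos order_refl]) blast
  have "\<exists>\<eta>. 0 < \<eta> \<and> \<eta> < \<tau> \<and> norm (z0 - S0 \<eta> z0) + cost_0 * \<eta> < \<delta> / C1"
  proof -
    have "((\<lambda>\<eta>. S0 \<eta> z0) \<longlongrightarrow> S0 0 z0) (at 0)"
      using lim.continuous_heat_semigroup_UNIV[of z0] unfolding continuous_on_def by blast
    hence "((\<lambda>\<eta>. S0 \<eta> z0) \<longlongrightarrow> S0 0 z0) (at_right 0)" by (rule tendsto_within_subset) simp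
    hence "((\<lambda>\<eta>. norm (z0 - S0 \<eta> z0) + cost_0 * \<eta>) \<longlongrightarrow> norm (z0 - S0 0 z0) + cost_0 * 0) (at_right 0)"
      by (intro tendsto_intros)
    hence "((\<lambda>\<eta>. norm (z0 - S0 \<eta> z0) + cost_0 * \<eta>) \<longlongrightarrow> 0) (at_right 0)" by simp
    hence "\<forall>\<^sub>F \<eta> in at_right 0. norm (z0 - S0 \<eta> z0) + cost_0 * \<eta> < \<delta> / C1"
      by (rule order_tendstoD) (use \<delta> C1(1) in simp)
    moreover have "\<forall>\<^sub>F \<eta> in at_right 0. 0 < \<eta> \<and> \<eta> < \<tau>"
      using eventually_at_right_less[of 0] eventually_at_right_real[OF \<tau>_pos] by (auto elim: eventually_mono)
    ultimately have "\<forall>\<^sub>F \<eta> in at_right (0::real). 0 < \<eta> \<and> \<eta> < \<tau> \<and> norm (z0 - S0 \<eta> z0) + cost_0 * \<eta> < \<delta> / C1"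
      by eventually_elim simp
    thus ?thesis by (rule eventually_happens'[rotated]) simp
  qed
  then obtain \<eta> where \<eta>: "0 < \<eta>" "\<eta> < \<tau>" "norm (z0 - S0 \<eta> z0) + cost_0 * \<eta> < \<delta> / C1" by blast
  obtain C2 where C2: "C2 > 0" "\<And>n \<psi>. norm (Sn n \<eta> \<psi>) \<le> C2 * control_system.mass (c n) K i0 i1 \<tau> \<psi>"
    by (rule observability_n[OF \<eta>(1) less_imp_le[OF \<eta>(2)]]) blast
  have "(\<lambda>n. cost_0 + C1 * norm (z0 - state_n n u \<eta>) + C2 * norm (state_n n u \<tau>)) \<longlonglongrightarrow>
      cost_0 + C1 * norm (z0 - lim.state z0 u \<eta>) + C2 * norm (lim.state z0 u \<tau>)"
    using \<eta> \<tau>_pos by (intro tendsto_intros state_tendsto[OF ua]) auto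
  moreover have "cost_0 + C1 * norm (z0 - lim.state z0 u \<eta>) + C2 * norm (lim.state z0 u \<tau>) < cost_0 + \<delta>"
  proof -
    have "norm (z0 - lim.state z0 u \<eta>) < \<delta> / C1" using lim.norm_state_diff_le[OF ua, of \<eta> z0] \<eta> by linarith
    hence "C1 * norm (z0 - lim.state z0 u \<eta>) < \<delta>" using C1(1) by (simp add: pos_less_divide_eq mult.commute)
    thus ?thesis by (simp add: fin)
  qed
  ultimately have "\<forall>\<^sub>F n in sequentially. cost_0 + C1 * norm (z0 - state_n n u \<eta>) + C2 * norm (state_n n u \<tau>) < cost_0 + \<delta>"
    by (rule order_tendstoD(2))
  thus ?thesis
  proof eventually_elim
    case (elim n)
    have "cost_n n \<le> cost_0 + C1 * norm (z0 - state_n n u \<eta>) + C2 * norm (state_n n u \<tau>)"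
      by (rule control_system.cost_perturbation[OF sys ua \<eta>(1,2)]) (use C1 C2 in auto)
    thus ?case using elim by linarith
  qed
qed

text \<open>The controls vary with \<open>n\<close>, so the difference of the semigroups is moved by
  symmetry onto the fixed vector \<open>d\<close>, where it converges strongly.\<close>

lemma inner_final_diff_tendsto:
  assumes u: "\<And>n. n \<ge> n0 \<Longrightarrow> u n \<in> admissible R" and R: "R \<ge> 0"
  shows "(\<lambda>n. inner d (lim.final (u n) - control_system.final (c n) K i0 i1 \<tau> (u n))) \<longlonglongrightarrow> 0"
proof -
  interpret finite_measure J by (rule finite_measure_J)
  have mS: "(\<lambda>s. S0 (\<tau> - s) d) \<in> borel_measurable J" by (rule lim.propagated_measurable) simp
  have mSn: "(\<lambda>s. Sn n (\<tau> - s) d) \<in> borel_measurable J" for n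
    by (rule control_system.propagated_measurable[OF sys]) simp
  note [measurable] = mS mSn
  have n0: "norm (S0 r d) \<le> norm d" for r by (rule lim.norm_heat_semigroup_le)
  have nn: "norm (Sn n r d) \<le> norm d" for n r
    by (rule positive_operator.norm_heat_semigroup_le[OF coefficient.positive_operator_inv_op[OF coeff]])
  have bd: "norm (S0 r d - Sn n r d) \<le> 2 * norm d" for n r
    using norm_triangle_ineq4[of "S0 r d" "Sn n r d"] n0[of r] nn[of n r] by linarith
  have int: "integrable J (\<lambda>s. norm (S0 (\<tau> - s) d - Sn n (\<tau> - s) d))" for n
    by (rule integrable_const_bound[where B = "2 * norm d"]) (use bd in auto)
  have "(\<lambda>n. LINT s|J. norm (S0 (\<tau> - s) d - Sn n (\<tau> - s) d)) \<longlonglongrightarrow> (LINT s|J. 0)"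
  proof (rule integral_dominated_convergence[where w = "\<lambda>_. 2 * norm d"])
    show "AE s in J. (\<lambda>n. norm (S0 (\<tau> - s) d - Sn n (\<tau> - s) d)) \<longlonglongrightarrow> 0"
    proof (rule AE_I2)
      fix s assume "s \<in> space J"
      hence "(\<lambda>n. norm (S0 (\<tau> - s) d - Sn n (\<tau> - s) d)) \<longlonglongrightarrow> norm (S0 (\<tau> - s) d - S0 (\<tau> - s) d)"
        by (intro tendsto_intros semigroup_tendsto) simp
      thus "(\<lambda>n. norm (S0 (\<tau> - s) d - Sn n (\<tau> - s) d)) \<longlonglongrightarrow> 0" by simp
    qed
  qed (use bd in auto)
  hence "(\<lambda>n. R * (LINT s|J. norm (S0 (\<tau> - s) d - Sn n (\<tau> - s) d))) \<longlonglongrightarrow> 0"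
    using tendsto_mult_right_zero by fastforce
  thus ?thesis
  proof (rule Lim_null_comparison[rotated])
    show "\<forall>\<^sub>F n in sequentially. norm (inner d (lim.final (u n) - control_system.final (c n) K i0 i1 \<tau> (u n)))
        \<le> R * (LINT s|J. norm (S0 (\<tau> - s) d - Sn n (\<tau> - s) d))" using eventually_ge_at_top[of n0]
    proof eventually_elim
      case (elim n)
      interpret n: control_system "c n" K i0 i1 \<tau> by (rule sys)
      note un = u[OF elim]
      have eq: "inner d (lim.final (u n) - n.final (u n)) = (LINT s|J. inner (S0 (\<tau> - s) d - Sn n (\<tau> - s) d) (source I (u n) s))"
        unfolding inner_diff_right inner_diff_left lim.inner_final[OF un R] n.inner_final[OF un R]
        by (rule Bochner_Integration.integral_diff[symmetric, OF lim.inner_final_integrable[OF un R] n.inner_final_integrable[OF un R]])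
      have ii: "integrable J (\<lambda>s. inner (S0 (\<tau> - s) d - Sn n (\<tau> - s) d) (source I (u n) s))"
        unfolding inner_diff_left
        by (rule Bochner_Integration.integrable_diff[OF lim.inner_final_integrable[OF un R] n.inner_final_integrable[OF un R]])
      have "norm (inner d (lim.final (u n) - n.final (u n))) \<le> (LINT s|J. norm (inner (S0 (\<tau> - s) d - Sn n (\<tau> - s) d) (source I (u n) s)))"
        unfolding eq by (rule integral_norm_bound)
      also have "\<dots> \<le> (LINT s|J. R * norm (S0 (\<tau> - s) d - Sn n (\<tau> - s) d))"
      proof (rule integral_mono_AE[OF integrable_norm[OF ii] integrable_mult_right[OF int]])
        show "AE s in J. norm (inner (S0 (\<tau> - s) d - Sn n (\<tau> - s) d) (source I (u n) s)) \<le> R * norm (S0 (\<tau> - s) d - Sn n (\<tau> - s) d)"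
          using norm_source_le[OF un R]
        proof eventually_elim
          case (elim s)
          have "norm (inner (S0 (\<tau> - s) d - Sn n (\<tau> - s) d) (source I (u n) s)) \<le> norm (S0 (\<tau> - s) d - Sn n (\<tau> - s) d) * norm (source I (u n) s)"
            by (simp add: Cauchy_Schwarz_ineq2)
          also have "\<dots> \<le> norm (S0 (\<tau> - s) d - Sn n (\<tau> - s) d) * R" by (rule mult_left_mono[OF elim]) simp
          finally show ?case by (simp add: mult.commute)
        qed
      qed
      finally show ?case by simp
    qed
  qed
qed

definition overlap :: "(real \<times> real \<Rightarrow> complex) \<Rightarrow> (real \<times> real \<Rightarrow> complex) \<Rightarrow> real" where
  "overlap u v = (LINT p|Q. u p \<bullet> v p)"

text \<open>A subsequence violating the bound would have a cluster point that respects the limit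
  cost and solves the limit control problem. By uniqueness it is \<open>u0\<close> almost
  everywhere, yet it inherits the deficient overlap.\<close>

lemma eventually_overlap_gt:
  assumes u: "\<And>n. u n \<in> control_system.controls (c n) K i0 i1 \<tau> z0 (cost_n n)"
    and u0: "u0 \<in> lim.controls z0 cost_0" and e: "e > 0"
  shows "\<forall>\<^sub>F n in sequentially. overlap (u n) u0 > overlap u0 u0 - e"
proof (rule ccontr)
  assume neg: "\<not> ?thesis"
  have u0a: "u0 \<in> admissible cost_0" using u0 by (simp add: lim.controls_def)
  have un: "u n \<in> admissible (cost_n n)" "control_system.final (c n) K i0 i1 \<tau> (u n) = - Sn n \<tau> z0" for n
    using u[of n] by (auto simp: control_system.controls_def[OF sys] add_eq_0_iff)
  define R where "R = cost_0 + 1"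
  have R: "R \<ge> 0" using cost_0_pos by (simp add: R_def)
  obtain n0 where n0: "\<forall>n\<ge>n0. cost_n n \<le> cost_0 + 1"
    using eventually_cost_le[OF zero_less_one] by (auto simp: eventually_sequentially)
  hence un': "u n \<in> admissible R" if "n \<ge> n0" for n using admissible_mono[OF un(1)] that by (simp add: R_def)
  define N where "N = {n. n \<ge> n0 \<and> overlap (u n) u0 \<le> overlap u0 u0 - e}"
  have N: "infinite N" unfolding infinite_nat_iff_unbounded_le
  proof
    fix m
    obtain n where "n \<ge> max m n0" "overlap (u n) u0 \<le> overlap u0 u0 - e"
      using neg unfolding eventually_sequentially not_ex not_all not_imp not_less by blast
    thus "\<exists>n\<ge>m. n \<in> N" by (auto simp: N_def)
  qed
  define r where "r = enumerate N"
  have r: "filterlim r sequentially sequentially" unfolding r_def by (intro filterlim_subseq strict_mono_enumerate N)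
  have rN: "u (r n) \<in> admissible R" "overlap (u (r n)) u0 \<le> overlap u0 u0 - e" for n
    using enumerate_in_set[OF N, of n] un' by (auto simp: N_def r_def)
  obtain v where v: "\<And>P. stable P \<Longrightarrow> \<forall>\<^sub>F n in sequentially. P (u (r n)) \<Longrightarrow> P v"
    by (rule weak_cluster[of "\<lambda>n. u (r n)" R, OF rN(1)]) blast
  have "v \<in> admissible (cost_0 + inverse (real (Suc k)))" for k
  proof (rule v[OF stable_admissible])
    have "\<forall>\<^sub>F n in sequentially. cost_n (r n) \<le> cost_0 + inverse (real (Suc k))"
      by (rule eventually_compose_filterlim[OF eventually_cost_le r]) simp
    thus "\<forall>\<^sub>F n in sequentially. u (r n) \<in> admissible (cost_0 + inverse (real (Suc k)))"
      by eventually_elim (rule admissible_mono[OF un(1)])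
  qed
  hence ae: "AE p in Q. \<forall>k. norm (v p) \<le> cost_0 + inverse (real (Suc k))" and vm: "v \<in> borel_measurable Q"
    by (auto simp: admissible_def AE_all_countable)
  from ae have "AE p in Q. norm (v p) \<le> cost_0"
  proof eventually_elim
    case (elim p)
    have "(\<lambda>k. cost_0 + inverse (real (Suc k))) \<longlonglongrightarrow> cost_0 + 0" by (intro tendsto_intros LIMSEQ_inverse_real_of_nat)
    thus ?case using LIMSEQ_le_const[of _ "cost_0 + 0" "norm (v p)"] elim by auto
  qed
  hence va: "v \<in> admissible cost_0" using vm by (simp add: admissible_def)
  \<comment> \<open>One-sided bounds for all \<open>d\<close> are enough: in the end
    \<open>d\<close> is the vector itself.\<close>
  have "inner d (lim.final v + S0 \<tau> z0) \<le> 0 + \<delta>" if "\<delta> > 0" for d \<delta>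
  proof -
    have "v \<in> admissible R \<and> inner d (lim.final v + S0 \<tau> z0) \<le> \<delta>"
    proof (rule v[OF stable_le])
      show "inner d (lim.final (\<lambda>p. (1/2) *\<^sub>R (v p + w p)) + S0 \<tau> z0) \<le>
          (inner d (lim.final v + S0 \<tau> z0) + inner d (lim.final w + S0 \<tau> z0)) / 2"
        if "v \<in> admissible R" "w \<in> admissible R" for v w
        unfolding lim.final_midpoint[OF that R] by (simp add: inner_add_right field_simps)
      show "(\<lambda>k. inner d (lim.final (v k) + S0 \<tau> z0)) \<longlonglongrightarrow> inner d (lim.final w + S0 \<tau> z0)"
        if "\<And>k. v k \<in> admissible R" "w \<in> admissible R" "AE p in Q. (\<lambda>k. v k p) \<longlonglongrightarrow> w p" for v w
        by (intro tendsto_intros lim.final_tendsto[OF that(1,2) R that(3)])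
      have "(\<lambda>n. inner d (S0 \<tau> z0 - Sn n \<tau> z0)) \<longlonglongrightarrow> inner d (S0 \<tau> z0 - S0 \<tau> z0)"
        using \<tau>_pos by (intro tendsto_intros semigroup_tendsto) simp
      from tendsto_add[OF inner_final_diff_tendsto[of n0 u R d, OF un' R] this]
      have "(\<lambda>n. inner d (lim.final (u n) + S0 \<tau> z0)) \<longlonglongrightarrow> 0" by (simp add: un(2) inner_diff_right inner_add_right)
      from order_tendstoD(2)[OF filterlim_compose[OF this r] that]
      show "\<forall>\<^sub>F n in sequentially. u (r n) \<in> admissible R \<and> inner d (lim.final (u (r n)) + S0 \<tau> z0) \<le> \<delta>"
        by eventually_elim (simp add: rN(1))
    qed
    thus ?thesis by simp
  qed
  hence "inner (lim.final v + S0 \<tau> z0) (lim.final v + S0 \<tau> z0) \<le> 0" by (rule field_le_epsilon)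
  hence "lim.final v + S0 \<tau> z0 = 0" using inner_ge_zero inner_eq_zero_iff order_antisym by blast
  hence "S0 \<tau> z0 + lim.final v = 0" by (simp add: add.commute)
  hence vc: "v \<in> lim.controls z0 cost_0" using va by (simp add: lim.controls_def)
  have m [measurable]: "w \<in> borel_measurable Q" if "w \<in> admissible R'" for w R' using that by (simp add: admissible_def)
  note [measurable] = m[OF u0a] m[OF va]
  have "v \<in> admissible R \<and> overlap v u0 \<le> overlap u0 u0 - e"
  proof (rule v[OF stable_le])
    note int = admissible_inner_integrable[OF _ u0a R less_imp_le[OF cost_0_pos]]
    show "overlap (\<lambda>p. (1/2) *\<^sub>R (v p + w p)) u0 \<le> (overlap v u0 + overlap w u0) / 2"
      if "v \<in> admissible R" "w \<in> admissible R" for v w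
    proof -
      have "overlap (\<lambda>p. (1/2) *\<^sub>R (v p + w p)) u0 = (LINT p|Q. (1/2) * (v p \<bullet> u0 p + w p \<bullet> u0 p))"
        unfolding overlap_def by (simp add: inner_add_left)
      thus ?thesis unfolding overlap_def using int(1)[OF that(1)] int(1)[OF that(2)] by simp
    qed
    show "(\<lambda>n. overlap (v n) u0) \<longlonglongrightarrow> overlap w u0"
      if v: "\<And>k. v k \<in> admissible R" "w \<in> admissible R" "AE p in Q. (\<lambda>k. v k p) \<longlonglongrightarrow> w p" for v w
      unfolding overlap_def
    proof (rule integral_dominated_convergence[where w = "\<lambda>_. R * cost_0"])
      interpret finite_measure Q by (rule finite_measure_Q)
      show "integrable Q (\<lambda>_. R * cost_0)" by simp
      show "(\<lambda>p. w p \<bullet> u0 p) \<in> borel_measurable Q" "(\<lambda>p. v n p \<bullet> u0 p) \<in> borel_measurable Q" for n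
        using int(1)[OF v(2)] int(1)[OF v(1)[of n]] by auto
      show "AE p in Q. (\<lambda>n. v n p \<bullet> u0 p) \<longlonglongrightarrow> w p \<bullet> u0 p"
        using v(3) by eventually_elim (intro tendsto_intros)
    qed (rule int(2)[OF v(1)])
  qed (simp add: rN)
  moreover have "overlap v u0 = overlap u0 u0" unfolding overlap_def
  proof (rule integral_cong_AE)
    show "AE p in Q. v p \<bullet> u0 p = u0 p \<bullet> u0 p" using lim.optimal_control_unique[OF z0 u0 vc] by eventually_elim simp
  qed measurable
  ultimately show False using e by simp
qed

end

section \<open>From quadratic means to weak-star and \<open>L^p\<close> convergence\<close>

text \<open>The weight is merely integrable, so Cauchy-Schwarz does not apply; subsequences that
  converge almost everywhere are dominated by \<open>w * B\<close> instead. The weight is the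
  modulus of the test function for weak-star convergence and \<open>1\<close> for \<open>L^p\<close>
  norms.\<close>

lemma weighted_L1_tendsto_0:
  fixes f :: "nat \<Rightarrow> 'a \<Rightarrow> complex" and w :: "'a \<Rightarrow> real"
  assumes M: "finite_measure M" and f: "\<And>n. f n \<in> borel_measurable M"
    and B: "\<And>n. AE x in M. norm (f n x) \<le> B"
    and lim: "(\<lambda>n. LINT x|M. (norm (f n x))^2) \<longlonglongrightarrow> 0"
    and w: "integrable M w" "\<And>x. 0 \<le> w x"
  shows "(\<lambda>n. LINT x|M. w x * norm (f n x)) \<longlonglongrightarrow> 0"
proof (rule ccontr)
  interpret finite_measure M by (rule M)
  note [measurable] = f borel_measurable_integrable[OF w(1)]
  define a where "a n = (LINT x|M. w x * norm (f n x))" for n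
  assume "\<not> (\<lambda>n. LINT x|M. w x * norm (f n x)) \<longlonglongrightarrow> 0"
  then obtain e where e: "e > 0" "\<And>N. \<exists>n\<ge>N. e \<le> norm (a n)" unfolding LIMSEQ_iff a_def by (auto simp: not_less)
  hence inf: "infinite {n. e \<le> norm (a n)}" by (auto simp: infinite_nat_iff_unbounded_le)
  define r where "r = enumerate {n. e \<le> norm (a n)}"
  have r: "strict_mono r" "e \<le> norm (a (r n))" for n
    using strict_mono_enumerate[OF inf] enumerate_in_set[OF inf, of n] by (auto simp: r_def)
  have sq: "integrable M (\<lambda>x. (norm (f n x))^2)" for n
    by (rule integrable_const_bound[where B = "B^2"]) (use B[of n] in "auto elim!: eventually_mono simp: power_mono")
  have "\<exists>s. strict_mono s \<and> (AE x in M. (\<lambda>n. (norm (f (r (s n)) x))^2) \<longlonglongrightarrow> 0)"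
    by (rule tendsto_L1_AE_subseq[of M "\<lambda>n x. (norm (f (r n) x))^2", OF sq])
      (use LIMSEQ_subseq_LIMSEQ[OF lim r(1)] in "simp add: o_def")
  then obtain s where s: "AE x in M. (\<lambda>n. (norm (f (r (s n)) x))^2) \<longlonglongrightarrow> 0" by blast
  have "(\<lambda>n. a (r (s n))) \<longlonglongrightarrow> (LINT x|M. 0)" unfolding a_def
  proof (rule integral_dominated_convergence[where w = "\<lambda>x. w x * B"])
    show "AE x in M. (\<lambda>n. w x * norm (f (r (s n)) x)) \<longlonglongrightarrow> 0" using s
    proof eventually_elim
      case (elim x)
      have "(\<lambda>n. w x * sqrt ((norm (f (r (s n)) x))^2)) \<longlonglongrightarrow> w x * sqrt 0" by (intro tendsto_intros elim)
      thus ?case by simp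
    qed
    show "AE x in M. norm (w x * norm (f (r (s n)) x)) \<le> w x * B" for n
      using B[of "r (s n)"] by eventually_elim (simp add: w(2) mult_left_mono)
  qed (use w(1) in auto)
  hence "(\<lambda>n. norm (a (r (s n)))) \<longlonglongrightarrow> 0" using tendsto_norm_zero by fastforce
  hence "e \<le> 0" by (rule LIMSEQ_le_const) (use r(2) in blast)
  thus False using e(1) by simp
qed

lemma weak_integral_tendsto_0:
  fixes f :: "nat \<Rightarrow> 'a \<Rightarrow> complex"
  assumes M: "finite_measure M" and f: "\<And>n. f n \<in> borel_measurable M"
    and B: "\<And>n. AE x in M. norm (f n x) \<le> B"
    and lim: "(\<lambda>n. LINT x|M. (norm (f n x))^2) \<longlonglongrightarrow> 0" and \<phi>: "integrable M \<phi>"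
  shows "(\<lambda>n. LINT x|M. f n x * \<phi> x) \<longlonglongrightarrow> 0"
proof (rule Lim_null_comparison[OF always_eventually weighted_L1_tendsto_0[OF M f B lim integrable_norm[OF \<phi>]]], rule allI)
  show "norm (LINT x|M. f n x * \<phi> x) \<le> (LINT x|M. norm (\<phi> x) * norm (f n x))" for n
    using integral_norm_bound[of M "\<lambda>x. f n x * \<phi> x"] by (simp add: norm_mult mult.commute)
qed simp

text \<open>Interpolation with the uniform bound: the \<open>p\<close>-th power is at most
  \<open>B powr (p - 1)\<close> times the modulus itself.\<close>

lemma Lp_norm_tendsto_0:
  fixes f :: "nat \<Rightarrow> 'a \<Rightarrow> complex"
  assumes M: "finite_measure M" and f: "\<And>n. f n \<in> borel_measurable M"
    and B: "\<And>n. AE x in M. norm (f n x) \<le> B"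
    and lim: "(\<lambda>n. LINT x|M. (norm (f n x))^2) \<longlonglongrightarrow> 0" and p: "p \<ge> 1"
  shows "(\<lambda>n. Lp_norm p M (f n)) \<longlonglongrightarrow> 0"
proof -
  interpret finite_measure M by (rule M)
  note [measurable] = f
  have L1: "(\<lambda>n. LINT x|M. 1 * norm (f n x)) \<longlonglongrightarrow> 0" by (rule weighted_L1_tendsto_0[OF M f B lim]) auto
  have le: "AE x in M. norm (f n x) powr p \<le> B powr (p - 1) * norm (f n x)" for n using B[of n]
  proof eventually_elim
    case (elim x)
    show ?case
    proof (cases "f n x = 0")
      case False
      hence "norm (f n x) powr p = norm (f n x) powr (p - 1) * norm (f n x)" using powr_add[of "norm (f n x)" "p - 1" 1] by simp
      also have "\<dots> \<le> B powr (p - 1) * norm (f n x)" using elim p by (intro mult_right_mono powr_mono2) auto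
      finally show ?thesis .
    qed simp
  qed
  have n1: "integrable M (\<lambda>x. norm (f n x))" for n by (rule integrable_const_bound[where B = B]) (use B in auto)
  have np: "integrable M (\<lambda>x. norm (f n x) powr p)" for n
  proof (rule Bochner_Integration.integrable_bound)
    show "integrable M (\<lambda>x. B powr (p - 1) * norm (f n x))" using n1 by simp
    show "AE x in M. norm (norm (f n x) powr p) \<le> norm (B powr (p - 1) * norm (f n x))" using le[of n] by eventually_elim simp
  qed measurable
  have "(\<lambda>n. B powr (p - 1) * (LINT x|M. 1 * norm (f n x))) \<longlonglongrightarrow> B powr (p - 1) * 0" by (intro tendsto_intros L1)
  hence z: "(\<lambda>n. B powr (p - 1) * (LINT x|M. 1 * norm (f n x))) \<longlonglongrightarrow> 0" by simp
  have nn: "0 \<le> (LINT x|M. norm (f n x) powr p)" for n by (intro integral_nonneg_AE AE_I2) simp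
  have "(\<lambda>n. LINT x|M. norm (f n x) powr p) \<longlonglongrightarrow> 0"
  proof (rule Lim_null_comparison[OF always_eventually z], rule allI)
    fix n
    have "(LINT x|M. norm (f n x) powr p) \<le> (LINT x|M. B powr (p - 1) * norm (f n x))"
      by (rule integral_mono_AE[OF np _ le]) (use n1 in simp)
    thus "norm (LINT x|M. norm (f n x) powr p) \<le> B powr (p - 1) * (LINT x|M. 1 * norm (f n x))" using nn[of n] by simp
  qed
  thus ?thesis unfolding Lp_norm_def by (rule tendsto_zero_powrI[OF _ tendsto_const]) (use nn p in auto)
qed

section \<open>Convergence of costs and strong convergence of controls\<close>

context control_sequence
begin

lemma overlap_self:
  assumes u: "AE p in Q. norm (u p) = r" and m: "u \<in> borel_measurable Q"
  shows "overlap u u = r^2 * volume"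
proof -
  note [measurable] = m
  have "overlap u u = (LINT p|Q. r^2)" unfolding overlap_def
  proof (rule integral_cong_AE)
    show "AE p in Q. u p \<bullet> u p = r^2" using u by eventually_elim (simp add: power2_norm_eq_inner[symmetric])
  qed measurable
  thus ?thesis by (simp only: integral_Q_const)
qed

lemma volume_pos: "volume > 0"
proof -
  have "measure lebesgue ({0<..<\<tau>} \<times> I) = measure lebesgue {0<..<\<tau>} * measure lebesgue I"
  proof -
    have "measure lebesgue ({0<..<\<tau>} \<times> I) = measure lborel ({0<..<\<tau>} \<times> I)"
      by (rule measure_completion) (simp, intro borel_open open_Times open_greaterThanLessThan)
    also have "\<dots> = measure (lborel \<Otimes>\<^sub>M lborel) ({0<..<\<tau>} \<times> I)" by (simp only: lborel_prod)
    also have "\<dots> = measure lborel {0<..<\<tau>} * measure lborel I"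
      unfolding measure_def by (subst lborel.emeasure_pair_measure_Times) (auto simp: enn2real_mult)
    finally show ?thesis by simp
  qed
  thus ?thesis unfolding volume_def using \<tau>_pos i01 by (subst measure_restrict_space) (simp_all add: measure_restrict_space)
qed

context
  fixes u u0
  assumes u: "\<And>n. u n \<in> control_system.controls (c n) K i0 i1 \<tau> z0 (cost_n n)"
    and u0: "u0 \<in> lim.controls z0 cost_0"
begin

lemma u_admissible: "u n \<in> admissible (cost_n n)" and u0_admissible: "u0 \<in> admissible cost_0"
  using u[of n] u0 by (auto simp: control_system.controls_def[OF sys] lim.controls_def)

lemma u_measurable [measurable]: "u n \<in> borel_measurable Q" "u0 \<in> borel_measurable Q"
  using u_admissible u0_admissible by (auto simp: admissible_def)

lemma u_norm: "AE p in Q. norm (u n p) = cost_n n" "AE p in Q. norm (u0 p) = cost_0"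
  using control_system.bang_bang[OF sys z0 u] lim.bang_bang[OF z0 u0] by auto

lemma overlap_le: "overlap (u n) u0 \<le> cost_n n * cost_0 * volume"
proof -
  note b = admissible_inner_integrable[OF u_admissible u0_admissible less_imp_le[OF cost_n_pos] less_imp_le[OF cost_0_pos]]
  interpret finite_measure Q by (rule finite_measure_Q)
  have "overlap (u n) u0 \<le> (LINT p|Q. cost_n n * cost_0)" unfolding overlap_def
  proof (rule integral_mono_AE[OF b(1)])
    show "AE p in Q. u n p \<bullet> u0 p \<le> cost_n n * cost_0" using b(2)[of n] by eventually_elim simp
  qed simp
  thus ?thesis by (simp only: integral_Q_const)
qed

text \<open>Only the lower bound is new. The self-overlap of \<open>u0\<close> is
  \<open>cost_0^2 * volume\<close> by the bang-bang property; eventually it exceeds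
  \<open>overlap (u n) u0\<close> by less than any given amount, and the latter is at most
  \<open>cost_n n * cost_0 * volume\<close>.\<close>

lemma cost_tendsto: "(\<lambda>n. cost_n n) \<longlonglongrightarrow> cost_0"
proof (rule order_tendstoI)
  fix r assume "r > cost_0"
  hence "\<forall>\<^sub>F n in sequentially. cost_n n \<le> cost_0 + (r - cost_0) / 2" by (intro eventually_cost_le) simp
  thus "\<forall>\<^sub>F n in sequentially. cost_n n < r" by eventually_elim (use \<open>r > cost_0\<close> in "simp add: field_simps")
next
  fix r assume r: "r < cost_0"
  have "(cost_0 - r) * (cost_0 * volume) > 0" using r cost_0_pos volume_pos by simp
  from eventually_overlap_gt[OF u u0 this] show "\<forall>\<^sub>F n in sequentially. r < cost_n n"
  proof eventually_elim
    case (elim n)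
    have "overlap u0 u0 = cost_0^2 * volume" by (rule overlap_self[OF u_norm(2) u_measurable(2)])
    hence "r * (cost_0 * volume) < cost_n n * (cost_0 * volume)"
      using elim overlap_le[of n] by (simp add: power2_eq_square algebra_simps)
    moreover have "cost_0 * volume > 0" using cost_0_pos volume_pos by simp
    ultimately show ?case by (rule mult_right_less_imp_less[OF _ less_imp_le])
  qed
qed

text \<open>Constant moduli make the squared norms explicit in the costs, so that expanding the
  square leaves only the overlap to be followed.\<close>

lemma L2_tendsto: "(\<lambda>n. LINT p|Q. (norm (u n p - u0 p))^2) \<longlonglongrightarrow> 0"
proof -
  note b0 = admissible_inner_integrable(1)[OF u_admissible u0_admissible less_imp_le[OF cost_n_pos] less_imp_le[OF cost_0_pos]]
  note b1 = admissible_inner_integrable(1)[OF u_admissible u_admissible less_imp_le[OF cost_n_pos] less_imp_le[OF cost_n_pos]]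
  note b2 = admissible_inner_integrable(1)[OF u0_admissible u0_admissible less_imp_le[OF cost_0_pos] less_imp_le[OF cost_0_pos]]
  have eq: "(LINT p|Q. (norm (u n p - u0 p))^2) = (cost_n n)^2 * volume - 2 * overlap (u n) u0 + cost_0^2 * volume" for n
  proof -
    have "(LINT p|Q. (norm (u n p - u0 p))^2) = (LINT p|Q. (u n p \<bullet> u n p - 2 * (u n p \<bullet> u0 p)) + u0 p \<bullet> u0 p)"
      by (rule Bochner_Integration.integral_cong) (auto simp: power2_norm_eq_inner inner_diff inner_commute)
    also have "\<dots> = (LINT p|Q. u n p \<bullet> u n p - 2 * (u n p \<bullet> u0 p)) + overlap u0 u0"
      unfolding overlap_def using b0[of n] b1[of n n] b2 by (intro Bochner_Integration.integral_add) auto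
    also have "(LINT p|Q. u n p \<bullet> u n p - 2 * (u n p \<bullet> u0 p)) = overlap (u n) (u n) - 2 * overlap (u n) u0"
      unfolding overlap_def using b0[of n] b1[of n n] by (subst Bochner_Integration.integral_diff) auto
    finally show ?thesis by (simp only: overlap_self[OF u_norm(2) u_measurable(2)] overlap_self[OF u_norm(1) u_measurable(1)])
  qed
  have ov: "(\<lambda>n. overlap (u n) u0) \<longlonglongrightarrow> cost_0^2 * volume"
  \<comment> \<open>The minimum converts the one-sided eventual bound for the overlap into a
    convergent lower bound.\<close>
  proof (rule tendsto_sandwich[where f = "\<lambda>n. min (overlap (u n) u0) (cost_0^2 * volume)" and h = "\<lambda>n. cost_n n * cost_0 * volume"])
    have "(\<lambda>n. cost_n n * cost_0 * volume) \<longlonglongrightarrow> cost_0 * cost_0 * volume" by (intro tendsto_intros cost_tendsto)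
    thus "(\<lambda>n. cost_n n * cost_0 * volume) \<longlonglongrightarrow> cost_0^2 * volume" by (simp add: power2_eq_square)
    show "\<forall>\<^sub>F n in sequentially. overlap (u n) u0 \<le> cost_n n * cost_0 * volume" by (simp add: overlap_le)
    show "\<forall>\<^sub>F n in sequentially. min (overlap (u n) u0) (cost_0^2 * volume) \<le> overlap (u n) u0" by simp
    show "(\<lambda>n. min (overlap (u n) u0) (cost_0^2 * volume)) \<longlonglongrightarrow> cost_0^2 * volume"
    proof (rule order_tendstoI)
      fix r assume "r < cost_0^2 * volume"
      hence "\<forall>\<^sub>F n in sequentially. overlap (u n) u0 > overlap u0 u0 - (cost_0^2 * volume - r)"
        by (intro eventually_overlap_gt[OF u u0]) simp
      thus "\<forall>\<^sub>F n in sequentially. r < min (overlap (u n) u0) (cost_0^2 * volume)"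
        by eventually_elim (use \<open>r < _\<close> in "simp add: overlap_self[OF u_norm(2) u_measurable(2)]")
    qed (simp add: min_less_iff_disj)
  qed
  have "(\<lambda>n. (cost_n n)^2 * volume - 2 * overlap (u n) u0 + cost_0^2 * volume) \<longlonglongrightarrow>
      cost_0^2 * volume - 2 * (cost_0^2 * volume) + cost_0^2 * volume" by (intro tendsto_intros cost_tendsto ov)
  thus ?thesis unfolding eq by simp
qed

lemma difference_bounded: obtains B where "\<And>n. AE p in Q. norm (u n p - u0 p) \<le> B"
proof -
  obtain B where B: "\<And>n. norm (cost_n n) \<le> B"
    using convergent_imp_Bseq[OF convergentI[OF cost_tendsto]] unfolding Bseq_def by blast
  have "AE p in Q. norm (u n p - u0 p) \<le> B + cost_0" for n using u_norm(1)[of n] u_norm(2)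
  proof eventually_elim
    case (elim p)
    have "cost_n n \<le> B" using B[of n] by simp
    thus ?case using norm_triangle_ineq4[of "u n p" "u0 p"] elim by simp
  qed
  thus thesis by (rule that)
qed

lemma control_weak_tendsto:
  assumes \<phi>: "integrable Q \<phi>"
  shows "(\<lambda>n. LINT p|Q. u n p * \<phi> p) \<longlonglongrightarrow> (LINT p|Q. u0 p * \<phi> p)"
proof -
  obtain B where B: "\<And>n. AE p in Q. norm (u n p - u0 p) \<le> B" by (rule difference_bounded) blast
  have i: "integrable Q (\<lambda>p. v p * \<phi> p)" if v: "v \<in> borel_measurable Q" "AE p in Q. norm (v p) = r" for v r
  proof (rule Bochner_Integration.integrable_bound)
    show "integrable Q (\<lambda>p. r * norm (\<phi> p))" using \<phi> by simp
    show "(\<lambda>p. v p * \<phi> p) \<in> borel_measurable Q" using v(1) \<phi> by measurable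
    show "AE p in Q. norm (v p * \<phi> p) \<le> norm (r * norm (\<phi> p))"
      using v(2) by eventually_elim (auto simp: norm_mult abs_mult)
  qed
  have "(\<lambda>n. LINT p|Q. (u n p - u0 p) * \<phi> p) \<longlonglongrightarrow> 0"
    by (rule weak_integral_tendsto_0[OF finite_measure_Q _ B L2_tendsto \<phi>]) measurable
  moreover have "(LINT p|Q. (u n p - u0 p) * \<phi> p) = (LINT p|Q. u n p * \<phi> p) - (LINT p|Q. u0 p * \<phi> p)" for n
    unfolding left_diff_distrib
    by (rule Bochner_Integration.integral_diff[OF i[OF u_measurable(1) u_norm(1)] i[OF u_measurable(2) u_norm(2)]])
  ultimately show ?thesis by (simp add: LIM_zero_cancel)
qed

lemma control_Lp_tendsto:
  assumes p: "p \<ge> 1"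
  shows "(\<lambda>n. Lp_norm p Q (\<lambda>q. u n q - u0 q)) \<longlonglongrightarrow> 0"
proof -
  obtain B where B: "\<And>n. AE p in Q. norm (u n p - u0 p) \<le> B" by (rule difference_bounded) blast
  show ?thesis by (rule Lp_norm_tendsto_0[OF finite_measure_Q _ B L2_tendsto p]) measurable
qed

end

end

section \<open>Reduction to explicit intervals and to sequences of parameters\<close>

lemma open_interval_bounded:
  fixes I :: "real set"
  assumes I: "open I" "is_interval I" "I \<noteq> {}" "I \<subseteq> {0<..<1}"
  obtains i0 i1 where "I = {i0<..<i1}" "0 \<le> i0" "i0 < i1" "i1 \<le> 1"
proof -
  have I01: "0 < x \<and> x < 1" if "x \<in> I" for x using I(4) that by auto
  have bd: "bdd_below I" by (rule bdd_belowI[of _ 0]) (use I01 in force)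
  have ba: "bdd_above I" by (rule bdd_aboveI[of _ 1]) (use I01 in force)
  have iv: "x \<in> I" if "y \<in> I" "z \<in> I" "y \<le> x" "x \<le> z" for x y z using I(2) that unfolding is_interval_1 by blast
  have eq: "I = {Inf I<..<Sup I}"
  proof (intro equalityI subsetI)
    fix x assume x: "x \<in> I"
    then obtain e where e: "e > 0" "ball x e \<subseteq> I" using I(1) open_contains_ball by blast
    have "x - e / 2 \<in> I" "x + e / 2 \<in> I" using e by (auto simp: dist_real_def subset_eq)
    hence "Inf I \<le> x - e / 2" "x + e / 2 \<le> Sup I" by (auto intro: cInf_lower[OF _ bd] cSup_upper[OF _ ba])
    thus "x \<in> {Inf I<..<Sup I}" using e(1) by simp
  next
    fix x assume "x \<in> {Inf I<..<Sup I}"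
    then obtain y z where "y \<in> I" "y < x" "z \<in> I" "x < z" using cInf_lessD[OF I(3), of x] less_cSupD[OF I(3), of x] by auto
    thus "x \<in> I" using iv[of y z x] by simp
  qed
  obtain x where x: "x \<in> I" using I(3) by blast
  have "0 \<le> Inf I" by (rule cInf_greatest[OF I(3)]) (use I01 in force)
  moreover have "Sup I \<le> 1" by (rule cSup_least[OF I(3)]) (use I01 in force)
  moreover have "Inf I < Sup I" using subsetD[OF equalityD1[OF eq] x] by simp
  ultimately show thesis using eq by (intro that)
qed

theorem theorem1p1:
  fixes a :: "real \<Rightarrow> real" and K \<tau> :: real and I :: "real set" and z0 :: L2
  assumes "a \<in> borel_measurable lebesgue"
    and "AE x in lebesgue. a (x + 1) = a x"
    and "K > 0"
    and "AE x in lebesgue. 1 / K \<le> a x \<and> a x \<le> K"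
    and "open I" and "is_interval I" and "I \<noteq> {}" and "I \<subseteq> {0<..<1}"
    and "\<tau> > 0"
    and "z0 \<noteq> 0"
  shows
    "(\<forall>\<epsilon>\<ge>0.
        (\<exists>u. norm_optimal a I \<tau> z0 \<epsilon> u \<and>
           (\<forall>v. norm_optimal a I \<tau> z0 \<epsilon> v \<longrightarrow> (AE p in cylinder \<tau> I. v p = u p))) \<and>
        (\<forall>u. norm_optimal a I \<tau> z0 \<epsilon> u \<longrightarrow>
           (AE p in cylinder \<tau> I. ennreal (norm (u p)) = optimal_norm a I \<tau> z0 \<epsilon>))) \<and>
     ((\<lambda>\<epsilon>. optimal_norm a I \<tau> z0 \<epsilon>) \<longlongrightarrow> optimal_norm a I \<tau> z0 0) (at_right 0) \<and>
     (\<forall>u. (\<forall>\<epsilon>\<ge>0. norm_optimal a I \<tau> z0 \<epsilon> (u \<epsilon>)) \<longrightarrow>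
        weak_star_tendsto (cylinder \<tau> I) u (u 0) (at_right 0) \<and>
        (\<forall>p\<ge>1. ((\<lambda>\<epsilon>. Lp_norm p (cylinder \<tau> I) (\<lambda>q. u \<epsilon> q - u 0 q)) \<longlongrightarrow> 0) (at_right 0)))"
proof -
  obtain i0 i1 where I: "I = {i0<..<i1}" "0 \<le> i0" "i0 < i1" "i1 \<le> 1" by (rule open_interval_bounded[OF assms(5-8)])
  interpret periodic_coefficient a K by unfold_locales (use assms in auto)
  have cyl: "control_cylinder i0 i1 \<tau>" by unfold_locales (use I assms in auto)
  have sys: "control_system (coef a \<epsilon>) K i0 i1 \<tau>" if "\<epsilon> \<ge> 0" for \<epsilon>
    by (intro control_system.intro coefficient_coef that cyl)
  have seq: "control_sequence (\<lambda>n. coef a (X n)) (coef a 0) K i0 i1 \<tau> z0"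
    if "\<And>n. X n > 0" "X \<longlonglongrightarrow> 0" for X
    by (intro control_sequence.intro control_sequence_axioms.intro coefficient_sequence_coef that cyl assms)
  define N where "N \<epsilon> = control_system.cost (coef a \<epsilon>) K i0 i1 \<tau> z0" for \<epsilon>
  define Opt where "Opt \<epsilon> = control_system.controls (coef a \<epsilon>) K i0 i1 \<tau> z0 (N \<epsilon>)" for \<epsilon>
  have opt: "norm_optimal a I \<tau> z0 \<epsilon> u \<longleftrightarrow> u \<in> Opt \<epsilon>" if "\<epsilon> \<ge> 0" for \<epsilon> u
    unfolding I(1) Opt_def N_def by (rule control_system.norm_optimal_iff[OF sys[OF that] refl])
  have optN: "optimal_norm a I \<tau> z0 \<epsilon> = ennreal (N \<epsilon>)" if "\<epsilon> \<ge> 0" for \<epsilon>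
    unfolding I(1) N_def by (rule control_system.optimal_norm_eq[OF sys[OF that] refl])
  have ne: "\<exists>u. u \<in> Opt \<epsilon>" if "\<epsilon> \<ge> 0" for \<epsilon>
    unfolding Opt_def N_def using control_system.controls_cost_nonempty[OF sys[OF that]] by blast
  have limN: "(\<lambda>n. N (X n)) \<longlonglongrightarrow> N 0" if X: "\<And>n. X n > 0" "X \<longlonglongrightarrow> 0" for X
  proof -
    interpret control_sequence "\<lambda>n. coef a (X n)" "coef a 0" K i0 i1 \<tau> z0 by (rule seq[OF X])
    \<comment> \<open>The convergence of the costs rests on the overlap of controls, hence optimal
      controls are selected although only their norms are in question here.\<close>
    obtain u where u: "\<And>n. u n \<in> Opt (X n)" using ne[OF less_imp_le[OF X(1)]] by metis
    obtain u0 where u0: "u0 \<in> Opt 0" using ne[OF order_refl] by blast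
    show ?thesis using cost_tendsto[OF u[unfolded Opt_def N_def] u0[unfolded Opt_def N_def]] by (simp add: N_def)
  qed
  have "((\<lambda>\<epsilon>. optimal_norm a I \<tau> z0 \<epsilon>) \<longlongrightarrow> optimal_norm a I \<tau> z0 0) (at_right 0)"
    unfolding tendsto_at_iff_sequentially
  proof (intro allI impI)
    fix X :: "nat \<Rightarrow> real" assume X: "\<forall>n. X n \<in> {0<..} - {0}" "X \<longlonglongrightarrow> 0"
    hence X': "X n > 0" for n by auto
    show "((\<lambda>\<epsilon>. optimal_norm a I \<tau> z0 \<epsilon>) \<circ> X) \<longlonglongrightarrow> optimal_norm a I \<tau> z0 0"
      using tendsto_ennrealI[OF limN[OF X' X(2)]] by (simp add: o_def optN less_imp_le[OF X'])
  qed
  moreover have "weak_star_tendsto (cylinder \<tau> I) u (u 0) (at_right 0) \<and>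
      (\<forall>p\<ge>1. ((\<lambda>\<epsilon>. Lp_norm p (cylinder \<tau> I) (\<lambda>q. u \<epsilon> q - u 0 q)) \<longlongrightarrow> 0) (at_right 0))"
    if u: "\<forall>\<epsilon>\<ge>0. norm_optimal a I \<tau> z0 \<epsilon> (u \<epsilon>)" for u
  proof -
    have uU: "u \<epsilon> \<in> control_system.controls (coef a \<epsilon>) K i0 i1 \<tau> z0 (control_system.cost (coef a \<epsilon>) K i0 i1 \<tau> z0)" if "\<epsilon> \<ge> 0" for \<epsilon>
      using u opt that unfolding Opt_def N_def by blast
    show ?thesis
    proof (intro conjI allI impI)
      show "weak_star_tendsto (cylinder \<tau> I) u (u 0) (at_right 0)"
        unfolding weak_star_tendsto_def tendsto_at_iff_sequentially I(1)
      proof (intro allI impI)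
        fix \<phi> :: "real \<times> real \<Rightarrow> complex" and X :: "nat \<Rightarrow> real"
        assume \<phi>: "integrable (cylinder \<tau> {i0<..<i1}) \<phi>" and X: "\<forall>n. X n \<in> {0<..} - {0}" "X \<longlonglongrightarrow> 0"
        hence X': "X n > 0" for n by auto
        interpret control_sequence "\<lambda>n. coef a (X n)" "coef a 0" K i0 i1 \<tau> z0 by (rule seq[OF X' X(2)])
        show "((\<lambda>\<epsilon>. LINT p|cylinder \<tau> {i0<..<i1}. u \<epsilon> p * \<phi> p) \<circ> X) \<longlonglongrightarrow> (LINT p|cylinder \<tau> {i0<..<i1}. u 0 p * \<phi> p)"
          using control_weak_tendsto[OF uU[OF less_imp_le[OF X']] uU[OF order_refl] \<phi>] by (simp add: o_def)
      qed
      fix p :: real assume p: "p \<ge> 1"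
      show "((\<lambda>\<epsilon>. Lp_norm p (cylinder \<tau> I) (\<lambda>q. u \<epsilon> q - u 0 q)) \<longlongrightarrow> 0) (at_right 0)"
        unfolding tendsto_at_iff_sequentially I(1)
      proof (intro allI impI)
        fix X :: "nat \<Rightarrow> real" assume X: "\<forall>n. X n \<in> {0<..} - {0}" "X \<longlonglongrightarrow> 0"
        hence X': "X n > 0" for n by auto
        interpret control_sequence "\<lambda>n. coef a (X n)" "coef a 0" K i0 i1 \<tau> z0 by (rule seq[OF X' X(2)])
        show "((\<lambda>\<epsilon>. Lp_norm p (cylinder \<tau> {i0<..<i1}) (\<lambda>q. u \<epsilon> q - u 0 q)) \<circ> X) \<longlonglongrightarrow> 0"
          using control_Lp_tendsto[OF uU[OF less_imp_le[OF X']] uU[OF order_refl] p] by (simp add: o_def)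
      qed
    qed
  qed
  moreover have "(\<exists>u. norm_optimal a I \<tau> z0 \<epsilon> u \<and>
           (\<forall>v. norm_optimal a I \<tau> z0 \<epsilon> v \<longrightarrow> (AE p in cylinder \<tau> I. v p = u p))) \<and>
        (\<forall>u. norm_optimal a I \<tau> z0 \<epsilon> u \<longrightarrow>
           (AE p in cylinder \<tau> I. ennreal (norm (u p)) = optimal_norm a I \<tau> z0 \<epsilon>))" if \<epsilon>: "\<epsilon> \<ge> 0" for \<epsilon>
  proof -
    interpret control_system "coef a \<epsilon>" K i0 i1 \<tau> by (rule sys[OF \<epsilon>])
    obtain u where u: "u \<in> Opt \<epsilon>" using ne[OF \<epsilon>] by blast
    have "AE p in cylinder \<tau> I. v p = u p" if "v \<in> Opt \<epsilon>" for v
      using optimal_control_unique[OF assms(10) u[unfolded Opt_def N_def] that[unfolded Opt_def N_def]] by (simp only: I(1))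
    moreover have "AE p in cylinder \<tau> I. ennreal (norm (v p)) = ennreal (N \<epsilon>)" if "v \<in> Opt \<epsilon>" for v
      using bang_bang[OF assms(10) that[unfolded Opt_def N_def]] unfolding I(1) N_def by eventually_elim simp
    ultimately show ?thesis using u unfolding opt[OF \<epsilon>] optN[OF \<epsilon>] by blast
  qed
  ultimately show ?thesis by blast
qed

end
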